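(* Let $H$ be a finite-dimensional Hopf algebra over a field $\Bbbk$ and $(M,\psi)$ an involutive Hopf bimodule over $H$. Let $\Gamma,\Delta$ be Kitaev graphs and $X\in\mathsf{Mod}_{\mathbb H_\Gamma}^{\mathbb H_\Gamma}$, $Y\in\mathsf{Mod}_{\mathbb H_\Delta}^{\mathbb H_\Delta}$ right-right modules-comodules. Then there is an embedding (injective linear map) $$\mathrm{Bit}_{\mathbb H_\Gamma}^{\mathbb H_\Gamma}(X,\mathbb M_\Gamma)\otimes\mathrm{Bit}_{\mathbb H_\Delta}^{\mathbb H_\Delta}(Y,\mathbb M_\Delta)\hookrightarrow\mathrm{Bit}_{\mathbb H_{\Gamma\#\Delta}}^{\mathbb H_{\Gamma\#\Delta}}(X\#Y,\mathbb M_{\Gamma\#\Delta}).$$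
   Context: **Hopf algebra notation.** $\otimes=\otimes_\Bbbk$; $S$ antipode; Sweedler notation $h_{(1)}\otimes h_{(2)}$. **Involutive Hopf bimodules.** An $H$-bimodule and $H$-bicomodule $M$ (coactions $m_{[-1]}\otimes m_{[0]}$, $m_{[0]}\otimes m_{[1]}$) with $$(h\triangleright m\triangleleft g)_{[-1]}\otimes(h\triangleright m\triangleleft g)_{[0]}\otimes(h\triangleright m\triangleleft g)_{[1]}=h_{(1)}m_{[-1]}g_{(1)}\otimes h_{(2)}\triangleright m_{[0]}\triangleleft g_{(2)}\otimes h_{(3)}m_{[1]}S^{-2}(g_{(3)}),$$ together with a linear involution $\psi:M\to M$ with $\psi(h\triangleright m)=\psi(m)\triangleleft S(h)$ and $\psi(m)_{[-1]}\otimes\psi(m)_{[0]}=S(m_{[1]})\otimes\psi(m_{[0]})$. **Kitaev graphs.** A ribbon graph $(\Gamma,\iota,\rho)$ is a finite set $\Gamma$ of half-edges with a fixed-point free involution $\iota$ and a permutation $\rho$. Vertices $V_\Gamma$, edges $E_\Gamma$, faces $F_\Gamma$ are the cycles (including those of length one) of $\rho$, $\iota$, $\rho^{-1}\iota$; $v_h,e_h,f_h$ are the ones containing $h\in\Gamma$. It is connected if $\langle\iota,\rho\rangle$ acts transitively. A Kitaev graph is a connected ribbon graph with a subset $C_\Gamma\subset\Gamma$ of cilia such that $C_\Gamma\to V_\Gamma$, $c\mapsto v_c$, and $C_\Gamma\to F_\Gamma$, $c\mapsto f_{\rho^{-1}(c)}$, are bijective, a distinguished cilium in $C_\Gamma$,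 and a total order on $\Gamma$ such that for $e_h\ne e_k$: $h<k$ iff $\iota(h)<\iota(k)$. The source of an edge $\{h,\iota(h)\}$ is $s=\min\{h,\iota(h)\}$, its target is $\iota(s)$. Edges are ordered by their sources, cilia by the order of $\Gamma$. **Extended Hilbert space.** $\mathbb M_\Gamma=\bigotimes_{e\in E_\Gamma}M_e$, $M_e=M$. For a half-edge $h$, $a\in H$, $\alpha\in H^*$, the operators $L_h(a),T_h(\alpha)$ on $\mathbb M_\Gamma$ are the identity on all factors except $M_{e_h}$, where $L_h(a)m=a\triangleright m$ if $h$ is a target, $L_h(a)m=m\triangleleft S(a)$ if $h$ is a source; $T_h(\alpha)m=\alpha(m_{[-1]})m_{[0]}$ if $h$ is a source, $T_h(\alpha)m=\alpha(S(m_{[1]}))m_{[0]}$ if $h$ is a target. For a cilium $c$ let $v_c=[h_1,\dots,h_i]$ with $h_1=c$, $h_{r+1}=\rho(h_r)$, and $f_{\rho^{-1}(c)}=[k_1,\dots,k_j]$ with $k_1=\rho^{-1}(c)$, $k_{r+1}=\rho^{-1}\iota(k_r)$. The vertex action of $H_c=H$ is $a\bullet_cm=L_{h_i}(a_{(i)})\cdots L_{h_1}(a_{(1)})m$; the face coaction $\delta_c$ of $H_c$ is determined by $(\alpha\otimes\mathrm{id})\delta_c(m)=T_{k_j}(\alpha_{(1)})\cdots T_{k_1}(\alpha_{(j)})m$ for $\alpha\in H^*$. These (co)actions commute for different cilia and turn $\mathbb M_\Gamma$ into a left-left Yetter--Drinfeld module over $\mathbb H_\Gamma=\bigotimes_{c\in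 C_\Gamma}H_c$. **Connected sum.** For Kitaev graphs $\Gamma,\Delta$ with disjoint half-edge sets and distinguished cilia $c_\Gamma,c_\Delta$, $\Gamma\#\Delta$ has half-edges $\Gamma\sqcup\Delta$ (elements of $\Gamma$ preceding those of $\Delta$), involution $\iota_\Gamma\sqcup\iota_\Delta$, cilia $C_\Gamma\sqcup(C_\Delta\setminus\{c_\Delta\})$, distinguished cilium $c_\Gamma$, and vertex permutation equal to $\rho_\Gamma\sqcup\rho_\Delta$ except that $\rho_\Gamma^{-1}(c_\Gamma)\mapsto c_\Delta$ and $\rho_\Delta^{-1}(c_\Delta)\mapsto c_\Gamma$. We identify $C_{\Gamma\#\Delta}$ with $C_\Gamma\cup C_\Delta$ where $c_\Gamma=c_\Delta=:c_0$. **Bitensor products.** $\mathsf{Mod}_A^C$ (resp. ${}_A^C\mathsf{Mod}$) is the category of right modules over an algebra $A$ that are also right comodules over a coalgebra $C$ (resp. left-left), with no compatibility. For $X\in\mathsf{Mod}_A^C$, $N\in{}_A^C\mathsf{Mod}$ let $\iota_{X,N}:X\square_CN\hookrightarrow X\otimes N$ be the inclusion of the cotensor product and $\pi_{X,N}:X\otimes N\to X\otimes_AN$ the projection; $\mathrm{Bit}_A^C(X,N):=\mathrm{im}(\pi_{X,N}\iota_{X,N})$. **$X\#Y$.** For $X\in\mathsf{Mod}_{\mathbb H_\Gamma}^{\mathbb H_\Gamma}$ and $c\in C_\Gamma$ write $x\triangleleft_ch$ and $x^{(c)}_{[0]}\otimes x^{(c)}_{[1]}$ for the (co)action of the tensor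 factor $H_c$, and similarly for $Y$. $X\#Y\in\mathsf{Mod}_{\mathbb H_{\Gamma\#\Delta}}^{\mathbb H_{\Gamma\#\Delta}}$ is $X\otimes Y$, where $H_c$ (co)acts only on $X$ for $c\in C_\Gamma\setminus\{c_0\}$, only on $Y$ for $c\in C_\Delta\setminus\{c_0\}$, and at $c_0$ diagonally: $(x\otimes y)h=x\triangleleft_{c_0}h_{(1)}\otimes y\triangleleft_{c_0}h_{(2)}$ with coaction $x\otimes y\mapsto(x^{(c_0)}_{[0]}\otimes y^{(c_0)}_{[0]})\otimes x^{(c_0)}_{[1]}y^{(c_0)}_{[1]}$. *)

theory Defs
  imports "HOL-Library.Function_Algebras" "HOL-Combinatorics.Combinatorics"
begin

section \<open>Vector spaces and linear maps\<close>

text \<open>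
  A vector space is a linear subspace \<open>carr\<close> of an ambient vector space on a type. Maps are
  only relevant on carriers.
\<close>

record ('k, 'v) kspace =
  carr :: "'v set"
  scl :: "'k \<Rightarrow> 'v \<Rightarrow> 'v"

definition vspace :: "('k::field, 'v::ab_group_add, 'z) kspace_scheme \<Rightarrow> bool" where
  "vspace V \<longleftrightarrow> vector_space (scl V) \<and> module.subspace (scl V) (carr V)"

definition finite_dim :: "('k::field, 'v::ab_group_add, 'z) kspace_scheme \<Rightarrow> bool" where
  "finite_dim V \<longleftrightarrow> (\<exists>B. finite B \<and> carr V = module.span (scl V) B)"

definition lin :: "('k::field, 'v::ab_group_add, 'y) kspace_scheme
    \<Rightarrow> ('k, 'w::ab_group_add, 'z) kspace_scheme \<Rightarrow> ('v \<Rightarrow> 'w) \<Rightarrow> bool" where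
  "lin V W f \<longleftrightarrow> f ` carr V \<subseteq> carr W
     \<and> (\<forall>x\<in>carr V. \<forall>y\<in>carr V. f (x + y) = f x + f y)
     \<and> (\<forall>c. \<forall>x\<in>carr V. f (scl V c x) = scl W c (f x))"

definition bilin :: "('k::field, 'v::ab_group_add, 'x) kspace_scheme
    \<Rightarrow> ('k, 'w::ab_group_add, 'y) kspace_scheme \<Rightarrow> ('k, 'u::ab_group_add, 'z) kspace_scheme
    \<Rightarrow> ('v \<Rightarrow> 'w \<Rightarrow> 'u) \<Rightarrow> bool" where
  "bilin V W U f \<longleftrightarrow> (\<forall>w\<in>carr W. lin V U (\<lambda>v. f v w)) \<and> (\<forall>v\<in>carr V. lin W U (f v))"

definition multilin :: "'i set \<Rightarrow> ('k::field, 'v::ab_group_add, 'y) kspace_scheme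
    \<Rightarrow> ('k, 'u::ab_group_add, 'z) kspace_scheme \<Rightarrow> (('i \<Rightarrow> 'v) \<Rightarrow> 'u) \<Rightarrow> bool" where
  "multilin I V U f \<longleftrightarrow> (\<forall>v \<in> I \<rightarrow>\<^sub>E carr V. f v \<in> carr U
     \<and> (\<forall>i\<in>I. lin V U (\<lambda>x. f (v(i := x)))))"

definition kfield :: "('k::field, 'k) kspace" where
  "kfield = \<lparr>carr = UNIV, scl = (*)\<rparr>"

definition fscl :: "'k::field \<Rightarrow> ('a \<Rightarrow> 'k) \<Rightarrow> 'a \<Rightarrow> 'k" where
  "fscl c f = (\<lambda>x. c * f x)"

text \<open>The linear dual; functionals are made unique by setting them to zero off the carrier.\<close>

definition dual :: "('k::field, 'v::ab_group_add, 'z) kspace_scheme \<Rightarrow> ('k, 'v \<Rightarrow> 'k) kspace" where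
  "dual V = \<lparr>carr = {\<alpha>. lin V kfield \<alpha> \<and> (\<forall>x. x \<notin> carr V \<longrightarrow> \<alpha> x = 0)}, scl = fscl\<rparr>"

section \<open>Tensor products\<close>

text \<open>
  The pure tensor of \<open>v\<close> and \<open>w\<close> is realised as evaluation of bilinear forms at \<open>(v, w)\<close>, and the
  tensor product is the span of the pure tensors. Over a field this is a model of the
  tensor product; the universal property is proved below. The same device is used for
  tensor products indexed by a nonempty finite set (equal factors, extensional families) and,
  with balanced bilinear forms, for tensor products over an algebra.
\<close>

definition tens :: "('k::field, 'v::ab_group_add, 'y) kspace_scheme
    \<Rightarrow> ('k, 'w::ab_group_add, 'z) kspace_scheme \<Rightarrow> 'v \<Rightarrow> 'w \<Rightarrow> ('v \<Rightarrow> 'w \<Rightarrow> 'k) \<Rightarrow> 'k" where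
  "tens V W v w = (\<lambda>\<beta>. if bilin V W kfield \<beta> then \<beta> v w else 0)"

definition tensor :: "('k::field, 'v::ab_group_add, 'y) kspace_scheme
    \<Rightarrow> ('k, 'w::ab_group_add, 'z) kspace_scheme \<Rightarrow> ('k, ('v \<Rightarrow> 'w \<Rightarrow> 'k) \<Rightarrow> 'k) kspace" where
  "tensor V W = \<lparr>carr = module.span fscl {tens V W v w |v w. v \<in> carr V \<and> w \<in> carr W},
                 scl = fscl\<rparr>"

definition ntens :: "'i set \<Rightarrow> ('k::field, 'v::ab_group_add, 'z) kspace_scheme
    \<Rightarrow> ('i \<Rightarrow> 'v) \<Rightarrow> (('i \<Rightarrow> 'v) \<Rightarrow> 'k) \<Rightarrow> 'k" where
  "ntens I V v = (\<lambda>\<mu>. if multilin I V kfield \<mu> then \<mu> (restrict v I) else 0)"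

definition ntensor :: "'i set \<Rightarrow> ('k::field, 'v::ab_group_add, 'z) kspace_scheme
    \<Rightarrow> ('k, (('i \<Rightarrow> 'v) \<Rightarrow> 'k) \<Rightarrow> 'k) kspace" where
  "ntensor I V = \<lparr>carr = module.span fscl (ntens I V ` (I \<rightarrow>\<^sub>E carr V)), scl = fscl\<rparr>"

text \<open>
  Linear extension from pure tensors: represent \<open>t\<close> as a sum of pure tensors \<open>\<tau> p\<close> with \<open>p\<close> in
  \<open>P\<close> and apply \<open>f\<close> termwise. For bilinear (multilinear) \<open>f\<close> the choice is irrelevant.
\<close>

definition lin_ext :: "'p set \<Rightarrow> ('p \<Rightarrow> 't::comm_monoid_add) \<Rightarrow> ('p \<Rightarrow> 'u::comm_monoid_add)
    \<Rightarrow> 't \<Rightarrow> 'u" where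
  "lin_ext P \<tau> f t =
     sum_list (map f (SOME ps. set ps \<subseteq> P \<and> t = sum_list (map \<tau> ps)))"

definition tlift :: "('k::field, 'v::ab_group_add, 'y) kspace_scheme
    \<Rightarrow> ('k, 'w::ab_group_add, 'z) kspace_scheme \<Rightarrow> ('v \<Rightarrow> 'w \<Rightarrow> 'u::comm_monoid_add)
    \<Rightarrow> (('v \<Rightarrow> 'w \<Rightarrow> 'k) \<Rightarrow> 'k) \<Rightarrow> 'u" where
  "tlift V W f = lin_ext (carr V \<times> carr W) (\<lambda>(v, w). tens V W v w) (\<lambda>(v, w). f v w)"

definition nlift :: "'i set \<Rightarrow> ('k::field, 'v::ab_group_add, 'z) kspace_scheme
    \<Rightarrow> (('i \<Rightarrow> 'v) \<Rightarrow> 'u::comm_monoid_add) \<Rightarrow> ((('i \<Rightarrow> 'v) \<Rightarrow> 'k) \<Rightarrow> 'k) \<Rightarrow> 'u" where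
  "nlift I V f = lin_ext (I \<rightarrow>\<^sub>E carr V) (ntens I V) f"

definition tens3 :: "('k::field, 'u::ab_group_add, 'x) kspace_scheme
    \<Rightarrow> ('k, 'v::ab_group_add, 'y) kspace_scheme \<Rightarrow> ('k, 'w::ab_group_add, 'z) kspace_scheme
    \<Rightarrow> 'u \<Rightarrow> 'v \<Rightarrow> 'w \<Rightarrow> ('u \<Rightarrow> (('v \<Rightarrow> 'w \<Rightarrow> 'k) \<Rightarrow> 'k) \<Rightarrow> 'k) \<Rightarrow> 'k" where
  "tens3 U V W u v w = tens U (tensor V W) u (tens V W v w)"

lemma vector_space_fscl: "vector_space (fscl :: 'k::field \<Rightarrow> ('a \<Rightarrow> 'k) \<Rightarrow> 'a \<Rightarrow> 'k)"
  by unfold_locales (simp_all add: fscl_def fun_eq_iff distrib_left distrib_right mult.assoc)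

lemma vector_space_mult: "vector_space ((*) :: 'k::field \<Rightarrow> 'k \<Rightarrow> 'k)"
  by unfold_locales (simp_all add: distrib_left distrib_right)

lemma separating_functional:
  assumes vs: "vector_space s" and K: "module.subspace s K" and u: "u \<notin> K"
  shows "\<exists>\<phi>. Vector_Spaces.linear s ((*) :: 'k::field \<Rightarrow> 'k \<Rightarrow> 'k) \<phi> \<and> (\<forall>x\<in>K. \<phi> x = 0) \<and> \<phi> u \<noteq> 0"
proof -
  interpret vector_space_pair s "(*) :: 'k \<Rightarrow> 'k \<Rightarrow> 'k"
    by (rule vector_space_pair.intro[OF vs vector_space_mult])
  obtain B where B: "B \<subseteq> K" "vs1.independent B" "K \<subseteq> vs1.span B"
    by (rule vs1.basis_exists[of K])
  have sp: "vs1.span B = K"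
    using vs1.span_minimal[OF B(1) K] B(3) by (rule subset_antisym)
  have "u \<notin> vs1.span B" using u unfolding sp .
  then have ind: "vs1.independent (insert u B)"
    using B(2) by (rule vs1.independent_insertI)
  obtain \<phi> where lin: "Vector_Spaces.linear s (*) \<phi>"
      and \<phi>: "\<forall>x\<in>insert u B. \<phi> x = (if x = u then 1 else 0)"
    using linear_independent_extend[OF ind, of "\<lambda>x. if x = u then 1 else 0"] by blast
  have "\<phi> x = 0" if "x \<in> K" for x
  proof (rule linear_eq_0_on_span[OF lin])
    show "\<phi> y = 0" if "y \<in> B" for y
    proof -
      have "y \<noteq> u" using that B(1) u by blast
      then show ?thesis using \<phi> that by simp
    qed
    show "x \<in> vs1.span B" using that unfolding sp .
  qed
  moreover have "\<phi> u \<noteq> 0" using \<phi> by simp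
  ultimately show ?thesis using lin by blast
qed

lemma span_pure:
  assumes cl: "\<And>c p. p \<in> P \<Longrightarrow> \<exists>q\<in>P. fscl c (\<tau> p) = \<tau> q"
  shows "module.span fscl (\<tau> ` P) = {sum_list (map \<tau> ps) |ps. set ps \<subseteq> P}"
    (is "?L = ?R")
proof -
  interpret vector_space fscl by (rule vector_space_fscl)
  have *: "\<exists>qs. set qs \<subseteq> P \<and> fscl c (sum_list (map \<tau> ps)) = sum_list (map \<tau> qs)"
    if "set ps \<subseteq> P" for c ps
    using that
  proof (induction ps)
    case Nil
    then show ?case by (intro exI[of _ "[]"]) (simp add: fscl_def fun_eq_iff)
  next
    case (Cons p ps)
    have "set ps \<subseteq> P" "p \<in> P" using Cons.prems by simp_all
    obtain qs where qs: "set qs \<subseteq> P" "fscl c (sum_list (map \<tau> ps)) = sum_list (map \<tau> qs)"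
      using Cons.IH[OF \<open>set ps \<subseteq> P\<close>] by blast
    obtain q where q: "q \<in> P" "fscl c (\<tau> p) = \<tau> q"
      using cl[OF \<open>p \<in> P\<close>, of c] by blast
    have a: "fscl c (sum_list (map \<tau> (p # ps))) = sum_list (map \<tau> (q # qs))"
      by (simp only: list.map sum_list.Cons scale_right_distrib qs q)
    have d: "set (q # qs) \<subseteq> P" using qs(1) q(1) by simp
    show ?case by (rule exI[of _ "q # qs"]) (rule conjI[OF d a])
  qed
  have "subspace ?R"
  proof (rule subspaceI)
    show "0 \<in> ?R"
      by (rule CollectI, rule exI[of _ "[]"]) simp
    show "x + y \<in> ?R" if "x \<in> ?R" "y \<in> ?R" for x y
    proof -
      from that obtain ps qs where "set ps \<subseteq> P" "x = sum_list (map \<tau> ps)"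
        "set qs \<subseteq> P" "y = sum_list (map \<tau> qs)" by blast
      then show ?thesis
        by (intro CollectI exI[of _ "ps @ qs"]) (simp only: map_append sum_list_append set_append Un_least simp_thms)
    qed
    show "fscl c x \<in> ?R" if "x \<in> ?R" for c x using that * by blast
  qed
  moreover have "\<tau> ` P \<subseteq> ?R"
  proof
    fix t assume "t \<in> \<tau> ` P"
    then obtain p where "p \<in> P" "t = \<tau> p" by blast
    then have "set [p] \<subseteq> P" "t = sum_list (map \<tau> [p])" by simp_all
    then show "t \<in> ?R" by blast
  qed
  ultimately have "?L \<subseteq> ?R" by (rule span_minimal[rotated])
  moreover have "sum_list (map \<tau> ps) \<in> ?L" if "set ps \<subseteq> P" for ps
    using that
  proof (induction ps)
    case (Cons p ps)
    have "\<tau> p \<in> ?L" using Cons.prems by (intro span_base) simp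
    moreover have "sum_list (map \<tau> ps) \<in> ?L" using Cons by simp
    ultimately show ?case by (simp only: list.map sum_list.Cons span_add)
  qed (simp add: span_zero del: zero_fun_apply)
  ultimately show ?thesis by blast
qed

lemma lin_ext_sum_list:
  fixes \<tau> :: "'p \<Rightarrow> ('b \<Rightarrow> 'k::field)" and f :: "'p \<Rightarrow> 'u::ab_group_add"
  assumes U: "vspace (U :: ('k, 'u, 'z) kspace_scheme)"
    and ev: "\<And>\<phi>. Vector_Spaces.linear (scl U) (*) \<phi> \<Longrightarrow> \<exists>\<beta>. \<forall>p\<in>P. \<tau> p \<beta> = \<phi> (f p)"
    and ps: "set ps \<subseteq> P"
  shows "lin_ext P \<tau> f (sum_list (map \<tau> ps)) = sum_list (map f ps)"
proof -
  let ?Q = "\<lambda>qs. set qs \<subseteq> P \<and> sum_list (map \<tau> ps) = sum_list (map \<tau> qs)"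
  define qs where "qs = (SOME qs. ?Q qs)"
  have qs: "?Q qs" unfolding qs_def by (rule someI[of ?Q ps]) (use ps in simp)
  interpret vector_space "scl U" using U by (simp add: vspace_def)
  have "sum_list (map f qs) - sum_list (map f ps) \<in> {0}"
  proof (rule ccontr)
    assume "\<not> ?thesis"
    then obtain \<phi> where \<phi>: "Vector_Spaces.linear (scl U) (*) \<phi>"
        "\<phi> (sum_list (map f qs) - sum_list (map f ps)) \<noteq> 0"
      using separating_functional[OF vector_space_axioms subspace_single_0] by blast
    interpret l: Vector_Spaces.linear "scl U" "(*)" \<phi> by fact
    obtain \<beta> where \<beta>: "\<forall>p\<in>P. \<tau> p \<beta> = \<phi> (f p)" using ev[OF \<phi>(1)] by blast
    have *: "\<phi> (sum_list (map f rs)) = sum_list (map \<tau> rs) \<beta>" if "set rs \<subseteq> P" for rs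
      using that by (induction rs) (auto simp: l.add l.zero \<beta>)
    show False using \<phi>(2) *[OF ps] * qs by (simp add: l.diff)
  qed
  then show ?thesis by (simp add: lin_ext_def qs_def)
qed

lemma lin_lin_ext:
  fixes \<tau> :: "'p \<Rightarrow> ('b \<Rightarrow> 'k::field)" and f :: "'p \<Rightarrow> 'u::ab_group_add"
  assumes U: "vspace (U :: ('k, 'u, 'z) kspace_scheme)"
    and ev: "\<And>\<phi>. Vector_Spaces.linear (scl U) (*) \<phi> \<Longrightarrow> \<exists>\<beta>. \<forall>p\<in>P. \<tau> p \<beta> = \<phi> (f p)"
    and fU: "\<And>p. p \<in> P \<Longrightarrow> f p \<in> carr U"
    and cl: "\<And>c p. p \<in> P \<Longrightarrow> \<exists>q\<in>P. fscl c (\<tau> p) = \<tau> q \<and> scl U c (f p) = f q"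
    and T: "carr T = module.span fscl (\<tau> ` P)" "scl T = fscl"
  shows "lin T U (lin_ext P \<tau> f)"
proof -
  have span: "carr T = {sum_list (map \<tau> ps) |ps. set ps \<subseteq> P}"
    unfolding T(1) by (rule span_pure) (use cl in blast)
  have ext: "lin_ext P \<tau> f (sum_list (map \<tau> ps)) = sum_list (map f ps)" if "set ps \<subseteq> P" for ps
  proof (rule lin_ext_sum_list[OF U _ that])
    show "\<exists>\<beta>. \<forall>p\<in>P. \<tau> p \<beta> = \<phi> (f p)" if "Vector_Spaces.linear (scl U) (*) \<phi>" for \<phi>
      by (rule ev[OF that])
  qed
  interpret vector_space "scl U" using U by (simp add: vspace_def)
  interpret F: vector_space fscl by (rule vector_space_fscl)
  have sub: "subspace (carr U)" using U by (simp add: vspace_def)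
  have mem: "sum_list (map f ps) \<in> carr U" if "set ps \<subseteq> P" for ps
    using that fU by (induction ps) (auto intro: subspace_add[OF sub] subspace_0[OF sub])
  have sc: "\<exists>qs. set qs \<subseteq> P \<and> fscl c (sum_list (map \<tau> ps)) = sum_list (map \<tau> qs)
      \<and> scl U c (sum_list (map f ps)) = sum_list (map f qs)"
    if "set ps \<subseteq> P" for c ps
    using that
  proof (induction ps)
    case Nil
    have "fscl c (0 :: 'b \<Rightarrow> 'k) = 0" by (rule F.scale_zero_right)
    then show ?case by (intro exI[of _ "[]"]) (simp del: zero_fun_apply)
  next
    case (Cons p ps)
    have "set ps \<subseteq> P" "p \<in> P" using Cons.prems by simp_all
    obtain qs where qs: "set qs \<subseteq> P" "fscl c (sum_list (map \<tau> ps)) = sum_list (map \<tau> qs)"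
        "scl U c (sum_list (map f ps)) = sum_list (map f qs)"
      using Cons.IH[OF \<open>set ps \<subseteq> P\<close>] by blast
    obtain q where q: "q \<in> P" "fscl c (\<tau> p) = \<tau> q" "scl U c (f p) = f q"
      using cl[OF \<open>p \<in> P\<close>, of c] by blast
    have a: "fscl c (sum_list (map \<tau> (p # ps))) = sum_list (map \<tau> (q # qs))"
      by (simp only: list.map sum_list.Cons F.scale_right_distrib qs q)
    have b: "scl U c (sum_list (map f (p # ps))) = sum_list (map f (q # qs))"
      by (simp only: list.map sum_list.Cons scale_right_distrib qs q)
    have d: "set (q # qs) \<subseteq> P" using qs(1) q(1) by simp
    show ?case by (rule exI[of _ "q # qs"]) (rule conjI[OF d conjI[OF a b]])
  qed
  show ?thesis unfolding lin_def
  proof (intro conjI ballI allI)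
    show "lin_ext P \<tau> f ` carr T \<subseteq> carr U"
    proof
      fix u assume "u \<in> lin_ext P \<tau> f ` carr T"
      then obtain ps where "set ps \<subseteq> P" "u = lin_ext P \<tau> f (sum_list (map \<tau> ps))"
        unfolding span by blast
      then show "u \<in> carr U" by (simp only: ext mem)
    qed
    fix x c assume "x \<in> carr T"
    then obtain ps where ps: "set ps \<subseteq> P" "x = sum_list (map \<tau> ps)" unfolding span by blast
    show "lin_ext P \<tau> f (scl T c x) = scl U c (lin_ext P \<tau> f x)"
    proof -
      obtain qs where qs: "set qs \<subseteq> P" "fscl c (sum_list (map \<tau> ps)) = sum_list (map \<tau> qs)"
          "scl U c (sum_list (map f ps)) = sum_list (map f qs)"
        using sc[OF ps(1), of c] by blast
      show ?thesis unfolding T(2) ps(2) qs(2) ext[OF qs(1)] ext[OF ps(1)] qs(3) ..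
    qed
    fix y assume "y \<in> carr T"
    then obtain qs where qs: "set qs \<subseteq> P" "y = sum_list (map \<tau> qs)" unfolding span by blast
    have *: "x + y = sum_list (map \<tau> (ps @ qs))" by (simp only: map_append sum_list_append ps qs)
    have "set (ps @ qs) \<subseteq> P" using ps qs by simp
    from ext[OF this]
    have "lin_ext P \<tau> f (x + y) = sum_list (map f ps) + sum_list (map f qs)"
      by (simp only: * map_append sum_list_append)
    then show "lin_ext P \<tau> f (x + y) = lin_ext P \<tau> f x + lin_ext P \<tau> f y"
      by (simp only: ps(2) qs(2) ext[OF ps(1)] ext[OF qs(1)])
  qed
qed

lemma vspace_kfield: "vspace kfield"
  unfolding vspace_def kfield_def
  using vector_space_mult module.subspace_UNIV[OF vector_space_mult[unfolded module_iff_vector_space[symmetric]]]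
  by simp

lemma vspace_scl: "vspace V \<Longrightarrow> x \<in> carr V \<Longrightarrow> scl V c x \<in> carr V"
  unfolding vspace_def by (metis module.subspace_scale module_iff_vector_space)

lemma linear_lin_comp:
  assumes "lin V U g" "Vector_Spaces.linear (scl U) (*) \<phi>"
  shows "lin V kfield (\<lambda>x. \<phi> (g x))"
proof -
  interpret Vector_Spaces.linear "scl U" "(*)" \<phi> by fact
  show ?thesis using assms(1) by (auto simp: lin_def kfield_def add scale)
qed

lemma bilin_scl_left:
  "bilin V W U f \<Longrightarrow> v \<in> carr V \<Longrightarrow> w \<in> carr W \<Longrightarrow> f (scl V c v) w = scl U c (f v w)"
  by (auto simp: bilin_def lin_def)

text \<open>The universal property of the tensor product.\<close>

theorem tensor_universal:
  assumes V: "vspace V" and W: "vspace W" and U: "vspace U" and f: "bilin V W U f"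
  shows "lin (tensor V W) U (tlift V W f)"
    and "v \<in> carr V \<Longrightarrow> w \<in> carr W \<Longrightarrow> tlift V W f (tens V W v w) = f v w"
proof -
  let ?P = "carr V \<times> carr W"
  let ?t = "\<lambda>(v, w). tens V W v w" and ?f = "\<lambda>(v, w). f v w"
  have ev: "\<exists>\<beta>. \<forall>p\<in>?P. ?t p \<beta> = \<phi> (?f p)"
    if "Vector_Spaces.linear (scl U) (*) \<phi>" for \<phi>
  proof -
    have "bilin V W kfield (\<lambda>v w. \<phi> (f v w))"
      using f that by (auto simp: bilin_def intro: linear_lin_comp)
    then show ?thesis by (intro exI[of _ "\<lambda>v w. \<phi> (f v w)"]) (auto simp: tens_def)
  qed
  have img: "{tens V W v w |v w. v \<in> carr V \<and> w \<in> carr W} = ?t ` ?P" by auto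
  show "lin (tensor V W) U (tlift V W f)"
    unfolding tlift_def
  proof (rule lin_lin_ext[OF U])
    fix c p assume "p \<in> ?P"
    then obtain v w where p: "p = (v, w)" "v \<in> carr V" "w \<in> carr W" by auto
    have "fscl c (?t p) = ?t (scl V c v, w)"
      using p by (auto simp: tens_def fscl_def fun_eq_iff kfield_def bilin_scl_left)
    then show "\<exists>q\<in>?P. fscl c (?t p) = ?t q \<and> scl U c (?f p) = ?f q"
      using p V f by (intro bexI[of _ "(scl V c v, w)"]) (auto simp: bilin_scl_left vspace_scl)
    show "?f p \<in> carr U" using p f by (simp add: bilin_def lin_def image_subset_iff)
  qed (use ev img in \<open>simp_all add: tensor_def\<close>)
  show "tlift V W f (tens V W v w) = f v w" if "v \<in> carr V" "w \<in> carr W"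
  proof -
    have "lin_ext ?P ?t ?f (sum_list (map ?t [(v, w)])) = sum_list (map ?f [(v, w)])"
      by (rule lin_ext_sum_list[OF U]) (erule ev, use that in simp)
    then show ?thesis by (simp add: tlift_def)
  qed
qed

theorem ntensor_universal:
  assumes V: "vspace V" and U: "vspace U" and f: "multilin I V U f" and "I \<noteq> {}"
  shows "lin (ntensor I V) U (nlift I V f)"
    and "v \<in> I \<rightarrow>\<^sub>E carr V \<Longrightarrow> nlift I V f (ntens I V v) = f v"
proof -
  let ?P = "I \<rightarrow>\<^sub>E carr V"
  obtain i where i: "i \<in> I" using assms by blast
  have ev: "\<exists>\<beta>. \<forall>p\<in>?P. ntens I V p \<beta> = \<phi> (f p)"
    if "Vector_Spaces.linear (scl U) (*) \<phi>" for \<phi>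
  proof -
    have "lin V kfield (\<lambda>x. \<phi> (f (v(i := x))))" if "v \<in> ?P" "i \<in> I" for v i
      using linear_lin_comp[OF _ \<open>Vector_Spaces.linear (scl U) (*) \<phi>\<close>] f that
      unfolding multilin_def by blast
    then have "multilin I V kfield (\<lambda>v. \<phi> (f v))"
      by (simp add: multilin_def) (simp add: kfield_def)
    then show ?thesis
      by (intro exI[of _ "\<lambda>v. \<phi> (f v)"]) (auto simp: ntens_def PiE_restrict)
  qed
  have hom: "g (p(i := scl V c (p i))) = scl Z c (g p)"
    if "multilin I V Z g" "p \<in> ?P" for p c g and Z :: "('a, 'x::ab_group_add, 'y) kspace_scheme"
  proof -
    have "lin V Z (\<lambda>x. g (p(i := x)))" "p i \<in> carr V" using that i by (auto simp: multilin_def)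
    then have "g (p(i := scl V c (p i))) = scl Z c (g (p(i := p i)))"
      unfolding lin_def by blast
    then show ?thesis by simp
  qed
  show "lin (ntensor I V) U (nlift I V f)"
    unfolding nlift_def
  proof (rule lin_lin_ext[OF U])
    fix c p assume p: "p \<in> ?P"
    let ?q = "p(i := scl V c (p i))"
    have "p i \<in> carr V" using p i by (rule PiE_mem)
    then have q: "?q \<in> ?P" using p i by (auto simp: vspace_scl[OF V] PiE_def extensional_def Pi_iff)
    have "fscl c (ntens I V p) = ntens I V ?q"
      using hom[OF _ p, of kfield] p q by (auto simp: ntens_def fscl_def fun_eq_iff PiE_restrict kfield_def)
    then show "\<exists>q\<in>?P. fscl c (ntens I V p) = ntens I V q \<and> scl U c (f p) = f q"
      using q hom[OF f p] by metis
  qed (use ev f in \<open>auto simp: ntensor_def multilin_def\<close>)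
  show "nlift I V f (ntens I V v) = f v" if "v \<in> ?P"
  proof -
    have "lin_ext ?P (ntens I V) f (sum_list (map (ntens I V) [v])) = sum_list (map f [v])"
      by (rule lin_ext_sum_list[OF U]) (erule ev, use that in simp)
    then show ?thesis by (simp add: nlift_def)
  qed
qed

section \<open>Algebras, coalgebras, modules, comodules\<close>

record ('k, 'a) kalg = "('k, 'a) kspace" +
  amult :: "'a \<Rightarrow> 'a \<Rightarrow> 'a"
  aone :: 'a

text \<open>Algebra and coalgebra structure on one space, without compatibility.\<close>

record ('k, 'a) kbialg = "('k, 'a) kalg" +
  comult :: "'a \<Rightarrow> ('a \<Rightarrow> 'a \<Rightarrow> 'k) \<Rightarrow> 'k"
  counit :: "'a \<Rightarrow> 'k"

record ('k, 'a) khopf = "('k, 'a) kbialg" +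
  antipode :: "'a \<Rightarrow> 'a"

definition is_algebra :: "('k::field, 'a::ab_group_add, 'z) kalg_scheme \<Rightarrow> bool" where
  "is_algebra A \<longleftrightarrow> vspace A \<and> bilin A A A (amult A) \<and> aone A \<in> carr A
     \<and> (\<forall>a\<in>carr A. \<forall>b\<in>carr A. \<forall>c\<in>carr A.
          amult A (amult A a b) c = amult A a (amult A b c))
     \<and> (\<forall>a\<in>carr A. amult A (aone A) a = a \<and> amult A a (aone A) = a)"

text \<open>Sweedler sums: in \<open>sw2 C c f\<close> the function \<open>f\<close> is applied to the legs of the coproduct
  of \<open>c\<close>, and in \<open>sw3\<close> to those of the iterated coproduct.\<close>

definition sw2 :: "('k::field, 'c::ab_group_add, 'z) kbialg_scheme \<Rightarrow> 'c
    \<Rightarrow> ('c \<Rightarrow> 'c \<Rightarrow> 'u::comm_monoid_add) \<Rightarrow> 'u" where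
  "sw2 C c f = tlift C C f (comult C c)"

definition sw3 :: "('k::field, 'c::ab_group_add, 'z) kbialg_scheme \<Rightarrow> 'c
    \<Rightarrow> ('c \<Rightarrow> 'c \<Rightarrow> 'c \<Rightarrow> 'u::comm_monoid_add) \<Rightarrow> 'u" where
  "sw3 C c f = sw2 C c (\<lambda>c1 c'. sw2 C c' (\<lambda>c2 c3. f c1 c2 c3))"

definition is_coalgebra :: "('k::field, 'c::ab_group_add, 'z) kbialg_scheme \<Rightarrow> bool" where
  "is_coalgebra C \<longleftrightarrow> vspace C \<and> lin C (tensor C C) (comult C) \<and> lin C kfield (counit C)
     \<and> (\<forall>c\<in>carr C.
          sw2 C c (\<lambda>a b. sw2 C a (\<lambda>a1 a2. tens3 C C C a1 a2 b))
            = sw2 C c (\<lambda>a b. sw2 C b (\<lambda>b1 b2. tens3 C C C a b1 b2))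
        \<and> sw2 C c (\<lambda>a b. scl C (counit C a) b) = c
        \<and> sw2 C c (\<lambda>a b. scl C (counit C b) a) = c)"

definition hopf_algebra :: "('k::field, 'h::ab_group_add) khopf \<Rightarrow> bool" where
  "hopf_algebra H \<longleftrightarrow> is_algebra H \<and> is_coalgebra H
     \<and> (\<forall>a\<in>carr H. \<forall>b\<in>carr H.
          comult H (amult H a b)
            = sw2 H a (\<lambda>a1 a2. sw2 H b (\<lambda>b1 b2. tens H H (amult H a1 b1) (amult H a2 b2)))
        \<and> counit H (amult H a b) = counit H a * counit H b)
     \<and> comult H (aone H) = tens H H (aone H) (aone H) \<and> counit H (aone H) = 1
     \<and> lin H H (antipode H)
     \<and> (\<forall>a\<in>carr H.
          sw2 H a (\<lambda>a1 a2. amult H (antipode H a1) a2) = scl H (counit H a) (aone H)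
        \<and> sw2 H a (\<lambda>a1 a2. amult H a1 (antipode H a2)) = scl H (counit H a) (aone H))"

definition left_module :: "('k::field, 'a::ab_group_add, 'y) kalg_scheme
    \<Rightarrow> ('k, 'n::ab_group_add, 'z) kspace_scheme \<Rightarrow> ('a \<Rightarrow> 'n \<Rightarrow> 'n) \<Rightarrow> bool" where
  "left_module A N act \<longleftrightarrow> vspace N \<and> bilin A N N act
     \<and> (\<forall>a\<in>carr A. \<forall>b\<in>carr A. \<forall>n\<in>carr N. act (amult A a b) n = act a (act b n))
     \<and> (\<forall>n\<in>carr N. act (aone A) n = n)"

definition right_module :: "('k::field, 'a::ab_group_add, 'y) kalg_scheme
    \<Rightarrow> ('k, 'n::ab_group_add, 'z) kspace_scheme \<Rightarrow> ('n \<Rightarrow> 'a \<Rightarrow> 'n) \<Rightarrow> bool" where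
  "right_module A N act \<longleftrightarrow> vspace N \<and> bilin N A N act
     \<and> (\<forall>a\<in>carr A. \<forall>b\<in>carr A. \<forall>n\<in>carr N. act n (amult A a b) = act (act n a) b)
     \<and> (\<forall>n\<in>carr N. act n (aone A) = n)"

definition left_comodule :: "('k::field, 'c::ab_group_add, 'y) kbialg_scheme
    \<Rightarrow> ('k, 'n::ab_group_add, 'z) kspace_scheme \<Rightarrow> ('n \<Rightarrow> ('c \<Rightarrow> 'n \<Rightarrow> 'k) \<Rightarrow> 'k) \<Rightarrow> bool" where
  "left_comodule C N \<delta> \<longleftrightarrow> vspace N \<and> lin N (tensor C N) \<delta>
     \<and> (\<forall>n\<in>carr N.
          tlift C N (\<lambda>c n0. sw2 C c (\<lambda>c1 c2. tens3 C C N c1 c2 n0)) (\<delta> n)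
            = tlift C N (\<lambda>c n0. tlift C N (\<lambda>d n1. tens3 C C N c d n1) (\<delta> n0)) (\<delta> n)
        \<and> tlift C N (\<lambda>c n0. scl N (counit C c) n0) (\<delta> n) = n)"

definition right_comodule :: "('k::field, 'c::ab_group_add, 'y) kbialg_scheme
    \<Rightarrow> ('k, 'n::ab_group_add, 'z) kspace_scheme \<Rightarrow> ('n \<Rightarrow> ('n \<Rightarrow> 'c \<Rightarrow> 'k) \<Rightarrow> 'k) \<Rightarrow> bool" where
  "right_comodule C N \<delta> \<longleftrightarrow> vspace N \<and> lin N (tensor N C) \<delta>
     \<and> (\<forall>n\<in>carr N.
          tlift N C (\<lambda>n0 c. sw2 C c (\<lambda>c1 c2. tens3 N C C n0 c1 c2)) (\<delta> n)
            = tlift N C (\<lambda>n0 c. tlift N C (\<lambda>n1 d. tens3 N C C n1 d c) (\<delta> n0)) (\<delta> n)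
        \<and> tlift N C (\<lambda>n0 c. scl N (counit C c) n0) (\<delta> n) = n)"

record ('k, 'n, 'a, 'c) left_modcomod = "('k, 'n) kspace" +
  lact :: "'a \<Rightarrow> 'n \<Rightarrow> 'n"
  lcoact :: "'n \<Rightarrow> ('c \<Rightarrow> 'n \<Rightarrow> 'k) \<Rightarrow> 'k"

record ('k, 'x, 'a, 'c) right_modcomod = "('k, 'x) kspace" +
  ract :: "'x \<Rightarrow> 'a \<Rightarrow> 'x"
  rcoact :: "'x \<Rightarrow> ('x \<Rightarrow> 'c \<Rightarrow> 'k) \<Rightarrow> 'k"

definition right_module_comodule :: "('k::field, 'a::ab_group_add, 'y) kbialg_scheme
    \<Rightarrow> ('k, 'x::ab_group_add, 'a, 'a) right_modcomod \<Rightarrow> bool" where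
  "right_module_comodule A X \<longleftrightarrow> right_module A X (ract X) \<and> right_comodule A X (rcoact X)"

section \<open>Involutive Hopf bimodules\<close>

record ('k, 'm, 'h) hopf_bimod = "('k, 'm, 'h, 'h) left_modcomod" +
  bract :: "'m \<Rightarrow> 'h \<Rightarrow> 'm"
  brcoact :: "'m \<Rightarrow> ('m \<Rightarrow> 'h \<Rightarrow> 'k) \<Rightarrow> 'k"
  invol :: "'m \<Rightarrow> 'm"

definition bicoact3 :: "('k::field, 'h::ab_group_add) khopf
    \<Rightarrow> ('k, 'm::ab_group_add, 'h) hopf_bimod
    \<Rightarrow> ('h \<Rightarrow> 'm \<Rightarrow> 'h \<Rightarrow> 'u::comm_monoid_add) \<Rightarrow> 'm \<Rightarrow> 'u" where
  "bicoact3 H M f m =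
     tlift H M (\<lambda>a n. tlift M H (\<lambda>n0 b. f a n0 b) (brcoact M n)) (lcoact M m)"

definition involutive_hopf_bimodule :: "('k::field, 'h::ab_group_add) khopf
    \<Rightarrow> ('k, 'm::ab_group_add, 'h) hopf_bimod \<Rightarrow> bool" where
  "involutive_hopf_bimodule H M \<longleftrightarrow>
     left_module H M (lact M) \<and> right_module H M (bract M)
   \<and> left_comodule H M (lcoact M) \<and> right_comodule H M (brcoact M)
   \<and> (\<forall>h\<in>carr H. \<forall>g\<in>carr H. \<forall>m\<in>carr M.
        bract M (lact M h m) g = lact M h (bract M m g))
   \<and> (\<forall>m\<in>carr M. bicoact3 H M (tens3 H M H) m
        = tlift M H (\<lambda>n b. tlift H M (\<lambda>a n0. tens3 H M H a n0 b) (lcoact M n)) (brcoact M m))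
   \<and> (let S' = inv_into (carr H) (antipode H) in
      \<forall>h\<in>carr H. \<forall>g\<in>carr H. \<forall>m\<in>carr M.
        bicoact3 H M (tens3 H M H) (bract M (lact M h m) g)
        = sw3 H h (\<lambda>h1 h2 h3. sw3 H g (\<lambda>g1 g2 g3.
            bicoact3 H M (\<lambda>a n b. tens3 H M H
              (amult H (amult H h1 a) g1)
              (bract M (lact M h2 n) g2)
              (amult H (amult H h3 b) (S' (S' g3)))) m)))
   \<and> lin M M (invol M) \<and> (\<forall>m\<in>carr M. invol M (invol M m) = m)
   \<and> (\<forall>h\<in>carr H. \<forall>m\<in>carr M.
        invol M (lact M h m) = bract M (invol M m) (antipode H h))
   \<and> (\<forall>m\<in>carr M. lcoact M (invol M m)
        = tlift M H (\<lambda>n a. tens H M (antipode H a) (invol M n)) (brcoact M m))"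

section \<open>Bitensor products\<close>

text \<open>The cotensor product, as a subspace of the tensor product.\<close>

definition cotensor :: "('k::field, 'c::ab_group_add, 'z) kspace_scheme
    \<Rightarrow> ('k, 'x::ab_group_add, 'a, 'c) right_modcomod
    \<Rightarrow> ('k, 'n::ab_group_add, 'a, 'c) left_modcomod \<Rightarrow> ('k, ('x \<Rightarrow> 'n \<Rightarrow> 'k) \<Rightarrow> 'k) kspace" where
  "cotensor C X N = \<lparr>carr = {t \<in> carr (tensor X N).
       tlift X N (\<lambda>x n. tlift X C (\<lambda>x0 c. tens3 X C N x0 c n) (rcoact X x)) t
     = tlift X N (\<lambda>x n. tlift C N (\<lambda>c n0. tens3 X C N x c n0) (lcoact N n)) t},
     scl = fscl\<rparr>"

definition balanced :: "('k::field, 'a::ab_group_add, 'z) kspace_scheme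
    \<Rightarrow> ('k, 'x::ab_group_add, 'a, 'c) right_modcomod
    \<Rightarrow> ('k, 'n::ab_group_add, 'a, 'c) left_modcomod \<Rightarrow> ('x \<Rightarrow> 'n \<Rightarrow> 'k) \<Rightarrow> bool" where
  "balanced A X N \<beta> \<longleftrightarrow> bilin X N kfield \<beta>
     \<and> (\<forall>x\<in>carr X. \<forall>a\<in>carr A. \<forall>n\<in>carr N. \<beta> (ract X x a) n = \<beta> x (lact N a n))"

definition atens :: "('k::field, 'a::ab_group_add, 'z) kspace_scheme
    \<Rightarrow> ('k, 'x::ab_group_add, 'a, 'c) right_modcomod
    \<Rightarrow> ('k, 'n::ab_group_add, 'a, 'c) left_modcomod
    \<Rightarrow> 'x \<Rightarrow> 'n \<Rightarrow> ('x \<Rightarrow> 'n \<Rightarrow> 'k) \<Rightarrow> 'k" where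
  "atens A X N x n = (\<lambda>\<beta>. if balanced A X N \<beta> then \<beta> x n else 0)"

definition atensor :: "('k::field, 'a::ab_group_add, 'z) kspace_scheme
    \<Rightarrow> ('k, 'x::ab_group_add, 'a, 'c) right_modcomod
    \<Rightarrow> ('k, 'n::ab_group_add, 'a, 'c) left_modcomod \<Rightarrow> ('k, ('x \<Rightarrow> 'n \<Rightarrow> 'k) \<Rightarrow> 'k) kspace" where
  "atensor A X N = \<lparr>carr = module.span fscl {atens A X N x n |x n. x \<in> carr X \<and> n \<in> carr N},
                    scl = fscl\<rparr>"

definition aproj :: "('k::field, 'a::ab_group_add, 'z) kspace_scheme
    \<Rightarrow> ('k, 'x::ab_group_add, 'a, 'c) right_modcomod
    \<Rightarrow> ('k, 'n::ab_group_add, 'a, 'c) left_modcomod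
    \<Rightarrow> (('x \<Rightarrow> 'n \<Rightarrow> 'k) \<Rightarrow> 'k) \<Rightarrow> ('x \<Rightarrow> 'n \<Rightarrow> 'k) \<Rightarrow> 'k" where
  "aproj A X N = tlift X N (atens A X N)"

definition Bit :: "('k::field, 'a::ab_group_add, 'y) kspace_scheme
    \<Rightarrow> ('k, 'c::ab_group_add, 'z) kspace_scheme
    \<Rightarrow> ('k, 'x::ab_group_add, 'a, 'c) right_modcomod
    \<Rightarrow> ('k, 'n::ab_group_add, 'a, 'c) left_modcomod \<Rightarrow> ('k, ('x \<Rightarrow> 'n \<Rightarrow> 'k) \<Rightarrow> 'k) kspace" where
  "Bit A C X N = \<lparr>carr = aproj A X N ` carr (cotensor C X N), scl = scl (atensor A X N)\<rparr>"

lemma sum_list_apply_0: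
  "(\<And>x. x \<in> set xs \<Longrightarrow> f x \<beta> = 0) \<Longrightarrow> sum_list (map f xs) \<beta> = (0::'k::field)"
  by (induction xs) auto

text \<open>The kernel of the projection onto the tensor product over an algebra.\<close>

theorem aproj_kernel:
  fixes A :: "('k::field, 'a::ab_group_add, 'z) kspace_scheme"
    and X :: "('k, 'x::ab_group_add, 'a, 'c) right_modcomod"
    and N :: "('k, 'n::ab_group_add, 'a, 'c) left_modcomod"
  assumes X: "vspace X" and N: "vspace N"
    and bal: "bilin X A X (ract X)" "bilin A N N (lact N)"
    and t: "t \<in> carr (tensor X N)"
  shows "aproj A X N t = 0 \<longleftrightarrow> t \<in> module.span fscl
    {tens X N (ract X x a) n - tens X N x (lact N a n) |x a n.
       x \<in> carr X \<and> a \<in> carr A \<and> n \<in> carr N}" (is "_ \<longleftrightarrow> t \<in> module.span fscl ?K")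
proof -
  interpret F: vector_space fscl by (rule vector_space_fscl)
  define AT where "AT = (\<lparr>carr = UNIV, scl = fscl\<rparr> :: ('k, ('x \<Rightarrow> 'n \<Rightarrow> 'k) \<Rightarrow> 'k) kspace)"
  have AT: "vspace AT" by (simp add: vspace_def AT_def vector_space_fscl)
  have at: "bilin X N AT (atens A X N)"
    by (auto simp: bilin_def lin_def AT_def atens_def fun_eq_iff balanced_def kfield_def fscl_def)
  have vals: "ract X x a \<in> carr X" "lact N a n \<in> carr N"
    if "x \<in> carr X" "a \<in> carr A" "n \<in> carr N" for x a n
    using bal that by (simp_all add: bilin_def lin_def image_subset_iff)
  have tens_mem: "tens X N x n \<in> carr (tensor X N)" if "x \<in> carr X" "n \<in> carr N" for x n
    using that by (auto simp: tensor_def intro!: F.span_base)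
  note linp = tensor_universal(1)[OF X N AT at] and pure = tensor_universal(2)[OF X N AT at]
  have eval: "aproj A X N s \<beta> = s \<beta>" if s: "s \<in> carr (tensor X N)" and \<beta>: "balanced A X N \<beta>" for s \<beta>
  proof -
    have "s \<in> F.span {tens X N v w |v w. v \<in> carr X \<and> w \<in> carr N}"
      using s by (simp add: tensor_def)
    then have "s \<in> carr (tensor X N) \<and> aproj A X N s \<beta> = s \<beta>"
    proof (induction rule: F.span_induct_alt)
      case base
      have z: "0 \<in> carr (tensor X N)" by (simp add: tensor_def F.span_zero)
      then have "aproj A X N (0 + 0) = aproj A X N 0 + aproj A X N 0"
        using linp unfolding lin_def aproj_def by blast
      then have "aproj A X N 0 = 0" by (metis add_cancel_right_right add_0)
      then show ?case using z by (metis zero_fun_apply)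
    next
      case (step c x y)
      then obtain v w where vw: "x = tens X N v w" "v \<in> carr X" "w \<in> carr N" by blast
      have x: "x \<in> carr (tensor X N)" using vw tens_mem by blast
      have cx: "fscl c x \<in> carr (tensor X N)" using x by (simp add: tensor_def F.span_scale)
      have "aproj A X N (fscl c x + y) = fscl c (aproj A X N x) + aproj A X N y"
        using linp cx x step unfolding lin_def aproj_def AT_def tensor_def by simp
      then have "aproj A X N (fscl c x + y) \<beta> = c * aproj A X N x \<beta> + aproj A X N y \<beta>"
        by (simp only: plus_fun_apply fscl_def)
      moreover have "aproj A X N x \<beta> = x \<beta>"
        using vw \<beta> pure by (simp add: aproj_def atens_def tens_def balanced_def)
      moreover have "(fscl c x + y) \<beta> = c * x \<beta> + y \<beta>" by (simp only: plus_fun_apply fscl_def)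
      moreover have "fscl c x + y \<in> carr (tensor X N)"
        using cx step by (simp add: tensor_def F.span_add)
      ultimately show ?case using step by metis
    qed
    then show ?thesis by simp
  qed
  have unb: "aproj A X N t \<beta> = 0" if "\<not> balanced A X N \<beta>" for \<beta>
    using that by (auto simp: aproj_def tlift_def lin_ext_def atens_def split_def
      intro!: sum_list_apply_0)
  show ?thesis
  proof
    assume L: "t \<in> F.span ?K"
    have "t \<beta> = 0" if \<beta>: "balanced A X N \<beta>" for \<beta>
      using L
    proof (induction rule: F.span_induct_alt)
      case (step c x y)
      then show ?case using \<beta> by (auto simp: tens_def balanced_def fscl_def)
    qed simp
    then show "aproj A X N t = 0" using eval[OF t] unb by (auto simp: fun_eq_iff)
  next
    assume R: "aproj A X N t = 0"
    show "t \<in> F.span ?K"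
    proof (rule ccontr)
      assume "t \<notin> F.span ?K"
      then obtain \<psi> where \<psi>: "Vector_Spaces.linear fscl (*) \<psi>" "\<forall>x\<in>F.span ?K. \<psi> x = 0" "\<psi> t \<noteq> 0"
        using separating_functional[OF vector_space_fscl F.subspace_span] by blast
      interpret l: Vector_Spaces.linear fscl "(*)" \<psi> by fact
      define \<beta> where "\<beta> = (\<lambda>x n. \<psi> (tens X N x n))"
      have tb: "bilin X N AT (tens X N)"
        by (auto simp: bilin_def lin_def AT_def tens_def fun_eq_iff kfield_def fscl_def)
      have lf: "Vector_Spaces.linear (scl AT) (*) \<psi>" using \<psi>(1) by (simp add: AT_def)
      have bl: "bilin X N kfield \<beta>"
        unfolding bilin_def \<beta>_def
      proof (intro conjI ballI)
        show "lin X kfield (\<lambda>v. \<psi> (tens X N v w))" if "w \<in> carr N" for w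
          using tb that by (intro linear_lin_comp[OF _ lf]) (simp add: bilin_def)
        show "lin N kfield (\<lambda>n. \<psi> (tens X N v n))" if "v \<in> carr X" for v
          using tb that by (intro linear_lin_comp[OF _ lf]) (simp add: bilin_def)
      qed
      have bb: "\<beta> (ract X x a) n = \<beta> x (lact N a n)"
        if "x \<in> carr X" "a \<in> carr A" "n \<in> carr N" for x a n
      proof -
        have "tens X N (ract X x a) n - tens X N x (lact N a n) \<in> F.span ?K"
          using that by (intro F.span_base) blast
        then have "\<psi> (tens X N (ract X x a) n - tens X N x (lact N a n)) = 0"
          using \<psi>(2) by blast
        then show ?thesis unfolding \<beta>_def l.diff by (simp only: right_minus_eq)
      qed
      have b: "balanced A X N \<beta>" using bl bb by (simp add: balanced_def)
      have "t \<in> F.span {tens X N v w |v w. v \<in> carr X \<and> w \<in> carr N}"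
        using t by (simp add: tensor_def)
      then have "t \<beta> = \<psi> t"
      proof (induction rule: F.span_induct_alt)
        case base
        show ?case by (metis l.zero zero_fun_apply)
      next
        case (step c x y)
        then have "x \<beta> = \<psi> x" using bl by (auto simp: tens_def \<beta>_def)
        moreover have "(fscl c x + y) \<beta> = c * x \<beta> + y \<beta>" by (simp only: plus_fun_apply fscl_def)
        moreover have "\<psi> (fscl c x + y) = c * \<psi> x + \<psi> y" by (simp only: l.add l.scale)
        ultimately show ?case using step by metis
      qed
      then show False using \<psi>(3) R eval[OF t b] by simp
    qed
  qed
qed

section \<open>Kitaev graphs\<close>

record 'g kgraph =
  hedges :: "'g set"
  iot :: "'g \<Rightarrow> 'g"
  rho :: "'g \<Rightarrow> 'g"
  cilia :: "'g set"
  base :: 'g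
  hord :: "'g rel"

definition ribbon_graph :: "'g kgraph \<Rightarrow> bool" where
  "ribbon_graph \<Gamma> \<longleftrightarrow> finite (hedges \<Gamma>) \<and> iot \<Gamma> permutes hedges \<Gamma> \<and> rho \<Gamma> permutes hedges \<Gamma>
     \<and> (\<forall>h\<in>hedges \<Gamma>. iot \<Gamma> h \<noteq> h \<and> iot \<Gamma> (iot \<Gamma> h) = h)"

definition face_perm :: "'g kgraph \<Rightarrow> 'g \<Rightarrow> 'g" where
  "face_perm \<Gamma> = inv (rho \<Gamma>) \<circ> iot \<Gamma>"

definition vertex_of :: "'g kgraph \<Rightarrow> 'g \<Rightarrow> 'g set" where
  "vertex_of \<Gamma> h = orbit (rho \<Gamma>) h"

definition edge_of :: "'g kgraph \<Rightarrow> 'g \<Rightarrow> 'g set" where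
  "edge_of \<Gamma> h = orbit (iot \<Gamma>) h"

definition face_of :: "'g kgraph \<Rightarrow> 'g \<Rightarrow> 'g set" where
  "face_of \<Gamma> h = orbit (face_perm \<Gamma>) h"

definition edges :: "'g kgraph \<Rightarrow> 'g set set" where
  "edges \<Gamma> = edge_of \<Gamma> ` hedges \<Gamma>"

definition connected_graph :: "'g kgraph \<Rightarrow> bool" where
  "connected_graph \<Gamma> \<longleftrightarrow> (\<forall>h\<in>hedges \<Gamma>. \<forall>k\<in>hedges \<Gamma>.
     (h, k) \<in> (let R = {(x, iot \<Gamma> x) |x. True} \<union> {(x, rho \<Gamma> x) |x. True} in (R \<union> R\<inverse>)\<^sup>*))"

definition hless :: "'g kgraph \<Rightarrow> 'g \<Rightarrow> 'g \<Rightarrow> bool" where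
  "hless \<Gamma> h k \<longleftrightarrow> (h, k) \<in> hord \<Gamma> \<and> h \<noteq> k"

definition kitaev_graph :: "'g kgraph \<Rightarrow> bool" where
  "kitaev_graph \<Gamma> \<longleftrightarrow> ribbon_graph \<Gamma> \<and> connected_graph \<Gamma> \<and> cilia \<Gamma> \<subseteq> hedges \<Gamma>
     \<and> bij_betw (vertex_of \<Gamma>) (cilia \<Gamma>) (vertex_of \<Gamma> ` hedges \<Gamma>)
     \<and> bij_betw (\<lambda>c. face_of \<Gamma> (inv (rho \<Gamma>) c)) (cilia \<Gamma>) (face_of \<Gamma> ` hedges \<Gamma>)
     \<and> base \<Gamma> \<in> cilia \<Gamma>
     \<and> linear_order_on (hedges \<Gamma>) (hord \<Gamma>)
     \<and> (\<forall>h\<in>hedges \<Gamma>. \<forall>k\<in>hedges \<Gamma>. edge_of \<Gamma> h \<noteq> edge_of \<Gamma> k \<longrightarrow>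
          (hless \<Gamma> h k \<longleftrightarrow> hless \<Gamma> (iot \<Gamma> h) (iot \<Gamma> k)))"

definition is_source :: "'g kgraph \<Rightarrow> 'g \<Rightarrow> bool" where
  "is_source \<Gamma> h \<longleftrightarrow> hless \<Gamma> h (iot \<Gamma> h)"

text \<open>
  The factors of tensor products over cilia are indexed, so no order of the cilia is needed
  for the spaces. The list below only fixes in which order commuting (co)actions attached
  to different cilia are composed; this does not affect the result. The distinguished
  cilium comes first, the others follow in the order of the half-edges.
\<close>

definition cilia_list :: "'g kgraph \<Rightarrow> 'g list" where
  "cilia_list \<Gamma> = base \<Gamma> # (THE cs. distinct cs \<and> set cs = cilia \<Gamma> - {base \<Gamma>}
                             \<and> sorted_wrt (hless \<Gamma>) cs)"

definition connected_sum :: "'g kgraph \<Rightarrow> 'g kgraph \<Rightarrow> 'g kgraph" where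
  "connected_sum \<Gamma> \<Delta> =
     \<lparr>hedges = hedges \<Gamma> \<union> hedges \<Delta>,
      iot = (\<lambda>h. if h \<in> hedges \<Gamma> then iot \<Gamma> h else iot \<Delta> h),
      rho = (\<lambda>h. if h = inv (rho \<Gamma>) (base \<Gamma>) then base \<Delta>
                 else if h = inv (rho \<Delta>) (base \<Delta>) then base \<Gamma>
                 else if h \<in> hedges \<Gamma> then rho \<Gamma> h else rho \<Delta> h),
      cilia = cilia \<Gamma> \<union> (cilia \<Delta> - {base \<Delta>}),
      base = base \<Gamma>,
      hord = hord \<Gamma> \<union> hord \<Delta> \<union> hedges \<Gamma> \<times> hedges \<Delta>\<rparr>"

section \<open>Tensor powers of a Hopf algebra\<close>

text \<open>
  In \<open>sweedler_family H cs a f\<close> every \<open>a c\<close> with \<open>c\<close> in \<open>cs\<close> is split by the coproduct, and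
  \<open>f\<close> is applied to the families of first and of second legs.
\<close>

primrec sweedler_family :: "('k::field, 'h::ab_group_add) khopf \<Rightarrow> 'i list \<Rightarrow> ('i \<Rightarrow> 'h)
    \<Rightarrow> (('i \<Rightarrow> 'h) \<Rightarrow> ('i \<Rightarrow> 'h) \<Rightarrow> 'u::comm_monoid_add) \<Rightarrow> 'u" where
  "sweedler_family H [] a f = f (\<lambda>_. undefined) (\<lambda>_. undefined)"
| "sweedler_family H (c # cs) a f =
     sw2 H (a c) (\<lambda>u v. sweedler_family H cs a (\<lambda>p q. f (p(c := u)) (q(c := v))))"

definition tensor_power :: "('k::field, 'h::ab_group_add) khopf \<Rightarrow> 'i set
    \<Rightarrow> ('k, (('i \<Rightarrow> 'h) \<Rightarrow> 'k) \<Rightarrow> 'k) kbialg" where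
  "tensor_power H C =
     \<lparr>carr = carr (ntensor C H),
      scl = fscl,
      amult = (\<lambda>s t. nlift C H (\<lambda>a. nlift C H (\<lambda>b.
                 ntens C H (\<lambda>c. amult H (a c) (b c))) t) s),
      aone = ntens C H (\<lambda>_. aone H),
      comult = nlift C H (\<lambda>a. sweedler_family H (SOME cs. distinct cs \<and> set cs = C) a
                 (\<lambda>p q. tens (ntensor C H) (ntensor C H) (ntens C H p) (ntens C H q))),
      counit = nlift C H (\<lambda>a. \<Prod>c\<in>C. counit H (a c))\<rparr>"

definition graph_algebra :: "('k::field, 'h::ab_group_add) khopf \<Rightarrow> 'g kgraph
    \<Rightarrow> ('k, (('g \<Rightarrow> 'h) \<Rightarrow> 'k) \<Rightarrow> 'k) kbialg" where
  "graph_algebra H \<Gamma> = tensor_power H (cilia \<Gamma>)"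

text \<open>
  Commuting (co)actions of the factors \<open>H\<close>, one for each \<open>c\<close> in \<open>cs\<close>, assembled to a (co)action
  of the tensor power. The coactions collect the coefficient for \<open>c\<close> in \<open>acc c\<close>; every
  \<open>acc c\<close> is overwritten, so its initial value is irrelevant.
\<close>

definition left_assemble_act :: "('k::field, 'h::ab_group_add) khopf \<Rightarrow> 'i list
    \<Rightarrow> ('i \<Rightarrow> 'h \<Rightarrow> 'n \<Rightarrow> 'n::comm_monoid_add)
    \<Rightarrow> ((('i \<Rightarrow> 'h) \<Rightarrow> 'k) \<Rightarrow> 'k) \<Rightarrow> 'n \<Rightarrow> 'n" where
  "left_assemble_act H cs act t n =
     nlift (set cs) H (\<lambda>a. foldr (\<lambda>c. act c (a c)) cs n) t"

definition right_assemble_act :: "('k::field, 'h::ab_group_add) khopf \<Rightarrow> 'i list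
    \<Rightarrow> ('i \<Rightarrow> 'n \<Rightarrow> 'h \<Rightarrow> 'n::comm_monoid_add)
    \<Rightarrow> 'n \<Rightarrow> ((('i \<Rightarrow> 'h) \<Rightarrow> 'k) \<Rightarrow> 'k) \<Rightarrow> 'n" where
  "right_assemble_act H cs act n t =
     nlift (set cs) H (\<lambda>a. foldl (\<lambda>n c. act c n (a c)) n cs) t"

primrec left_coact_list :: "('k::field, 'h::ab_group_add) khopf
    \<Rightarrow> ('k, 'n::ab_group_add, 'z) kspace_scheme \<Rightarrow> 'i set
    \<Rightarrow> ('i \<Rightarrow> 'n \<Rightarrow> ('h \<Rightarrow> 'n \<Rightarrow> 'k) \<Rightarrow> 'k) \<Rightarrow> 'i list \<Rightarrow> ('i \<Rightarrow> 'h) \<Rightarrow> 'n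
    \<Rightarrow> (((('i \<Rightarrow> 'h) \<Rightarrow> 'k) \<Rightarrow> 'k) \<Rightarrow> 'n \<Rightarrow> 'k) \<Rightarrow> 'k" where
  "left_coact_list H N C coact [] acc n = tens (ntensor C H) N (ntens C H acc) n"
| "left_coact_list H N C coact (c # cs) acc n =
     tlift H N (\<lambda>a n0. left_coact_list H N C coact cs (acc(c := a)) n0) (coact c n)"

primrec right_coact_list :: "('k::field, 'h::ab_group_add) khopf
    \<Rightarrow> ('k, 'n::ab_group_add, 'z) kspace_scheme \<Rightarrow> 'i set
    \<Rightarrow> ('i \<Rightarrow> 'n \<Rightarrow> ('n \<Rightarrow> 'h \<Rightarrow> 'k) \<Rightarrow> 'k) \<Rightarrow> 'i list \<Rightarrow> ('i \<Rightarrow> 'h) \<Rightarrow> 'n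
    \<Rightarrow> ('n \<Rightarrow> ((('i \<Rightarrow> 'h) \<Rightarrow> 'k) \<Rightarrow> 'k) \<Rightarrow> 'k) \<Rightarrow> 'k" where
  "right_coact_list H N C coact [] acc n = tens N (ntensor C H) n (ntens C H acc)"
| "right_coact_list H N C coact (c # cs) acc n =
     tlift N H (\<lambda>n0 a. right_coact_list H N C coact cs (acc(c := a)) n0) (coact c n)"

definition left_assemble_coact :: "('k::field, 'h::ab_group_add) khopf
    \<Rightarrow> ('k, 'n::ab_group_add, 'z) kspace_scheme \<Rightarrow> 'i list
    \<Rightarrow> ('i \<Rightarrow> 'n \<Rightarrow> ('h \<Rightarrow> 'n \<Rightarrow> 'k) \<Rightarrow> 'k) \<Rightarrow> 'n
    \<Rightarrow> (((('i \<Rightarrow> 'h) \<Rightarrow> 'k) \<Rightarrow> 'k) \<Rightarrow> 'n \<Rightarrow> 'k) \<Rightarrow> 'k" where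
  "left_assemble_coact H N cs coact n =
     left_coact_list H N (set cs) coact (rev cs) (\<lambda>_. undefined) n"

definition right_assemble_coact :: "('k::field, 'h::ab_group_add) khopf
    \<Rightarrow> ('k, 'n::ab_group_add, 'z) kspace_scheme \<Rightarrow> 'i list
    \<Rightarrow> ('i \<Rightarrow> 'n \<Rightarrow> ('n \<Rightarrow> 'h \<Rightarrow> 'k) \<Rightarrow> 'k) \<Rightarrow> 'n
    \<Rightarrow> ('n \<Rightarrow> ((('i \<Rightarrow> 'h) \<Rightarrow> 'k) \<Rightarrow> 'k) \<Rightarrow> 'k) \<Rightarrow> 'k" where
  "right_assemble_coact H N cs coact n =
     right_coact_list H N (set cs) coact cs (\<lambda>_. undefined) n"

text \<open>Conversely, the (co)action of the tensor factor \<open>H\<close> at one index on a (co)module over the tensor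
  power.\<close>

definition factor_incl :: "('k::field, 'h::ab_group_add) khopf \<Rightarrow> 'i set \<Rightarrow> 'i \<Rightarrow> 'h
    \<Rightarrow> (('i \<Rightarrow> 'h) \<Rightarrow> 'k) \<Rightarrow> 'k" where
  "factor_incl H C c h = ntens C H ((\<lambda>_. aone H)(c := h))"

definition factor_proj :: "('k::field, 'h::ab_group_add) khopf \<Rightarrow> 'i set \<Rightarrow> 'i
    \<Rightarrow> ((('i \<Rightarrow> 'h) \<Rightarrow> 'k) \<Rightarrow> 'k) \<Rightarrow> 'h" where
  "factor_proj H C c = nlift C H (\<lambda>a. scl H (\<Prod>d\<in>C - {c}. counit H (a d)) (a c))"

definition factor_ract :: "('k::field, 'h::ab_group_add) khopf \<Rightarrow> 'i set
    \<Rightarrow> ('k, 'x::ab_group_add, (('i \<Rightarrow> 'h) \<Rightarrow> 'k) \<Rightarrow> 'k, (('i \<Rightarrow> 'h) \<Rightarrow> 'k) \<Rightarrow> 'k) right_modcomod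
    \<Rightarrow> 'i \<Rightarrow> 'x \<Rightarrow> 'h \<Rightarrow> 'x" where
  "factor_ract H C X c x h = ract X x (factor_incl H C c h)"

definition factor_rcoact :: "('k::field, 'h::ab_group_add) khopf \<Rightarrow> 'i set
    \<Rightarrow> ('k, 'x::ab_group_add, (('i \<Rightarrow> 'h) \<Rightarrow> 'k) \<Rightarrow> 'k, (('i \<Rightarrow> 'h) \<Rightarrow> 'k) \<Rightarrow> 'k) right_modcomod
    \<Rightarrow> 'i \<Rightarrow> 'x \<Rightarrow> ('x \<Rightarrow> 'h \<Rightarrow> 'k) \<Rightarrow> 'k" where
  "factor_rcoact H C X c x =
     tlift X (ntensor C H) (\<lambda>x0 a. tens X H x0 (factor_proj H C c a)) (rcoact X x)"

section \<open>The extended Hilbert space\<close>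

definition hilbert_space :: "('k::field, 'm::ab_group_add, 'h) hopf_bimod \<Rightarrow> 'g kgraph
    \<Rightarrow> ('k, (('g set \<Rightarrow> 'm) \<Rightarrow> 'k) \<Rightarrow> 'k) kspace" where
  "hilbert_space M \<Gamma> = ntensor (edges \<Gamma>) M"

definition on_edge :: "('k::field, 'm::ab_group_add, 'h) hopf_bimod \<Rightarrow> 'g kgraph \<Rightarrow> 'g set
    \<Rightarrow> ('m \<Rightarrow> 'm) \<Rightarrow> ((('g set \<Rightarrow> 'm) \<Rightarrow> 'k) \<Rightarrow> 'k) \<Rightarrow> (('g set \<Rightarrow> 'm) \<Rightarrow> 'k) \<Rightarrow> 'k" where
  "on_edge M \<Gamma> e f = nlift (edges \<Gamma>) M (\<lambda>m. ntens (edges \<Gamma>) M (m(e := f (m e))))"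

definition edge_act :: "('k::field, 'h::ab_group_add) khopf
    \<Rightarrow> ('k, 'm::ab_group_add, 'h) hopf_bimod \<Rightarrow> 'g kgraph \<Rightarrow> 'g \<Rightarrow> 'h
    \<Rightarrow> ((('g set \<Rightarrow> 'm) \<Rightarrow> 'k) \<Rightarrow> 'k) \<Rightarrow> (('g set \<Rightarrow> 'm) \<Rightarrow> 'k) \<Rightarrow> 'k" where
  "edge_act H M \<Gamma> h a = on_edge M \<Gamma> (edge_of \<Gamma> h)
     (\<lambda>m. if is_source \<Gamma> h then bract M m (antipode H a) else lact M a m)"

definition edge_dual_act :: "('k::field, 'h::ab_group_add) khopf
    \<Rightarrow> ('k, 'm::ab_group_add, 'h) hopf_bimod \<Rightarrow> 'g kgraph \<Rightarrow> 'g \<Rightarrow> ('h \<Rightarrow> 'k)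
    \<Rightarrow> ((('g set \<Rightarrow> 'm) \<Rightarrow> 'k) \<Rightarrow> 'k) \<Rightarrow> (('g set \<Rightarrow> 'm) \<Rightarrow> 'k) \<Rightarrow> 'k" where
  "edge_dual_act H M \<Gamma> h \<alpha> = on_edge M \<Gamma> (edge_of \<Gamma> h)
     (\<lambda>m. if is_source \<Gamma> h
          then tlift H M (\<lambda>a n. scl M (\<alpha> a) n) (lcoact M m)
          else tlift M H (\<lambda>n a. scl M (\<alpha> (antipode H a)) n) (brcoact M m))"

text \<open>The vertex action for the half-edges in the list; the head of the list acts first and with
  the first leg of the coproduct. The empty list does not occur.\<close>

fun vertex_act_list :: "('k::field, 'h::ab_group_add) khopf
    \<Rightarrow> ('k, 'm::ab_group_add, 'h) hopf_bimod \<Rightarrow> 'g kgraph \<Rightarrow> 'g list \<Rightarrow> 'h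
    \<Rightarrow> ((('g set \<Rightarrow> 'm) \<Rightarrow> 'k) \<Rightarrow> 'k) \<Rightarrow> (('g set \<Rightarrow> 'm) \<Rightarrow> 'k) \<Rightarrow> 'k" where
  "vertex_act_list H M \<Gamma> [] a t = fscl (counit H a) t"
| "vertex_act_list H M \<Gamma> [h] a t = edge_act H M \<Gamma> h a t"
| "vertex_act_list H M \<Gamma> (h # hs) a t =
     sw2 H a (\<lambda>a1 a'. vertex_act_list H M \<Gamma> hs a' (edge_act H M \<Gamma> h a1 t))"

definition vertex_act :: "('k::field, 'h::ab_group_add) khopf
    \<Rightarrow> ('k, 'm::ab_group_add, 'h) hopf_bimod \<Rightarrow> 'g kgraph \<Rightarrow> 'g \<Rightarrow> 'h
    \<Rightarrow> ((('g set \<Rightarrow> 'm) \<Rightarrow> 'k) \<Rightarrow> 'k) \<Rightarrow> (('g set \<Rightarrow> 'm) \<Rightarrow> 'k) \<Rightarrow> 'k" where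
  "vertex_act H M \<Gamma> c = vertex_act_list H M \<Gamma> (support (rho \<Gamma>) c)"

text \<open>The coproduct of the dual Hopf algebra, dual to the multiplication.\<close>

definition dual_comult :: "('k::field, 'h::ab_group_add) khopf \<Rightarrow> ('h \<Rightarrow> 'k)
    \<Rightarrow> (('h \<Rightarrow> 'k) \<Rightarrow> ('h \<Rightarrow> 'k) \<Rightarrow> 'k) \<Rightarrow> 'k" where
  "dual_comult H \<alpha> = (THE d. d \<in> carr (tensor (dual H) (dual H))
     \<and> (\<forall>a\<in>carr H. \<forall>b\<in>carr H.
          tlift (dual H) (dual H) (\<lambda>\<alpha>1 \<alpha>2. \<alpha>1 a * \<alpha>2 b) d = \<alpha> (amult H a b)))"

text \<open>The head of the list acts last and with the first leg of the dual coproduct. The empty list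
  does not occur.\<close>

fun face_dual_act_list :: "('k::field, 'h::ab_group_add) khopf
    \<Rightarrow> ('k, 'm::ab_group_add, 'h) hopf_bimod \<Rightarrow> 'g kgraph \<Rightarrow> 'g list \<Rightarrow> ('h \<Rightarrow> 'k)
    \<Rightarrow> ((('g set \<Rightarrow> 'm) \<Rightarrow> 'k) \<Rightarrow> 'k) \<Rightarrow> (('g set \<Rightarrow> 'm) \<Rightarrow> 'k) \<Rightarrow> 'k" where
  "face_dual_act_list H M \<Gamma> [] \<alpha> t = fscl (\<alpha> (aone H)) t"
| "face_dual_act_list H M \<Gamma> [k] \<alpha> t = edge_dual_act H M \<Gamma> k \<alpha> t"
| "face_dual_act_list H M \<Gamma> (k # ks) \<alpha> t =
     tlift (dual H) (dual H)
       (\<lambda>\<alpha>1 \<alpha>'. edge_dual_act H M \<Gamma> k \<alpha>1 (face_dual_act_list H M \<Gamma> ks \<alpha>' t))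
       (dual_comult H \<alpha>)"

definition face_coact :: "('k::field, 'h::ab_group_add) khopf
    \<Rightarrow> ('k, 'm::ab_group_add, 'h) hopf_bimod \<Rightarrow> 'g kgraph \<Rightarrow> 'g
    \<Rightarrow> ((('g set \<Rightarrow> 'm) \<Rightarrow> 'k) \<Rightarrow> 'k)
    \<Rightarrow> ('h \<Rightarrow> ((('g set \<Rightarrow> 'm) \<Rightarrow> 'k) \<Rightarrow> 'k) \<Rightarrow> 'k) \<Rightarrow> 'k" where
  "face_coact H M \<Gamma> c t = (THE d. d \<in> carr (tensor H (hilbert_space M \<Gamma>))
     \<and> (\<forall>\<alpha>\<in>carr (dual H).
          tlift H (hilbert_space M \<Gamma>) (\<lambda>a n. fscl (\<alpha> a) n) d
        = face_dual_act_list H M \<Gamma> (rev (support (face_perm \<Gamma>) (inv (rho \<Gamma>) c))) \<alpha> t))"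

definition graph_module :: "('k::field, 'h::ab_group_add) khopf
    \<Rightarrow> ('k, 'm::ab_group_add, 'h) hopf_bimod \<Rightarrow> 'g kgraph
    \<Rightarrow> ('k, (('g set \<Rightarrow> 'm) \<Rightarrow> 'k) \<Rightarrow> 'k,
        (('g \<Rightarrow> 'h) \<Rightarrow> 'k) \<Rightarrow> 'k, (('g \<Rightarrow> 'h) \<Rightarrow> 'k) \<Rightarrow> 'k) left_modcomod" where
  "graph_module H M \<Gamma> =
     \<lparr>carr = carr (hilbert_space M \<Gamma>),
      scl = scl (hilbert_space M \<Gamma>),
      lact = left_assemble_act H (cilia_list \<Gamma>) (vertex_act H M \<Gamma>),
      lcoact = left_assemble_coact H (hilbert_space M \<Gamma>) (cilia_list \<Gamma>) (face_coact H M \<Gamma>)\<rparr>"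

section \<open>The module-comodule \<open>X # Y\<close>\<close>

definition sum_factor_ract :: "('k::field, 'h::ab_group_add) khopf \<Rightarrow> 'g kgraph \<Rightarrow> 'g kgraph
    \<Rightarrow> ('k, 'x::ab_group_add, (('g \<Rightarrow> 'h) \<Rightarrow> 'k) \<Rightarrow> 'k, (('g \<Rightarrow> 'h) \<Rightarrow> 'k) \<Rightarrow> 'k) right_modcomod
    \<Rightarrow> ('k, 'y::ab_group_add, (('g \<Rightarrow> 'h) \<Rightarrow> 'k) \<Rightarrow> 'k, (('g \<Rightarrow> 'h) \<Rightarrow> 'k) \<Rightarrow> 'k) right_modcomod
    \<Rightarrow> 'g \<Rightarrow> (('x \<Rightarrow> 'y \<Rightarrow> 'k) \<Rightarrow> 'k) \<Rightarrow> 'h \<Rightarrow> ('x \<Rightarrow> 'y \<Rightarrow> 'k) \<Rightarrow> 'k" where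
  "sum_factor_ract H \<Gamma> \<Delta> X Y c z h = tlift X Y (\<lambda>x y.
     if c = base \<Gamma> then
       sw2 H h (\<lambda>h1 h2. tens X Y (factor_ract H (cilia \<Gamma>) X (base \<Gamma>) x h1)
                                 (factor_ract H (cilia \<Delta>) Y (base \<Delta>) y h2))
     else if c \<in> cilia \<Gamma> then tens X Y (factor_ract H (cilia \<Gamma>) X c x h) y
     else tens X Y x (factor_ract H (cilia \<Delta>) Y c y h)) z"

definition sum_factor_rcoact :: "('k::field, 'h::ab_group_add) khopf \<Rightarrow> 'g kgraph \<Rightarrow> 'g kgraph
    \<Rightarrow> ('k, 'x::ab_group_add, (('g \<Rightarrow> 'h) \<Rightarrow> 'k) \<Rightarrow> 'k, (('g \<Rightarrow> 'h) \<Rightarrow> 'k) \<Rightarrow> 'k) right_modcomod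
    \<Rightarrow> ('k, 'y::ab_group_add, (('g \<Rightarrow> 'h) \<Rightarrow> 'k) \<Rightarrow> 'k, (('g \<Rightarrow> 'h) \<Rightarrow> 'k) \<Rightarrow> 'k) right_modcomod
    \<Rightarrow> 'g \<Rightarrow> (('x \<Rightarrow> 'y \<Rightarrow> 'k) \<Rightarrow> 'k) \<Rightarrow> ((('x \<Rightarrow> 'y \<Rightarrow> 'k) \<Rightarrow> 'k) \<Rightarrow> 'h \<Rightarrow> 'k) \<Rightarrow> 'k" where
  "sum_factor_rcoact H \<Gamma> \<Delta> X Y c z = tlift X Y (\<lambda>x y.
     if c = base \<Gamma> then
       tlift X H (\<lambda>x0 a. tlift Y H (\<lambda>y0 b. tens (tensor X Y) H (tens X Y x0 y0) (amult H a b))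
           (factor_rcoact H (cilia \<Delta>) Y (base \<Delta>) y))
         (factor_rcoact H (cilia \<Gamma>) X (base \<Gamma>) x)
     else if c \<in> cilia \<Gamma> then
       tlift X H (\<lambda>x0 a. tens (tensor X Y) H (tens X Y x0 y) a)
         (factor_rcoact H (cilia \<Gamma>) X c x)
     else
       tlift Y H (\<lambda>y0 b. tens (tensor X Y) H (tens X Y x y0) b)
         (factor_rcoact H (cilia \<Delta>) Y c y)) z"

definition sum_modcomod :: "('k::field, 'h::ab_group_add) khopf \<Rightarrow> 'g kgraph \<Rightarrow> 'g kgraph
    \<Rightarrow> ('k, 'x::ab_group_add, (('g \<Rightarrow> 'h) \<Rightarrow> 'k) \<Rightarrow> 'k, (('g \<Rightarrow> 'h) \<Rightarrow> 'k) \<Rightarrow> 'k) right_modcomod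
    \<Rightarrow> ('k, 'y::ab_group_add, (('g \<Rightarrow> 'h) \<Rightarrow> 'k) \<Rightarrow> 'k, (('g \<Rightarrow> 'h) \<Rightarrow> 'k) \<Rightarrow> 'k) right_modcomod
    \<Rightarrow> ('k, ('x \<Rightarrow> 'y \<Rightarrow> 'k) \<Rightarrow> 'k,
        (('g \<Rightarrow> 'h) \<Rightarrow> 'k) \<Rightarrow> 'k, (('g \<Rightarrow> 'h) \<Rightarrow> 'k) \<Rightarrow> 'k) right_modcomod" where
  "sum_modcomod H \<Gamma> \<Delta> X Y = (let cs = cilia_list (connected_sum \<Gamma> \<Delta>) in
     \<lparr>carr = carr (tensor X Y),
      scl = scl (tensor X Y),
      ract = right_assemble_act H cs (sum_factor_ract H \<Gamma> \<Delta> X Y),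
      rcoact = right_assemble_coact H (tensor X Y) cs (sum_factor_rcoact H \<Gamma> \<Delta> X Y)\<rparr>)"

definition graph_bit :: "('k::field, 'h::ab_group_add) khopf
    \<Rightarrow> ('k, 'm::ab_group_add, 'h) hopf_bimod \<Rightarrow> 'g kgraph
    \<Rightarrow> ('k, 'x::ab_group_add, (('g \<Rightarrow> 'h) \<Rightarrow> 'k) \<Rightarrow> 'k, (('g \<Rightarrow> 'h) \<Rightarrow> 'k) \<Rightarrow> 'k) right_modcomod
    \<Rightarrow> ('k, ('x \<Rightarrow> ((('g set \<Rightarrow> 'm) \<Rightarrow> 'k) \<Rightarrow> 'k) \<Rightarrow> 'k) \<Rightarrow> 'k) kspace" where
  "graph_bit H M \<Gamma> X = Bit (graph_algebra H \<Gamma>) (graph_algebra H \<Gamma>) X (graph_module H M \<Gamma>)"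

end

theory Submission
  imports Defs
begin

text \<open>
  Every action of \<open>H\<close> and every coaction of \<open>H\<close>, contracted with a functional in \<open>H\<^sup>*\<close>, is a family of
  operators indexed by a vector space with a coassociative coproduct (\<open>H\<close> or \<open>H\<^sup>*\<close>). In \<open>\<Gamma> # \<Delta>\<close> the vertex
  cycle of the distinguished cilium is the concatenation of those of \<open>\<Gamma>\<close> and \<open>\<Delta>\<close>, and likewise for
  the face cycle, while all other cycles of cilia are unchanged. Hence under
  \<open>M\<^sub>\<Gamma> \<otimes> M\<^sub>\<Delta> \<cong> M\<^bsub>\<Gamma>#\<Delta>\<^esub>\<close> the distinguished cilium acts diagonally and every other one on a single factor,
  which is exactly how \<open>X # Y\<close> is defined.

  Therefore \<open>X \<otimes> M\<^sub>\<Gamma> \<otimes> Y \<otimes> M\<^sub>\<Delta> \<cong> (X # Y) \<otimes> M\<^bsub>\<Gamma>#\<Delta>\<^esub>\<close> maps the tensor product of the two cotensor products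
  into the cotensor product for \<open>\<Gamma> # \<Delta>\<close>, and products of balanced forms on \<open>X \<times> M\<^sub>\<Gamma>\<close> and \<open>Y \<times> M\<^sub>\<Delta>\<close> are
  balanced on \<open>(X # Y) \<times> M\<^bsub>\<Gamma>#\<Delta>\<^esub>\<close>. So a subspace of the bitensor product for \<open>\<Gamma> # \<Delta>\<close> projects onto the
  tensor product of the two bitensor products, and a linear section of this projection is the
  embedding.
\<close>

section \<open>Tensor products\<close>

text \<open>The two bitensor products are quotients, and \<open>\<tau>\<close> is not known to
  descend to them: a form balanced for \<open>\<Gamma> # \<Delta>\<close> is balanced only for the
  diagonal action of \<open>H\<close> at the distinguished cilium, not for the two copies of
  \<open>H\<close> separately, so an element killed by one projection may survive. Hence the
  embedding is built from chosen linear sections of the two projections, and its injectivity is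
  tested on products of balanced forms only.

  Coactions enter through their contractions with functionals. Finite dimension of \<open>H\<close>
  serves this twice: product functionals separate the points of the tensor powers of
  \<open>H\<close>, and a coaction can be recovered from the action of the dual. Tensors are
  functions on forms, so testing an equation means evaluating both sides. The decisive point in each
  comparison is that \<open>X # Y\<close> and the Hilbert space of the sum split the datum at the
  distinguished cilium by the same coproduct, so that both sides become finite sums with matching
  summands.\<close>

lemma lin_kfield_iff:
  "lin V kfield f \<longleftrightarrow> (\<forall>x\<in>carr V. \<forall>y\<in>carr V. f (x + y) = f x + f y)
     \<and> (\<forall>c. \<forall>x\<in>carr V. f (scl V c x) = c * f x)"
  by (auto simp: lin_def kfield_def)

lemma lin_mem: "lin V W f \<Longrightarrow> x \<in> carr V \<Longrightarrow> f x \<in> carr W"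
  and lin_add: "lin V W f \<Longrightarrow> x \<in> carr V \<Longrightarrow> y \<in> carr V \<Longrightarrow> f (x + y) = f x + f y"
  and lin_scl: "lin V W f \<Longrightarrow> x \<in> carr V \<Longrightarrow> f (scl V c x) = scl W c (f x)"
  by (auto simp: lin_def)

lemma lin_kfield_scl: "lin V kfield f \<Longrightarrow> x \<in> carr V \<Longrightarrow> f (scl V c x) = c * f x"
  by (simp add: lin_kfield_iff)

lemma lin_comp: "lin V W f \<Longrightarrow> lin W U g \<Longrightarrow> lin V U (\<lambda>x. g (f x))"
  by (auto simp: lin_def image_subset_iff)

lemma lin_id: "lin V V (\<lambda>x. x)"
  by (simp add: lin_def)

lemma vspace_zero: "vspace V \<Longrightarrow> 0 \<in> carr V"
  unfolding vspace_def by (metis module.subspace_0 module_iff_vector_space)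

lemma vspace_add: "vspace V \<Longrightarrow> x \<in> carr V \<Longrightarrow> y \<in> carr V \<Longrightarrow> x + y \<in> carr V"
  unfolding vspace_def by (metis module.subspace_add module_iff_vector_space)

lemma vspace_sum_list: "vspace V \<Longrightarrow> (\<And>p. p \<in> set ps \<Longrightarrow> f p \<in> carr V) \<Longrightarrow> sum_list (map f ps) \<in> carr V"
  by (induction ps) (auto intro: vspace_zero vspace_add)

lemma vspace_sum: "vspace V \<Longrightarrow> (\<And>p. p \<in> S \<Longrightarrow> f p \<in> carr V) \<Longrightarrow> sum f S \<in> carr V"
  by (induction S rule: infinite_finite_induct) (auto intro: vspace_zero vspace_add)

lemma vspace_scl_simps:
  assumes "vspace V"
  shows "scl V c (x + y) = scl V c x + scl V c y" "scl V (c + d) x = scl V c x + scl V d x"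
    "scl V c (scl V d x) = scl V (c * d) x" "scl V 1 x = x" "scl V 0 x = 0" "scl V c 0 = 0"
proof -
  interpret vector_space "scl V" using assms by (simp add: vspace_def)
  show "scl V c (x + y) = scl V c x + scl V c y" "scl V (c + d) x = scl V c x + scl V d x"
    "scl V c (scl V d x) = scl V (c * d) x" "scl V 1 x = x" "scl V 0 x = 0" "scl V c 0 = 0"
    by (simp_all add: scale_right_distrib scale_left_distrib)
qed

lemma lin_cong:
  assumes "vspace V" "\<And>x. x \<in> carr V \<Longrightarrow> f x = g x" "lin V W g"
  shows "lin V W f"
  using assms by (auto simp: lin_def image_subset_iff vspace_add vspace_scl)

lemma lin_zero: "vspace V \<Longrightarrow> lin V W f \<Longrightarrow> f 0 = 0"
  using lin_add[of V W f 0 0] by (simp add: vspace_zero)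

lemma lin_plus: "vspace W \<Longrightarrow> lin V W f \<Longrightarrow> lin V W g \<Longrightarrow> lin V W (\<lambda>x. f x + g x)"
  by (auto simp: lin_def vspace_scl_simps image_subset_iff intro: vspace_add)

lemma lin_const_zero: "vspace W \<Longrightarrow> lin V W (\<lambda>x. 0)"
  by (auto simp: lin_def vspace_zero vspace_scl_simps)

lemma lin_scl_left: "vspace W \<Longrightarrow> lin V kfield f \<Longrightarrow> w \<in> carr W \<Longrightarrow> lin V W (\<lambda>x. scl W (f x) w)"
  by (auto simp: lin_def kfield_def vspace_scl_simps intro: vspace_scl)

lemma lin_sum_list: "vspace W \<Longrightarrow> (\<And>p. p \<in> set ps \<Longrightarrow> lin V W (f p)) \<Longrightarrow>
    lin V W (\<lambda>x. sum_list (map (\<lambda>p. f p x) ps))"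
  by (induction ps) (auto intro!: lin_const_zero lin_plus)

lemma lin_sum: "vspace W \<Longrightarrow> (\<And>p. p \<in> S \<Longrightarrow> lin V W (f p)) \<Longrightarrow> lin V W (\<lambda>x. \<Sum>p\<in>S. f p x)"
  by (induction S rule: infinite_finite_induct) (auto intro!: lin_const_zero lin_plus)

lemma lin_cmult: "lin V kfield f \<Longrightarrow> lin V kfield (\<lambda>x. c * f x)"
  and lin_multc: "lin V kfield f \<Longrightarrow> lin V kfield (\<lambda>x. f x * c)"
  by (auto simp: lin_kfield_iff algebra_simps)

lemma lin_apply_sum_list:
  assumes "vspace V" "vspace W" "lin V W f" "\<And>p. p \<in> set ps \<Longrightarrow> g p \<in> carr V"
  shows "f (sum_list (map g ps)) = sum_list (map (\<lambda>p. f (g p)) ps)"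
  using assms(4)
  by (induction ps) (auto simp: lin_zero[OF assms(1,3)] lin_add[OF assms(3)] vspace_sum_list[OF
      assms(1)])

lemma lin_apply_sum:
  assumes "vspace V" "lin V W f" "\<And>p. p \<in> S \<Longrightarrow> g p \<in> carr V"
  shows "f (sum g S) = (\<Sum>p\<in>S. f (g p))"
  using assms(3)
  by (induction S rule: infinite_finite_induct)
    (auto simp: lin_zero[OF assms(1,2)] lin_add[OF assms(2)] vspace_sum[OF assms(1)])

lemma bilin_left: "bilin V W U f \<Longrightarrow> w \<in> carr W \<Longrightarrow> lin V U (\<lambda>v. f v w)"
  and bilin_right: "bilin V W U f \<Longrightarrow> v \<in> carr V \<Longrightarrow> lin W U (f v)"
  by (auto simp: bilin_def)

lemma bilinI: "(\<And>w. w \<in> carr W \<Longrightarrow> lin V U (\<lambda>v. f v w)) \<Longrightarrow> (\<And>v. v \<in> carr V \<Longrightarrow> lin W U (\<lambda>w. f v w))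
    \<Longrightarrow> bilin V W U f"
  by (auto simp: bilin_def)

lemma bilin_mem: "bilin V W U f \<Longrightarrow> v \<in> carr V \<Longrightarrow> w \<in> carr W \<Longrightarrow> f v w \<in> carr U"
  by (metis bilin_right lin_mem)

lemma bilin_comp: "bilin V W U f \<Longrightarrow> lin U T g \<Longrightarrow> bilin V W T (\<lambda>v w. g (f v w))"
  by (auto simp: bilin_def intro: lin_comp)

lemma bilin_comp2:
  "bilin V W U f \<Longrightarrow> lin V' V g \<Longrightarrow> lin W' W h \<Longrightarrow> bilin V' W' U (\<lambda>v w. f (g v) (h w))"
  by (intro bilinI; rule lin_comp[of _ V] lin_comp[of _ W]; auto simp: bilin_def lin_mem)

lemma bilin_mult: "lin V kfield \<phi> \<Longrightarrow> lin W kfield \<psi> \<Longrightarrow> bilin V W kfield (\<lambda>v w. \<phi> v * \<psi> w)"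
  by (intro bilinI lin_cmult lin_multc)

lemma bilin_cmult: "bilin V W kfield \<beta> \<Longrightarrow> bilin V W kfield (\<lambda>v w. c * \<beta> v w)"
  by (auto simp: bilin_def lin_cmult)

section \<open>Pure tensors and representing lists\<close>

lemma vspace_spanI: "scl V = fscl \<Longrightarrow> carr V = module.span fscl S \<Longrightarrow> vspace V"
  by (simp add: vspace_def vector_space_fscl module.subspace_span
      module_iff_vector_space[symmetric])
    (metis module.subspace_span module_iff_vector_space vector_space_fscl)

lemma vspace_tensor [simp]: "vspace (tensor V W)"
  by (rule vspace_spanI) (simp_all add: tensor_def)

lemma vspace_ntensor [simp]: "vspace (ntensor I V)"
  by (rule vspace_spanI) (simp_all add: ntensor_def)

lemma scl_tensor [simp]: "scl (tensor V W) = fscl"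
  and scl_ntensor [simp]: "scl (ntensor I V) = fscl"
  and scl_dual [simp]: "scl (dual V) = fscl"
  by (simp_all add: tensor_def ntensor_def dual_def)

lemma fscl_apply [simp]: "fscl c f x = c * f x"
  by (simp add: fscl_def)

lemma lin_eval: "scl V = fscl \<Longrightarrow> lin V kfield (\<lambda>f. f x)"
  by (simp add: lin_kfield_iff)

lemma fscl_span_base: "x \<in> S \<Longrightarrow> x \<in> module.span fscl S"
  by (metis module.span_base module_iff_vector_space vector_space_fscl)

lemma tens_mem [simp, intro]: "v \<in> carr V \<Longrightarrow> w \<in> carr W \<Longrightarrow> tens V W v w \<in> carr (tensor V W)"
  by (auto simp: tensor_def intro!: fscl_span_base)

lemma tens_apply: "bilin V W kfield \<beta> \<Longrightarrow> tens V W v w \<beta> = \<beta> v w"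
  by (simp add: tens_def)

lemma bilin_tens: "bilin V W (tensor V W) (tens V W)"
  by (simp add: bilin_def lin_def image_subset_iff)
    (auto simp: tens_def fun_eq_iff bilin_def lin_kfield_iff)

text \<open>The list chosen inside \<open>lin_ext\<close>. It does not depend on the function being
  lifted, so naming it turns \<open>tlift V W f t\<close> into a finite sum over one list shared by
  all \<open>f\<close>.\<close>

definition trep :: "('k::field, 'v::ab_group_add, 'y) kspace_scheme
    \<Rightarrow> ('k, 'w::ab_group_add, 'z) kspace_scheme \<Rightarrow> (('v \<Rightarrow> 'w \<Rightarrow> 'k) \<Rightarrow> 'k) \<Rightarrow> ('v \<times> 'w) list" where
  "trep V W t = (SOME ps. set ps \<subseteq> carr V \<times> carr W
     \<and> t = sum_list (map (\<lambda>(v, w). tens V W v w) ps))"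

lemma tlift_trep: "tlift V W f t = sum_list (map (\<lambda>(v, w). f v w) (trep V W t))"
  by (simp add: tlift_def lin_ext_def trep_def)

text \<open>A scalar can be absorbed into the first leg, so the span of the pure tensors consists of
  their finite sums.\<close>

lemma trep:
  assumes V: "vspace V" and t: "t \<in> carr (tensor V W)"
  shows "set (trep V W t) \<subseteq> carr V \<times> carr W"
    and "t = sum_list (map (\<lambda>(v, w). tens V W v w) (trep V W t))"
proof -
  let ?t = "\<lambda>(v, w). tens V W v w"
  have "\<exists>q\<in>carr V \<times> carr W. fscl c (?t p) = ?t q" if pVW: "p \<in> carr V \<times> carr W" for c p
  proof -
    obtain v w where p: "p = (v, w)" "v \<in> carr V" "w \<in> carr W" using pVW by (cases p) auto
    have "fscl c (?t p) = ?t (scl V c v, w)"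
      using lin_scl[OF bilin_left[OF bilin_tens p(3)] p(2)] by (simp add: p)
    then show ?thesis using p V by (intro bexI[of _ "(scl V c v, w)"]) (auto simp: vspace_scl)
  qed
  then have "module.span fscl (?t ` (carr V \<times> carr W))
      = {sum_list (map ?t ps) |ps. set ps \<subseteq> carr V \<times> carr W}"
    by (rule span_pure)
  moreover have "{tens V W v w |v w. v \<in> carr V \<and> w \<in> carr W} = ?t ` (carr V \<times> carr W)" by auto
  ultimately have "\<exists>ps. set ps \<subseteq> carr V \<times> carr W \<and> t = sum_list (map ?t ps)"
    using t by (auto simp: tensor_def)
  then have "set (trep V W t) \<subseteq> carr V \<times> carr W \<and> t = sum_list (map ?t (trep V W t))"
    unfolding trep_def by (rule someI_ex)
  then show "set (trep V W t) \<subseteq> carr V \<times> carr W" "t = sum_list (map ?t (trep V W t))" by auto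
qed

lemma sum_list_apply: "sum_list (map f ps) x = sum_list (map (\<lambda>p. f p x) ps)"
  by (induction ps) auto

lemma tensor_apply:
  assumes "vspace V" "t \<in> carr (tensor V W)" "bilin V W kfield \<beta>"
  shows "t \<beta> = sum_list (map (\<lambda>(v, w). \<beta> v w) (trep V W t))"
proof -
  have "t \<beta> = sum_list (map (\<lambda>(v, w). tens V W v w) (trep V W t)) \<beta>"
    using trep(2)[OF assms(1,2)] by simp
  then show ?thesis using assms(3) by (simp add: sum_list_apply split_def tens_apply)
qed

text \<open>Pure tensors are zero at forms that are not bilinear, and this passes to sums. Equality
  of tensors therefore has to be tested on bilinear forms only.\<close>

lemma tensor_apply_not_bilin:
  assumes "vspace V" "t \<in> carr (tensor V W)" "\<not> bilin V W kfield \<beta>"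
  shows "t \<beta> = 0"
proof -
  have "t \<beta> = sum_list (map (\<lambda>(v, w). tens V W v w) (trep V W t)) \<beta>"
    using trep(2)[OF assms(1,2)] by simp
  then show ?thesis using assms(3) by (simp add: sum_list_apply split_def tens_def)
qed

lemma bilin_cong:
  assumes "vspace V" "vspace W" "\<And>v w. v \<in> carr V \<Longrightarrow> w \<in> carr W \<Longrightarrow> f v w = g v w" "bilin V W U g"
  shows "bilin V W U f"
  using assms(4) unfolding bilin_def
  by (auto intro: lin_cong[OF assms(1)] lin_cong[OF assms(2)] simp: assms(3))

text \<open>Two forms that agree on the carriers are both bilinear or both not, and in the second
  case both values are zero. A form under a tensor can thus be rewritten without checking
  bilinearity.\<close>

lemma tensor_cong:
  assumes "vspace V" "vspace W" "t \<in> carr (tensor V W)"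
    and eq: "\<And>v w. v \<in> carr V \<Longrightarrow> w \<in> carr W \<Longrightarrow> \<beta> v w = \<gamma> v w"
  shows "t \<beta> = t \<gamma>"
proof (cases "bilin V W kfield \<beta>")
  case True
  then have "bilin V W kfield \<gamma>" using bilin_cong[OF assms(1,2), of \<gamma> \<beta>] eq by metis
  then show ?thesis using True trep(1)[OF assms(1,3)] eq
    by (auto simp: tensor_apply[OF assms(1,3)] intro!: arg_cong[where f = sum_list] map_cong)
next
  case False
  then have "\<not> bilin V W kfield \<gamma>" using bilin_cong[OF assms(1,2), of \<beta> \<gamma>] eq by metis
  then show ?thesis using False by (simp add: tensor_apply_not_bilin[OF assms(1,3)])
qed

lemma tlift_cong:
  assumes "vspace V" "t \<in> carr (tensor V W)"
    and eq: "\<And>v w. v \<in> carr V \<Longrightarrow> w \<in> carr W \<Longrightarrow> f v w = g v w"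
  shows "tlift V W f t = tlift V W g t"
  unfolding tlift_trep using trep(1)[OF assms(1,2)] eq
  by (auto intro!: arg_cong[where f = sum_list] map_cong)

lemma tensor_eqI:
  assumes "vspace V" "t \<in> carr (tensor V W)" "t' \<in> carr (tensor V W)"
    and "\<And>\<beta>. bilin V W kfield \<beta> \<Longrightarrow> t \<beta> = t' \<beta>"
  shows "t = t'"
proof
  show "t \<beta> = t' \<beta>" for \<beta>
    using assms(4) tensor_apply_not_bilin[OF assms(1,2)] tensor_apply_not_bilin[OF assms(1,3)]
    by (cases "bilin V W kfield \<beta>") metis+
qed

lemma tlift_mem:
  assumes "vspace V" "vspace U" "t \<in> carr (tensor V W)"
    and "\<And>v w. v \<in> carr V \<Longrightarrow> w \<in> carr W \<Longrightarrow> f v w \<in> carr U"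
  shows "tlift V W f t \<in> carr U"
  unfolding tlift_trep using trep(1)[OF assms(1,3)] assms(4)
  by (intro vspace_sum_list[OF assms(2)]) auto

text \<open>Bilinearity is only needed after evaluation, because a tensor is represented by the same sum of
  pure tensors for all \<open>f\<close>.\<close>

lemma tlift_functional:
  assumes "vspace V" "vspace U" "t \<in> carr (tensor V W)" "lin U kfield \<phi>"
    and "\<And>v w. v \<in> carr V \<Longrightarrow> w \<in> carr W \<Longrightarrow> f v w \<in> carr U"
    and "bilin V W kfield (\<lambda>v w. \<phi> (f v w))"
  shows "\<phi> (tlift V W f t) = t (\<lambda>v w. \<phi> (f v w))"
proof -
  have "\<phi> (tlift V W f t) = sum_list (map (\<lambda>p. \<phi> ((\<lambda>(v, w). f v w) p)) (trep V W t))"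
    unfolding tlift_trep using trep(1)[OF assms(1,3)] assms(5)
    by (intro lin_apply_sum_list[OF assms(2) vspace_kfield assms(4)]) auto
  then show ?thesis by (simp add: tensor_apply[OF assms(1,3,6)] split_def)
qed

lemma tlift_apply:
  assumes "vspace V" "t \<in> carr (tensor V W)" "bilin V W kfield (\<lambda>v w. f v w x)"
  shows "tlift V W f t x = t (\<lambda>v w. f v w x)"
  unfolding tlift_trep by (simp add: tensor_apply[OF assms] sum_list_apply split_def)

lemma tlift_kfield:
  assumes "vspace V" "t \<in> carr (tensor V W)" "bilin V W kfield \<beta>"
  shows "tlift V W \<beta> t = t \<beta>"
  unfolding tlift_trep by (simp add: tensor_apply[OF assms])

lemma tlift_tens:
  "vspace V \<Longrightarrow> vspace W \<Longrightarrow> vspace U \<Longrightarrow> bilin V W U f \<Longrightarrow> v \<in> carr V \<Longrightarrow> w \<in> carr W \<Longrightarrow>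
    tlift V W f (tens V W v w) = f v w"
  by (rule tensor_universal(2))

text \<open>Linear dependence on a parameter survives the lift because all values of the parameter
  share the same representing list.\<close>

lemma lin_tlift_param:
  assumes "vspace V" "vspace U" "t \<in> carr (tensor V W)"
    and "\<And>v w. v \<in> carr V \<Longrightarrow> w \<in> carr W \<Longrightarrow> lin X U (\<lambda>x. f x v w)"
  shows "lin X U (\<lambda>x. tlift V W (f x) t)"
  unfolding tlift_trep split_def using trep(1)[OF assms(1,3)] assms(4)
  by (intro lin_sum_list[OF assms(2)]) auto

lemma lin_apply_param:
  assumes "vspace V" "t \<in> carr (tensor V W)" "vspace X"
    and "\<And>v w. v \<in> carr V \<Longrightarrow> w \<in> carr W \<Longrightarrow> lin X kfield (\<lambda>x. f x v w)"
    and "\<And>x. x \<in> carr X \<Longrightarrow> bilin V W kfield (f x)"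
  shows "lin X kfield (\<lambda>x. t (f x))"
  by (rule lin_cong[OF assms(3)], rule tlift_kfield[OF assms(1,2) assms(5), symmetric])
    (auto intro!: lin_tlift_param assms vspace_kfield)

lemma tensor_lin_eq:
  assumes "vspace V" "vspace W" "lin (tensor V W) U f" "lin (tensor V W) U g" "vspace U"
    and "\<And>v w. v \<in> carr V \<Longrightarrow> w \<in> carr W \<Longrightarrow> f (tens V W v w) = g (tens V W v w)"
    and t: "t \<in> carr (tensor V W)"
  shows "f t = g t"
proof -
  note r = trep[OF assms(1) t]
  have "h t = sum_list (map (\<lambda>p. h (tens V W (fst p) (snd p))) (trep V W t))"
    if "lin (tensor V W) U h" for h
    using r(1) by (subst r(2), subst split_def) (rule lin_apply_sum_list[OF _ assms(5) that]; auto)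
  from this[OF assms(3)] this[OF assms(4)] show ?thesis using r(1) assms(6)
    by (auto intro!: arg_cong[where f = sum_list] map_cong)
qed

section \<open>Dual bases and separation by functionals\<close>

lemma finite_dual_basis:
  assumes V: "vspace V" and fin: "finite_dim V"
  obtains E \<epsilon> where "finite E" "E \<subseteq> carr V" "\<And>e. e \<in> E \<Longrightarrow> \<epsilon> e \<in> carr (dual V)"
    "\<And>x. x \<in> carr V \<Longrightarrow> (\<Sum>e\<in>E. scl V (\<epsilon> e x) e) = x"
proof -
  interpret vector_space "scl V" using V by (simp add: vspace_def)
  obtain B where B: "finite B" "carr V = span B" using fin by (auto simp: finite_dim_def)
  obtain E where E: "E \<subseteq> B" "independent E" "B \<subseteq> span E" by (rule basis_exists[of B])
  have finE: "finite E" using E B finite_subset by blast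
  have sp: "carr V = span E"
    using E B by (metis span_minimal span_mono subset_antisym subspace_span)
  \<comment> \<open>The coordinate functionals are cut off outside the carrier because membership in
    \<open>dual V\<close> demands it.\<close>
  define \<epsilon> where "\<epsilon> e x = (if x \<in> carr V then representation E x e else 0)" for e x
  have "\<epsilon> e \<in> carr (dual V)" for e
    by (auto simp: \<epsilon>_def dual_def lin_kfield_iff vspace_add[OF V] vspace_scl[OF V]
        representation_add[OF E(2)] representation_scale[OF E(2)] sp span_add span_scale)
  moreover have "(\<Sum>e\<in>E. scl V (\<epsilon> e x) e) = x" if "x \<in> carr V" for x
    using that sum_representation_eq[OF E(2) _ finE subset_refl, of x] by (simp add: \<epsilon>_def sp)
  ultimately show ?thesis using that finE sp span_superset[of E] by blast
qed

text \<open>Write \<open>u\<close> as a finite sum of pure tensors and expand the first legs in a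
  basis \<open>E\<close> of their span. This writes \<open>u\<close> as the sum over
  \<open>e\<close> of the pure tensors of \<open>e\<close> with vectors w_e of \<open>W\<close>.
  Separation by \<open>\<Phi>\<close> shows that contracting the second legs with
  \<open>\<psi>\<close> gives zero; taking coordinates, \<open>\<psi>\<close> kills every w_e, and
  separation by \<open>\<Psi>\<close> gives w_e = 0.\<close>

lemma tensor_sep_zero:
  assumes V: "vspace V" and W: "vspace W" and u: "u \<in> carr (tensor V W)"
    and \<Phi>: "\<And>\<phi>. \<phi> \<in> \<Phi> \<Longrightarrow> lin V kfield \<phi>" and \<Psi>: "\<And>\<psi>. \<psi> \<in> \<Psi> \<Longrightarrow> lin W kfield \<psi>"
    and \<Phi>0: "\<And>v. v \<in> carr V \<Longrightarrow> (\<And>\<phi>. \<phi> \<in> \<Phi> \<Longrightarrow> \<phi> v = 0) \<Longrightarrow> v = 0"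
    and \<Psi>0: "\<And>w. w \<in> carr W \<Longrightarrow> (\<And>\<psi>. \<psi> \<in> \<Psi> \<Longrightarrow> \<psi> w = 0) \<Longrightarrow> w = 0"
    and z: "\<And>\<phi> \<psi>. \<phi> \<in> \<Phi> \<Longrightarrow> \<psi> \<in> \<Psi> \<Longrightarrow> u (\<lambda>v w. \<phi> v * \<psi> w) = 0"
  shows "u = 0"
proof (rule tensor_eqI[OF V u])
  show "0 \<in> carr (tensor V W)" by (rule vspace_zero) simp
  fix \<beta> assume \<beta>: "bilin V W kfield \<beta>"
  define ps where "ps = trep V W u"
  have ps: "v \<in> carr V" "w \<in> carr W" if "(v, w) \<in> set ps" for v w
    using trep(1)[OF V u] that by (auto simp: ps_def)
  have uev: "u \<gamma> = (\<Sum>p\<leftarrow>ps. \<gamma> (fst p) (snd p))" if "bilin V W kfield \<gamma>" for \<gamma>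
    using tensor_apply[OF V u that] by (simp add: ps_def split_def)
  interpret vector_space "scl V" using V by (simp add: vspace_def)
  \<comment> \<open>A basis is needed only for the span of the finitely many first legs, so
    \<open>V\<close> itself may have infinite dimension.\<close>
  define V' where "V' = V\<lparr>carr := span (fst ` set ps)\<rparr>"
  have sV: "scl V' = scl V" by (simp add: V'_def)
  have V': "vspace V'" by (simp add: vspace_def V'_def vector_space_axioms)
  have V'V: "carr V' \<subseteq> carr V"
  proof -
    have "span (fst ` set ps) \<subseteq> carr V"
      using V by (intro span_minimal) (auto simp: vspace_def dest: ps)
    then show ?thesis by (simp add: V'_def)
  qed
  have psV': "fst p \<in> carr V'" if "p \<in> set ps" for p using that by (auto simp: V'_def intro: span_base)
  obtain E \<epsilon> where E: "finite E" "E \<subseteq> carr V'" "\<And>e. e \<in> E \<Longrightarrow> \<epsilon> e \<in> carr (dual V')"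
      "\<And>x. x \<in> carr V' \<Longrightarrow> (\<Sum>e\<in>E. scl V' (\<epsilon> e x) e) = x"
    by (rule finite_dual_basis[OF V']) (auto simp: finite_dim_def V'_def)
  have z1: "(\<Sum>p\<leftarrow>ps. scl V (\<psi> (snd p)) (fst p)) = 0" if "\<psi> \<in> \<Psi>" for \<psi>
  proof (rule \<Phi>0)
    show mem: "(\<Sum>p\<leftarrow>ps. scl V (\<psi> (snd p)) (fst p)) \<in> carr V"
      using ps by (intro vspace_sum_list[OF V] vspace_scl[OF V]) auto
    fix \<phi> assume \<phi>: "\<phi> \<in> \<Phi>"
    have "\<phi> (\<Sum>p\<leftarrow>ps. scl V (\<psi> (snd p)) (fst p)) = (\<Sum>p\<leftarrow>ps. \<phi> (scl V (\<psi> (snd p)) (fst p)))"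
      using ps by (intro lin_apply_sum_list[OF V vspace_kfield \<Phi>[OF \<phi>]] vspace_scl[OF V]) auto
    also have "\<dots> = (\<Sum>p\<leftarrow>ps. \<phi> (fst p) * \<psi> (snd p))"
      using ps by (intro arg_cong[where f = sum_list] map_cong) (auto simp: lin_kfield_scl[OF \<Phi>[OF \<phi>]])
    also have "\<dots> = 0"
      using z[OF \<phi> that] uev[OF bilin_mult[OF \<Phi>[OF \<phi>] \<Psi>[OF that]]] by simp
    finally show "\<phi> (\<Sum>p\<leftarrow>ps. scl V (\<psi> (snd p)) (fst p)) = 0" .
  qed
  \<comment> \<open>\<open>\<epsilon> e\<close> is linear on \<open>V'\<close> only; it can be
    applied to the sum from \<open>z1\<close> because all terms of that sum lie in
    \<open>V'\<close>.\<close>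
  have z2: "(\<Sum>p\<leftarrow>ps. scl W (\<epsilon> e (fst p)) (snd p)) = 0" if e: "e \<in> E" for e
  proof (rule \<Psi>0)
    have le: "lin V' kfield (\<epsilon> e)" using E(3)[OF e] by (simp add: dual_def)
    show mem: "(\<Sum>p\<leftarrow>ps. scl W (\<epsilon> e (fst p)) (snd p)) \<in> carr W"
      using ps by (intro vspace_sum_list[OF W] vspace_scl[OF W]) auto
    fix \<psi> assume \<psi>: "\<psi> \<in> \<Psi>"
    have "\<psi> (\<Sum>p\<leftarrow>ps. scl W (\<epsilon> e (fst p)) (snd p)) = (\<Sum>p\<leftarrow>ps. \<psi> (scl W (\<epsilon> e (fst p)) (snd p)))"
      using ps by (intro lin_apply_sum_list[OF W vspace_kfield \<Psi>[OF \<psi>]] vspace_scl[OF W]) auto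
    also have "\<dots> = (\<Sum>p\<leftarrow>ps. \<epsilon> e (scl V' (\<psi> (snd p)) (fst p)))"
      using ps psV' by (intro arg_cong[where f = sum_list] map_cong)
        (auto simp: lin_kfield_scl[OF \<Psi>[OF \<psi>]] lin_kfield_scl[OF le] mult.commute)
    also have "\<dots> = \<epsilon> e (\<Sum>p\<leftarrow>ps. scl V' (\<psi> (snd p)) (fst p))"
      using psV' by (intro lin_apply_sum_list[OF V' vspace_kfield le, symmetric] vspace_scl[OF V']) auto
    also have "\<dots> = 0" using z1[OF \<psi>] lin_zero[OF V' le] by (simp add: sV)
    finally show "\<psi> (\<Sum>p\<leftarrow>ps. scl W (\<epsilon> e (fst p)) (snd p)) = 0" .
  qed
  have "u \<beta> = (\<Sum>p\<leftarrow>ps. \<beta> (fst p) (snd p))" by (rule uev[OF \<beta>])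
  \<comment> \<open>The coordinates move from the first leg to the second, where the terms belonging
    to one \<open>e\<close> add up to the vector that vanishes by \<open>z2\<close>.\<close>
  also have "\<dots> = (\<Sum>p\<leftarrow>ps. \<Sum>e\<in>E. \<beta> e (scl W (\<epsilon> e (fst p)) (snd p)))"
  proof (intro arg_cong[where f = sum_list] map_cong refl)
    fix p assume p: "p \<in> set ps"
    have w: "snd p \<in> carr W" using ps[of "fst p" "snd p"] p by simp
    have "\<beta> (fst p) (snd p) = \<beta> (\<Sum>e\<in>E. scl V' (\<epsilon> e (fst p)) e) (snd p)"
      using E(4)[OF psV'[OF p]] by simp
    also have "\<dots> = (\<Sum>e\<in>E. \<beta> (scl V' (\<epsilon> e (fst p)) e) (snd p))"
      using E V'V by (intro lin_apply_sum[OF V bilin_left[OF \<beta> w]])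
        (auto simp: sV intro: vspace_scl[OF V])
    also have "\<dots> = (\<Sum>e\<in>E. \<beta> e (scl W (\<epsilon> e (fst p)) (snd p)))"
    proof (intro sum.cong refl)
      fix e assume "e \<in> E"
      then have eV: "e \<in> carr V" using E V'V by auto
      show "\<beta> (scl V' (\<epsilon> e (fst p)) e) (snd p) = \<beta> e (scl W (\<epsilon> e (fst p)) (snd p))"
        unfolding sV lin_kfield_scl[OF bilin_left[OF \<beta> w] eV]
          lin_kfield_scl[OF bilin_right[OF \<beta> eV] w] ..
    qed
    finally show "\<beta> (fst p) (snd p) = (\<Sum>e\<in>E. \<beta> e (scl W (\<epsilon> e (fst p)) (snd p)))" .
  qed
  also have "\<dots> = (\<Sum>e\<in>E. \<Sum>p\<leftarrow>ps. \<beta> e (scl W (\<epsilon> e (fst p)) (snd p)))"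
    by (induction ps) (simp_all add: sum.distrib)
  also have "\<dots> = (\<Sum>e\<in>E. \<beta> e (\<Sum>p\<leftarrow>ps. scl W (\<epsilon> e (fst p)) (snd p)))"
    using ps V'V E(2) by (intro sum.cong refl lin_apply_sum_list[OF W vspace_kfield bilin_right[OF \<beta>],
        symmetric]
      vspace_scl[OF W]) auto
  also have "\<dots> = 0"
    using z2 V'V E(2) by (intro sum.neutral) (auto simp: lin_zero[OF W bilin_right[OF \<beta>]])
  finally show "u \<beta> = 0 \<beta>" by simp
qed

lemma tensor_sep:
  assumes V: "vspace V" and W: "vspace W" and u: "u \<in> carr (tensor V W)" "u' \<in> carr (tensor V W)"
    and \<Phi>: "\<And>\<phi>. \<phi> \<in> \<Phi> \<Longrightarrow> lin V kfield \<phi>" and \<Psi>: "\<And>\<psi>. \<psi> \<in> \<Psi> \<Longrightarrow> lin W kfield \<psi>"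
    and \<Phi>0: "\<And>v. v \<in> carr V \<Longrightarrow> (\<And>\<phi>. \<phi> \<in> \<Phi> \<Longrightarrow> \<phi> v = 0) \<Longrightarrow> v = 0"
    and \<Psi>0: "\<And>w. w \<in> carr W \<Longrightarrow> (\<And>\<psi>. \<psi> \<in> \<Psi> \<Longrightarrow> \<psi> w = 0) \<Longrightarrow> w = 0"
    and z: "\<And>\<phi> \<psi>. \<phi> \<in> \<Phi> \<Longrightarrow> \<psi> \<in> \<Psi> \<Longrightarrow> u (\<lambda>v w. \<phi> v * \<psi> w) = u' (\<lambda>v w. \<phi> v * \<psi> w)"
  shows "u = u'"
proof -
  \<comment> \<open>Carriers are known to be closed under sums and multiples, so the difference is
    written with the scalar -1.\<close>
  have d: "u - u' = u + fscl (-1) u'" by (auto simp: fun_eq_iff)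
  have "u - u' \<in> carr (tensor V W)"
    unfolding d using u by (intro vspace_add) (auto intro: vspace_scl[of "tensor V W", simplified])
  then have "u - u' = 0" by (rule tensor_sep_zero[OF V W _ \<Phi> \<Psi> \<Phi>0 \<Psi>0]) (auto simp: z)
  then show ?thesis by simp
qed

text \<open>\<open>scl V\<close> is a vector space structure on the whole type, so a functional that
  is nonzero at \<open>v\<close> exists there; it is linear on the carrier in particular.\<close>

lemma functional_sep:
  assumes V: "vspace V" and v: "\<And>\<phi>. lin V kfield \<phi> \<Longrightarrow> \<phi> v = 0"
  shows "v = 0"
proof (rule ccontr)
  interpret vector_space "scl V" using V by (simp add: vspace_def)
  assume "v \<noteq> 0"
  then have "v \<notin> {0}" by simp
  then obtain \<phi> where \<phi>: "Vector_Spaces.linear (scl V) (*) \<phi>" "\<phi> v \<noteq> 0"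
    using separating_functional[OF vector_space_axioms subspace_single_0] by blast
  then interpret l: Vector_Spaces.linear "scl V" "(*)" \<phi> by blast
  have "lin V kfield \<phi>" by (simp add: lin_kfield_iff l.add l.scale)
  then show False using v \<phi> by blast
qed

lemma functional_eqI:
  assumes V: "vspace V" and v: "\<And>\<phi>. lin V kfield \<phi> \<Longrightarrow> \<phi> v = \<phi> w" "v \<in> carr V" "w \<in> carr V"
  shows "v = w"
proof -
  interpret vector_space "scl V" using V by (simp add: vspace_def)
  have "v - w = 0"
  proof (rule functional_sep[OF V])
    fix \<phi> assume \<phi>: "lin V kfield \<phi>"
    have "v - w = v + scl V (-1) w" by simp
    moreover have "scl V (-1) w \<in> carr V" by (rule vspace_scl[OF V v(3)])
    ultimately have "\<phi> (v - w) = \<phi> v + \<phi> (scl V (-1) w)" using lin_add[OF \<phi> v(2)] by metis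
    then show "\<phi> (v - w) = 0" using v(1)[OF \<phi>] lin_kfield_scl[OF \<phi> v(3), of "-1"] by simp
  qed
  then show ?thesis by simp
qed

section \<open>Tensor powers\<close>

lemma sum_list_sum: "(\<Sum>p\<leftarrow>ps. \<Sum>e\<in>E. f e p) = (\<Sum>e\<in>E. \<Sum>p\<leftarrow>ps. f e p :: 'a::comm_monoid_add)"
  by (induction ps) (simp_all add: sum.distrib)

section \<open>Multilinear maps and pure tensors of families\<close>

lemma multilinI:
  "(\<And>v. v \<in> I \<rightarrow>\<^sub>E carr V \<Longrightarrow> f v \<in> carr U)
    \<Longrightarrow> (\<And>v i. v \<in> I \<rightarrow>\<^sub>E carr V \<Longrightarrow> i \<in> I \<Longrightarrow> lin V U (\<lambda>x. f (v(i := x)))) \<Longrightarrow> multilin I V U f"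
  by (simp add: multilin_def)

lemma multilin_mem: "multilin I V U f \<Longrightarrow> v \<in> I \<rightarrow>\<^sub>E carr V \<Longrightarrow> f v \<in> carr U"
  and multilin_lin: "multilin I V U f \<Longrightarrow> v \<in> I \<rightarrow>\<^sub>E carr V \<Longrightarrow> i \<in> I \<Longrightarrow> lin V U (\<lambda>x. f (v(i := x)))"
  by (simp_all add: multilin_def)

lemma PiE_upd: "v \<in> I \<rightarrow>\<^sub>E S \<Longrightarrow> i \<in> I \<Longrightarrow> x \<in> S \<Longrightarrow> v(i := x) \<in> I \<rightarrow>\<^sub>E S"
  by (auto simp: PiE_def Pi_def extensional_def)

lemma multilin_cong:
  assumes "vspace V" "\<And>v. v \<in> I \<rightarrow>\<^sub>E carr V \<Longrightarrow> f v = g v" "multilin I V U g"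
  shows "multilin I V U f"
proof (rule multilinI)
  show "f v \<in> carr U" if "v \<in> I \<rightarrow>\<^sub>E carr V" for v
    using assms(2)[OF that] multilin_mem[OF assms(3) that] by simp
  show "lin V U (\<lambda>x. f (v(i := x)))" if "v \<in> I \<rightarrow>\<^sub>E carr V" "i \<in> I" for v i
    by (rule lin_cong[OF assms(1) assms(2)[OF PiE_upd[OF that]] multilin_lin[OF assms(3) that]])
qed

lemma multilin_sum_list: "vspace U \<Longrightarrow> (\<And>p. p \<in> set ps \<Longrightarrow> multilin I V U (f p)) \<Longrightarrow>
    multilin I V U (\<lambda>v. sum_list (map (\<lambda>p. f p v) ps))"
  by (intro multilinI vspace_sum_list lin_sum_list) (auto intro: multilin_lin multilin_mem)

lemma multilin_sum: "vspace U \<Longrightarrow> (\<And>p. p \<in> S \<Longrightarrow> multilin I V U (f p)) \<Longrightarrow>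
    multilin I V U (\<lambda>v. \<Sum>p\<in>S. f p v)"
  by (intro multilinI vspace_sum lin_sum) (auto intro: multilin_lin multilin_mem)

lemma multilin_cmult: "multilin I V kfield f \<Longrightarrow> multilin I V kfield (\<lambda>v. c * f v)"
  by (auto simp: multilin_def kfield_def[THEN arg_cong[where f = carr]] intro: lin_cmult)

lemma ntens_apply: "multilin I V kfield \<mu> \<Longrightarrow> ntens I V v \<mu> = \<mu> (restrict v I)"
  by (simp add: ntens_def)

lemma ntens_cong: "(\<And>i. i \<in> I \<Longrightarrow> v i = w i) \<Longrightarrow> ntens I V v = ntens I V w"
  unfolding ntens_def by (metis restrict_ext)

lemma ntens_mem_PiE: "v \<in> I \<rightarrow>\<^sub>E carr V \<Longrightarrow> ntens I V v \<in> carr (ntensor I V)"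
  by (auto simp: ntensor_def intro!: fscl_span_base)

lemma ntens_restrict: "ntens I V (restrict v I) = ntens I V v"
  by (rule ntens_cong) simp

lemma ntens_mem: "(\<And>i. i \<in> I \<Longrightarrow> v i \<in> carr V) \<Longrightarrow> ntens I V v \<in> carr (ntensor I V)"
  using ntens_mem_PiE[of "restrict v I" I V] by (simp add: ntens_restrict)

lemma multilin_ntens: "multilin I V (ntensor I V) (ntens I V)"
proof (rule multilinI)
  fix v i assume v: "v \<in> I \<rightarrow>\<^sub>E carr V" and i: "i \<in> I"
  have r: "restrict (v(i := x)) I = v(i := x)" for x
    using v i by (auto simp: restrict_def PiE_def extensional_def)
  show "lin V (ntensor I V) (\<lambda>x. ntens I V (v(i := x)))"
    unfolding lin_def
  proof (intro conjI ballI allI image_subsetI)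
    show "ntens I V (v(i := x)) \<in> carr (ntensor I V)" if "x \<in> carr V" for x
      using v i that by (intro ntens_mem_PiE PiE_upd)
    fix x y c assume x: "x \<in> carr V"
    show "ntens I V (v(i := scl V c x)) = scl (ntensor I V) c (ntens I V (v(i := x)))"
      using lin_kfield_scl[OF multilin_lin[OF _ v i] x]
      by (auto simp: fun_eq_iff ntens_def r)
    assume y: "y \<in> carr V"
    show "ntens I V (v(i := x + y)) = ntens I V (v(i := x)) + ntens I V (v(i := y))"
      using lin_add[OF multilin_lin[OF _ v i] x y]
      by (auto simp: fun_eq_iff ntens_def r)
  qed
qed (rule ntens_mem_PiE)

definition nrep :: "'i set \<Rightarrow> ('k::field, 'v::ab_group_add, 'y) kspace_scheme
    \<Rightarrow> ((('i \<Rightarrow> 'v) \<Rightarrow> 'k) \<Rightarrow> 'k) \<Rightarrow> ('i \<Rightarrow> 'v) list" where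
  "nrep I V t = (SOME ps. set ps \<subseteq> I \<rightarrow>\<^sub>E carr V \<and> t = sum_list (map (ntens I V) ps))"

lemma nlift_nrep: "nlift I V f t = sum_list (map f (nrep I V t))"
  by (simp add: nlift_def lin_ext_def nrep_def)

text \<open>A scalar is absorbed into one coordinate. This is where \<open>I \<noteq> {}\<close>
  enters: over the empty index set there is a single pure tensor, and its sums need not be closed
  under scalars.\<close>

lemma nrep:
  assumes I: "I \<noteq> {}" and V: "vspace V" and t: "t \<in> carr (ntensor I V)"
  shows "set (nrep I V t) \<subseteq> I \<rightarrow>\<^sub>E carr V"
    and "t = sum_list (map (ntens I V) (nrep I V t))"
proof -
  obtain i where i: "i \<in> I" using I by blast
  have "\<exists>q\<in>I \<rightarrow>\<^sub>E carr V. fscl c (ntens I V p) = ntens I V q" if p: "p \<in> I \<rightarrow>\<^sub>E carr V" for c p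
  proof -
    have pi: "p i \<in> carr V" using p i by auto
    have "fscl c (ntens I V p) = ntens I V (p(i := scl V c (p i)))"
      using lin_scl[OF multilin_lin[OF multilin_ntens p i] pi] by simp
    then show ?thesis using PiE_upd[OF p i vspace_scl[OF V pi]] by blast
  qed
  then have "module.span fscl (ntens I V ` (I \<rightarrow>\<^sub>E carr V))
      = {sum_list (map (ntens I V) ps) |ps. set ps \<subseteq> I \<rightarrow>\<^sub>E carr V}"
    by (rule span_pure)
  then have "\<exists>ps. set ps \<subseteq> I \<rightarrow>\<^sub>E carr V \<and> t = sum_list (map (ntens I V) ps)"
    using t by (auto simp: ntensor_def)
  then have "set (nrep I V t) \<subseteq> I \<rightarrow>\<^sub>E carr V \<and> t = sum_list (map (ntens I V) (nrep I V t))"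
    unfolding nrep_def by (rule someI_ex)
  then show "set (nrep I V t) \<subseteq> I \<rightarrow>\<^sub>E carr V" "t = sum_list (map (ntens I V) (nrep I V t))" by auto
qed

lemma ntensor_apply:
  assumes "I \<noteq> {}" "vspace V" "t \<in> carr (ntensor I V)" "multilin I V kfield \<mu>"
  shows "t \<mu> = sum_list (map \<mu> (nrep I V t))"
proof -
  have "t \<mu> = sum_list (map (ntens I V) (nrep I V t)) \<mu>"
    using nrep(2)[OF assms(1-3)] by simp
  also have "\<dots> = sum_list (map \<mu> (nrep I V t))"
    unfolding sum_list_apply using nrep(1)[OF assms(1-3)] assms(4)
    by (intro arg_cong[where f = sum_list] map_cong) (auto simp: ntens_apply PiE_restrict)
  finally show ?thesis .
qed

lemma ntensor_cong:
  assumes "I \<noteq> {}" "vspace V" "t \<in> carr (ntensor I V)" "multilin I V kfield \<mu>"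
    "\<And>v. v \<in> I \<rightarrow>\<^sub>E carr V \<Longrightarrow> \<nu> v = \<mu> v"
  shows "t \<nu> = t \<mu>"
  using nrep(1)[OF assms(1-3)] assms(5)
  by (auto simp: ntensor_apply[OF assms(1-3)] assms(4) multilin_cong[OF assms(2,5,4)]
      intro!: arg_cong[where f = sum_list] map_cong)

lemma ntensor_apply_not_multilin:
  assumes "I \<noteq> {}" "vspace V" "t \<in> carr (ntensor I V)" "\<not> multilin I V kfield \<mu>"
  shows "t \<mu> = 0"
proof -
  have "t \<mu> = sum_list (map (ntens I V) (nrep I V t)) \<mu>"
    using nrep(2)[OF assms(1-3)] by simp
  then show ?thesis using assms(4) by (simp add: sum_list_apply ntens_def)
qed

lemma nlift_mem:
  assumes "I \<noteq> {}" "vspace V" "vspace U" "t \<in> carr (ntensor I V)"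
    and "\<And>v. v \<in> I \<rightarrow>\<^sub>E carr V \<Longrightarrow> f v \<in> carr U"
  shows "nlift I V f t \<in> carr U"
  unfolding nlift_nrep using nrep(1)[OF assms(1,2,4)] assms(5)
  by (intro vspace_sum_list[OF assms(3)]) auto

lemma nlift_kfield:
  assumes "I \<noteq> {}" "vspace V" "t \<in> carr (ntensor I V)" "multilin I V kfield \<mu>"
  shows "nlift I V \<mu> t = t \<mu>"
  unfolding nlift_nrep by (simp add: ntensor_apply[OF assms])

lemma lin_nlift: "vspace V \<Longrightarrow> vspace U \<Longrightarrow> multilin I V U f \<Longrightarrow> I \<noteq> {} \<Longrightarrow> lin (ntensor I V) U (nlift I V f)"
  by (rule ntensor_universal(1))

lemma nlift_ntens:
  assumes "vspace V" "vspace U" "multilin I V U f" "I \<noteq> {}" "\<And>i. i \<in> I \<Longrightarrow> v i \<in> carr V"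
  shows "nlift I V f (ntens I V v) = f (restrict v I)"
  using ntensor_universal(2)[OF assms(1-4), of "restrict v I"] assms(5) by (simp add: ntens_restrict)

lemma lin_nlift_param:
  assumes "I \<noteq> {}" "vspace V" "vspace U" "t \<in> carr (ntensor I V)"
    and "\<And>v. v \<in> I \<rightarrow>\<^sub>E carr V \<Longrightarrow> lin X U (\<lambda>x. f x v)"
  shows "lin X U (\<lambda>x. nlift I V (f x) t)"
  unfolding nlift_nrep using nrep(1)[OF assms(1,2,4)] assms(5)
  by (intro lin_sum_list[OF assms(3)]) auto

lemma ntensor_lin_eq:
  assumes "I \<noteq> {}" "vspace V" "lin (ntensor I V) U f" "lin (ntensor I V) U g" "vspace U"
    and "\<And>v. v \<in> I \<rightarrow>\<^sub>E carr V \<Longrightarrow> f (ntens I V v) = g (ntens I V v)"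
    and t: "t \<in> carr (ntensor I V)"
  shows "f t = g t"
proof -
  note r = nrep[OF assms(1,2) t]
  have "h t = sum_list (map (\<lambda>p. h (ntens I V p)) (nrep I V t))"
    if "lin (ntensor I V) U h" for h
    using r(1) by (subst r(2)) (rule lin_apply_sum_list[OF _ assms(5) that]; auto intro: ntens_mem_PiE)
  from this[OF assms(3)] this[OF assms(4)] show ?thesis using r(1) assms(6)
    by (auto intro!: arg_cong[where f = sum_list] map_cong)
qed

text \<open>These are the intermediate forms of the separation argument below: the coordinates in
  \<open>T\<close> are seen only through the functionals \<open>\<alpha> i\<close> and have been
  replaced by fixed vectors \<open>b i\<close> inside \<open>\<mu>\<close>.\<close>

lemma multilin_prod_mult:
  assumes "finite T" "T \<subseteq> I" "\<And>i. i \<in> T \<Longrightarrow> lin V kfield (\<alpha> i)" "\<And>i. i \<in> T \<Longrightarrow> b i \<in> carr V"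
    "vspace V" "multilin I V kfield \<mu>"
  shows "multilin I V kfield (\<lambda>a. (\<Prod>i\<in>T. \<alpha> i (a i)) * \<mu> (\<lambda>i. if i \<in> T then b i else a i))"
proof (rule multilinI)
  fix v i assume v: "v \<in> I \<rightarrow>\<^sub>E carr V" and i: "i \<in> I"
  let ?w = "\<lambda>a i. if i \<in> T then b i else a i"
  show "lin V kfield (\<lambda>x. (\<Prod>j\<in>T. \<alpha> j ((v(i := x)) j)) * \<mu> (?w (v(i := x))))"
  proof (cases "i \<in> T")
    case True
    have "?w (v(i := x)) = ?w v" for x using True by auto
    moreover have "(\<Prod>j\<in>T. \<alpha> j ((v(i := x)) j)) = \<alpha> i x * (\<Prod>j\<in>T - {i}. \<alpha> j (v j))" for x
      by (subst prod.remove[OF assms(1) True]) (auto intro!: prod.cong)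
    ultimately show ?thesis using assms(3)[OF True] by (simp add: lin_multc)
  next
    case False
    have "?w (v(i := x)) = (?w v)(i := x)" for x using False by auto
    moreover have "(\<Prod>j\<in>T. \<alpha> j ((v(i := x)) j)) = (\<Prod>j\<in>T. \<alpha> j (v j))" for x
      using False by (auto intro!: prod.cong)
    moreover have "?w v \<in> I \<rightarrow>\<^sub>E carr V" using v assms(2,4) by (auto simp: PiE_def extensional_def
        Pi_def)
    ultimately show ?thesis using multilin_lin[OF assms(6) _ i] by (simp add: lin_cmult)
  qed
qed (simp add: kfield_def)

lemma multilin_prod:
  assumes "finite I" "vspace V" "\<And>i. i \<in> I \<Longrightarrow> lin V kfield (\<alpha> i)"
  shows "multilin I V kfield (\<lambda>a. \<Prod>i\<in>I. \<alpha> i (a i))"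
proof (rule multilinI)
  fix v i assume i: "i \<in> I"
  have "(\<Prod>j\<in>I. \<alpha> j ((v(i := x)) j)) = \<alpha> i x * (\<Prod>j\<in>I - {i}. \<alpha> j (v j))" for x
    by (subst prod.remove[OF assms(1) i]) (auto intro!: prod.cong)
  then show "lin V kfield (\<lambda>x. \<Prod>j\<in>I. \<alpha> j ((v(i := x)) j))"
    using assms(3)[OF i] by (simp add: lin_multc)
qed (simp add: kfield_def)

text \<open>The coordinates of an arbitrary multilinear form are replaced one after another by dual
  basis expansions. When all are replaced, a constant times a product of functionals is left, and
  there \<open>u\<close> vanishes by assumption; each earlier form is a finite sum of later
  ones.\<close>

lemma ntensor_sep_zero:
  assumes fin: "finite I" "I \<noteq> {}" and V: "vspace V" "finite_dim V" and u: "u \<in> carr (ntensor I V)"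
    and z: "\<And>\<alpha>. (\<And>i. i \<in> I \<Longrightarrow> \<alpha> i \<in> carr (dual V)) \<Longrightarrow> u (\<lambda>a. \<Prod>i\<in>I. \<alpha> i (a i)) = 0"
  shows "u = 0"
proof
  fix \<mu>
  obtain E \<epsilon> where E: "finite E" "E \<subseteq> carr V" "\<And>e. e \<in> E \<Longrightarrow> \<epsilon> e \<in> carr (dual V)"
    "\<And>x. x \<in> carr V \<Longrightarrow> (\<Sum>e\<in>E. scl V (\<epsilon> e x) e) = x"
    using finite_dual_basis[OF V] by metis
  note uev = ntensor_apply[OF fin(2) V(1) u]
  show "u \<mu> = 0 \<mu>"
  proof (cases "multilin I V kfield \<mu>")
    case \<mu>: True
    let ?F = "\<lambda>T \<alpha> b a. (\<Prod>i\<in>T. \<alpha> i (a i)) * \<mu> (\<lambda>i. if i \<in> T then b i else a i)"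
    have dl: "\<alpha> \<in> carr (dual V) \<Longrightarrow> lin V kfield \<alpha>" for \<alpha> by (simp add: dual_def)
    have F: "multilin I V kfield (?F T \<alpha> b)"
      if "T \<subseteq> I" "\<And>i. i \<in> T \<Longrightarrow> \<alpha> i \<in> carr (dual V)" "\<And>i. i \<in> T \<Longrightarrow> b i \<in> carr V" for T \<alpha> b
      using that finite_subset[OF that(1) fin(1)] by (intro multilin_prod_mult V \<mu> dl) auto
    \<comment> \<open>\<open>S\<close> is the set of coordinates that still enter
      \<open>\<mu>\<close>. The induction starts with none of them and ends with
      \<open>S = I\<close>, where the form is \<open>\<mu>\<close> itself.\<close>
    have "u (?F (I - S) \<alpha> b) = 0"
      if "S \<subseteq> I" "\<And>i. i \<in> I - S \<Longrightarrow> \<alpha> i \<in> carr (dual V)" "\<And>i. i \<in> I - S \<Longrightarrow> b i \<in> carr V" for S \<alpha> b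
      using finite_subset[OF that(1) fin(1)] that
    proof (induction S arbitrary: \<alpha> b rule: finite_induct)
      case empty
      \<comment> \<open>Extensional families are \<open>undefined\<close> outside \<open>I\<close>,
        so once all coordinates are replaced the argument of \<open>\<mu>\<close> is the same for
        every family.\<close>
      let ?c = "\<mu> (\<lambda>i. if i \<in> I then b i else undefined)"
      let ?P = "\<lambda>a. \<Prod>i\<in>I. \<alpha> i (a i)"
      have P: "multilin I V kfield ?P"
        using empty by (intro multilin_prod fin V dl) auto
      have "u (?F I \<alpha> b) = u (\<lambda>a. ?c * ?P a)"
      proof (rule ntensor_cong[OF fin(2) V(1) u multilin_cmult[OF P]])
        fix v assume "v \<in> I \<rightarrow>\<^sub>E carr V"
        then have "(\<lambda>i. if i \<in> I then b i else v i) = (\<lambda>i. if i \<in> I then b i else undefined)"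
          by (auto simp: PiE_def extensional_def)
        then show "?F I \<alpha> b v = ?c * ?P v" by simp
      qed
      also have "\<dots> = ?c * u ?P"
        by (simp add: uev[OF P] uev[OF multilin_cmult[OF P]] sum_list_const_mult)
      also have "u ?P = 0" using empty by (intro z) auto
      finally show ?case by simp
    next
      case (insert j S)
      let ?T = "I - insert j S" and ?T' = "I - S"
      have T: "?T' = insert j ?T" "j \<notin> ?T" "finite ?T" "j \<in> I" using insert fin by auto
      let ?\<alpha> = "\<lambda>e. \<alpha>(j := \<epsilon> e)" and ?b = "\<lambda>e. b(j := e)"
      have IH: "u (?F ?T' (?\<alpha> e) (?b e)) = 0" if "e \<in> E" for e
        using that insert.prems E by (intro insert.IH) auto
      have Fe: "multilin I V kfield (?F ?T' (?\<alpha> e) (?b e))" if "e \<in> E" for e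
        using that insert.prems E by (intro F) auto
      have S: "multilin I V kfield (\<lambda>a. \<Sum>e\<in>E. ?F ?T' (?\<alpha> e) (?b e) a)"
        by (intro multilin_sum vspace_kfield Fe)
      \<comment> \<open>Expanding the coordinate at \<open>j\<close> in the basis adds
        \<open>j\<close> to the replaced coordinates, with \<open>\<epsilon> e\<close> as functional
        and \<open>e\<close> as fixed vector.\<close>
      have "u (?F ?T \<alpha> b) = u (\<lambda>a. \<Sum>e\<in>E. ?F ?T' (?\<alpha> e) (?b e) a)"
      proof (rule ntensor_cong[OF fin(2) V(1) u S])
        fix v assume v: "v \<in> I \<rightarrow>\<^sub>E carr V"
        let ?w = "\<lambda>i. if i \<in> ?T then b i else v i"
        have w: "?w \<in> I \<rightarrow>\<^sub>E carr V" using v insert.prems by (auto simp: PiE_def extensional_def Pi_def)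
        have vj: "v j \<in> carr V" using v T(4) by auto
        note l = multilin_lin[OF \<mu> w T(4)]
        have "?w(j := v j) = ?w" using T(2) by auto
        then have "\<mu> ?w = \<mu> (?w(j := v j))" by simp
        also have "\<dots> = \<mu> (?w(j := (\<Sum>e\<in>E. scl V (\<epsilon> e (v j)) e)))" by (simp add: E(4)[OF vj])
        also have "\<dots> = (\<Sum>e\<in>E. \<mu> (?w(j := scl V (\<epsilon> e (v j)) e)))"
          using E(2) by (intro lin_apply_sum[OF V(1) l] vspace_scl[OF V(1)]) auto
        also have "\<dots> = (\<Sum>e\<in>E. \<epsilon> e (v j) * \<mu> (?w(j := e)))"
          using E(2) by (intro sum.cong refl lin_kfield_scl[OF l]) auto
        finally have m: "\<mu> ?w = (\<Sum>e\<in>E. \<epsilon> e (v j) * \<mu> (?w(j := e)))" .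
        have p: "(\<Prod>i\<in>?T'. ?\<alpha> e i (v i)) = \<epsilon> e (v j) * (\<Prod>i\<in>?T. \<alpha> i (v i))" for e
        proof -
          have "(\<Prod>i\<in>?T'. ?\<alpha> e i (v i)) = \<epsilon> e (v j) * (\<Prod>i\<in>?T. ?\<alpha> e i (v i))"
            unfolding T(1) using T(2,3) by (subst prod.insert) auto
          also have "(\<Prod>i\<in>?T. ?\<alpha> e i (v i)) = (\<Prod>i\<in>?T. \<alpha> i (v i))" using T(2) by (intro prod.cong) auto
          finally show ?thesis .
        qed
        have q: "(\<lambda>i. if i \<in> ?T' then ?b e i else v i) = ?w(j := e)" for e
          using insert.prems(1) insert.hyps(2) by (auto simp: fun_eq_iff)
        show "?F ?T \<alpha> b v = (\<Sum>e\<in>E. ?F ?T' (?\<alpha> e) (?b e) v)"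
          unfolding p q m by (simp add: sum_distrib_left mult_ac)
      qed
      also have "\<dots> = (\<Sum>e\<in>E. u (?F ?T' (?\<alpha> e) (?b e)))"
        unfolding uev[OF S] sum_list_sum by (intro sum.cong refl) (rule uev[OF Fe, symmetric])
      also have "\<dots> = 0" using IH by (intro sum.neutral) blast
      finally show ?case .
    qed
    from this[of I] show ?thesis by simp
  qed (simp add: ntensor_apply_not_multilin[OF fin(2) V(1) u])
qed

text \<open>For disjoint nonempty \<open>I\<close> and \<open>J\<close> this is the bilinear map
  behind the isomorphism of the tensor product of two tensor powers with the one over
  \<open>I \<union> J\<close>. With edges as indices it identifies
  \<open>M\<^sub>\<Gamma> \<otimes> M\<^sub>\<Delta>\<close> with the Hilbert space of the connected
  sum.\<close>

definition njoin :: "'i set \<Rightarrow> 'i set \<Rightarrow> ('k::field, 'v::ab_group_add, 'z) kspace_scheme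
    \<Rightarrow> ((('i \<Rightarrow> 'v) \<Rightarrow> 'k) \<Rightarrow> 'k) \<Rightarrow> ((('i \<Rightarrow> 'v) \<Rightarrow> 'k) \<Rightarrow> 'k) \<Rightarrow> (('i \<Rightarrow> 'v) \<Rightarrow> 'k) \<Rightarrow> 'k" where
  "njoin I J V s t = nlift I V (\<lambda>p. nlift J V (\<lambda>q.
     ntens (I \<union> J) V (\<lambda>i. if i \<in> I then p i else q i)) t) s"

lemma PiE_join:
  "p \<in> I \<rightarrow>\<^sub>E S \<Longrightarrow> q \<in> J \<rightarrow>\<^sub>E S \<Longrightarrow> (\<lambda>i. if i \<in> I then p i else q i) \<in> I \<union> J \<rightarrow>\<^sub>E S"
  by (auto simp: PiE_def extensional_def Pi_def)

lemma
  fixes V :: "('k::field, 'v::ab_group_add, 'z) kspace_scheme"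
  assumes I: "I \<noteq> {}" and J: "J \<noteq> {}" and IJ: "I \<inter> J = {}" and V: "vspace V"
  shows bilin_njoin: "bilin (ntensor I V) (ntensor J V) (ntensor (I \<union> J) V) (njoin I J V)"
    and njoin_ntens: "\<And>p q. (\<And>i. i \<in> I \<Longrightarrow> p i \<in> carr V) \<Longrightarrow> (\<And>i. i \<in> J \<Longrightarrow> q i \<in> carr V) \<Longrightarrow>
      njoin I J V (ntens I V p) (ntens J V q) = ntens (I \<union> J) V (\<lambda>i. if i \<in> I then p i else q i)"
proof -
  let ?m = "\<lambda>p q i. if i \<in> I then p i else q i"
  let ?N = "ntensor (I \<union> J) V"
  have m1: "multilin I V ?N (\<lambda>p. ntens (I \<union> J) V (?m p q))" if q: "q \<in> J \<rightarrow>\<^sub>E carr V" for q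
  proof (rule multilinI)
    fix p i assume p: "p \<in> I \<rightarrow>\<^sub>E carr V" and i: "i \<in> I"
    have e: "?m (p(i := x)) q = (?m p q)(i := x)" for x using i by (auto simp: fun_eq_iff)
    show "lin V ?N (\<lambda>x. ntens (I \<union> J) V (?m (p(i := x)) q))"
      unfolding e using i by (intro multilin_lin[OF multilin_ntens PiE_join] p q) auto
  qed (intro ntens_mem_PiE PiE_join q)
  have m2: "multilin J V ?N (\<lambda>q. ntens (I \<union> J) V (?m p q))" if p: "p \<in> I \<rightarrow>\<^sub>E carr V" for p
  proof (rule multilinI)
    fix q i assume q: "q \<in> J \<rightarrow>\<^sub>E carr V" and i: "i \<in> J"
    have e: "?m p (q(i := x)) = (?m p q)(i := x)" for x using i IJ by (auto simp: fun_eq_iff)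
    show "lin V ?N (\<lambda>x. ntens (I \<union> J) V (?m p (q(i := x))))"
      unfolding e using i by (intro multilin_lin[OF multilin_ntens PiE_join] p q) auto
  qed (intro ntens_mem_PiE PiE_join p)
  \<comment> \<open>The inner lift is a sum over a fixed list, so multilinearity in the outer family
    can be checked termwise.\<close>
  have m3: "multilin I V ?N (\<lambda>p. nlift J V (\<lambda>q. ntens (I \<union> J) V (?m p q)) t)"
    if "t \<in> carr (ntensor J V)" for t
    unfolding nlift_nrep using nrep(1)[OF J V that] by (intro multilin_sum_list m1) auto
  show "bilin (ntensor I V) (ntensor J V) ?N (njoin I J V)"
    unfolding njoin_def
    by (intro bilinI lin_nlift lin_nlift_param m3 m2 I J V vspace_ntensor)
  fix p q :: "'a \<Rightarrow> 'v"
  assume p: "\<And>i. i \<in> I \<Longrightarrow> p i \<in> carr V" and q: "\<And>i. i \<in> J \<Longrightarrow> q i \<in> carr V"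
  have p': "restrict p I \<in> I \<rightarrow>\<^sub>E carr V" using p by auto
  have "njoin I J V (ntens I V p) (ntens J V q)
      = ntens (I \<union> J) V (?m (restrict p I) (restrict q J))"
    unfolding njoin_def
    by (subst nlift_ntens[OF V vspace_ntensor m3[OF ntens_mem[OF q]] I p], assumption+)
      (rule nlift_ntens[OF V vspace_ntensor m2[OF p'] J q])
  also have "\<dots> = ntens (I \<union> J) V (?m p q)" by (rule ntens_cong) auto
  finally show "njoin I J V (ntens I V p) (ntens J V q) = ntens (I \<union> J) V (?m p q)" .
qed

lemma ntens_split:
  assumes "I \<noteq> {}" "J \<noteq> {}" "I \<inter> J = {}" "vspace V" "v \<in> I \<union> J \<rightarrow>\<^sub>E carr V"
  shows "ntens (I \<union> J) V v = njoin I J V (ntens I V v) (ntens J V v)"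
proof -
  have "v i \<in> carr V" if "i \<in> I \<union> J" for i using that assms(5) by auto
  then show ?thesis by (subst njoin_ntens[OF assms(1-4)]) (auto intro: ntens_cong)
qed

text \<open>Every pure tensor over \<open>I \<union> J\<close> is a join of two pure tensors, so the
  joins span.\<close>

lemma njoin_lin_eq:
  assumes "I \<noteq> {}" "J \<noteq> {}" "I \<inter> J = {}" "vspace V" "vspace U"
    and "lin (ntensor (I \<union> J) V) U f" "lin (ntensor (I \<union> J) V) U g"
    and eq: "\<And>s t. s \<in> carr (ntensor I V) \<Longrightarrow> t \<in> carr (ntensor J V) \<Longrightarrow> f (njoin I J V s t) = g (njoin I J
        V s t)"
    and t: "t \<in> carr (ntensor (I \<union> J) V)"
  shows "f t = g t"
proof (rule ntensor_lin_eq[OF _ assms(4,6,7,5) _ t])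
  show "f (ntens (I \<union> J) V v) = g (ntens (I \<union> J) V v)" if "v \<in> I \<union> J \<rightarrow>\<^sub>E carr V" for v
    unfolding ntens_split[OF assms(1-4) that] using that by (intro eq ntens_mem) auto
qed (use assms(1) in auto)

section \<open>Coassociative maps and the dual coproduct\<close>

lemma sum_fun_apply: "(\<Sum>i\<in>S. f i) x = (\<Sum>i\<in>S. f i x)"
  by (induction S rule: infinite_finite_induct) auto

lemma sum_swap3: "(\<Sum>e\<in>A. \<Sum>g\<in>B. \<Sum>h\<in>C. f e g h) = (\<Sum>g\<in>B. \<Sum>h\<in>C. \<Sum>e\<in>A. f e g h)"
  by (subst sum.swap) (intro sum.cong refl sum.swap)

section \<open>Trilinear forms and coassociativity\<close>

definition trilin :: "('k::field, 'u::ab_group_add, 'x) kspace_scheme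
    \<Rightarrow> ('k, 'v::ab_group_add, 'y) kspace_scheme \<Rightarrow> ('k, 'w::ab_group_add, 'z) kspace_scheme
    \<Rightarrow> ('u \<Rightarrow> 'v \<Rightarrow> 'w \<Rightarrow> 'k) \<Rightarrow> bool" where
  "trilin U V W \<gamma> \<longleftrightarrow> (\<forall>u\<in>carr U. bilin V W kfield (\<gamma> u))
     \<and> (\<forall>v\<in>carr V. \<forall>w\<in>carr W. lin U kfield (\<lambda>u. \<gamma> u v w))"

lemma trilin_bilin: "trilin U V W \<gamma> \<Longrightarrow> u \<in> carr U \<Longrightarrow> bilin V W kfield (\<gamma> u)"
  by (simp add: trilin_def)

lemma trilin_bilin_left: "trilin U V W \<gamma> \<Longrightarrow> w \<in> carr W \<Longrightarrow> bilin U V kfield (\<lambda>u v. \<gamma> u v w)"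
  by (intro bilinI) (auto simp: trilin_def bilin_def)

lemma trilinI:
  "(\<And>v w. v \<in> carr V \<Longrightarrow> w \<in> carr W \<Longrightarrow> lin U kfield (\<lambda>u. \<gamma> u v w))
    \<Longrightarrow> (\<And>u w. u \<in> carr U \<Longrightarrow> w \<in> carr W \<Longrightarrow> lin V kfield (\<lambda>v. \<gamma> u v w))
    \<Longrightarrow> (\<And>u v. u \<in> carr U \<Longrightarrow> v \<in> carr V \<Longrightarrow> lin W kfield (\<lambda>w. \<gamma> u v w)) \<Longrightarrow> trilin U V W \<gamma>"
  by (auto simp: trilin_def bilin_def)

lemma tlift_apply_eq:
  assumes "vspace V" "vspace W" "t \<in> carr (tensor V W)" "bilin V W kfield \<beta>"
    and "\<And>v w. v \<in> carr V \<Longrightarrow> w \<in> carr W \<Longrightarrow> f v w x = \<beta> v w"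
  shows "tlift V W f t x = t \<beta>"
  using tlift_apply[OF assms(1,3) bilin_cong[OF assms(1,2) _ assms(4)], of f x]
    tensor_cong[OF assms(1-3), of "\<lambda>v w. f v w x" \<beta>] assms(5) by simp

lemma tlift_functional_eq:
  assumes "vspace V" "vspace W" "vspace U" "t \<in> carr (tensor V W)" "lin U kfield \<phi>"
    "bilin V W kfield \<beta>"
    and "\<And>v w. v \<in> carr V \<Longrightarrow> w \<in> carr W \<Longrightarrow> f v w \<in> carr U"
    and "\<And>v w. v \<in> carr V \<Longrightarrow> w \<in> carr W \<Longrightarrow> \<phi> (f v w) = \<beta> v w"
  shows "\<phi> (tlift V W f t) = t \<beta>"
  using tlift_functional[OF assms(1,3-5,7) bilin_cong[OF assms(1,2) _ assms(6)]]
    tensor_cong[OF assms(1,2,4), of "\<lambda>v w. \<phi> (f v w)" \<beta>] assms(8) by simp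

lemma lin_apply: "lin X T \<delta> \<Longrightarrow> scl T = fscl \<Longrightarrow> lin X kfield (\<lambda>x. \<delta> x \<beta>)"
  by (rule lin_comp[OF _ lin_eval])

lemma trilin_right:
  assumes "trilin U V W \<gamma>" "vspace U" "vspace V" "lin X (tensor V W) \<delta>"
  shows "bilin U X kfield (\<lambda>u x. \<delta> x (\<gamma> u))"
proof (rule bilinI)
  show "lin U kfield (\<lambda>u. \<delta> x (\<gamma> u))" if "x \<in> carr X" for x
    using assms that by (intro lin_apply_param[OF assms(3) lin_mem[OF assms(4) that] assms(2)])
      (auto simp: trilin_def)
qed (rule lin_apply[OF assms(4)], simp)

lemma trilin_left:
  assumes "trilin U V W \<gamma>" "vspace U" "vspace W" "lin X (tensor U V) \<delta>"
  shows "bilin X W kfield (\<lambda>x w. \<delta> x (\<lambda>u v. \<gamma> u v w))"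
proof (rule bilinI)
  show "lin W kfield (\<lambda>w. \<delta> x (\<lambda>u v. \<gamma> u v w))" if "x \<in> carr X" for x
    using assms that trilin_bilin_left[OF assms(1)]
    by (intro lin_apply_param[OF assms(2) lin_mem[OF assms(4) that] assms(3)])
      (auto simp: trilin_def bilin_def)
qed (rule lin_apply[OF assms(4)], simp)

lemma bilin_tens3_form:
  "trilin U V W \<gamma> \<Longrightarrow> vspace U \<Longrightarrow> vspace V \<Longrightarrow> bilin U (tensor V W) kfield (\<lambda>u t. t (\<gamma> u))"
  using trilin_right[OF _ _ _ lin_id] .

text \<open>Triple tensors are nested, so a trilinear form has to be fed to them as a bilinear form
  on \<open>U\<close> and \<open>tensor V W\<close>, namely
  \<open>\<lambda>u t. t (\<gamma> u)\<close>.\<close>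

lemma tens3_apply:
  assumes "trilin U V W \<gamma>" "vspace U" "vspace V" "u \<in> carr U"
  shows "tens3 U V W u v w (\<lambda>u t. t (\<gamma> u)) = \<gamma> u v w"
  unfolding tens3_def
  by (simp add: tens_apply[OF bilin_tens3_form[OF assms(1-3)]] tens_apply[OF trilin_bilin[OF
      assms(1,4)]])

text \<open>Coassociativity is tested on trilinear forms so that the coproduct of \<open>H\<close>
  and the one of its dual, which are introduced in very different ways, can be used alike.\<close>

definition coassociative :: "('k::field, 'v::ab_group_add, 'z) kspace_scheme
    \<Rightarrow> ('v \<Rightarrow> ('v \<Rightarrow> 'v \<Rightarrow> 'k) \<Rightarrow> 'k) \<Rightarrow> bool" where
  "coassociative V D \<longleftrightarrow> vspace V \<and> lin V (tensor V V) D
     \<and> (\<forall>v\<in>carr V. \<forall>\<gamma>. trilin V V V \<gamma> \<longrightarrow>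
          D v (\<lambda>a b. D a (\<lambda>a1 a2. \<gamma> a1 a2 b)) = D v (\<lambda>a b. D b (\<lambda>b1 b2. \<gamma> a b1 b2)))"

text \<open>The coalgebra axiom is an equation of triple tensors; its value at the form encoding
  \<open>\<gamma>\<close> is the tested version.\<close>

lemma coassociative_comult:
  assumes C: "is_coalgebra C"
  shows "coassociative C (comult C)"
proof -
  have V: "vspace C" and D: "lin C (tensor C C) (comult C)" using C by (auto simp: is_coalgebra_def)
  have "comult C c (\<lambda>a b. comult C a (\<lambda>a1 a2. \<gamma> a1 a2 b)) = comult C c (\<lambda>a b. comult C b (\<gamma> a))"
    if c: "c \<in> carr C" and \<gamma>: "trilin C C C \<gamma>" for c \<gamma>
  proof -
    let ?\<theta> = "\<lambda>u t. t (\<gamma> u)"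
    note t3 = tens3_apply[OF \<gamma> V V] and m = lin_mem[OF D]
    have eq: "sw2 C c (\<lambda>a b. sw2 C a (\<lambda>a1 a2. tens3 C C C a1 a2 b)) ?\<theta>
        = sw2 C c (\<lambda>a b. sw2 C b (\<lambda>b1 b2. tens3 C C C a b1 b2)) ?\<theta>"
      using C c by (simp add: is_coalgebra_def)
    have L: "sw2 C c (\<lambda>a b. sw2 C a (\<lambda>a1 a2. tens3 C C C a1 a2 b)) ?\<theta>
        = comult C c (\<lambda>a b. comult C a (\<lambda>a1 a2. \<gamma> a1 a2 b))"
      unfolding sw2_def
      by (rule tlift_apply_eq[OF V V m[OF c] trilin_left[OF \<gamma> V V D]])
        (intro tlift_apply_eq V m trilin_bilin_left[OF \<gamma>] t3)
    have R: "sw2 C c (\<lambda>a b. sw2 C b (\<lambda>b1 b2. tens3 C C C a b1 b2)) ?\<theta>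
        = comult C c (\<lambda>a b. comult C b (\<gamma> a))"
      unfolding sw2_def
      by (rule tlift_apply_eq[OF V V m[OF c] trilin_right[OF \<gamma> V V D]])
        (intro tlift_apply_eq V m trilin_bilin[OF \<gamma>] t3)
    show ?thesis using eq unfolding L R .
  qed
  then show ?thesis using V D by (simp add: coassociative_def)
qed

section \<open>The dual space and its coproduct\<close>

lemma vspace_dual [simp]: "vspace (dual V)"
proof -
  interpret vector_space "fscl :: 'a \<Rightarrow> ('b \<Rightarrow> 'a) \<Rightarrow> _" by (rule vector_space_fscl)
  show ?thesis
    unfolding vspace_def
  proof (intro conjI)
    show "vector_space (scl (dual V))" by (simp add: vector_space_fscl)
    have "subspace (carr (dual V))"
      by (rule subspaceI) (auto simp: dual_def lin_kfield_iff algebra_simps)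
    then show "module.subspace (scl (dual V)) (carr (dual V))" by simp
  qed
qed

lemma dual_lin: "\<alpha> \<in> carr (dual V) \<Longrightarrow> lin V kfield \<alpha>"
  by (simp add: dual_def)

lemma dual_eq_zero: "\<alpha> \<in> carr (dual V) \<Longrightarrow> (\<And>a. a \<in> carr V \<Longrightarrow> \<alpha> a = 0) \<Longrightarrow> \<alpha> = 0"
  by (auto simp: dual_def fun_eq_iff)

text \<open>Encoded by the expansion property rather than by independence, since expansion is the
  form in which the basis is used.\<close>

locale dual_basis =
  fixes V :: "('k::field, 'v::ab_group_add, 'z) kspace_scheme" and E :: "'v set"
    and \<epsilon> :: "'v \<Rightarrow> 'v \<Rightarrow> 'k"
  assumes V: "vspace V" and fin: "finite E" and E: "\<And>e. e \<in> E \<Longrightarrow> e \<in> carr V"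
    and \<epsilon>: "\<And>e. e \<in> E \<Longrightarrow> \<epsilon> e \<in> carr (dual V)"
    and expand: "\<And>x. x \<in> carr V \<Longrightarrow> (\<Sum>e\<in>E. scl V (\<epsilon> e x) e) = x"
begin

lemma dual_sep:
  assumes "v \<in> carr V" "\<And>\<phi>. \<phi> \<in> carr (dual V) \<Longrightarrow> \<phi> v = 0"
  shows "v = 0"
proof -
  have "(\<Sum>e\<in>E. scl V (\<epsilon> e v) e) = 0"
    by (rule sum.neutral) (simp add: assms \<epsilon> vspace_scl_simps[OF V])
  then show ?thesis using expand[OF assms(1)] by simp
qed

lemma expand_lin:
  assumes "lin V U f" "vspace U" "x \<in> carr V"
  shows "f x = (\<Sum>e\<in>E. scl U (\<epsilon> e x) (f e))"
proof -
  have "f x = f (\<Sum>e\<in>E. scl V (\<epsilon> e x) e)" by (simp add: expand assms)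
  also have "\<dots> = (\<Sum>e\<in>E. f (scl V (\<epsilon> e x) e))"
    by (intro lin_apply_sum[OF V assms(1)] vspace_scl[OF V] E)
  finally show ?thesis using lin_scl[OF assms(1)] E by simp
qed

lemma expand_lin_kfield: "lin V kfield f \<Longrightarrow> x \<in> carr V \<Longrightarrow> f x = (\<Sum>e\<in>E. \<epsilon> e x * f e)"
  using expand_lin[OF _ vspace_kfield] by (simp add: kfield_def)

lemma expand_bilin_kfield:
  assumes \<beta>: "bilin V V kfield \<beta>" and x: "x \<in> carr V" and y: "y \<in> carr V"
  shows "\<beta> x y = (\<Sum>e\<in>E. \<Sum>f\<in>E. \<epsilon> e x * \<epsilon> f y * \<beta> e f)"
proof -
  have "\<beta> x y = (\<Sum>e\<in>E. \<epsilon> e x * \<beta> e y)" by (rule expand_lin_kfield[OF bilin_left[OF \<beta> y] x])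
  also have "\<dots> = (\<Sum>e\<in>E. \<epsilon> e x * (\<Sum>f\<in>E. \<epsilon> f y * \<beta> e f))"
    using E by (intro sum.cong refl arg_cong2[where f = "(*)"] expand_lin_kfield[OF bilin_right[OF \<beta>]
        y])
  finally show ?thesis by (simp add: sum_distrib_left mult.assoc)
qed

end

lemma dual_basis_exists:
  assumes "vspace V" "finite_dim V"
  obtains E \<epsilon> where "dual_basis V E \<epsilon>"
proof -
  obtain E \<epsilon> where E: "finite E" "E \<subseteq> carr V" "\<And>e. e \<in> E \<Longrightarrow> \<epsilon> e \<in> carr (dual V)"
    "\<And>x. x \<in> carr V \<Longrightarrow> (\<Sum>e\<in>E. scl V (\<epsilon> e x) e) = x"
    using finite_dual_basis[OF assms] by metis
  have "dual_basis V E \<epsilon>" by unfold_locales (use E assms in auto)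
  then show ?thesis by (rule that)
qed

lemma dual_sep_finite_dim:
  assumes "vspace V" "finite_dim V" "v \<in> carr V" "\<And>\<phi>. \<phi> \<in> carr (dual V) \<Longrightarrow> \<phi> v = 0"
  shows "v = 0"
proof -
  obtain E \<epsilon> where "dual_basis V E \<epsilon>" using dual_basis_exists[OF assms(1,2)] .
  then show ?thesis using assms(3,4) by (rule dual_basis.dual_sep)
qed

locale fd_algebra =
  fixes H :: "('k::field, 'h::ab_group_add) khopf"
  assumes alg: "is_algebra H" and fd: "finite_dim H"
begin

lemma vspace_H: "vspace H" and bilin_mult_H: "bilin H H H (amult H)"
  and assoc_H: "\<And>a b c. a \<in> carr H \<Longrightarrow> b \<in> carr H \<Longrightarrow> c \<in> carr H \<Longrightarrow>
    amult H (amult H a b) c = amult H a (amult H b c)"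
  using alg by (auto simp: is_algebra_def)

lemma mult_mem: "a \<in> carr H \<Longrightarrow> b \<in> carr H \<Longrightarrow> amult H a b \<in> carr H"
  by (rule bilin_mem[OF bilin_mult_H])

text \<open>Expanding the bilinear map \<open>\<alpha> (amult H a b)\<close> in coordinates shows
  that \<open>d\<close> has the required values. It is the only such tensor because evaluations at
  points of \<open>H\<close> separate the dual, so pairs of evaluations separate tensors; this
  resolves the definite description.\<close>

lemma dual_comult_basis:
  assumes "dual_basis H E \<epsilon>" and \<alpha>: "\<alpha> \<in> carr (dual H)"
  defines "d \<equiv> \<Sum>e\<in>E. \<Sum>f\<in>E. fscl (\<alpha> (amult H e f)) (tens (dual H) (dual H) (\<epsilon> e) (\<epsilon> f))"
  shows "dual_comult H \<alpha> = d" "d \<in> carr (tensor (dual H) (dual H))"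
    "\<And>a b. a \<in> carr H \<Longrightarrow> b \<in> carr H \<Longrightarrow> d (\<lambda>\<alpha>1 \<alpha>2. \<alpha>1 a * \<alpha>2 b) = \<alpha> (amult H a b)"
proof -
  interpret dual_basis H E \<epsilon> by fact
  let ?D = "dual H" and ?T = "tensor (dual H) (dual H)"
  have ev: "bilin ?D ?D kfield (\<lambda>\<alpha>1 \<alpha>2. \<alpha>1 a * \<alpha>2 b)" for a b
    by (intro bilin_mult lin_eval) simp_all
  show mem: "d \<in> carr ?T"
    unfolding d_def by (intro vspace_sum vspace_scl[of ?T, simplified] tens_mem \<epsilon>) simp_all
  have d: "d \<beta> = (\<Sum>e\<in>E. \<Sum>f\<in>E. \<alpha> (amult H e f) * \<beta> (\<epsilon> e) (\<epsilon> f))" if "bilin ?D ?D kfield \<beta>" for \<beta>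
    using that by (simp add: d_def tens_apply sum_fun_apply)
  show de: "d (\<lambda>\<alpha>1 \<alpha>2. \<alpha>1 a * \<alpha>2 b) = \<alpha> (amult H a b)" if "a \<in> carr H" "b \<in> carr H" for a b
    unfolding d[OF ev] expand_bilin_kfield[OF bilin_comp[OF bilin_mult_H dual_lin[OF \<alpha>]] that]
    by (simp add: mult_ac)
  have k: "tlift ?D ?D (\<lambda>\<alpha>1 \<alpha>2. \<alpha>1 a * \<alpha>2 b) t = t (\<lambda>\<alpha>1 \<alpha>2. \<alpha>1 a * \<alpha>2 b)" if "t \<in> carr ?T" for a b t
    by (rule tlift_kfield[OF vspace_dual that ev])
  show "dual_comult H \<alpha> = d"
    unfolding dual_comult_def
  proof (rule the_equality)
    show "d \<in> carr ?T \<and> (\<forall>a\<in>carr H. \<forall>b\<in>carr H. tlift ?D ?D (\<lambda>\<alpha>1 \<alpha>2. \<alpha>1 a * \<alpha>2 b) d = \<alpha> (amult H a b))"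
      using mem de by (simp add: k)
    fix d' assume d': "d' \<in> carr ?T \<and> (\<forall>a\<in>carr H. \<forall>b\<in>carr H. tlift ?D ?D (\<lambda>\<alpha>1 \<alpha>2. \<alpha>1 a * \<alpha>2 b) d' = \<alpha>
        (amult H a b))"
    show "d' = d"
    proof (rule tensor_sep[OF vspace_dual vspace_dual _ mem,
          where \<Phi> = "(\<lambda>a \<alpha>. \<alpha> a) ` carr H" and \<Psi> = "(\<lambda>a \<alpha>. \<alpha> a) ` carr H"])
      fix \<phi> \<psi> :: "('h \<Rightarrow> 'k) \<Rightarrow> 'k"
      assume "\<phi> \<in> (\<lambda>a \<alpha>. \<alpha> a) ` carr H" "\<psi> \<in> (\<lambda>a \<alpha>. \<alpha> a) ` carr H"
      then obtain a b where "\<phi> = (\<lambda>\<alpha>. \<alpha> a)" "a \<in> carr H" "\<psi> = (\<lambda>\<alpha>. \<alpha> b)" "b \<in> carr H" by auto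
      then show "d' (\<lambda>v w. \<phi> v * \<psi> w) = d (\<lambda>v w. \<phi> v * \<psi> w)" using d' k[of d'] de by simp
    qed (use d' in \<open>auto simp: image_iff intro: lin_eval dual_eq_zero\<close>)
  qed
qed

lemma dual_comult_mem: "\<alpha> \<in> carr (dual H) \<Longrightarrow> dual_comult H \<alpha> \<in> carr (tensor (dual H) (dual H))"
  and dual_comult_eval: "\<alpha> \<in> carr (dual H) \<Longrightarrow> a \<in> carr H \<Longrightarrow> b \<in> carr H \<Longrightarrow>
    dual_comult H \<alpha> (\<lambda>\<alpha>1 \<alpha>2. \<alpha>1 a * \<alpha>2 b) = \<alpha> (amult H a b)"
proof -
  obtain E \<epsilon> where b: "dual_basis H E \<epsilon>" using dual_basis_exists[OF vspace_H fd] .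
  note d = dual_comult_basis[OF b]
  show "dual_comult H \<alpha> \<in> carr (tensor (dual H) (dual H))" if "\<alpha> \<in> carr (dual H)"
    using d(2)[OF that] unfolding d(1)[OF that] .
  show "dual_comult H \<alpha> (\<lambda>\<alpha>1 \<alpha>2. \<alpha>1 a * \<alpha>2 b) = \<alpha> (amult H a b)"
    if "\<alpha> \<in> carr (dual H)" "a \<in> carr H" "b \<in> carr H"
    using d(3)[OF that] unfolding d(1)[OF that(1)] .
qed

lemma dual_comult_apply:
  assumes "dual_basis H E \<epsilon>" "\<alpha> \<in> carr (dual H)" "bilin (dual H) (dual H) kfield \<beta>"
  shows "dual_comult H \<alpha> \<beta> = (\<Sum>e\<in>E. \<Sum>f\<in>E. \<alpha> (amult H e f) * \<beta> (\<epsilon> e) (\<epsilon> f))"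
  using assms(3) by (simp add: dual_comult_basis(1)[OF assms(1,2)] tens_apply sum_fun_apply)

text \<open>This is associativity of the multiplication in coordinates: both sides become the sum
  over \<open>g\<close>, \<open>h\<close>, \<open>f\<close> of \<open>\<alpha>\<close> at the triple
  product times \<open>\<gamma>\<close> at the coordinate functionals.\<close>

lemma coassociative_dual: "coassociative (dual H) (dual_comult H)"
proof -
  obtain E \<epsilon> where "dual_basis H E \<epsilon>" using dual_basis_exists[OF vspace_H fd] .
  then interpret dual_basis H E \<epsilon> .
  let ?D = "dual H" and ?T = "tensor (dual H) (dual H)"
  note b = dual_comult_basis(1)[OF dual_basis_axioms]
    and ap = dual_comult_apply[OF dual_basis_axioms]
  have lin: "lin ?D ?T (dual_comult H)"
  proof (rule lin_cong[OF vspace_dual b])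
    have "lin ?D ?T (\<lambda>\<alpha>. scl ?T (\<alpha> (amult H e f)) (tens ?D ?D (\<epsilon> e) (\<epsilon> f)))" if "e \<in> E" "f \<in> E" for e f
      using that by (intro lin_scl_left[OF vspace_tensor] lin_eval tens_mem \<epsilon>) simp_all
    then show "lin ?D ?T (\<lambda>\<alpha>. \<Sum>e\<in>E. \<Sum>f\<in>E. fscl (\<alpha> (amult H e f)) (tens ?D ?D (\<epsilon> e) (\<epsilon> f)))"
      by (intro lin_sum vspace_tensor) simp
  qed
  have "dual_comult H \<alpha> (\<lambda>a b. dual_comult H a (\<lambda>a1 a2. \<gamma> a1 a2 b))
      = dual_comult H \<alpha> (\<lambda>a b. dual_comult H b (\<lambda>b1 b2. \<gamma> a b1 b2))"
    if \<alpha>: "\<alpha> \<in> carr ?D" and \<gamma>: "trilin ?D ?D ?D \<gamma>" for \<alpha> \<gamma>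
  proof -
    have mult: "amult H e f \<in> carr H" if "e \<in> E" "f \<in> E" for e f using that by (intro mult_mem E)
    have "dual_comult H \<alpha> (\<lambda>a b. dual_comult H a (\<lambda>a1 a2. \<gamma> a1 a2 b))
        = (\<Sum>e\<in>E. \<Sum>f\<in>E. \<alpha> (amult H e f) * (\<Sum>g\<in>E. \<Sum>h\<in>E. \<epsilon> e (amult H g h) * \<gamma> (\<epsilon> g) (\<epsilon> h) (\<epsilon> f)))"
      unfolding ap[OF \<alpha> trilin_left[OF \<gamma> vspace_dual vspace_dual lin]]
      by (intro sum.cong refl arg_cong2[where f = "(*)"] ap \<epsilon> trilin_bilin_left[OF \<gamma>])
    also have "\<dots> = (\<Sum>g\<in>E. \<Sum>h\<in>E. \<Sum>f\<in>E. (\<Sum>e\<in>E. \<epsilon> e (amult H g h) * \<alpha> (amult H e f)) * \<gamma> (\<epsilon> g) (\<epsilon> h) (\<epsilon>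
        f))"
      unfolding sum_distrib_left sum_distrib_right
      by (subst sum.swap, subst sum_swap3, subst (2) sum_swap3) (simp add: mult_ac)
    \<comment> \<open>The sum over \<open>e\<close> reassembles \<open>amult H g h\<close> from its
      coordinates.\<close>
    also have "\<dots> = (\<Sum>g\<in>E. \<Sum>h\<in>E. \<Sum>f\<in>E. \<alpha> (amult H (amult H g h) f) * \<gamma> (\<epsilon> g) (\<epsilon> h) (\<epsilon> f))"
      using expand_lin_kfield[OF lin_comp[OF bilin_left[OF bilin_mult_H E] dual_lin[OF \<alpha>]] mult]
      by (intro sum.cong refl arg_cong2[where f = "(*)"]) simp
    also have "\<dots> = (\<Sum>g\<in>E. \<Sum>h\<in>E. \<Sum>f\<in>E. \<alpha> (amult H g (amult H h f)) * \<gamma> (\<epsilon> g) (\<epsilon> h) (\<epsilon> f))"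
      by (simp add: assoc_H E)
    also have "\<dots> = (\<Sum>g\<in>E. \<Sum>h\<in>E. \<Sum>f\<in>E. (\<Sum>e\<in>E. \<epsilon> e (amult H h f) * \<alpha> (amult H g e)) * \<gamma> (\<epsilon> g) (\<epsilon> h) (\<epsilon>
        f))"
      using expand_lin_kfield[OF lin_comp[OF bilin_right[OF bilin_mult_H E] dual_lin[OF \<alpha>]] mult]
      by (intro sum.cong refl arg_cong2[where f = "(*)"]) simp
    also have "\<dots> = (\<Sum>g\<in>E. \<Sum>e\<in>E. \<alpha> (amult H g e) * (\<Sum>h\<in>E. \<Sum>f\<in>E. \<epsilon> e (amult H h f) * \<gamma> (\<epsilon> g) (\<epsilon> h) (\<epsilon>
        f)))"
      unfolding sum_distrib_left sum_distrib_right
      by (subst (2) sum_swap3) (simp add: mult_ac)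
    also have "\<dots> = dual_comult H \<alpha> (\<lambda>a b. dual_comult H b (\<lambda>b1 b2. \<gamma> a b1 b2))"
      unfolding ap[OF \<alpha> trilin_right[OF \<gamma> vspace_dual vspace_dual lin]]
      by (intro sum.cong refl arg_cong2[where f = "(*)"] ap[symmetric] \<epsilon> trilin_bilin[OF \<gamma>])
    finally show ?thesis .
  qed
  then show ?thesis using lin by (simp add: coassociative_def)
qed

end

section \<open>Iterated edge operators\<close>

text \<open>\<open>on_edge\<close> without the graph, so that its behaviour under joining index sets
  can be studied for tensor powers in general.\<close>

definition nslot :: "'i set \<Rightarrow> ('k::field, 'v::ab_group_add, 'z) kspace_scheme \<Rightarrow> 'i \<Rightarrow> ('v \<Rightarrow> 'v)
    \<Rightarrow> ((('i \<Rightarrow> 'v) \<Rightarrow> 'k) \<Rightarrow> 'k) \<Rightarrow> (('i \<Rightarrow> 'v) \<Rightarrow> 'k) \<Rightarrow> 'k" where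
  "nslot I V i f = nlift I V (\<lambda>m. ntens I V (m(i := f (m i))))"

lemma on_edge_nslot: "on_edge M \<Gamma> e = nslot (edges \<Gamma>) M e"
  by (intro ext) (simp add: on_edge_def nslot_def)

lemma multilin_slot:
  assumes f: "lin V V f" and i: "i \<in> I"
  shows "multilin I V (ntensor I V) (\<lambda>m. ntens I V (m(i := f (m i))))"
proof (rule multilinI)
  have mem: "m(i := f (m i)) \<in> I \<rightarrow>\<^sub>E carr V" if "m \<in> I \<rightarrow>\<^sub>E carr V" for m
    using that i by (intro PiE_upd lin_mem[OF f]) auto
  show "ntens I V (m(i := f (m i))) \<in> carr (ntensor I V)" if "m \<in> I \<rightarrow>\<^sub>E carr V" for m
    by (intro ntens_mem_PiE mem that)
  fix m j assume m: "m \<in> I \<rightarrow>\<^sub>E carr V" and j: "j \<in> I"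
  show "lin V (ntensor I V) (\<lambda>x. ntens I V ((m(j := x))(i := f ((m(j := x)) i))))"
  proof (cases "j = i")
    case True
    then show ?thesis using lin_comp[OF f multilin_lin[OF multilin_ntens m i]] by simp
  next
    case False
    then have "(m(j := x))(i := f ((m(j := x)) i)) = (m(i := f (m i)))(j := x)" for x by auto
    then show ?thesis using multilin_lin[OF multilin_ntens mem[OF m] j] by simp
  qed
qed

lemma bilin_nslot:
  assumes "I \<noteq> {}" "vspace V" "i \<in> I" and g: "bilin A V V g"
  shows "bilin A (ntensor I V) (ntensor I V) (\<lambda>a. nslot I V i (g a))"
  unfolding nslot_def
proof (intro bilinI lin_nlift lin_nlift_param assms vspace_ntensor multilin_slot bilin_right[OF g])
  show "lin A (ntensor I V) (\<lambda>a. ntens I V (m(i := g a (m i))))" if "m \<in> I \<rightarrow>\<^sub>E carr V" for m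
    using that assms(3) by (intro lin_comp[OF bilin_left[OF g] multilin_lin[OF multilin_ntens]]) auto
qed

lemma lin_nslot:
  "I \<noteq> {} \<Longrightarrow> vspace V \<Longrightarrow> i \<in> I \<Longrightarrow> lin V V f \<Longrightarrow> lin (ntensor I V) (ntensor I V) (nslot I V i f)"
  unfolding nslot_def by (intro lin_nlift multilin_slot vspace_ntensor)

lemma nslot_ntens:
  assumes "I \<noteq> {}" "vspace V" "i \<in> I" "lin V V f" "v \<in> I \<rightarrow>\<^sub>E carr V"
  shows "nslot I V i f (ntens I V v) = ntens I V (v(i := f (v i)))"
  using ntensor_universal(2)[OF assms(2) vspace_ntensor multilin_slot[OF assms(4,3)] assms(1,5)]
  by (simp add: nslot_def)

lemma njoin_ntens_PiE:
  "I \<noteq> {} \<Longrightarrow> J \<noteq> {} \<Longrightarrow> I \<inter> J = {} \<Longrightarrow> vspace V \<Longrightarrow> p \<in> I \<rightarrow>\<^sub>E carr V \<Longrightarrow> q \<in> J \<rightarrow>\<^sub>E carr V \<Longrightarrow>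
    njoin I J V (ntens I V p) (ntens J V q) = ntens (I \<union> J) V (\<lambda>i. if i \<in> I then p i else q i)"
  by (rule njoin_ntens) auto

text \<open>Both sides are linear in \<open>s\<close> and in \<open>t\<close>, so families suffice;
  updating one coordinate of a joined family updates the part that contains it.\<close>

lemma nslot_njoin:
  fixes V :: "('k::field, 'v::ab_group_add, 'z) kspace_scheme"
  assumes I: "I \<noteq> {}" and J: "J \<noteq> {}" and IJ: "I \<inter> J = {}" and V: "vspace V" and f: "lin V V f"
    and s: "s \<in> carr (ntensor I V)" and t: "t \<in> carr (ntensor J V)"
  shows "i \<in> I \<Longrightarrow> nslot (I \<union> J) V i f (njoin I J V s t) = njoin I J V (nslot I V i f s) t"
    and "i \<in> J \<Longrightarrow> nslot (I \<union> J) V i f (njoin I J V s t) = njoin I J V s (nslot J V i f t)"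
proof -
  have U: "I \<union> J \<noteq> {}" using I by auto
  note nj = bilin_njoin[OF I J IJ V]
  note L = bilin_left[OF nj] and R = bilin_right[OF nj]
  show "nslot (I \<union> J) V i f (njoin I J V s t) = njoin I J V (nslot I V i f s) t" if i: "i \<in> I"
  proof (rule ntensor_lin_eq[OF I V _ _ vspace_ntensor _ s])
    have iU: "i \<in> I \<union> J" using i by simp
    note nU = lin_nslot[OF U V iU f] and nI = lin_nslot[OF I V i f]
    show "lin (ntensor I V) (ntensor (I \<union> J) V) (\<lambda>s. nslot (I \<union> J) V i f (njoin I J V s t))"
      by (rule lin_comp[OF L[OF t] nU])
    show "lin (ntensor I V) (ntensor (I \<union> J) V) (\<lambda>s. njoin I J V (nslot I V i f s) t)"
      by (rule lin_comp[OF nI L[OF t]])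
    fix p assume p: "p \<in> I \<rightarrow>\<^sub>E carr V"
    show "nslot (I \<union> J) V i f (njoin I J V (ntens I V p) t) = njoin I J V (nslot I V i f (ntens I V p))
        t"
    proof (rule ntensor_lin_eq[OF J V _ _ vspace_ntensor _ t])
      have pm: "ntens I V p \<in> carr (ntensor I V)" by (rule ntens_mem_PiE[OF p])
      show "lin (ntensor J V) (ntensor (I \<union> J) V) (\<lambda>t. nslot (I \<union> J) V i f (njoin I J V (ntens I V p)
          t))"
        by (rule lin_comp[OF R[OF pm] nU])
      show "lin (ntensor J V) (ntensor (I \<union> J) V) (\<lambda>t. njoin I J V (nslot I V i f (ntens I V p)) t)"
        by (rule R[OF lin_mem[OF nI pm]])
      fix q assume q: "q \<in> J \<rightarrow>\<^sub>E carr V"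
      have "p(i := f (p i)) \<in> I \<rightarrow>\<^sub>E carr V" using p i by (intro PiE_upd lin_mem[OF f]) auto
      then show "nslot (I \<union> J) V i f (njoin I J V (ntens I V p) (ntens J V q))
          = njoin I J V (nslot I V i f (ntens I V p)) (ntens J V q)"
        using i by (simp add: njoin_ntens_PiE I J IJ V p q nslot_ntens f U PiE_join)
          (rule ntens_cong, auto)
    qed
  qed
  show "nslot (I \<union> J) V i f (njoin I J V s t) = njoin I J V s (nslot J V i f t)" if i: "i \<in> J"
  proof (rule ntensor_lin_eq[OF I V _ _ vspace_ntensor _ s])
    have iU: "i \<in> I \<union> J" "i \<notin> I" using i IJ by auto
    note nU = lin_nslot[OF U V iU(1) f] and nJ = lin_nslot[OF J V i f]
    show "lin (ntensor I V) (ntensor (I \<union> J) V) (\<lambda>s. nslot (I \<union> J) V i f (njoin I J V s t))"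
      by (rule lin_comp[OF L[OF t] nU])
    show "lin (ntensor I V) (ntensor (I \<union> J) V) (\<lambda>s. njoin I J V s (nslot J V i f t))"
      by (rule L[OF lin_mem[OF nJ t]])
    fix p assume p: "p \<in> I \<rightarrow>\<^sub>E carr V"
    show "nslot (I \<union> J) V i f (njoin I J V (ntens I V p) t) = njoin I J V (ntens I V p) (nslot J V i f
        t)"
    proof (rule ntensor_lin_eq[OF J V _ _ vspace_ntensor _ t])
      have pm: "ntens I V p \<in> carr (ntensor I V)" by (rule ntens_mem_PiE[OF p])
      show "lin (ntensor J V) (ntensor (I \<union> J) V) (\<lambda>t. nslot (I \<union> J) V i f (njoin I J V (ntens I V p)
          t))"
        by (rule lin_comp[OF R[OF pm] nU])
      show "lin (ntensor J V) (ntensor (I \<union> J) V) (\<lambda>t. njoin I J V (ntens I V p) (nslot J V i f t))"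
        by (rule lin_comp[OF nJ R[OF pm]])
      fix q assume q: "q \<in> J \<rightarrow>\<^sub>E carr V"
      have "q(i := f (q i)) \<in> J \<rightarrow>\<^sub>E carr V" using q i by (intro PiE_upd lin_mem[OF f]) auto
      then show "nslot (I \<union> J) V i f (njoin I J V (ntens I V p) (ntens J V q))
          = njoin I J V (ntens I V p) (nslot J V i f (ntens J V q))"
        using i iU by (simp add: njoin_ntens_PiE I J IJ V p q nslot_ntens f U PiE_join)
          (rule ntens_cong, auto)
    qed
  qed
qed

text \<open>A linear map passes through the sum over the representing list termwise, so
  \<open>f\<close> may be any function with values in the carrier.\<close>

lemma tlift_comm:
  assumes "vspace V" "vspace U" "vspace N" "t \<in> carr (tensor V W)" "lin U N g"
    and "\<And>v w. v \<in> carr V \<Longrightarrow> w \<in> carr W \<Longrightarrow> f v w \<in> carr U"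
  shows "g (tlift V W f t) = tlift V W (\<lambda>v w. g (f v w)) t"
  unfolding tlift_trep using trep(1)[OF assms(1,4)] assms(6)
  by (subst lin_apply_sum_list[OF assms(2,3,5)]) (auto simp: split_def)

text \<open>The flag says whether the head of the list acts first (as for vertices) or last (as for faces);
  in both cases it takes the first leg of the coproduct.\<close>

fun op_list :: "bool \<Rightarrow> ('k::field, 'v::ab_group_add, 'z) kspace_scheme
    \<Rightarrow> ('v \<Rightarrow> ('v \<Rightarrow> 'v \<Rightarrow> 'k) \<Rightarrow> 'k) \<Rightarrow> ('g \<Rightarrow> 'v \<Rightarrow> 'n \<Rightarrow> 'n::comm_monoid_add)
    \<Rightarrow> 'g list \<Rightarrow> 'v \<Rightarrow> 'n \<Rightarrow> 'n" where
  "op_list b V D E [] a t = t"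
| "op_list b V D E [h] a t = E h a t"
| "op_list b V D E (h # h' # hs) a t = tlift V V (\<lambda>a1 a2.
     if b then op_list b V D E (h' # hs) a2 (E h a1 t) else E h a1 (op_list b V D E (h' # hs) a2 t)) (D
         a)"

lemma vertex_act_list_op_list:
  "hs \<noteq> [] \<Longrightarrow> vertex_act_list H M \<Gamma> hs a t = op_list True H (comult H) (edge_act H M \<Gamma>) hs a t"
  by (induction H M \<Gamma> hs a t rule: vertex_act_list.induct) (auto simp: sw2_def)

lemma face_dual_act_list_op_list:
  "hs \<noteq> [] \<Longrightarrow> face_dual_act_list H M \<Gamma> hs \<alpha> t
    = op_list False (dual H) (dual_comult H) (edge_dual_act H M \<Gamma>) hs \<alpha> t"
  by (induction H M \<Gamma> hs \<alpha> t rule: face_dual_act_list.induct) auto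

text \<open>The head combined with the rest of the list in either order of composition. Most
  arguments about it then need not distinguish the two values of the flag.\<close>

definition op_list_step :: "bool \<Rightarrow> ('v \<Rightarrow> 'n \<Rightarrow> 'n) \<Rightarrow> ('v \<Rightarrow> 'n \<Rightarrow> 'n) \<Rightarrow> 'v \<Rightarrow> 'v \<Rightarrow> 'n \<Rightarrow> 'n" where
  "op_list_step b F G a1 a2 t = (if b then G a2 (F a1 t) else F a1 (G a2 t))"

lemma op_list_step_True: "b \<Longrightarrow> op_list_step b F G a1 a2 t = G a2 (F a1 t)"
  by (simp add: op_list_step_def)

lemma op_list_step_False: "\<not> b \<Longrightarrow> op_list_step b F G a1 a2 t = F a1 (G a2 t)"
  by (simp add: op_list_step_def)

lemma op_list_step_map:
  "G a2 (F a1 t) = g (G' a2 (F' a1 t')) \<Longrightarrow> F a1 (G a2 t) = g (F' a1 (G' a2 t'))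
    \<Longrightarrow> op_list_step b F G a1 a2 t = g (op_list_step b F' G' a1 a2 t')"
  by (simp add: op_list_step_def)

lemma op_list_step_eqI: "G a2 (F a1 t) = u \<Longrightarrow> F a1 (G a2 t) = u \<Longrightarrow> op_list_step b F G a1 a2 t = u"
  by (simp add: op_list_step_def)

lemma op_list_Cons:
  "hs \<noteq> [] \<Longrightarrow> op_list b V D E (h # hs) a t
    = tlift V V (\<lambda>a1 a2. op_list_step b (E h) (op_list b V D E hs) a1 a2 t) (D a)"
  by (cases hs) (simp_all add: op_list_step_def)

declare op_list.simps(3) [simp del]

lemma op_list_step_lin:
  assumes "bilin V N N F" "bilin V N N G"
  shows "t \<in> carr N \<Longrightarrow> bilin V V N (\<lambda>a1 a2. op_list_step b F G a1 a2 t)"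
    and "a1 \<in> carr V \<Longrightarrow> a2 \<in> carr V \<Longrightarrow> lin N N (op_list_step b F G a1 a2)"
proof -
  have s: "op_list_step b F G a1 a2 = (\<lambda>t. if b then G a2 (F a1 t) else F a1 (G a2 t))" for a1 a2
    by (rule ext) (simp add: op_list_step_def)
  note l = bilin_left[OF assms(1)] bilin_left[OF assms(2)] 
  note r = bilin_right[OF assms(1)] bilin_right[OF assms(2)]
  show "bilin V V N (\<lambda>a1 a2. op_list_step b F G a1 a2 t)" if t: "t \<in> carr N"
  proof (cases b)
    case True
    show ?thesis unfolding op_list_step_def using True t
      by (auto intro!: bilinI l lin_comp[OF l(1) r(2)] lin_mem[OF r(1)])
  next
    case False
    show ?thesis unfolding op_list_step_def using False t
      by (auto intro!: bilinI l lin_comp[OF l(2) r(1)] lin_mem[OF r(2)])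
  qed
  show "lin N N (op_list_step b F G a1 a2)" if "a1 \<in> carr V" "a2 \<in> carr V"
    unfolding s using lin_comp[OF r(1)[OF that(1)] r(2)[OF that(2)]]
      lin_comp[OF r(2)[OF that(2)] r(1)[OF that(1)]] by (cases b) auto
qed

section \<open>Iterated operators over a coassociative coproduct\<close>

locale coassoc =
  fixes V :: "('k::field, 'v::ab_group_add, 'z) kspace_scheme" and D :: "'v \<Rightarrow> ('v \<Rightarrow> 'v \<Rightarrow> 'k) \<Rightarrow> 'k"
  assumes coassociative: "coassociative V D"
begin

lemma V: "vspace V" and D: "lin V (tensor V V) D"
  using coassociative by (auto simp: coassociative_def)

lemma D_mem: "v \<in> carr V \<Longrightarrow> D v \<in> carr (tensor V V)"
  by (rule lin_mem[OF D])

lemma lin_tlift_D: "vspace U \<Longrightarrow> bilin V V U f \<Longrightarrow> lin V U (\<lambda>v. tlift V V f (D v))"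
  by (rule lin_comp[OF D tensor_universal(1)[OF V V]])

text \<open>The target consists of functions, so the equation follows from the tested version of
  coassociativity at each point \<open>x\<close>.\<close>

lemma tlift_D_assoc:
  fixes T :: "'v \<Rightarrow> 'v \<Rightarrow> 'v \<Rightarrow> 'a \<Rightarrow> 'k"
  assumes T: "\<And>x. trilin V V V (\<lambda>a b c. T a b c x)" and v: "v \<in> carr V"
  shows "tlift V V (\<lambda>a c. tlift V V (\<lambda>a1 a2. T a1 a2 c) (D a)) (D v)
    = tlift V V (\<lambda>a b. tlift V V (\<lambda>b1 b2. T a b1 b2) (D b)) (D v)"
proof
  fix x
  let ?\<gamma> = "\<lambda>a b c. T a b c x"
  have "tlift V V (\<lambda>a c. tlift V V (\<lambda>a1 a2. T a1 a2 c) (D a)) (D v) x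
      = D v (\<lambda>a c. D a (\<lambda>a1 a2. ?\<gamma> a1 a2 c))"
    by (rule tlift_apply_eq[OF V V D_mem[OF v] trilin_left[OF T V V D]])
      (intro tlift_apply V D_mem trilin_bilin_left[OF T])
  also have "\<dots> = D v (\<lambda>a b. D b (?\<gamma> a))"
    using coassociative v T by (simp add: coassociative_def)
  also have "\<dots> = tlift V V (\<lambda>a b. tlift V V (\<lambda>b1 b2. T a b1 b2) (D b)) (D v) x"
    by (rule tlift_apply_eq[OF V V D_mem[OF v] trilin_right[OF T V V D], symmetric])
      (intro tlift_apply V D_mem trilin_bilin[OF T])
  finally show "tlift V V (\<lambda>a c. tlift V V (\<lambda>a1 a2. T a1 a2 c) (D a)) (D v) x
    = tlift V V (\<lambda>a b. tlift V V (\<lambda>b1 b2. T a b1 b2) (D b)) (D v) x" .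
qed

lemma bilin_op_list:
  assumes N: "vspace N"
  shows "hs \<noteq> [] \<Longrightarrow> (\<And>h. h \<in> set hs \<Longrightarrow> bilin V N N (E h)) \<Longrightarrow> bilin V N N (op_list b V D E hs)"
proof (induction hs rule: list_nonempty_induct)
  case (single h)
  have "op_list b V D E [h] = E h" by (intro ext) simp
  then show ?case using single by simp
next
  case (cons h hs)
  have E: "bilin V N N (E h)" and O: "bilin V N N (op_list b V D E hs)" using cons by auto
  note s = op_list_step_lin[OF E O]
  show ?case unfolding op_list_Cons[OF cons(1)] 
    by (intro bilinI lin_tlift_D lin_tlift_param N s V D_mem) 
qed

text \<open>With \<open>g\<close> a partial application of \<open>njoin\<close>, this transfers the
  operators of a cilium lying on one summand only to the connected sum.\<close>

lemma op_list_map: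
  assumes N: "vspace N" "vspace N'" and g: "lin N' N g"
  shows "hs \<noteq> [] \<Longrightarrow> (\<And>h. h \<in> set hs \<Longrightarrow> bilin V N' N' (E' h))
    \<Longrightarrow> (\<And>h v m. h \<in> set hs \<Longrightarrow> v \<in> carr V \<Longrightarrow> m \<in> carr N' \<Longrightarrow> E h v (g m) = g (E' h v m))
    \<Longrightarrow> v \<in> carr V \<Longrightarrow> m \<in> carr N' \<Longrightarrow> op_list b V D E hs v (g m) = g (op_list b V D E' hs v m)"
proof (induction hs arbitrary: v m rule: list_nonempty_induct)
  case (cons h hs)
  have E: "bilin V N' N' (E' h)" and O: "bilin V N' N' (op_list b V D E' hs)"
    using cons by (auto intro!: bilin_op_list N)
  note s = op_list_step_lin[OF E O]
  have IH: "op_list b V D E hs v (g m) = g (op_list b V D E' hs v m)" if "v \<in> carr V" "m \<in> carr N'" for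
      v m
    using cons.prems that by (intro cons.IH) auto
  have "op_list b V D E (h # hs) v (g m)
      = tlift V V (\<lambda>a1 a2. g (op_list_step b (E' h) (op_list b V D E' hs) a1 a2 m)) (D v)"
    unfolding op_list_Cons[OF cons(1)]
    by (intro tlift_cong[OF V D_mem] op_list_step_map)
      (simp_all add: cons.prems IH bilin_mem[OF E] bilin_mem[OF O])
  also have "\<dots> = g (op_list b V D E' (h # hs) v m)"
    unfolding op_list_Cons[OF cons(1)]
    by (intro tlift_comm[symmetric, OF V N(2,1) D_mem g] bilin_mem[OF s(1)] cons.prems)
  finally show ?case .
qed simp

text \<open>The source of the diagonal action at the distinguished cilium. Splitting off the head
  and then, by induction, the rest of \<open>xs\<close> from \<open>ys\<close> groups three legs as
  first and (second, third); coassociativity regroups them as (first, second) and third, and the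
  pair recombines to the iterated operator of the longer list. Operators along \<open>xs\<close> and
  along \<open>ys\<close> act on different arguments of \<open>J\<close>, so both orders of
  composition are covered.\<close>

lemma op_list_append:
  fixes N :: "('k, 'a \<Rightarrow> 'k, 'y) kspace_scheme"
  assumes N: "vspace N" "vspace N1" "vspace N2" "scl N = fscl" and J: "bilin N1 N2 N J" and ys: "ys \<noteq>
      []"
    and E2: "\<And>h. h \<in> set ys \<Longrightarrow> bilin V N2 N2 (E2 h)"
    and J2: "\<And>h v m n. h \<in> set ys \<Longrightarrow> v \<in> carr V \<Longrightarrow> m \<in> carr N1 \<Longrightarrow> n \<in> carr N2 \<Longrightarrow>
      E h v (J m n) = J m (E2 h v n)" and n: "n \<in> carr N2"
  shows "xs \<noteq> [] \<Longrightarrow> (\<And>h. h \<in> set xs \<Longrightarrow> bilin V N1 N1 (E1 h)) \<Longrightarrow>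
    (\<And>h. h \<in> set xs \<Longrightarrow> bilin V N N (E h)) \<Longrightarrow>
    (\<And>h v m n. h \<in> set xs \<Longrightarrow> v \<in> carr V \<Longrightarrow> m \<in> carr N1 \<Longrightarrow> n \<in> carr N2 \<Longrightarrow>
      E h v (J m n) = J (E1 h v m) n) \<Longrightarrow> v \<in> carr V \<Longrightarrow> m \<in> carr N1 \<Longrightarrow>
    op_list b V D E (xs @ ys) v (J m n)
      = tlift V V (\<lambda>v1 v2. J (op_list b V D E1 xs v1 m) (op_list b V D E2 ys v2 n)) (D v)"
proof (induction xs arbitrary: v m rule: list_nonempty_induct)
  case (single x)
  have r: "op_list b V D E ys w (J m' n) = J m' (op_list b V D E2 ys w n)" if "w \<in> carr V" "m' \<in> carr
      N1" for w m'
    using that by (intro op_list_map[OF N(1,3) bilin_right[OF J]] ys E2 J2 n)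
  have o2: "bilin V N2 N2 (op_list b V D E2 ys)" by (intro bilin_op_list N ys E2)
  have "op_list b V D E (x # ys) v (J m n)
      = tlift V V (\<lambda>v1 v2. J (op_list b V D E1 [x] v1 m) (op_list b V D E2 ys v2 n)) (D v)"
    unfolding op_list_Cons[OF ys]
    using single(1)[of x] bilin_mem[OF single(1)[of x]]
    by (intro tlift_cong[OF V D_mem] op_list_step_eqI) (simp_all add: single r n bilin_mem[OF o2])
  then show ?case by simp
next
  case (cons x xs)
  have E: "bilin V N N (E x)" and E1: "bilin V N1 N1 (E1 x)" and O: "bilin V N1 N1 (op_list b V D E1
      xs)"
    using cons by (auto intro!: bilin_op_list N)
  have o2: "bilin V N2 N2 (op_list b V D E2 ys)" by (intro bilin_op_list N ys E2)
  note s = op_list_step_lin[OF E1 O]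
  let ?T = "\<lambda>a1 a2 a3. J (op_list_step b (E1 x) (op_list b V D E1 xs) a1 a2 m) (op_list b V D E2 ys a3
      n)"
  have IH: "op_list b V D E (xs @ ys) v (J m n)
      = tlift V V (\<lambda>v1 v2. J (op_list b V D E1 xs v1 m) (op_list b V D E2 ys v2 n)) (D v)"
    if "v \<in> carr V" "m \<in> carr N1" for v m
    using cons.prems that by (intro cons.IH) auto
  \<comment> \<open>If \<open>b\<close> holds, the head has acted before the rest, so the induction
    hypothesis is used with a changed \<open>m\<close>. Otherwise the head acts afterwards and has
    to be moved through the sum by linearity.\<close>
  have step: "op_list_step b (E x) (op_list b V D E (xs @ ys)) a1 a2 (J m n) = tlift V V (?T a1) (D a2)"
    if a: "a1 \<in> carr V" "a2 \<in> carr V" for a1 a2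
  proof (cases b)
    case True
    show ?thesis
      unfolding op_list_step_True[OF True] cons.prems(3)[OF list.set_intros(1) a(1) cons.prems(5) n]
      by (intro IH a bilin_mem[OF E1] cons.prems)
  next
    case False
    have "op_list_step b (E x) (op_list b V D E (xs @ ys)) a1 a2 (J m n)
       = E x a1 (tlift V V (\<lambda>v1 v2. J (op_list b V D E1 xs v1 m) (op_list b V D E2 ys v2 n)) (D a2))"
      unfolding op_list_step_False[OF False] IH[OF a(2) cons.prems(5)] ..
    also have "\<dots> = tlift V V (\<lambda>v1 v2. E x a1 (J (op_list b V D E1 xs v1 m) (op_list b V D E2 ys v2 n)))
        (D a2)"
      using a cons.prems n
      by (intro tlift_comm[OF V N(1,1) D_mem bilin_right[OF E]] bilin_mem[OF J] bilin_mem[OF O]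
          bilin_mem[OF o2])
    also have "\<dots> = tlift V V (?T a1) (D a2)"
      unfolding op_list_step_False[OF False]
      by (intro tlift_cong[OF V D_mem] cons.prems(3) list.set_intros a cons.prems n bilin_mem[OF O]
          bilin_mem[OF o2])
    finally show ?thesis .
  qed
  have tri: "trilin V V V (\<lambda>a b c. ?T a b c x)" for x
  proof (rule trilinI)
    have ev: "lin N kfield (\<lambda>f. f x)" by (rule lin_eval[OF N(4)])
    note sm = s(1)[OF cons.prems(5)]
    show "lin V kfield (\<lambda>a. ?T a b c x)" if "b \<in> carr V" "c \<in> carr V" for b c
      by (rule lin_comp[OF lin_comp[OF bilin_left[OF sm] bilin_left[OF J]] ev])
        (intro bilin_mem[OF o2] that n)+
    show "lin V kfield (\<lambda>b. ?T a b c x)" if "a \<in> carr V" "c \<in> carr V" for a c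
      by (rule lin_comp[OF lin_comp[OF bilin_right[OF sm] bilin_left[OF J]] ev])
        (intro bilin_mem[OF o2] that n)+
    show "lin V kfield (\<lambda>c. ?T a b c x)" if "a \<in> carr V" "b \<in> carr V" for a b
      by (rule lin_comp[OF lin_comp[OF bilin_left[OF o2] bilin_right[OF J]] ev])
        (intro bilin_mem[OF sm] that n)+
  qed
  have "op_list b V D E ((x # xs) @ ys) v (J m n) = tlift V V (\<lambda>a b. tlift V V (?T a) (D b)) (D v)"
    using ys cons(1) by (simp add: op_list_Cons) (intro tlift_cong[OF V D_mem] step cons.prems)
  \<comment> \<open>Coassociativity moves the outer cut from behind the head to the boundary between
    \<open>xs\<close> and \<open>ys\<close>.\<close>
  also have "\<dots> = tlift V V (\<lambda>a c. tlift V V (\<lambda>a1 a2. ?T a1 a2 c) (D a)) (D v)"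
    by (rule tlift_D_assoc[symmetric, OF tri cons.prems(4)])
  also have "\<dots> = tlift V V (\<lambda>v1 v2. J (op_list b V D E1 (x # xs) v1 m) (op_list b V D E2 ys v2 n)) (D
      v)"
    unfolding op_list_Cons[OF cons(1)]
    by (intro tlift_cong[OF V D_mem] tlift_comm[symmetric, OF V N(2,1) D_mem bilin_left[OF J]]
        bilin_mem[OF s(1)] bilin_mem[OF o2] n cons.prems)
  finally show ?case .
qed

end

section \<open>Contracting coactions with functionals\<close>

lemma lin_foldr:
  assumes "\<And>c. c \<in> set cs \<Longrightarrow> bilin V N N (act c)" "\<And>c. c \<in> set cs \<Longrightarrow> a c \<in> carr V"
  shows "lin N N (foldr (\<lambda>c. act c (a c)) cs)"
  using assms
proof (induction cs)
  case Nil
  show ?case using lin_id[of N] by (simp add: id_def)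
next
  case (Cons c cs)
  have "lin N N (act c (a c))" by (rule bilin_right[OF Cons.prems(1) Cons.prems(2)]) simp_all
  then show ?case using Cons lin_comp by (force simp: comp_def)
qed

lemma foldr_mem:
  "(\<And>c. c \<in> set cs \<Longrightarrow> bilin V N N (act c)) \<Longrightarrow> (\<And>c. c \<in> set cs \<Longrightarrow> a c \<in> carr V) \<Longrightarrow> n \<in> carr N
    \<Longrightarrow> foldr (\<lambda>c. act c (a c)) cs n \<in> carr N"
  by (rule lin_mem[OF lin_foldr])

text \<open>By distinctness each coordinate enters exactly one operator, which sits between a fixed
  linear map and a fixed vector.\<close>

lemma multilin_foldr:
  assumes act: "\<And>c. c \<in> set cs \<Longrightarrow> bilin V N N (act c)" and cs: "distinct cs" and n: "n \<in> carr N"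
  shows "multilin (set cs) V N (\<lambda>a. foldr (\<lambda>c. act c (a c)) cs n)"
proof (rule multilinI)
  show "foldr (\<lambda>c. act c (a c)) cs n \<in> carr N" if "a \<in> set cs \<rightarrow>\<^sub>E carr V" for a
    using that by (intro foldr_mem[where a = a and V = V] act n) auto
  fix a i assume a: "a \<in> set cs \<rightarrow>\<^sub>E carr V" and i: "i \<in> set cs"
  then obtain ys zs where s: "cs = ys @ i # zs" by (meson split_list)
  have e: "foldr (\<lambda>c. act c ((a(i := x)) c)) cs n
      = foldr (\<lambda>c. act c (a c)) ys (act i x (foldr (\<lambda>c. act c (a c)) zs n))" for x
  proof -
    have "foldr (\<lambda>c. act c ((a(i := x)) c)) us m = foldr (\<lambda>c. act c (a c)) us m" if "i \<notin> set us" for us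
        m
      using that by (intro foldr_cong) auto
    then show ?thesis using cs by (simp add: s)
  qed
  have z: "foldr (\<lambda>c. act c (a c)) zs n \<in> carr N"
    using a s act by (intro foldr_mem[where a = a and V = V] n) auto
  have y: "lin N N (foldr (\<lambda>c. act c (a c)) ys)" using a s act by (intro lin_foldr[where V = V]) auto
  show "lin V N (\<lambda>x. foldr (\<lambda>c. act c ((a(i := x)) c)) cs n)"
    unfolding e by (rule lin_comp[OF bilin_left[OF act[OF i] z] y])
qed

lemma foldl_foldr_rev: "foldl (\<lambda>n c. act c (a c) n) n cs = foldr (\<lambda>c. act c (a c)) (rev cs) n"
  by (simp add: foldl_conv_foldr)

lemma multilin_foldl:
  assumes "\<And>c. c \<in> set cs \<Longrightarrow> bilin V N N (act c)" "distinct cs" "n \<in> carr N"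
  shows "multilin (set cs) V N (\<lambda>a. foldl (\<lambda>n c. act c (a c) n) n cs)"
  unfolding foldl_foldr_rev using multilin_foldr[of "rev cs" V N act n] assms by simp

lemma lin_foldl:
  "(\<And>c. c \<in> set cs \<Longrightarrow> bilin V N N (act c)) \<Longrightarrow> (\<And>c. c \<in> set cs \<Longrightarrow> a c \<in> carr V)
    \<Longrightarrow> lin N N (\<lambda>n. foldl (\<lambda>n c. act c (a c) n) n cs)"
  unfolding foldl_foldr_rev using lin_foldr[of "rev cs" V N act a] by simp

lemma
  assumes V: "vspace V" "vspace N" and act: "\<And>c. c \<in> set cs \<Longrightarrow> bilin V N N (act c)"
    and cs: "distinct cs" "cs \<noteq> []" and n: "n \<in> carr N"
  shows lin_left_assemble_act: "lin (ntensor (set cs) V) N (\<lambda>t. left_assemble_act V cs act t n)"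
    and left_assemble_act_ntens: "(\<And>c. c \<in> set cs \<Longrightarrow> a c \<in> carr V) \<Longrightarrow>
      left_assemble_act V cs act (ntens (set cs) V a) n = foldr (\<lambda>c. act c (a c)) cs n"
proof -
  have ne: "set cs \<noteq> {}" using cs by simp
  note m = multilin_foldr[OF act cs(1) n]
  show "lin (ntensor (set cs) V) N (\<lambda>t. left_assemble_act V cs act t n)"
    unfolding left_assemble_act_def by (rule lin_nlift[OF V m ne])
  show "left_assemble_act V cs act (ntens (set cs) V a) n = foldr (\<lambda>c. act c (a c)) cs n"
    if "\<And>c. c \<in> set cs \<Longrightarrow> a c \<in> carr V"
    unfolding left_assemble_act_def
    by (subst nlift_ntens[OF V m ne that], assumption+) (auto intro: foldr_cong)
qed

lemma
  assumes V: "vspace V" "vspace N" and act: "\<And>c. c \<in> set cs \<Longrightarrow> bilin V N N (\<lambda>v n. act c n v)"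
    and cs: "distinct cs" "cs \<noteq> []" and n: "n \<in> carr N"
  shows lin_right_assemble_act: "lin (ntensor (set cs) V) N (right_assemble_act V cs act n)"
    and right_assemble_act_ntens: "(\<And>c. c \<in> set cs \<Longrightarrow> a c \<in> carr V) \<Longrightarrow>
      right_assemble_act V cs act n (ntens (set cs) V a) = foldl (\<lambda>n c. act c n (a c)) n cs"
proof -
  have ne: "set cs \<noteq> {}" using cs by simp
  note m = multilin_foldl[OF act cs(1) n]
  show "lin (ntensor (set cs) V) N (right_assemble_act V cs act n)"
    unfolding right_assemble_act_def by (rule lin_nlift[OF V m ne])
  show "right_assemble_act V cs act n (ntens (set cs) V a) = foldl (\<lambda>n c. act c n (a c)) n cs"
    if "\<And>c. c \<in> set cs \<Longrightarrow> a c \<in> carr V"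
    unfolding right_assemble_act_def
    by (subst nlift_ntens[OF V m ne that], assumption+) (auto intro: foldl_cong)
qed

text \<open>This is \<open>\<alpha> \<otimes> id\<close>. Composed with a coaction it becomes an
  action of the dual, which makes the results on actions available for coactions.\<close>

definition lcontract :: "('k::field, 'h::ab_group_add, 'y) kspace_scheme
    \<Rightarrow> ('k, 'n::ab_group_add, 'z) kspace_scheme \<Rightarrow> ('h \<Rightarrow> 'k) \<Rightarrow> (('h \<Rightarrow> 'n \<Rightarrow> 'k) \<Rightarrow> 'k) \<Rightarrow> 'n" where
  "lcontract H N \<alpha> = tlift H N (\<lambda>a n0. scl N (\<alpha> a) n0)"

definition rcontract :: "('k::field, 'h::ab_group_add, 'y) kspace_scheme
    \<Rightarrow> ('k, 'n::ab_group_add, 'z) kspace_scheme \<Rightarrow> ('h \<Rightarrow> 'k) \<Rightarrow> (('n \<Rightarrow> 'h \<Rightarrow> 'k) \<Rightarrow> 'k) \<Rightarrow> 'n" where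
  "rcontract H N \<alpha> = tlift N H (\<lambda>n0 a. scl N (\<alpha> a) n0)"

lemma bilin_scl_kfield: "vspace N \<Longrightarrow> bilin kfield N N (scl N)"
  by (intro bilinI) (auto simp: lin_def kfield_def vspace_scl_simps mult.commute intro: vspace_scl)

lemma bilin_lcontract_form: "vspace N \<Longrightarrow> lin H kfield \<alpha> \<Longrightarrow> bilin H N N (\<lambda>a n. scl N (\<alpha> a) n)"
  by (rule bilin_comp2[OF bilin_scl_kfield _ lin_id])

lemma bilin_rcontract_form: "vspace N \<Longrightarrow> lin H kfield \<alpha> \<Longrightarrow> bilin N H N (\<lambda>n a. scl N (\<alpha> a) n)"
  using bilin_lcontract_form[of N H \<alpha>] by (simp add: bilin_def)

lemma bilin_lcontract:
  assumes "vspace H" "vspace N" "lin X (tensor H N) \<delta>"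
  shows "bilin (dual H) X N (\<lambda>\<alpha> n. lcontract H N \<alpha> (\<delta> n))"
  unfolding lcontract_def
  by (intro bilinI lin_tlift_param assms lin_mem[OF assms(3)] lin_scl_left lin_eval
      lin_comp[OF assms(3) tensor_universal(1)] bilin_lcontract_form dual_lin) simp_all

lemma bilin_rcontract:
  assumes "vspace H" "vspace N" "lin X (tensor N H) \<delta>"
  shows "bilin (dual H) X N (\<lambda>\<alpha> n. rcontract H N \<alpha> (\<delta> n))"
  unfolding rcontract_def
  by (intro bilinI lin_tlift_param assms lin_mem[OF assms(3)] lin_scl_left lin_eval
      lin_comp[OF assms(3) tensor_universal(1)] bilin_rcontract_form dual_lin) simp_all

lemma lcontract_functional:
  assumes "vspace H" "vspace N" "t \<in> carr (tensor H N)" "lin H kfield \<alpha>" "lin N kfield \<nu>"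
  shows "\<nu> (lcontract H N \<alpha> t) = t (\<lambda>a n. \<alpha> a * \<nu> n)"
  unfolding lcontract_def
  by (rule tlift_functional_eq[OF assms(1,2,2,3,5) bilin_mult[OF assms(4,5)]])
    (auto simp: lin_kfield_scl[OF assms(5)] intro: vspace_scl[OF assms(2)])

lemma rcontract_functional:
  assumes "vspace H" "vspace N" "t \<in> carr (tensor N H)" "lin H kfield \<alpha>" "lin N kfield \<nu>"
  shows "\<nu> (rcontract H N \<alpha> t) = t (\<lambda>n a. \<nu> n * \<alpha> a)"
  unfolding rcontract_def
  by (rule tlift_functional_eq[OF assms(2,1,2,3,5) bilin_mult[OF assms(5,4)]])
    (auto simp: lin_kfield_scl[OF assms(5)] intro: vspace_scl[OF assms(2)])

lemma lcontract_mem: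
  "vspace H \<Longrightarrow> vspace N \<Longrightarrow> t \<in> carr (tensor H N) \<Longrightarrow> lcontract H N \<alpha> t \<in> carr N"
  unfolding lcontract_def by (intro tlift_mem vspace_scl)

lemma rcontract_mem:
  "vspace H \<Longrightarrow> vspace N \<Longrightarrow> t \<in> carr (tensor N H) \<Longrightarrow> rcontract H N \<alpha> t \<in> carr N"
  unfolding rcontract_def by (intro tlift_mem vspace_scl)

text \<open>For coactions given by a description or by iterated lifts, linearity is easier to see
  after pairing with functionals; separation transfers it back to the tensors.\<close>

lemma lin_by_sep:
  assumes V: "vspace V" "vspace W" and f: "\<And>x. x \<in> carr X \<Longrightarrow> f x \<in> carr (tensor V W)" and X: "vspace X"
    and \<Phi>: "\<And>\<phi>. \<phi> \<in> \<Phi> \<Longrightarrow> lin V kfield \<phi>" and \<Psi>: "\<And>\<psi>. \<psi> \<in> \<Psi> \<Longrightarrow> lin W kfield \<psi>"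
    and \<Phi>0: "\<And>v. v \<in> carr V \<Longrightarrow> (\<And>\<phi>. \<phi> \<in> \<Phi> \<Longrightarrow> \<phi> v = 0) \<Longrightarrow> v = 0"
    and \<Psi>0: "\<And>w. w \<in> carr W \<Longrightarrow> (\<And>\<psi>. \<psi> \<in> \<Psi> \<Longrightarrow> \<psi> w = 0) \<Longrightarrow> w = 0"
    and lin: "\<And>\<phi> \<psi>. \<phi> \<in> \<Phi> \<Longrightarrow> \<psi> \<in> \<Psi> \<Longrightarrow> lin X kfield (\<lambda>x. f x (\<lambda>v w. \<phi> v * \<psi> w))"
  shows "lin X (tensor V W) f"
  unfolding lin_def
proof (intro conjI ballI allI image_subsetI f)
  note sep = tensor_sep[OF V _ _ \<Phi> \<Psi> \<Phi>0 \<Psi>0]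
  fix x y c assume x: "x \<in> carr X"
  show "f (scl X c x) = scl (tensor V W) c (f x)"
    by (rule sep) (auto simp: lin_kfield_scl[OF lin x] vspace_scl[OF X x] x f
        intro: vspace_scl[of "tensor V W", simplified])
  assume y: "y \<in> carr X"
  show "f (x + y) = f x + f y"
    by (rule sep) (auto simp: lin_add[OF lin x y] vspace_add[OF X x y] x y f intro: vspace_add)
qed

section \<open>Product functionals on tensor powers\<close>

definition prod_form :: "'i set \<Rightarrow> ('i \<Rightarrow> 'h \<Rightarrow> 'k) \<Rightarrow> ('i \<Rightarrow> 'h) \<Rightarrow> 'k::comm_monoid_mult" where
  "prod_form C \<alpha> a = (\<Prod>c\<in>C. \<alpha> c (a c))"

locale powers =
  fixes H :: "('k::field, 'h::ab_group_add) khopf" and C :: "'i set"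
  assumes HH: "vspace H" and fdH: "finite_dim H" and C: "finite C" "C \<noteq> {}"
begin

abbreviation "HC \<equiv> ntensor C H"

lemma multilin_prod_form: "(\<And>c. c \<in> C \<Longrightarrow> lin H kfield (\<alpha> c)) \<Longrightarrow> multilin C H kfield (prod_form C \<alpha>)"
  unfolding prod_form_def by (rule multilin_prod[OF C(1) HH])

lemma ntens_prod_form: "(\<And>c. c \<in> C \<Longrightarrow> lin H kfield (\<alpha> c)) \<Longrightarrow> ntens C H a (prod_form C \<alpha>) = prod_form C \<alpha>
    a"
  by (subst ntens_apply[OF multilin_prod_form]) (auto simp: prod_form_def)

text \<open>Evaluation at \<open>prod_form C \<alpha>\<close> is the tensor product of the
  functionals \<open>\<alpha> c\<close>. These evaluations take the place of the full dual of the
  tensor power; they separate its points since \<open>H\<close> has finite dimension.\<close>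

definition "prod_evals = (\<lambda>\<alpha> (u :: (('i \<Rightarrow> 'h) \<Rightarrow> 'k) \<Rightarrow> 'k). u (prod_form C \<alpha>)) ` {\<alpha>. \<forall>c\<in>C. \<alpha> c \<in> carr
    (dual H)}"

lemma prod_evals_lin: "\<phi> \<in> prod_evals \<Longrightarrow> lin HC kfield \<phi>"
  by (auto simp: prod_evals_def intro: lin_eval)

lemma prod_evals_sep: "u \<in> carr HC \<Longrightarrow> (\<And>\<phi>. \<phi> \<in> prod_evals \<Longrightarrow> \<phi> u = 0) \<Longrightarrow> u = 0"
  by (rule ntensor_sep_zero[OF C HH fdH]) (auto simp: prod_evals_def prod_form_def[abs_def])

lemma all_lin_sep: "vspace N \<Longrightarrow> n \<in> carr N \<Longrightarrow> (\<And>\<psi>. \<psi> \<in> {\<psi>. lin N kfield \<psi>} \<Longrightarrow> \<psi> n = 0) \<Longrightarrow> n = 0"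
  by (rule functional_sep) auto

lemma left_coact_list_mem:
  assumes N: "vspace N" and coact: "\<And>c. c \<in> set cs \<Longrightarrow> lin N (tensor H N) (coact c)"
    and acc: "\<And>c. c \<in> C \<Longrightarrow> c \<notin> set cs \<Longrightarrow> acc c \<in> carr H" and n: "n \<in> carr N"
  shows "left_coact_list H N C coact cs acc n \<in> carr (tensor HC N)"
  using coact acc n
proof (induction cs arbitrary: acc n)
  case Nil
  then show ?case by (auto intro!: tens_mem ntens_mem)
next
  case (Cons c cs)
  have "coact c n \<in> carr (tensor H N)" by (rule lin_mem[OF Cons.prems(1) Cons.prems(3)]) simp
  then show ?case by simp (intro tlift_mem HH vspace_tensor Cons.IH Cons.prems(1); simp add:
      Cons.prems(2))
qed

lemma right_coact_list_mem:
  assumes N: "vspace N" and coact: "\<And>c. c \<in> set cs \<Longrightarrow> lin N (tensor N H) (coact c)"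
    and acc: "\<And>c. c \<in> C \<Longrightarrow> c \<notin> set cs \<Longrightarrow> acc c \<in> carr H" and n: "n \<in> carr N"
  shows "right_coact_list H N C coact cs acc n \<in> carr (tensor N HC)"
  using coact acc n
proof (induction cs arbitrary: acc n)
  case Nil
  then show ?case by (auto intro!: tens_mem ntens_mem)
next
  case (Cons c cs)
  have "coact c n \<in> carr (tensor N H)" by (rule lin_mem[OF Cons.prems(1) Cons.prems(3)]) simp
  then show ?case by simp (intro tlift_mem N vspace_tensor Cons.IH Cons.prems(1); simp add:
      Cons.prems(2))
qed

lemma prod_upd:
  assumes "c \<in> C" "c \<notin> set cs"
  shows "(\<Prod>d\<in>C - set cs. \<alpha> d ((acc(c := a)) d)) = \<alpha> c a * (\<Prod>d\<in>C - set (c # cs). \<alpha> d (acc d) :: 'k)"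
proof -
  have e: "C - set cs = insert c (C - set (c # cs))" using assms by auto
  have "(\<Prod>d\<in>C - set cs. \<alpha> d ((acc(c := a)) d))
      = \<alpha> c a * (\<Prod>d\<in>C - set (c # cs). \<alpha> d ((acc(c := a)) d))"
    unfolding e using C(1) by (subst prod.insert) auto
  also have "(\<Prod>d\<in>C - set (c # cs). \<alpha> d ((acc(c := a)) d)) = (\<Prod>d\<in>C - set (c # cs). \<alpha> d (acc d))"
    by (intro prod.cong) auto
  finally show ?thesis .
qed

text \<open>Invariant of the recursion: indices outside \<open>cs\<close> already have their
  coefficient in \<open>acc\<close>, those in \<open>cs\<close> are still to be contracted. Each
  step trades one coefficient paired with \<open>\<alpha> c\<close> for a contraction.\<close>

lemma left_coact_list_eval:
  assumes N: "vspace N" and coact: "\<And>c. c \<in> set cs \<Longrightarrow> lin N (tensor H N) (coact c)"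
    and cs: "distinct cs" "set cs \<subseteq> C" and \<alpha>: "\<And>c. c \<in> C \<Longrightarrow> \<alpha> c \<in> carr (dual H)"
    and \<nu>: "lin N kfield \<nu>" and n: "n \<in> carr N"
  shows "left_coact_list H N C coact cs acc n (\<lambda>u m. u (prod_form C \<alpha>) * \<nu> m)
    = (\<Prod>c\<in>C - set cs. \<alpha> c (acc c)) * \<nu> (foldl (\<lambda>n c. lcontract H N (\<alpha> c) (coact c n)) n cs)"
  using coact cs n
proof (induction cs arbitrary: acc n)
  case Nil
  show ?case
    by (simp add: tens_apply[OF bilin_mult[OF lin_eval \<nu>]] ntens_prod_form \<alpha> dual_lin)
      (simp add: prod_form_def)
next
  case (Cons c cs)
  let ?F = "\<lambda>n. foldl (\<lambda>n c. lcontract H N (\<alpha> c) (coact c n)) n cs"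
  let ?K = "\<Prod>d\<in>C - set (c # cs). \<alpha> d (acc d)"
  let ?\<beta> = "\<lambda>a m. \<alpha> c a * (?K * \<nu> (?F m))"
  have c: "c \<in> C" "c \<notin> set cs" using Cons.prems by auto
  have ac: "lin H kfield (\<alpha> c)" using \<alpha>[OF c(1)] by (rule dual_lin)
  have b: "bilin (dual H) N N (\<lambda>\<alpha> n. lcontract H N \<alpha> (coact d n))" if "d \<in> set (c # cs)" for d
    by (rule bilin_lcontract[OF HH N Cons.prems(1)[OF that]])
  have F: "lin N N ?F"
    using Cons.prems(3) by (intro lin_foldl[where V = "dual H" and act = "\<lambda>c \<alpha> n. lcontract H N \<alpha> (coact
        c n)"] b \<alpha>) auto
  have F': "lin N kfield (\<lambda>m. ?K * \<nu> (?F m))" by (intro lin_cmult lin_comp[OF F \<nu>])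
  have cn: "coact c n \<in> carr (tensor H N)" by (rule lin_mem[OF Cons.prems(1) Cons.prems(4)]) simp
  have "left_coact_list H N C coact (c # cs) acc n (\<lambda>u m. u (prod_form C \<alpha>) * \<nu> m) = coact c n ?\<beta>"
    unfolding left_coact_list.simps
  proof (rule tlift_apply_eq[OF HH N cn bilin_mult[OF ac F']])
    fix a m assume "a \<in> carr H" "m \<in> carr N"
    then show "left_coact_list H N C coact cs (acc(c := a)) m (\<lambda>u m. u (prod_form C \<alpha>) * \<nu> m) = ?\<beta> a m"
      using Cons.prems by (subst Cons.IH) (auto simp: prod_upd[OF c] simp del: fun_upd_apply)
  qed
  also have "coact c n ?\<beta> = ?K * \<nu> (?F (lcontract H N (\<alpha> c) (coact c n)))"
    by (rule lcontract_functional[OF HH N cn ac F', symmetric])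
  finally show ?case by simp
qed

lemma right_coact_list_eval:
  assumes N: "vspace N" and coact: "\<And>c. c \<in> set cs \<Longrightarrow> lin N (tensor N H) (coact c)"
    and cs: "distinct cs" "set cs \<subseteq> C" and \<alpha>: "\<And>c. c \<in> C \<Longrightarrow> \<alpha> c \<in> carr (dual H)"
    and \<nu>: "lin N kfield \<nu>" and n: "n \<in> carr N"
  shows "right_coact_list H N C coact cs acc n (\<lambda>m u. \<nu> m * u (prod_form C \<alpha>))
    = \<nu> (foldl (\<lambda>n c. rcontract H N (\<alpha> c) (coact c n)) n cs) * (\<Prod>c\<in>C - set cs. \<alpha> c (acc c))"
  using coact cs n
proof (induction cs arbitrary: acc n)
  case Nil
  show ?case
    by (simp add: tens_apply[OF bilin_mult[OF \<nu> lin_eval]] ntens_prod_form \<alpha> dual_lin)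
      (simp add: prod_form_def)
next
  case (Cons c cs)
  let ?F = "\<lambda>n. foldl (\<lambda>n c. rcontract H N (\<alpha> c) (coact c n)) n cs"
  let ?K = "\<Prod>d\<in>C - set (c # cs). \<alpha> d (acc d)"
  let ?\<beta> = "\<lambda>m a. (\<nu> (?F m) * ?K) * \<alpha> c a"
  have c: "c \<in> C" "c \<notin> set cs" using Cons.prems by auto
  have ac: "lin H kfield (\<alpha> c)" using \<alpha>[OF c(1)] by (rule dual_lin)
  have b: "bilin (dual H) N N (\<lambda>\<alpha> n. rcontract H N \<alpha> (coact d n))" if "d \<in> set (c # cs)" for d
    by (rule bilin_rcontract[OF HH N Cons.prems(1)[OF that]])
  have F: "lin N N ?F"
    using Cons.prems(3) by (intro lin_foldl[where V = "dual H" and act = "\<lambda>c \<alpha> n. rcontract H N \<alpha> (coact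
        c n)"] b \<alpha>) auto
  have F': "lin N kfield (\<lambda>m. \<nu> (?F m) * ?K)" by (intro lin_multc lin_comp[OF F \<nu>])
  have cn: "coact c n \<in> carr (tensor N H)" by (rule lin_mem[OF Cons.prems(1) Cons.prems(4)]) simp
  have "right_coact_list H N C coact (c # cs) acc n (\<lambda>m u. \<nu> m * u (prod_form C \<alpha>)) = coact c n ?\<beta>"
    unfolding right_coact_list.simps
  proof (rule tlift_apply_eq[OF N HH cn bilin_mult[OF F' ac]])
    fix m a assume "m \<in> carr N" "a \<in> carr H"
    then show "right_coact_list H N C coact cs (acc(c := a)) m (\<lambda>m u. \<nu> m * u (prod_form C \<alpha>)) = ?\<beta> m a"
      using Cons.prems by (subst Cons.IH) (auto simp: prod_upd[OF c] mult_ac simp del: fun_upd_apply)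
  qed
  also have "coact c n ?\<beta> = \<nu> (?F (rcontract H N (\<alpha> c) (coact c n))) * ?K"
    by (rule rcontract_functional[OF HH N cn ac F', symmetric])
  finally show ?case by simp
qed

lemma
  assumes N: "vspace N" and coact: "\<And>c. c \<in> C \<Longrightarrow> lin N (tensor H N) (coact c)"
    and cs: "distinct cs" "set cs = C"
  shows left_assemble_coact_eval: "(\<And>c. c \<in> C \<Longrightarrow> \<alpha> c \<in> carr (dual H)) \<Longrightarrow> lin N kfield \<nu> \<Longrightarrow> n \<in> carr N \<Longrightarrow>
      left_assemble_coact H N cs coact n (\<lambda>u m. u (prod_form C \<alpha>) * \<nu> m)
        = \<nu> (foldr (\<lambda>c n. lcontract H N (\<alpha> c) (coact c n)) cs n)"
    and lin_left_assemble_coact: "lin N (tensor HC N) (left_assemble_coact H N cs coact)"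
proof -
  have ev: "left_assemble_coact H N cs coact n (\<lambda>u m. u (prod_form C \<alpha>) * \<nu> m)
        = \<nu> (foldr (\<lambda>c n. lcontract H N (\<alpha> c) (coact c n)) cs n)"
    if "\<And>c. c \<in> C \<Longrightarrow> \<alpha> c \<in> carr (dual H)" "lin N kfield \<nu>" "n \<in> carr N" for \<alpha> \<nu> n
    \<comment> \<open>\<open>left_assemble_coact\<close> runs through the reversed list, so the
      \<open>foldl\<close> of the recursion becomes a \<open>foldr\<close> over \<open>cs\<close>,
      in parallel with \<open>left_assemble_act\<close>.\<close>
    using left_coact_list_eval[of N "rev cs" coact \<alpha> \<nu> n] that N coact cs
    by (simp add: left_assemble_coact_def foldr_conv_foldl)
  then show "(\<And>c. c \<in> C \<Longrightarrow> \<alpha> c \<in> carr (dual H)) \<Longrightarrow> lin N kfield \<nu> \<Longrightarrow> n \<in> carr N \<Longrightarrow>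
      left_assemble_coact H N cs coact n (\<lambda>u m. u (prod_form C \<alpha>) * \<nu> m)
        = \<nu> (foldr (\<lambda>c n. lcontract H N (\<alpha> c) (coact c n)) cs n)" .
  show "lin N (tensor HC N) (left_assemble_coact H N cs coact)"
  proof (rule lin_by_sep[OF vspace_ntensor N _ N prod_evals_lin _ prod_evals_sep all_lin_sep[OF N]])
    show "left_assemble_coact H N cs coact x \<in> carr (tensor HC N)" if "x \<in> carr N" for x
      unfolding left_assemble_coact_def cs(2)
      using that cs by (intro left_coact_list_mem N coact) auto
    fix \<phi> :: "((('i \<Rightarrow> 'h) \<Rightarrow> 'k) \<Rightarrow> 'k) \<Rightarrow> 'k" and \<psi>
    assume \<phi>: "\<phi> \<in> prod_evals" and "\<psi> \<in> {\<psi>. lin N kfield \<psi>}"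
    then obtain \<alpha> where \<alpha>: "\<forall>c\<in>C. \<alpha> c \<in> carr (dual H)" "\<phi> = (\<lambda>u. u (prod_form C \<alpha>))" and \<psi>: "lin N
        kfield \<psi>"
      by (auto simp: prod_evals_def)
    have "lin N N (foldr (\<lambda>c. (\<lambda>c \<alpha> n. lcontract H N \<alpha> (coact c n)) c (\<alpha> c)) cs)"
      using cs \<alpha> by (intro lin_foldr[where V = "dual H"] bilin_lcontract HH N coact) auto
    then have "lin N kfield (\<lambda>n. \<psi> (foldr (\<lambda>c n. lcontract H N (\<alpha> c) (coact c n)) cs n))"
      by (rule lin_comp[OF _ \<psi>])
    then show "lin N kfield (\<lambda>x. left_assemble_coact H N cs coact x (\<lambda>v w. \<phi> v * \<psi> w))"
      unfolding \<alpha>(2) by (rule lin_cong[OF N, rotated]) (rule ev, use \<alpha> \<psi> in auto)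
  qed simp_all
qed

lemma
  assumes N: "vspace N" and coact: "\<And>c. c \<in> C \<Longrightarrow> lin N (tensor N H) (coact c)"
    and cs: "distinct cs" "set cs = C"
  shows right_assemble_coact_eval: "(\<And>c. c \<in> C \<Longrightarrow> \<alpha> c \<in> carr (dual H)) \<Longrightarrow> lin N kfield \<nu> \<Longrightarrow> n \<in> carr N \<Longrightarrow>
      right_assemble_coact H N cs coact n (\<lambda>m u. \<nu> m * u (prod_form C \<alpha>))
        = \<nu> (foldl (\<lambda>n c. rcontract H N (\<alpha> c) (coact c n)) n cs)"
    and lin_right_assemble_coact: "lin N (tensor N HC) (right_assemble_coact H N cs coact)"
proof -
  have ev: "right_assemble_coact H N cs coact n (\<lambda>m u. \<nu> m * u (prod_form C \<alpha>))
        = \<nu> (foldl (\<lambda>n c. rcontract H N (\<alpha> c) (coact c n)) n cs)"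
    if "\<And>c. c \<in> C \<Longrightarrow> \<alpha> c \<in> carr (dual H)" "lin N kfield \<nu>" "n \<in> carr N" for \<alpha> \<nu> n
    using right_coact_list_eval[of N cs coact \<alpha> \<nu> n] that N coact cs
    by (simp add: right_assemble_coact_def)
  then show "(\<And>c. c \<in> C \<Longrightarrow> \<alpha> c \<in> carr (dual H)) \<Longrightarrow> lin N kfield \<nu> \<Longrightarrow> n \<in> carr N \<Longrightarrow>
      right_assemble_coact H N cs coact n (\<lambda>m u. \<nu> m * u (prod_form C \<alpha>))
        = \<nu> (foldl (\<lambda>n c. rcontract H N (\<alpha> c) (coact c n)) n cs)" .
  show "lin N (tensor N HC) (right_assemble_coact H N cs coact)"
  proof (rule lin_by_sep[OF N vspace_ntensor _ N _ prod_evals_lin all_lin_sep[OF N] prod_evals_sep])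
    show "right_assemble_coact H N cs coact x \<in> carr (tensor N HC)" if "x \<in> carr N" for x
      unfolding right_assemble_coact_def cs(2)
      using that cs by (intro right_coact_list_mem N coact) auto
    fix \<phi> :: "((('i \<Rightarrow> 'h) \<Rightarrow> 'k) \<Rightarrow> 'k) \<Rightarrow> 'k" and \<psi>
    assume \<phi>: "\<phi> \<in> prod_evals" and "\<psi> \<in> {\<psi>. lin N kfield \<psi>}"
    then obtain \<alpha> where \<alpha>: "\<forall>c\<in>C. \<alpha> c \<in> carr (dual H)" "\<phi> = (\<lambda>u. u (prod_form C \<alpha>))" and \<psi>: "lin N
        kfield \<psi>"
      by (auto simp: prod_evals_def)
    have "lin N N (\<lambda>n. foldl (\<lambda>n c. (\<lambda>c \<alpha> n. rcontract H N \<alpha> (coact c n)) c (\<alpha> c) n) n cs)"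
      using cs \<alpha> by (intro lin_foldl[where V = "dual H"] bilin_rcontract HH N coact) auto
    then have "lin N kfield (\<lambda>n. \<psi> (foldl (\<lambda>n c. rcontract H N (\<alpha> c) (coact c n)) n cs))"
      by (rule lin_comp[OF _ \<psi>])
    then show "lin N kfield (\<lambda>x. right_assemble_coact H N cs coact x (\<lambda>v w. \<psi> v * \<phi> w))"
      unfolding \<alpha>(2) by (rule lin_cong[OF N, rotated]) (rule ev, use \<alpha> \<psi> in auto)
  qed simp_all
qed

end

section \<open>Modules and comodules over a tensor power\<close>

text \<open>Algebras and module-comodules are records extending \<open>kspace\<close>, while the
  tensor constructions see only \<open>carr\<close> and \<open>scl\<close>. These equations move
  between such a record and its underlying space.\<close>

lemma same_space:
  fixes V :: "('k::field, 'v::ab_group_add, 'y) kspace_scheme"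
    and V' :: "('k, 'v, 'y') kspace_scheme"
  assumes "carr V = carr V'" "scl V = scl V'"
  shows "lin V U = lin V' U" "lin U' V = lin U' V'"
    and "vspace V = vspace V'"
    and "tens V W = tens V' W" "tens W V = tens W V'"
    and "tensor V W = tensor V' W" "tensor W V = tensor W V'"
    and "tlift V W f = tlift V' W f" "tlift W V g = tlift W V' g"
    and "bilin V W U = bilin V' W U" "bilin W V U = bilin W V' U" "bilin W U' V = bilin W U' V'"
proof -
  show "lin V U = lin V' U" "lin U' V = lin U' V'" using assms by (auto simp: lin_def fun_eq_iff)
  show "vspace V = vspace V'" using assms by (simp add: vspace_def)
  have b: "bilin V W U = bilin V' W U" "bilin W V U = bilin W V' U" "bilin W U' V = bilin W U' V'" for W
      U U'
    using assms by (auto simp: bilin_def lin_def fun_eq_iff)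
  show "bilin V W U = bilin V' W U" "bilin W V U = bilin W V' U" "bilin W U' V = bilin W U' V'" by (rule
      b)+
  have "bilin V W kfield = bilin V' W kfield" "bilin W V kfield = bilin W V' kfield"
    using assms by (auto simp: bilin_def lin_def fun_eq_iff)
  then show t: "tens V W = tens V' W" "tens W V = tens W V'" by (auto simp: tens_def fun_eq_iff)
  show "tensor V W = tensor V' W" "tensor W V = tensor W V'" using t assms by (auto simp: tensor_def)
  show "tlift V W f = tlift V' W f" "tlift W V g = tlift W V' g" using t assms by (auto simp: tlift_def)
qed

lemma nlift_functional_eq:
  assumes "I \<noteq> {}" "vspace V" "vspace U" "t \<in> carr (ntensor I V)" "lin U kfield \<phi>"
    and "multilin I V kfield \<mu>" "\<And>v. v \<in> I \<rightarrow>\<^sub>E carr V \<Longrightarrow> f v \<in> carr U"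
    and "\<And>v. v \<in> I \<rightarrow>\<^sub>E carr V \<Longrightarrow> \<phi> (f v) = \<mu> v"
  shows "\<phi> (nlift I V f t) = t \<mu>"
proof -
  note r = nrep(1)[OF assms(1,2,4)]
  have "\<phi> (nlift I V f t) = sum_list (map (\<lambda>p. \<phi> (f p)) (nrep I V t))"
    unfolding nlift_nrep using r assms(7)
    by (intro lin_apply_sum_list[OF assms(3) vspace_kfield assms(5)]) auto
  also have "\<dots> = t \<mu>" unfolding ntensor_apply[OF assms(1,2,4,6)]
    using r assms(8) by (intro arg_cong[where f = sum_list] map_cong) auto
  finally show ?thesis .
qed

lemma nlift_apply_eq:
  assumes "I \<noteq> {}" "vspace V" "t \<in> carr (ntensor I V)" "multilin I V kfield \<mu>"
    and "\<And>v. v \<in> I \<rightarrow>\<^sub>E carr V \<Longrightarrow> f v x = \<mu> v"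
  shows "nlift I V f t x = t \<mu>"
  unfolding nlift_nrep sum_list_apply ntensor_apply[OF assms(1-4)] using nrep(1)[OF assms(1-3)] assms(5)
  by (intro arg_cong[where f = sum_list] map_cong) auto

lemma multilin_ntens_map:
  assumes f: "\<And>c. c \<in> I \<Longrightarrow> lin V V (f c)"
  shows "multilin I V (ntensor I V) (\<lambda>a. ntens I V (\<lambda>c. f c (a c)))"
proof (rule multilinI)
  have mem: "f c (a c) \<in> carr V" if "a \<in> I \<rightarrow>\<^sub>E carr V" "c \<in> I" for a c
    using that by (intro lin_mem[OF f]) auto
  show "ntens I V (\<lambda>c. f c (a c)) \<in> carr (ntensor I V)" if "a \<in> I \<rightarrow>\<^sub>E carr V" for a
    by (intro ntens_mem mem that)
  fix a i assume a: "a \<in> I \<rightarrow>\<^sub>E carr V" and i: "i \<in> I"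
  let ?b = "restrict (\<lambda>c. f c (a c)) I"
  have e: "ntens I V (\<lambda>c. f c ((a(i := x)) c)) = ntens I V (?b(i := f i x))" for x
    by (rule ntens_cong) auto
  have "?b \<in> I \<rightarrow>\<^sub>E carr V" using mem[OF a] by auto
  from lin_comp[OF f[OF i] multilin_lin[OF multilin_ntens this i]]
  show "lin V (ntensor I V) (\<lambda>x. ntens I V (\<lambda>c. f c ((a(i := x)) c)))" unfolding e .
qed

lemma carr_tensor_power [simp]: "carr (tensor_power H C) = carr (ntensor C H)"
  and scl_tensor_power [simp]: "scl (tensor_power H C) = fscl"
  by (simp_all add: tensor_power_def)

lemmas tensor_power_same =
  same_space[where V = "tensor_power H C" and V' = "ntensor C H" for H C, simplified]

lemma sweedler_family_mem:
  assumes U: "vspace U" and H: "vspace H" "lin H (tensor H H) (comult H)"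
  shows "(\<And>c. c \<in> set cs \<Longrightarrow> a c \<in> carr H) \<Longrightarrow>
    (\<And>p q. (\<And>c. c \<in> set cs \<Longrightarrow> p c \<in> carr H \<and> q c \<in> carr H) \<Longrightarrow> F p q \<in> carr U) \<Longrightarrow>
    sweedler_family H cs a F \<in> carr U"
proof (induction cs arbitrary: F)
  case (Cons c cs)
  show ?case
    unfolding sweedler_family.simps sw2_def
  proof (intro tlift_mem H U lin_mem[OF H(2)] Cons.prems(1) Cons.IH)
    fix u v p q assume "u \<in> carr H" "v \<in> carr H" "\<And>c. c \<in> set cs \<Longrightarrow> p c \<in> carr H \<and> q c \<in> carr H"
    then show "F (p(c := u)) (q(c := v)) \<in> carr U" by (intro Cons.prems(2)) auto
  qed simp_all
qed simp

text \<open>In each recursive call \<open>F\<close> is replaced by a function with updated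
  arguments; \<open>\<kappa>\<close> collects the factors of the indices already split.\<close>

lemma sweedler_family_eval:
  assumes H: "vspace H" "lin H (tensor H H) (comult H)"
    and lin: "\<And>c. c \<in> set cs \<Longrightarrow> lin H kfield (f c)" "\<And>c. c \<in> set cs \<Longrightarrow> lin H kfield (g c)"
    and a: "\<And>c. c \<in> set cs \<Longrightarrow> a c \<in> carr H" and cs: "distinct cs"
    and F: "\<And>p q. F p q \<beta> = (\<Prod>c\<in>set cs. f c (p c) * g c (q c)) * \<kappa>"
  shows "sweedler_family H cs a F \<beta> = (\<Prod>c\<in>set cs. comult H (a c) (\<lambda>u v. f c u * g c v)) * \<kappa>"
  using lin a cs F
proof (induction cs arbitrary: F \<kappa>)
  case (Cons c cs)
  let ?K = "\<Prod>d\<in>set cs. comult H (a d) (\<lambda>u v. f d u * g d v)"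
  have lc: "lin H kfield (f c)" "lin H kfield (g c)" and ac: "comult H (a c) \<in> carr (tensor H H)"
    using Cons.prems lin_mem[OF H(2)] by auto
  have b: "bilin H H kfield (\<lambda>u v. (?K * \<kappa>) * (f c u * g c v))" by (intro bilin_cmult bilin_mult lc)
  have c: "c \<notin> set cs" using Cons.prems by simp
  have "sweedler_family H (c # cs) a F \<beta> = comult H (a c) (\<lambda>u v. (?K * \<kappa>) * (f c u * g c v))"
    unfolding sweedler_family.simps sw2_def
  proof (rule tlift_apply_eq[OF H(1,1) ac b])
    fix u v assume "u \<in> carr H" "v \<in> carr H"
    have "sweedler_family H cs a (\<lambda>p q. F (p(c := u)) (q(c := v))) \<beta> = ?K * (f c u * g c v * \<kappa>)"
    proof (rule Cons.IH)
      fix p q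
      have "(\<Prod>d\<in>set cs. f d ((p(c := u)) d) * g d ((q(c := v)) d)) = (\<Prod>d\<in>set cs. f d (p d) * g d (q d))"
        using c by (intro prod.cong) auto
      then show "F (p(c := u)) (q(c := v)) \<beta> = (\<Prod>d\<in>set cs. f d (p d) * g d (q d)) * (f c u * g c v * \<kappa>)"
        using c by (simp add: Cons.prems(5) mult_ac)
    qed (use Cons.prems in auto)
    then show "sweedler_family H cs a (\<lambda>p q. F (p(c := u)) (q(c := v))) \<beta> = (?K * \<kappa>) * (f c u * g c v)"
      by (simp add: mult_ac)
  qed
  also have "\<dots> = (?K * \<kappa>) * comult H (a c) (\<lambda>u v. f c u * g c v)"
    by (simp add: tensor_apply[OF H(1) ac b] tensor_apply[OF H(1) ac bilin_mult[OF lc]] split_def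
        sum_list_const_mult)
  finally show ?case using c by (simp add: mult_ac)
qed (simp add: assms)

section \<open>Hopf algebra structure on a tensor power\<close>

locale hopf_powers = powers H C
  for H :: "('k::field, 'h::ab_group_add) khopf" and C :: "'i set" +
  assumes hopf: "hopf_algebra H"
begin

sublocale fd_algebra H
  using hopf fdH by unfold_locales (auto simp: hopf_algebra_def)

abbreviation "A \<equiv> tensor_power H C"

lemma coalgH: "is_coalgebra H" and one_mem: "aone H \<in> carr H"
  and one_mult: "a \<in> carr H \<Longrightarrow> amult H (aone H) a = a" "a \<in> carr H \<Longrightarrow> amult H a (aone H) = a"
  using hopf by (auto simp: hopf_algebra_def is_algebra_def)

lemma comult_lin: "lin H (tensor H H) (comult H)" and counit_lin: "lin H kfield (counit H)"
  using coalgH by (auto simp: is_coalgebra_def)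

lemma comult_counit:
  assumes h: "h \<in> carr H" and \<alpha>: "lin H kfield \<alpha>"
  shows "comult H h (\<lambda>u v. counit H u * \<alpha> v) = \<alpha> h" "comult H h (\<lambda>u v. \<alpha> u * counit H v) = \<alpha> h"
proof -
  have c: "comult H h \<in> carr (tensor H H)" by (rule lin_mem[OF comult_lin h])
  have e: "sw2 H h (\<lambda>a b. scl H (counit H a) b) = h" "sw2 H h (\<lambda>a b. scl H (counit H b) a) = h"
    using coalgH h by (auto simp: is_coalgebra_def)
  have "\<alpha> (sw2 H h (\<lambda>a b. scl H (counit H a) b)) = comult H h (\<lambda>u v. counit H u * \<alpha> v)"
    using lcontract_functional[OF HH HH c counit_lin \<alpha>] by (simp add: sw2_def lcontract_def)
  then show "comult H h (\<lambda>u v. counit H u * \<alpha> v) = \<alpha> h" by (simp add: e)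
  have "\<alpha> (sw2 H h (\<lambda>a b. scl H (counit H b) a)) = comult H h (\<lambda>u v. \<alpha> u * counit H v)"
    using rcontract_functional[OF HH HH c counit_lin \<alpha>] by (simp add: sw2_def rcontract_def)
  then show "comult H h (\<lambda>u v. \<alpha> u * counit H v) = \<alpha> h" by (simp add: e)
qed

lemma amult_ntens:
  assumes p: "\<And>c. c \<in> C \<Longrightarrow> p c \<in> carr H" and q: "\<And>c. c \<in> C \<Longrightarrow> q c \<in> carr H"
  shows "amult A (ntens C H p) (ntens C H q) = ntens C H (\<lambda>c. amult H (p c) (q c))"
proof -
  have m1: "multilin C H HC (\<lambda>b. ntens C H (\<lambda>c. amult H (a c) (b c)))" if "\<And>c. c \<in> C \<Longrightarrow> a c \<in> carr H" for
      a
    by (rule multilin_ntens_map[where f = "\<lambda>c. amult H (a c)"]) (rule bilin_right[OF bilin_mult_H that])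
  have m2: "multilin C H HC (\<lambda>a. ntens C H (\<lambda>c. amult H (a c) (b c)))" if "b \<in> C \<rightarrow>\<^sub>E carr H" for b
    using that by (intro multilin_ntens_map[where f = "\<lambda>c x. amult H x (b c)"] bilin_left[OF
        bilin_mult_H]) auto
  have m3: "multilin C H HC (\<lambda>a. nlift C H (\<lambda>b. ntens C H (\<lambda>c. amult H (a c) (b c))) t)"
    if "t \<in> carr HC" for t
    unfolding nlift_nrep using nrep(1)[OF C(2) HH that] by (intro multilin_sum_list m2) auto
  have "amult A (ntens C H p) (ntens C H q)
      = nlift C H (\<lambda>b. ntens C H (\<lambda>c. amult H ((restrict p C) c) (b c))) (ntens C H q)"
    unfolding tensor_power_def using nlift_ntens[OF HH vspace_ntensor m3[OF ntens_mem[OF q]] C(2) p] by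
        simp
  also have "\<dots> = ntens C H (\<lambda>c. amult H ((restrict p C) c) ((restrict q C) c))"
    using nlift_ntens[OF HH vspace_ntensor m1 C(2) q, of "restrict p C"] p by simp
  also have "\<dots> = ntens C H (\<lambda>c. amult H (p c) (q c))" by (rule ntens_cong) simp
  finally show ?thesis .
qed

lemma factor_proj_functional:
  assumes c: "c \<in> C" and \<alpha>: "lin H kfield \<alpha>" and u: "u \<in> carr HC"
  shows "\<alpha> (factor_proj H C c u) = u (prod_form C ((\<lambda>_. counit H)(c := \<alpha>)))"
  unfolding factor_proj_def
proof (rule nlift_functional_eq[OF C(2) HH HH u \<alpha>])
  show "multilin C H kfield (prod_form C ((\<lambda>_. counit H)(c := \<alpha>)))"
    by (rule multilin_prod_form) (simp add: counit_lin \<alpha>)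
  fix a assume a: "a \<in> C \<rightarrow>\<^sub>E carr H"
  then have ac: "a c \<in> carr H" using c by auto
  show "scl H (\<Prod>d\<in>C - {c}. counit H (a d)) (a c) \<in> carr H" by (rule vspace_scl[OF HH ac])
  have "prod_form C ((\<lambda>_. counit H)(c := \<alpha>)) a = \<alpha> (a c) * (\<Prod>d\<in>C - {c}. counit H (a d))"
    unfolding prod_form_def by (subst prod.remove[OF C(1) c]) (auto intro!: prod.cong)
  then show "\<alpha> (scl H (\<Prod>d\<in>C - {c}. counit H (a d)) (a c)) = prod_form C ((\<lambda>_. counit H)(c := \<alpha>)) a"
    by (simp add: lin_kfield_scl[OF \<alpha> ac])
qed

lemma factor_proj_mem: "c \<in> C \<Longrightarrow> u \<in> carr HC \<Longrightarrow> factor_proj H C c u \<in> carr H"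
  unfolding factor_proj_def by (rule nlift_mem[OF C(2) HH HH]) (auto intro: vspace_scl[OF HH])

text \<open>The assumption on \<open>k\<close> makes it the factorwise convolution of
  \<open>f\<close> and \<open>g\<close>: in the algebra dual to a tensor power, product functionals
  multiply factor by factor.\<close>

lemma
  assumes u: "u \<in> carr HC"
  shows comult_A_mem: "comult A u \<in> carr (tensor HC HC)"
    and comult_A_eval: "(\<And>c. c \<in> C \<Longrightarrow> lin H kfield (f c)) \<Longrightarrow> (\<And>c. c \<in> C \<Longrightarrow> lin H kfield (g c)) \<Longrightarrow>
      (\<And>c. c \<in> C \<Longrightarrow> lin H kfield (k c)) \<Longrightarrow>
      (\<And>c h. c \<in> C \<Longrightarrow> h \<in> carr H \<Longrightarrow> comult H h (\<lambda>u v. f c u * g c v) = k c h) \<Longrightarrow>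
      comult A u (\<lambda>s t. s (prod_form C f) * t (prod_form C g)) = u (prod_form C k)"
proof -
  \<comment> \<open>The list over which the coproduct of the tensor power is defined; all that
    enters below is that it enumerates \<open>C\<close> without repetition.\<close>
  define ls where "ls = (SOME cs. distinct cs \<and> set cs = C)"
  have "\<exists>cs. distinct cs \<and> set cs = C" using finite_distinct_list[OF C(1)] by auto
  then have ls: "distinct ls" "set ls = C" unfolding ls_def by (metis (mono_tags, lifting) someI_ex)+
  have cm: "comult A u = nlift C H (\<lambda>a. sweedler_family H ls a
      (\<lambda>p q. tens HC HC (ntens C H p) (ntens C H q))) u"
    by (simp add: tensor_power_def ls_def)
  show "comult A u \<in> carr (tensor HC HC)"
    unfolding cm by (rule nlift_mem[OF C(2) HH vspace_tensor u], rule sweedler_family_mem[OF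
        vspace_tensor HH comult_lin])
      (auto simp: ls intro!: tens_mem ntens_mem)
  assume f: "\<And>c. c \<in> C \<Longrightarrow> lin H kfield (f c)" and g: "\<And>c. c \<in> C \<Longrightarrow> lin H kfield (g c)"
    and k: "\<And>c. c \<in> C \<Longrightarrow> lin H kfield (k c)"
      "\<And>c h. c \<in> C \<Longrightarrow> h \<in> carr H \<Longrightarrow> comult H h (\<lambda>u v. f c u * g c v) = k c h"
  show "comult A u (\<lambda>s t. s (prod_form C f) * t (prod_form C g)) = u (prod_form C k)"
    unfolding cm
  proof (rule nlift_apply_eq[OF C(2) HH u multilin_prod_form[OF k(1)]])
    fix a assume a: "a \<in> C \<rightarrow>\<^sub>E carr H"
    have "sweedler_family H ls a (\<lambda>p q. tens HC HC (ntens C H p) (ntens C H q))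
         (\<lambda>s t. s (prod_form C f) * t (prod_form C g))
       = (\<Prod>c\<in>set ls. comult H (a c) (\<lambda>u v. f c u * g c v)) * 1"
    proof (rule sweedler_family_eval[OF HH comult_lin])
      fix p q
      show "tens HC HC (ntens C H p) (ntens C H q) (\<lambda>s t. s (prod_form C f) * t (prod_form C g))
          = (\<Prod>c\<in>set ls. f c (p c) * g c (q c)) * 1"
        by (simp add: tens_apply[OF bilin_mult[OF lin_eval lin_eval]] ntens_prod_form f g ls)
          (simp add: prod_form_def prod.distrib)
    qed (use a f g ls in auto)
    also have "\<dots> = prod_form C k a" using a k(2) by (auto simp: prod_form_def ls intro!: prod.cong)
    finally show "sweedler_family H ls a (\<lambda>p q. tens HC HC (ntens C H p) (ntens C H q))
         (\<lambda>s t. s (prod_form C f) * t (prod_form C g)) = prod_form C k a" .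
  qed
qed

end

section \<open>Single factors of a module-comodule over a tensor power\<close>

locale tensor_power_modcomod = hopf_powers H C
  for H :: "('k::field, 'h::ab_group_add) khopf" and C :: "'i set" +
  fixes X :: "('k, 'x::ab_group_add, (('i \<Rightarrow> 'h) \<Rightarrow> 'k) \<Rightarrow> 'k, (('i \<Rightarrow> 'h) \<Rightarrow> 'k) \<Rightarrow> 'k) right_modcomod"
  assumes X: "right_module_comodule A X"
begin

lemma XV: "vspace X" and bilin_ract: "bilin X HC X (ract X)"
  and ract_mult: "\<And>a b x. a \<in> carr HC \<Longrightarrow> b \<in> carr HC \<Longrightarrow> x \<in> carr X \<Longrightarrow>
    ract X x (amult A a b) = ract X (ract X x a) b"
  and ract_one: "x \<in> carr X \<Longrightarrow> ract X x (ntens C H (\<lambda>_. aone H)) = x"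
  and lin_rcoact: "lin X (tensor X HC) (rcoact X)"
  using X unfolding right_module_comodule_def right_module_def right_comodule_def
  by (simp_all add: tensor_power_same) (simp_all add: tensor_power_def)

text \<open>The elements acting one after another have \<open>aone H\<close> at all places but their
  own. As the indices are distinct, no two of them meet at a place with entries other than
  \<open>aone H\<close>, and their product is a pure tensor.\<close>

lemma foldl_factor_ract:
  assumes "distinct cs" "set cs \<subseteq> C" "\<And>c. c \<in> set cs \<Longrightarrow> a c \<in> carr H" "x \<in> carr X"
  shows "foldl (\<lambda>x c. factor_ract H C X c x (a c)) x cs
    = ract X x (ntens C H (\<lambda>c. if c \<in> set cs then a c else aone H))"
  using assms
proof (induction cs rule: rev_induct)
  case (snoc c cs)
  let ?p = "\<lambda>cs c. if c \<in> set cs then a c else aone H"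
  have m: "?p cs d \<in> carr H" "((\<lambda>_. aone H)(c := a c)) d \<in> carr H" for d
    using snoc.prems one_mem by auto
  have "foldl (\<lambda>x c. factor_ract H C X c x (a c)) x (cs @ [c])
      = ract X (ract X x (ntens C H (?p cs))) (ntens C H ((\<lambda>_. aone H)(c := a c)))"
    using snoc by (simp add: factor_ract_def factor_incl_def)
  also have "\<dots> = ract X x (ntens C H (\<lambda>d. amult H (?p cs d) (((\<lambda>_. aone H)(c := a c)) d)))"
    using m snoc.prems by (simp add: ract_mult[symmetric] ntens_mem amult_ntens del: fun_upd_apply)
  also have "ntens C H (\<lambda>d. amult H (?p cs d) (((\<lambda>_. aone H)(c := a c)) d)) = ntens C H (?p (cs @ [c]))"
    using snoc.prems one_mem one_mult by (intro ntens_cong) auto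
  finally show ?case .
qed (simp add: ract_one)

lemma bilin_factor_ract:
  assumes c: "c \<in> C"
  shows "bilin H X X (\<lambda>h x. factor_ract H C X c x h)"
proof -
  have "lin H HC (\<lambda>h. ntens C H ((\<lambda>_. aone H)(c := h)))"
  proof -
    have "ntens C H ((\<lambda>_. aone H)(c := h)) = ntens C H ((restrict (\<lambda>_. aone H) C)(c := h))" for h
      by (rule ntens_cong) auto
    moreover have "restrict (\<lambda>_. aone H) C \<in> C \<rightarrow>\<^sub>E carr H" using one_mem by auto
    ultimately show ?thesis using multilin_lin[OF multilin_ntens _ c, of "restrict (\<lambda>_. aone H) C" H] by
        simp
  qed
  from bilin_comp2[OF bilin_ract lin_id this] show ?thesis
    by (simp add: factor_ract_def factor_incl_def bilin_def)
qed

text \<open>The product functional with components \<open>f c\<close>, acting through the coaction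
  of the whole tensor power.\<close>

definition contr :: "('i \<Rightarrow> 'h \<Rightarrow> 'k) \<Rightarrow> 'x \<Rightarrow> 'x" where
  "contr f x = rcontract HC X (\<lambda>u. u (prod_form C f)) (rcoact X x)"

lemma rcoact_mem: "x \<in> carr X \<Longrightarrow> rcoact X x \<in> carr (tensor X HC)"
  by (rule lin_mem[OF lin_rcoact])

lemma contr_mem: "x \<in> carr X \<Longrightarrow> contr f x \<in> carr X"
  unfolding contr_def by (rule rcontract_mem[OF vspace_ntensor XV rcoact_mem])

lemma contr_functional:
  "x \<in> carr X \<Longrightarrow> lin X kfield \<phi> \<Longrightarrow> \<phi> (contr f x) = rcoact X x (\<lambda>x0 u. \<phi> x0 * u (prod_form C f))"
  unfolding contr_def by (rule rcontract_functional[OF vspace_ntensor XV rcoact_mem lin_eval]) simp_all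

lemma contr_cong:
  assumes "\<And>c h. c \<in> C \<Longrightarrow> h \<in> carr H \<Longrightarrow> f c h = g c h" "\<And>c. c \<in> C \<Longrightarrow> lin H kfield (g c)" "x \<in> carr X"
  shows "contr f x = contr g x"
  unfolding contr_def rcontract_def
proof (intro tlift_cong XV rcoact_mem assms)
  fix x0 u assume "u \<in> carr HC"
  then have "u (prod_form C f) = u (prod_form C g)"
    by (rule ntensor_cong[OF C(2) HH _ multilin_prod_form[OF assms(2)]])
      (auto simp: prod_form_def intro!: prod.cong assms(1))
  then show "scl X (u (prod_form C f)) x0 = scl X (u (prod_form C g)) x0" by simp
qed

lemma contr_counit: "x \<in> carr X \<Longrightarrow> contr (\<lambda>_. counit H) x = x"
proof -
  assume x: "x \<in> carr X"
  have "counit A u = u (prod_form C (\<lambda>_. counit H))" if "u \<in> carr HC" for u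
    using nlift_kfield[OF C(2) HH that multilin_prod_form[of "\<lambda>_. counit H"]] counit_lin
    by (simp add: tensor_power_def prod_form_def[abs_def])
  then have "contr (\<lambda>_. counit H) x = tlift X HC (\<lambda>n0 c. scl X (counit A c) n0) (rcoact X x)"
    unfolding contr_def rcontract_def by (intro tlift_cong XV rcoact_mem x) simp
  also have "\<dots> = x"
    using X x unfolding right_module_comodule_def right_comodule_def by (simp add: tensor_power_same)
  finally show ?thesis .
qed

text \<open>\<open>k\<close> is the convolution of \<open>f\<close> and \<open>g\<close>, and the
  claim is coassociativity of the coaction evaluated at the form \<open>?\<gamma>\<close>. The
  functional applied second takes the first leg because the coaction is a right one.\<close>

lemma contr_contr:
  assumes x: "x \<in> carr X" and f: "\<And>c. c \<in> C \<Longrightarrow> lin H kfield (f c)" and g: "\<And>c. c \<in> C \<Longrightarrow> lin H kfield (g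
      c)"
    and k: "\<And>c. c \<in> C \<Longrightarrow> lin H kfield (k c)"
      "\<And>c h. c \<in> C \<Longrightarrow> h \<in> carr H \<Longrightarrow> comult H h (\<lambda>u v. f c u * g c v) = k c h"
  shows "contr f (contr g x) = contr k x"
proof (rule functional_eqI[OF XV])
  fix \<phi> assume \<phi>: "lin X kfield \<phi>"
  let ?\<gamma> = "\<lambda>x d c. \<phi> x * (d (prod_form C f) * c (prod_form C g))"
  let ?\<theta> = "\<lambda>u t. t (?\<gamma> u)"
  have ev: "lin HC kfield (\<lambda>u. u \<mu>)" for \<mu> by (rule lin_eval) simp
  have \<gamma>: "trilin X HC HC ?\<gamma>"
    by (intro trilinI lin_multc[OF \<phi>] lin_cmult lin_multc ev)
  note t3 = tens3_apply[OF \<gamma> XV vspace_ntensor]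
  have chi: "lin X kfield (\<lambda>y. rcoact X y (\<lambda>x1 d. \<phi> x1 * d (prod_form C f)))"
    by (rule lin_apply[OF lin_rcoact]) simp
  have coassoc: "tlift X HC (\<lambda>n0 c. tlift HC HC (\<lambda>c1 c2. tens3 X HC HC n0 c1 c2) (comult A c)) (rcoact X
      x) ?\<theta>
      = tlift X HC (\<lambda>n0 c. tlift X HC (\<lambda>n1 d. tens3 X HC HC n1 d c) (rcoact X n0)) (rcoact X x) ?\<theta>"
    using X x unfolding right_module_comodule_def right_comodule_def
    by (simp add: tensor_power_same tens3_def[abs_def] sw2_def)
  have L: "tlift X HC (\<lambda>n0 c. tlift HC HC (\<lambda>c1 c2. tens3 X HC HC n0 c1 c2) (comult A c)) (rcoact X x) ?\<theta>
      = rcoact X x (\<lambda>x0 c. \<phi> x0 * c (prod_form C k))"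
  proof (rule tlift_apply_eq[OF XV vspace_ntensor rcoact_mem[OF x] bilin_mult[OF \<phi> ev]])
    fix n0 c assume n0: "n0 \<in> carr X" and c: "c \<in> carr HC"
    have "tlift HC HC (\<lambda>c1 c2. tens3 X HC HC n0 c1 c2) (comult A c) ?\<theta> = comult A c (?\<gamma> n0)"
      by (rule tlift_apply_eq[OF vspace_ntensor vspace_ntensor comult_A_mem[OF c] trilin_bilin[OF \<gamma>
          n0]])
        (rule t3[OF n0])
    also have "\<dots> = \<phi> n0 * comult A c (\<lambda>c1 c2. c1 (prod_form C f) * c2 (prod_form C g))"
      by (simp add: tensor_apply[OF vspace_ntensor comult_A_mem[OF c] trilin_bilin[OF \<gamma> n0]]
        tensor_apply[OF vspace_ntensor comult_A_mem[OF c] bilin_mult[OF ev ev]] split_def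
            sum_list_const_mult)
    also have "\<dots> = \<phi> n0 * c (prod_form C k)"
      using comult_A_eval[OF c f g k] by simp
    finally show "tlift HC HC (\<lambda>c1 c2. tens3 X HC HC n0 c1 c2) (comult A c) ?\<theta> = \<phi> n0 * c (prod_form C
        k)" .
  qed
  let ?\<chi> = "\<lambda>y. rcoact X y (\<lambda>x1 d. \<phi> x1 * d (prod_form C f))"
  have R: "tlift X HC (\<lambda>n0 c. tlift X HC (\<lambda>n1 d. tens3 X HC HC n1 d c) (rcoact X n0)) (rcoact X x) ?\<theta>
      = rcoact X x (\<lambda>x0 c. ?\<chi> x0 * c (prod_form C g))"
  proof (rule tlift_apply_eq[OF XV vspace_ntensor rcoact_mem[OF x] bilin_mult[OF chi ev]])
    fix n0 c assume n0: "n0 \<in> carr X" and c: "c \<in> carr HC"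
    note b = bilin_cmult[OF bilin_mult[OF \<phi> ev], of "c (prod_form C g)" "prod_form C f"]
    have "tlift X HC (\<lambda>n1 d. tens3 X HC HC n1 d c) (rcoact X n0) ?\<theta>
        = rcoact X n0 (\<lambda>x1 d. c (prod_form C g) * (\<phi> x1 * d (prod_form C f)))"
      by (rule tlift_apply_eq[OF XV vspace_ntensor rcoact_mem[OF n0] b]) (simp add: t3 mult_ac)
    also have "\<dots> = c (prod_form C g) * ?\<chi> n0"
      by (simp add: tensor_apply[OF XV rcoact_mem[OF n0] b] tensor_apply[OF XV rcoact_mem[OF n0]
          bilin_mult[OF \<phi> ev]]
        split_def sum_list_const_mult)
    finally show "tlift X HC (\<lambda>n1 d. tens3 X HC HC n1 d c) (rcoact X n0) ?\<theta> = ?\<chi> n0 * c (prod_form C g)"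
      by (simp add: mult.commute)
  qed
  have "\<phi> (contr f (contr g x)) = ?\<chi> (contr g x)" by (rule contr_functional[OF contr_mem[OF x] \<phi>])
  also have "\<dots> = rcoact X x (\<lambda>x0 c. ?\<chi> x0 * c (prod_form C g))" by (rule contr_functional[OF x chi])
  also have "\<dots> = rcoact X x (\<lambda>x0 c. \<phi> x0 * c (prod_form C k))" using coassoc unfolding L R by simp
  also have "\<dots> = \<phi> (contr k x)" by (rule contr_functional[OF x \<phi>, symmetric])
  finally show "\<phi> (contr f (contr g x)) = \<phi> (contr k x)" .
qed (intro contr_mem x)+

lemma factor_rcoact_mem: "c \<in> C \<Longrightarrow> x \<in> carr X \<Longrightarrow> factor_rcoact H C X c x \<in> carr (tensor X H)"
  unfolding factor_rcoact_def by (intro tlift_mem XV rcoact_mem vspace_tensor tens_mem factor_proj_mem)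

lemma factor_rcoact_eval:
  assumes c: "c \<in> C" and x: "x \<in> carr X" and \<phi>: "lin X kfield \<phi>" and \<alpha>: "lin H kfield \<alpha>"
  shows "factor_rcoact H C X c x (\<lambda>x0 a. \<phi> x0 * \<alpha> a) = \<phi> (contr ((\<lambda>_. counit H)(c := \<alpha>)) x)"
  unfolding factor_rcoact_def contr_functional[OF x \<phi>]
  by (rule tlift_apply_eq[OF XV vspace_ntensor rcoact_mem[OF x] bilin_mult[OF \<phi> lin_eval]])
    (simp_all add: tens_apply[OF bilin_mult[OF \<phi> \<alpha>]] factor_proj_functional c \<alpha>)

lemma lin_contr: "lin X X (contr f)"
  unfolding contr_def rcontract_def
  by (intro lin_comp[OF lin_rcoact tensor_universal(1)] XV vspace_ntensor bilin_rcontract_form lin_eval)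
      simp

lemma lin_factor_rcoact: "c \<in> C \<Longrightarrow> lin X (tensor X H) (factor_rcoact H C X c)"
proof (rule lin_by_sep[OF XV HH factor_rcoact_mem XV, where \<Phi> = "{\<phi>. lin X kfield \<phi>}" and \<Psi> = "{\<phi>. lin H
    kfield \<phi>}"])
  fix \<phi> \<psi> assume "c \<in> C" "\<phi> \<in> {\<phi>. lin X kfield \<phi>}" "\<psi> \<in> {\<phi>. lin H kfield \<phi>}"
  then show "lin X kfield (\<lambda>x. factor_rcoact H C X c x (\<lambda>v w. \<phi> v * \<psi> w))"
    by (intro lin_cong[OF XV factor_rcoact_eval lin_comp[OF lin_contr]]) auto
qed (auto intro: functional_sep[OF XV] functional_sep[OF HH])

lemma rcontract_factor_rcoact:
  assumes c: "c \<in> C" and x: "x \<in> carr X" and \<alpha>: "lin H kfield \<alpha>"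
  shows "rcontract H X \<alpha> (factor_rcoact H C X c x) = contr ((\<lambda>_. counit H)(c := \<alpha>)) x"
  by (rule functional_eqI[OF XV])
    (simp_all add: rcontract_functional[OF HH XV factor_rcoact_mem[OF c x] \<alpha>] factor_rcoact_eval c x \<alpha>
      rcontract_mem[OF HH XV factor_rcoact_mem] contr_mem)

text \<open>At each place one of the two functionals being convolved is the counit, so contracting
  along distinct indices fills in the components one at a time.\<close>

lemma foldl_factor_rcoact:
  assumes "distinct cs" "set cs \<subseteq> C" "\<And>c. c \<in> set cs \<Longrightarrow> lin H kfield (\<alpha> c)" "x \<in> carr X"
  shows "foldl (\<lambda>x c. rcontract H X (\<alpha> c) (factor_rcoact H C X c x)) x cs
    = contr (\<lambda>c. if c \<in> set cs then \<alpha> c else counit H) x"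
  using assms
proof (induction cs rule: rev_induct)
  case (snoc c cs)
  let ?p = "\<lambda>cs c. if c \<in> set cs then \<alpha> c else counit H"
  have "foldl (\<lambda>x c. rcontract H X (\<alpha> c) (factor_rcoact H C X c x)) x (cs @ [c])
      = contr ((\<lambda>_. counit H)(c := \<alpha> c)) (contr (?p cs) x)"
    using snoc by (simp add: rcontract_factor_rcoact contr_mem)
  also have "\<dots> = contr (?p (cs @ [c])) x"
    using snoc.prems by (intro contr_contr) (auto simp: counit_lin comult_counit)
  finally show ?case .
qed (simp add: contr_counit)

end

section \<open>Cycles of the connected sum\<close>

text \<open>Describes the lists \<open>support f x\<close> of a permutation without powers of
  \<open>f\<close>: applying \<open>f\<close> rotates the list. In this form two cycles can be
  concatenated directly.\<close>

definition cyclic_list :: "('a \<Rightarrow> 'a) \<Rightarrow> 'a list \<Rightarrow> bool" where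
  "cyclic_list f xs \<longleftrightarrow> xs \<noteq> [] \<and> distinct xs \<and> map f xs = tl xs @ [hd xs]"

lemma cyclic_listI:
  "distinct (xs @ [x]) \<Longrightarrow> map f xs = tl (xs @ [x]) \<Longrightarrow> f x = hd (xs @ [x]) \<Longrightarrow> cyclic_list f (xs @ [x])"
  by (simp add: cyclic_list_def)

lemma cyclic_list_snoc:
  "cyclic_list f (xs @ [x]) \<longleftrightarrow> distinct (xs @ [x]) \<and> map f xs = tl (xs @ [x]) \<and> f x = hd (xs @ [x])"
  by (auto simp: cyclic_list_def)

lemma cyclic_list_support:
  assumes p: "permutation p"
  shows "cyclic_list p (support p x)" "hd (support p x) = x" "set (support p x) = orbit p x"
proof -
  note l = least_power_of_permutation[OF p, of x]
  obtain n where n: "least_power p x = Suc n" using l(2) by (cases "least_power p x") auto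
  show "hd (support p x) = x" using l(2) by (simp add: hd_map)
  have pn: "p ((p ^^ n) x) = x" using l(1) by (simp add: n)
  have d: "distinct (support p x)" by (rule cycle_of_permutation[OF p])
  have s: "support p x = map (\<lambda>i. (p ^^ i) x) [0..<n] @ [(p ^^ n) x]" by (simp add: n)
  have "map p (map (\<lambda>i. (p ^^ i) x) [0..<n]) = tl (map (\<lambda>i. (p ^^ i) x) [0..<Suc n])"
  proof -
    have "[0..<Suc n] = 0 # map Suc [0..<n]" by (simp add: upt_conv_Cons map_Suc_upt del: upt_Suc)
    then show ?thesis by (simp del: upt_Suc)
  qed
  then show "cyclic_list p (support p x)"
    using d pn unfolding s by (intro cyclic_listI) (auto simp: hd_append hd_map)
  show "set (support p x) = orbit p x"
    unfolding support_set[OF p] orbit_altdef_permutation[OF p] by auto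
qed

text \<open>The list gives the first powers of \<open>f\<close> at its head, and by distinctness its
  length is the least positive power that returns there.\<close>

lemma support_cyclic_list:
  assumes xs: "cyclic_list f xs"
  shows "support f (hd xs) = xs"
proof -
  have ne: "xs \<noteq> []" "distinct xs" and m: "map f xs = tl xs @ [hd xs]" using xs by (auto simp:
      cyclic_list_def)
  have nth: "f (xs ! i) = (if Suc i < length xs then xs ! Suc i else hd xs)" if "i < length xs" for i
  proof -
    have "f (xs ! i) = (tl xs @ [hd xs]) ! i" using m that by (metis nth_map)
    then show ?thesis using that by (auto simp: nth_append nth_tl)
  qed
  have pow: "(f ^^ i) (hd xs) = xs ! i" if "i < length xs" for i
    using that by (induction i) (use ne in \<open>auto simp: hd_conv_nth nth\<close>)
  have top: "(f ^^ length xs) (hd xs) = hd xs"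
  proof -
    obtain n where n: "length xs = Suc n" using ne by (cases xs) auto
    then show ?thesis using pow[of n] nth[of n] by simp
  qed
  have "least_power f (hd xs) = length xs"
    unfolding least_power_def
  proof (rule Least_equality)
    fix i assume i: "(f ^^ i) (hd xs) = hd xs \<and> 0 < i"
    show "length xs \<le> i"
    proof (rule ccontr)
      assume "\<not> length xs \<le> i"
      then have "xs ! i = xs ! 0" "i < length xs" using i pow[of i] ne by (auto simp: hd_conv_nth)
      then show False using i ne nth_eq_iff_index_eq[of xs i 0] by simp
    qed
  qed (use top ne in auto)
  then show ?thesis using pow by (intro nth_equalityI) auto
qed

lemma cyclic_list_cong: "cyclic_list f xs \<Longrightarrow> (\<And>x. x \<in> set xs \<Longrightarrow> g x = f x) \<Longrightarrow> cyclic_list g xs"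
  unfolding cyclic_list_def by (metis map_cong)

text \<open>Only the arrow that closes each cycle is changed: it is redirected to the head of the
  other list.\<close>

lemma cyclic_list_append:
  assumes xs: "cyclic_list f xs" and ys: "cyclic_list g ys" and d: "set xs \<inter> set ys = {}"
    and k: "\<And>x. x \<in> set xs \<Longrightarrow> f x \<noteq> hd xs \<Longrightarrow> k x = f x" "\<And>x. x \<in> set xs \<Longrightarrow> f x = hd xs \<Longrightarrow> k x = hd ys"
      "\<And>y. y \<in> set ys \<Longrightarrow> g y \<noteq> hd ys \<Longrightarrow> k y = g y" "\<And>y. y \<in> set ys \<Longrightarrow> g y = hd ys \<Longrightarrow> k y = hd xs"
  shows "cyclic_list k (xs @ ys)"
proof -
  obtain xs' x where x: "xs = xs' @ [x]" using xs by (cases xs rule: rev_cases) (auto simp: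
      cyclic_list_def)
  obtain ys' y where y: "ys = ys' @ [y]" using ys by (cases ys rule: rev_cases) (auto simp:
      cyclic_list_def)
  have X: "distinct xs" "map f xs' = tl xs" "f x = hd xs" using xs unfolding x cyclic_list_snoc by
      simp_all
  have Y: "distinct ys" "map g ys' = tl ys" "g y = hd ys" using ys unfolding y cyclic_list_snoc by
      simp_all
  \<comment> \<open>An arrow inside a list ends in its tail, which by distinctness does not contain
    the head, so it is not redirected.\<close>
  have ntl: "z \<in> set (tl zs) \<Longrightarrow> distinct zs \<Longrightarrow> z \<noteq> hd zs" for z :: 'a and zs by (cases zs) auto
  have "map k xs' = map f xs'"
  proof (rule map_cong[OF refl])
    fix z assume z: "z \<in> set xs'"
    then have "f z \<in> set (tl xs)" using X(2) by (metis image_eqI list.set_map)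
    then show "k z = f z" using z ntl[OF _ X(1)] by (intro k) (auto simp: x)
  qed
  moreover have "map k ys' = map g ys'"
  proof (rule map_cong[OF refl])
    fix z assume z: "z \<in> set ys'"
    then have "g z \<in> set (tl ys)" using Y(2) by (metis image_eqI list.set_map)
    then show "k z = g z" using z ntl[OF _ Y(1)] by (intro k) (auto simp: y)
  qed
  moreover have "k x = hd ys" by (rule k(2)[OF _ X(3)]) (simp add: x)
  moreover have "k y = hd xs" by (rule k(4)[OF _ Y(3)]) (simp add: y)
  ultimately have "map k (xs @ ys) = tl xs @ [hd ys] @ tl ys @ [hd xs]"
    unfolding x y using X(2) Y(2) by (simp add: x y)
  moreover have "xs \<noteq> []" "ys \<noteq> []" by (simp_all add: x y)
  ultimately show ?thesis using X(1) Y(1) d by (simp add: cyclic_list_def)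
qed

text \<open>On \<open>S\<close> the two maps may differ only at arrows into \<open>b\<close>, and a
  cycle that avoids \<open>b\<close> has no such arrow.\<close>

lemma support_other:
  assumes p: "p permutes S" "finite S" and c: "c \<in> S" and o: "b \<notin> orbit p c"
    and k: "\<And>h. h \<in> S \<Longrightarrow> p h \<noteq> b \<Longrightarrow> k h = p h"
  shows "support k c = support p c"
proof -
  have P: "permutation p" using p permutation_permutes by blast
  note s = cyclic_list_support[OF P, of c]
  have "cyclic_list k (support p c)"
  proof (rule cyclic_list_cong[OF s(1)])
    fix h assume "h \<in> set (support p c)"
    then have h: "h \<in> orbit p c" using s(3) by simp
    then have "p h \<noteq> b" using o by (metis orbit.step)
    moreover have "h \<in> S" using h permutes_orbit_subset[OF p(1) c] by auto
    ultimately show "k h = p h" using k by blast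
  qed
  from support_cyclic_list[OF this] show ?thesis unfolding s(2) .
qed

lemma support_splice:
  assumes p: "p permutes S" "finite S" and q: "q permutes T" "finite T" and ST: "S \<inter> T = {}"
    and b: "b \<in> S" "c \<in> T"
    and k: "\<And>h. h \<in> S \<Longrightarrow> p h \<noteq> b \<Longrightarrow> k h = p h" "\<And>h. h \<in> S \<Longrightarrow> p h = b \<Longrightarrow> k h = c"
      "\<And>h. h \<in> T \<Longrightarrow> q h \<noteq> c \<Longrightarrow> k h = q h" "\<And>h. h \<in> T \<Longrightarrow> q h = c \<Longrightarrow> k h = b"
  shows "support k b = support p b @ support q c"
proof -
  have P: "permutation p" "permutation q" using p q permutation_permutes by blast+
  define xs ys where "xs = support p b" and "ys = support q c"
  note s = cyclic_list_support[OF P(1), of b, folded xs_def]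
    and t = cyclic_list_support[OF P(2), of c, folded ys_def]
  have sub: "set xs \<subseteq> S" "set ys \<subseteq> T"
    unfolding s(3) t(3) by (intro permutes_orbit_subset p q b)+
  have "cyclic_list k (xs @ ys)"
    using sub ST by (intro cyclic_list_append[OF s(1) t(1)]) (auto simp: s(2) t(2) intro!: k)
  from support_cyclic_list[OF this] show ?thesis
    using s(1,2) unfolding xs_def[symmetric] ys_def[symmetric] by (simp add: cyclic_list_def hd_append)
qed

text \<open>The order of the half-edges is a relation carried by the graph. Uniqueness here and
  existence below are what resolves the description in \<open>cilia_list\<close>.\<close>

lemma sorted_wrt_unique:
  assumes "sorted_wrt r xs" "sorted_wrt r ys" "distinct xs" "distinct ys" "set xs = set ys"
    and "\<And>x y. x \<in> set xs \<Longrightarrow> y \<in> set xs \<Longrightarrow> r x y \<Longrightarrow> \<not> r y x"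
  shows "xs = ys"
  using assms
proof (induction xs arbitrary: ys)
  case (Cons x xs)
  obtain y ys' where y: "ys = y # ys'" using Cons.prems(5) by (cases ys) auto
  have "x = y"
  proof (rule ccontr)
    assume "x \<noteq> y"
    then have "x \<in> set ys'" "y \<in> set xs" using Cons.prems(5) by (auto simp: y)
    then have "r x y" "r y x" using Cons.prems(1,2) by (auto simp: y)
    then show False using Cons.prems(6)[of x y] \<open>y \<in> set xs\<close> by simp
  qed
  moreover have "xs = ys'"
  proof (rule Cons.IH)
    show "set xs = set ys'" using Cons.prems(3-5) \<open>x = y\<close> by (simp add: y insert_ident)
    show "\<not> r v u" if "u \<in> set xs" "v \<in> set xs" "r u v" for u v
      using that by (intro Cons.prems(6)) auto
  qed (use Cons.prems in \<open>simp_all add: y\<close>)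
  ultimately show ?case by (simp add: y)
qed simp

lemma sorted_wrt_exists:
  assumes "finite S" and tr: "\<And>x y z. x \<in> S \<Longrightarrow> y \<in> S \<Longrightarrow> z \<in> S \<Longrightarrow> r x y \<Longrightarrow> r y z \<Longrightarrow> r x z"
    and tot: "\<And>x y. x \<in> S \<Longrightarrow> y \<in> S \<Longrightarrow> x \<noteq> y \<Longrightarrow> r x y \<or> r y x"
  shows "\<exists>cs. distinct cs \<and> set cs = S \<and> sorted_wrt r cs"
proof -
  have "T \<subseteq> S \<Longrightarrow> \<exists>cs. distinct cs \<and> set cs = T \<and> sorted_wrt r cs" if "finite T" for T
    using that
  proof (induction T rule: finite_induct)
    case (insert t T)
    then obtain cs where cs: "distinct cs" "set cs = T" "sorted_wrt r cs" by auto
    define as where "as = filter (\<lambda>c. r c t) cs"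
    define bs where "bs = filter (\<lambda>c. \<not> r c t) cs"
    have b: "r t c" if "c \<in> set bs" for c
      using that tot[of t c] insert.prems insert.hyps(2) cs(2) by (auto simp: bs_def)
    have a: "r c t" if "c \<in> set as" for c using that by (simp add: as_def)
    have ab: "r x y" if "x \<in> set as" "y \<in> set bs" for x y
      using tr[OF _ _ _ a[OF that(1)] b[OF that(2)]] that insert.prems cs(2) by (auto simp: as_def
          bs_def)
    have "sorted_wrt r (as @ t # bs)"
    proof -
      have "sorted_wrt r as" "sorted_wrt r bs" using cs(3) by (simp_all add: as_def bs_def
          sorted_wrt_filter)
      then show ?thesis using a b ab by (simp only: sorted_wrt_append sorted_wrt.simps list.set) blast
    qed
    moreover have "distinct (as @ t # bs)" "set (as @ t # bs) = insert t T"
      using cs insert.hyps(2) by (auto simp: as_def bs_def)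
    ultimately show ?case by blast
  qed (auto intro: exI[of _ "[]"])
  then show ?thesis using assms(1) by blast
qed

lemma cilia_listI:
  assumes cs: "distinct cs" "set cs = cilia \<Gamma> - {base \<Gamma>}" "sorted_wrt (hless \<Gamma>) cs"
    and asym: "\<And>x y. x \<in> cilia \<Gamma> \<Longrightarrow> y \<in> cilia \<Gamma> \<Longrightarrow> hless \<Gamma> x y \<Longrightarrow> \<not> hless \<Gamma> y x"
  shows "cilia_list \<Gamma> = base \<Gamma> # cs"
proof -
  have "(THE cs. distinct cs \<and> set cs = cilia \<Gamma> - {base \<Gamma>} \<and> sorted_wrt (hless \<Gamma>) cs) = cs"
    using cs asym by (intro the_equality) (auto intro!: sorted_wrt_unique[of "hless \<Gamma>"])
  then show ?thesis by (simp add: cilia_list_def)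
qed

section \<open>Kitaev graphs and their connected sum\<close>

locale kitaev =
  fixes \<Gamma> :: "'g kgraph"
  assumes kitaev: "kitaev_graph \<Gamma>"
begin

lemma finite_hedges: "finite (hedges \<Gamma>)" and iot_permutes: "iot \<Gamma> permutes hedges \<Gamma>"
  and rho_permutes: "rho \<Gamma> permutes hedges \<Gamma>" and cilia_sub: "cilia \<Gamma> \<subseteq> hedges \<Gamma>"
  and base_cilia: "base \<Gamma> \<in> cilia \<Gamma>" and linear: "linear_order_on (hedges \<Gamma>) (hord \<Gamma>)"
  and inj_vertex: "inj_on (vertex_of \<Gamma>) (cilia \<Gamma>)"
  and inj_face: "inj_on (\<lambda>c. face_of \<Gamma> (inv (rho \<Gamma>) c)) (cilia \<Gamma>)"
  using kitaev by (auto simp: kitaev_graph_def ribbon_graph_def bij_betw_def)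

lemma base_hedges: "base \<Gamma> \<in> hedges \<Gamma>" using base_cilia cilia_sub by auto

lemma finite_cilia: "finite (cilia \<Gamma>)" using cilia_sub finite_hedges finite_subset by blast

lemma edges_nonempty: "edges \<Gamma> \<noteq> {}"
  using base_hedges by (auto simp: edges_def)

lemma hord_sub: "hord \<Gamma> \<subseteq> hedges \<Gamma> \<times> hedges \<Gamma>" and hord_trans: "trans (hord \<Gamma>)"
  and hord_antisym: "antisym (hord \<Gamma>)" and hord_total: "total_on (hedges \<Gamma>) (hord \<Gamma>)"
  using linear by (auto simp: order_on_defs)

lemma inv_rho_permutes: "inv (rho \<Gamma>) permutes hedges \<Gamma>"
  by (rule permutes_inv[OF rho_permutes])

lemma face_perm_permutes: "face_perm \<Gamma> permutes hedges \<Gamma>"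
  unfolding face_perm_def by (rule permutes_compose[OF iot_permutes inv_rho_permutes])

lemma edge_of_sub: "h \<in> hedges \<Gamma> \<Longrightarrow> edge_of \<Gamma> h \<subseteq> hedges \<Gamma>"
  unfolding edge_of_def by (rule permutes_orbit_subset[OF iot_permutes])

text \<open>Distinct cilia lie on distinct vertices. Hence the change of \<open>rho\<close> at the
  distinguished cilium is not felt at the vertices of the other cilia.\<close>

lemma base_not_in_vertex:
  assumes "c \<in> cilia \<Gamma>" "c \<noteq> base \<Gamma>"
  shows "base \<Gamma> \<notin> orbit (rho \<Gamma>) c"
proof
  assume "base \<Gamma> \<in> orbit (rho \<Gamma>) c"
  moreover have "permutation (rho \<Gamma>)" using rho_permutes finite_hedges permutation_permutes by blast
  ultimately have "vertex_of \<Gamma> (base \<Gamma>) = vertex_of \<Gamma> c"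
    unfolding vertex_of_def by (metis cyclic_on_orbit' orbit_cyclic_eq3)
  then show False using inj_vertex base_cilia assms by (auto dest: inj_onD)
qed

lemma base_not_in_face:
  assumes "c \<in> cilia \<Gamma>" "c \<noteq> base \<Gamma>"
  shows "inv (rho \<Gamma>) (base \<Gamma>) \<notin> orbit (face_perm \<Gamma>) (inv (rho \<Gamma>) c)"
proof
  assume "inv (rho \<Gamma>) (base \<Gamma>) \<in> orbit (face_perm \<Gamma>) (inv (rho \<Gamma>) c)"
  moreover have "permutation (face_perm \<Gamma>)"
    using face_perm_permutes finite_hedges permutation_permutes by blast
  ultimately have "face_of \<Gamma> (inv (rho \<Gamma>) (base \<Gamma>)) = face_of \<Gamma> (inv (rho \<Gamma>) c)"
    unfolding face_of_def by (metis cyclic_on_orbit' orbit_cyclic_eq3)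
  then show False using inj_face base_cilia assms by (auto dest: inj_onD)
qed

lemma hless_asym: "hless \<Gamma> x y \<Longrightarrow> \<not> hless \<Gamma> y x"
  using hord_antisym by (auto simp: hless_def antisym_def)

lemma cilia_list:
  obtains cs where "cilia_list \<Gamma> = base \<Gamma> # cs" "distinct cs" "set cs = cilia \<Gamma> - {base \<Gamma>}"
    "sorted_wrt (hless \<Gamma>) cs"
proof -
  have "\<exists>cs. distinct cs \<and> set cs = cilia \<Gamma> - {base \<Gamma>} \<and> sorted_wrt (hless \<Gamma>) cs"
  proof (rule sorted_wrt_exists)
    fix x y z assume x: "x \<in> cilia \<Gamma> - {base \<Gamma>}" and y: "y \<in> cilia \<Gamma> - {base \<Gamma>}"
    show "x \<noteq> y \<Longrightarrow> hless \<Gamma> x y \<or> hless \<Gamma> y x"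
      using hord_total cilia_sub x y by (auto simp: hless_def total_on_def)
    show "hless \<Gamma> x y \<Longrightarrow> hless \<Gamma> y z \<Longrightarrow> hless \<Gamma> x z"
      using transD[OF hord_trans] antisymD[OF hord_antisym] unfolding hless_def by metis
  qed (simp add: finite_cilia)
  then obtain cs where "distinct cs" "set cs = cilia \<Gamma> - {base \<Gamma>}" "sorted_wrt (hless \<Gamma>) cs" by auto
  then show ?thesis using cilia_listI[of cs \<Gamma>] hless_asym that by blast
qed

lemma set_support:
  assumes "p permutes hedges \<Gamma>" "h \<in> hedges \<Gamma>"
  shows "support p h \<noteq> []" "set (support p h) \<subseteq> hedges \<Gamma>"
proof -
  have P: "permutation p" using assms finite_hedges permutation_permutes by blast
  show "support p h \<noteq> []" using cyclic_list_support(1)[OF P, of h] by (simp add: cyclic_list_def)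
  show "set (support p h) \<subseteq> hedges \<Gamma>"
    unfolding cyclic_list_support(3)[OF P] by (rule permutes_orbit_subset[OF assms])
qed

end

locale two_graphs = G1: kitaev \<Gamma> + G2: kitaev \<Delta> for \<Gamma> \<Delta> :: "'g kgraph" +
  assumes disj: "hedges \<Gamma> \<inter> hedges \<Delta> = {}"
begin

abbreviation "G \<equiv> connected_sum \<Gamma> \<Delta>"

lemma G_simps: "hedges G = hedges \<Gamma> \<union> hedges \<Delta>" "cilia G = cilia \<Gamma> \<union> (cilia \<Delta> - {base \<Delta>})"
  "base G = base \<Gamma>" "h \<in> hedges \<Gamma> \<Longrightarrow> iot G h = iot \<Gamma> h" "h \<in> hedges \<Delta> \<Longrightarrow> iot G h = iot \<Delta> h"
  using disj by (auto simp: connected_sum_def)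

lemma iot_mem: "h \<in> hedges \<Gamma> \<Longrightarrow> iot \<Gamma> h \<in> hedges \<Gamma>" "h \<in> hedges \<Delta> \<Longrightarrow> iot \<Delta> h \<in> hedges \<Delta>"
  using permutes_in_image[OF G1.iot_permutes] permutes_in_image[OF G2.iot_permutes] by auto

lemma edge_of_G:
  "h \<in> hedges \<Gamma> \<Longrightarrow> edge_of G h = edge_of \<Gamma> h" "h \<in> hedges \<Delta> \<Longrightarrow> edge_of G h = edge_of \<Delta> h"
  unfolding edge_of_def
  using orbit_cong0[of h "hedges \<Gamma>" "iot G" "iot \<Gamma>"] orbit_cong0[of h "hedges \<Delta>" "iot G" "iot \<Delta>"]
  by (simp_all add: G_simps iot_mem)

lemma edges_G: "edges G = edges \<Gamma> \<union> edges \<Delta>"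
  by (auto simp: edges_def G_simps edge_of_G image_Un cong: image_cong)

lemma edges_disjoint: "edges \<Gamma> \<inter> edges \<Delta> = {}"
proof -
  have False if "h \<in> hedges \<Gamma>" "k \<in> hedges \<Delta>" "edge_of \<Gamma> h = edge_of \<Delta> k" for h k
    using that G1.edge_of_sub[OF that(1)] G2.edge_of_sub[OF that(2)] disj orbit_nonempty[of "iot \<Gamma>" h]
    by (auto simp: edge_of_def)
  then show ?thesis by (auto simp: edges_def)
qed

lemma hless_G: "h \<in> hedges \<Gamma> \<Longrightarrow> k \<in> hedges \<Gamma> \<Longrightarrow> hless G h k = hless \<Gamma> h k"
  "h \<in> hedges \<Delta> \<Longrightarrow> k \<in> hedges \<Delta> \<Longrightarrow> hless G h k = hless \<Delta> h k"
  "h \<in> hedges \<Gamma> \<Longrightarrow> k \<in> hedges \<Delta> \<Longrightarrow> hless G h k" "h \<in> hedges \<Delta> \<Longrightarrow> k \<in> hedges \<Gamma> \<Longrightarrow> \<not> hless G h k"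
  using disj G1.hord_sub G2.hord_sub by (auto simp: hless_def connected_sum_def)

lemma is_source_G: "h \<in> hedges \<Gamma> \<Longrightarrow> is_source G h = is_source \<Gamma> h"
  "h \<in> hedges \<Delta> \<Longrightarrow> is_source G h = is_source \<Delta> h"
  by (simp_all add: is_source_def G_simps hless_G iot_mem)

lemma base_disjoint: "base \<Delta> \<notin> hedges \<Gamma>" "base \<Gamma> \<notin> hedges \<Delta>"
  using disj G1.base_hedges G2.base_hedges by auto

text \<open>Half-edges of \<open>\<Gamma>\<close> precede those of \<open>\<Delta>\<close> in the
  sum, so the sorted lists of the remaining cilia are simply concatenated.\<close>

lemma cilia_list_G:
  "cilia_list G = base \<Gamma> # tl (cilia_list \<Gamma>) @ tl (cilia_list \<Delta>)"
proof -
  obtain cs where cs: "cilia_list \<Gamma> = base \<Gamma> # cs" "distinct cs" "set cs = cilia \<Gamma> - {base \<Gamma>}"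
    "sorted_wrt (hless \<Gamma>) cs" by (rule G1.cilia_list)
  obtain ds where ds: "cilia_list \<Delta> = base \<Delta> # ds" "distinct ds" "set ds = cilia \<Delta> - {base \<Delta>}"
    "sorted_wrt (hless \<Delta>) ds" by (rule G2.cilia_list)
  have sub: "set cs \<subseteq> hedges \<Gamma>" "set ds \<subseteq> hedges \<Delta>" using cs ds G1.cilia_sub G2.cilia_sub by auto
  have "cilia_list G = base G # (cs @ ds)"
  proof (rule cilia_listI)
    show "distinct (cs @ ds)" using cs ds sub disj by auto
    show "set (cs @ ds) = cilia G - {base G}"
      using cs ds base_disjoint G2.cilia_sub by (auto simp: G_simps)
    have "sorted_wrt (hless G) cs" "sorted_wrt (hless G) ds"
      using cs(4) ds(4) sub by (auto elim!: sorted_wrt_mono_rel[rotated] simp: hless_G subset_iff)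
    then show "sorted_wrt (hless G) (cs @ ds)" using sub by (auto simp: sorted_wrt_append hless_G
        subset_iff)
    fix x y assume "x \<in> cilia G" "y \<in> cilia G" "hless G x y"
    then show "\<not> hless G y x"
      using G1.hless_asym G2.hless_asym G1.cilia_sub G2.cilia_sub
      by (auto simp: G_simps subset_iff) (metis hless_G)+
  qed
  then show ?thesis by (simp add: cs(1) ds(1) G_simps)
qed

text \<open>Following both vertex permutations by the transposition of the two distinguished cilia
  redirects exactly the two arrows into them. In this form \<open>rho G\<close> is evidently a
  permutation.\<close>

lemma rho_G_eq: "rho G = transpose (base \<Gamma>) (base \<Delta>) \<circ> (rho \<Gamma> \<circ> rho \<Delta>)"
proof
  fix h
  have r: "rho \<Gamma> x = base \<Gamma> \<longleftrightarrow> x = inv (rho \<Gamma>) (base \<Gamma>)" "rho \<Delta> x = base \<Delta> \<longleftrightarrow> x = inv (rho \<Delta>) (base \<Delta>)"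
      for x
    using permutes_inv_eq[OF G1.rho_permutes] permutes_inv_eq[OF G2.rho_permutes] by metis+
  have i: "inv (rho \<Gamma>) (base \<Gamma>) \<in> hedges \<Gamma>" "inv (rho \<Delta>) (base \<Delta>) \<in> hedges \<Delta>"
    using permutes_in_image[OF G1.inv_rho_permutes] permutes_in_image[OF G2.inv_rho_permutes]
      G1.base_hedges G2.base_hedges by auto
  note m = permutes_in_image[OF G1.rho_permutes] permutes_in_image[OF G2.rho_permutes]
    and o = permutes_not_in[OF G1.rho_permutes] permutes_not_in[OF G2.rho_permutes]
  consider "h \<in> hedges \<Gamma>" "h \<notin> hedges \<Delta>" | "h \<in> hedges \<Delta>" "h \<notin> hedges \<Gamma>" | "h \<notin> hedges \<Gamma>" "h \<notin> hedges \<Delta>"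
    using disj by auto
  then show "rho G h = (transpose (base \<Gamma>) (base \<Delta>) \<circ> (rho \<Gamma> \<circ> rho \<Delta>)) h"
  proof cases
    case 1
    moreover have "rho \<Gamma> h \<noteq> base \<Delta>" using 1 m base_disjoint by metis
    ultimately show ?thesis using i by (auto simp: connected_sum_def o r transpose_def)
  next
    case 2
    moreover have "rho \<Delta> h \<in> hedges \<Delta>" using 2 m by simp
    then have "rho \<Delta> h \<noteq> base \<Gamma>" "rho \<Delta> h \<notin> hedges \<Gamma>" using base_disjoint disj by auto
    ultimately show ?thesis using i by (auto simp: connected_sum_def o r transpose_def)
  next
    case 3
    then show ?thesis using i G1.base_hedges G2.base_hedges by (auto simp: connected_sum_def o
        transpose_def)
  qed
qed

lemma rho_G_permutes: "rho G permutes hedges G"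
  unfolding rho_G_eq G_simps
  by (intro permutes_compose permutes_swap_id permutes_subset[OF G1.rho_permutes] permutes_subset[OF
      G2.rho_permutes])
    (use G1.base_hedges G2.base_hedges in auto)

lemma rho_G:
  "h \<in> hedges \<Gamma> \<Longrightarrow> rho G h = (if rho \<Gamma> h = base \<Gamma> then base \<Delta> else rho \<Gamma> h)"
  "h \<in> hedges \<Delta> \<Longrightarrow> rho G h = (if rho \<Delta> h = base \<Delta> then base \<Gamma> else rho \<Delta> h)"
proof -
  note m = permutes_in_image[OF G1.rho_permutes] permutes_in_image[OF G2.rho_permutes]
    and o = permutes_not_in[OF G1.rho_permutes] permutes_not_in[OF G2.rho_permutes]
  show "rho G h = (if rho \<Gamma> h = base \<Gamma> then base \<Delta> else rho \<Gamma> h)" if "h \<in> hedges \<Gamma>"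
  proof -
    have "rho \<Gamma> h \<in> hedges \<Gamma>" using that m by simp
    then have "h \<notin> hedges \<Delta>" "rho \<Gamma> h \<noteq> base \<Delta>" using that base_disjoint disj by auto
    then show ?thesis by (simp add: rho_G_eq o transpose_def)
  qed
  show "rho G h = (if rho \<Delta> h = base \<Delta> then base \<Gamma> else rho \<Delta> h)" if "h \<in> hedges \<Delta>"
  proof -
    have "rho \<Delta> h \<in> hedges \<Delta>" using that m by simp
    then have "rho \<Delta> h \<notin> hedges \<Gamma>" "rho \<Delta> h \<noteq> base \<Gamma>" using base_disjoint disj by auto
    then show ?thesis by (simp add: rho_G_eq o transpose_def)
  qed
qed

lemma inv_rho_mem: "h \<in> hedges \<Gamma> \<Longrightarrow> inv (rho \<Gamma>) h \<in> hedges \<Gamma>" "h \<in> hedges \<Delta> \<Longrightarrow> inv (rho \<Delta>) h \<in> hedges \<Delta>"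
  using permutes_in_image[OF G1.inv_rho_permutes] permutes_in_image[OF G2.inv_rho_permutes] by auto

lemma rho_inv: "rho \<Gamma> (inv (rho \<Gamma>) h) = h" "rho \<Delta> (inv (rho \<Delta>) h) = h"
  using permutes_inverses[OF G1.rho_permutes] permutes_inverses[OF G2.rho_permutes] by auto

lemma inv_rho_G:
  "h \<in> hedges \<Gamma> \<Longrightarrow> h \<noteq> base \<Gamma> \<Longrightarrow> inv (rho G) h = inv (rho \<Gamma>) h"
  "h \<in> hedges \<Delta> \<Longrightarrow> h \<noteq> base \<Delta> \<Longrightarrow> inv (rho G) h = inv (rho \<Delta>) h"
  "inv (rho G) (base \<Gamma>) = inv (rho \<Delta>) (base \<Delta>)" "inv (rho G) (base \<Delta>) = inv (rho \<Gamma>) (base \<Gamma>)"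
  unfolding permutes_inv_eq[OF rho_G_permutes] 
  using G1.base_hedges G2.base_hedges by (simp_all add: rho_G inv_rho_mem rho_inv)

text \<open>The last map in a face permutation is the inverse of \<open>rho\<close>, and that of the
  sum exchanges the predecessors of the two distinguished cilia. So only the arrows into these
  predecessors are redirected.\<close>

lemma face_perm_G:
  "h \<in> hedges \<Gamma> \<Longrightarrow> face_perm G h = (if face_perm \<Gamma> h = inv (rho \<Gamma>) (base \<Gamma>)
     then inv (rho \<Delta>) (base \<Delta>) else face_perm \<Gamma> h)"
  "h \<in> hedges \<Delta> \<Longrightarrow> face_perm G h = (if face_perm \<Delta> h = inv (rho \<Delta>) (base \<Delta>)
     then inv (rho \<Gamma>) (base \<Gamma>) else face_perm \<Delta> h)"
proof -
  have i: "inv (rho \<Gamma>) x = inv (rho \<Gamma>) y \<longleftrightarrow> x = y" "inv (rho \<Delta>) x = inv (rho \<Delta>) y \<longleftrightarrow> x = y" for x y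
    by (metis rho_inv)+
  show "face_perm G h = (if face_perm \<Gamma> h = inv (rho \<Gamma>) (base \<Gamma>)
     then inv (rho \<Delta>) (base \<Delta>) else face_perm \<Gamma> h)" if "h \<in> hedges \<Gamma>"
    using that iot_mem by (auto simp: face_perm_def i G_simps inv_rho_G)
  show "face_perm G h = (if face_perm \<Delta> h = inv (rho \<Delta>) (base \<Delta>)
     then inv (rho \<Gamma>) (base \<Gamma>) else face_perm \<Delta> h)" if "h \<in> hedges \<Delta>"
    using that iot_mem by (auto simp: face_perm_def i G_simps inv_rho_G)
qed

lemma vertex_support_G:
  "support (rho G) (base \<Gamma>) = support (rho \<Gamma>) (base \<Gamma>) @ support (rho \<Delta>) (base \<Delta>)"
  "c \<in> cilia \<Gamma> \<Longrightarrow> c \<noteq> base \<Gamma> \<Longrightarrow> support (rho G) c = support (rho \<Gamma>) c"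
  "c \<in> cilia \<Delta> \<Longrightarrow> c \<noteq> base \<Delta> \<Longrightarrow> support (rho G) c = support (rho \<Delta>) c"
proof -
  show "support (rho G) (base \<Gamma>) = support (rho \<Gamma>) (base \<Gamma>) @ support (rho \<Delta>) (base \<Delta>)"
    by (rule support_splice[OF G1.rho_permutes G1.finite_hedges G2.rho_permutes G2.finite_hedges disj
      G1.base_hedges G2.base_hedges]) (simp_all add: rho_G)
  show "support (rho G) c = support (rho \<Gamma>) c" if "c \<in> cilia \<Gamma>" "c \<noteq> base \<Gamma>"
    using that G1.cilia_sub
    by (intro support_other[OF G1.rho_permutes G1.finite_hedges _ G1.base_not_in_vertex]) (auto simp:
        rho_G)
  show "support (rho G) c = support (rho \<Delta>) c" if "c \<in> cilia \<Delta>" "c \<noteq> base \<Delta>"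
    using that G2.cilia_sub
    by (intro support_other[OF G2.rho_permutes G2.finite_hedges _ G2.base_not_in_vertex]) (auto simp:
        rho_G)
qed

text \<open>Unlike in the vertex cycle, the part of \<open>\<Delta>\<close> comes first, because the
  predecessor of the distinguished cilium in the sum is that of \<open>base \<Delta>\<close>. The
  reversal in \<open>face_coact\<close> restores the order \<open>\<Gamma>\<close>,
  \<open>\<Delta>\<close>.\<close>

lemma face_support_G:
  "support (face_perm G) (inv (rho G) (base \<Gamma>)) = support (face_perm \<Delta>) (inv (rho \<Delta>) (base \<Delta>))
     @ support (face_perm \<Gamma>) (inv (rho \<Gamma>) (base \<Gamma>))"
  "c \<in> cilia \<Gamma> \<Longrightarrow> c \<noteq> base \<Gamma> \<Longrightarrow>
     support (face_perm G) (inv (rho G) c) = support (face_perm \<Gamma>) (inv (rho \<Gamma>) c)"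
  "c \<in> cilia \<Delta> \<Longrightarrow> c \<noteq> base \<Delta> \<Longrightarrow>
     support (face_perm G) (inv (rho G) c) = support (face_perm \<Delta>) (inv (rho \<Delta>) c)"
proof -
  have disj': "hedges \<Delta> \<inter> hedges \<Gamma> = {}" using disj by auto
  show "support (face_perm G) (inv (rho G) (base \<Gamma>)) = support (face_perm \<Delta>) (inv (rho \<Delta>) (base \<Delta>))
     @ support (face_perm \<Gamma>) (inv (rho \<Gamma>) (base \<Gamma>))"
    unfolding inv_rho_G
    by (rule support_splice[OF G2.face_perm_permutes G2.finite_hedges G1.face_perm_permutes
        G1.finite_hedges disj'
      inv_rho_mem(2)[OF G2.base_hedges] inv_rho_mem(1)[OF G1.base_hedges]]) (simp_all add: face_perm_G)
  show "support (face_perm G) (inv (rho G) c) = support (face_perm \<Gamma>) (inv (rho \<Gamma>) c)"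
    if "c \<in> cilia \<Gamma>" "c \<noteq> base \<Gamma>"
  proof -
    have c: "c \<in> hedges \<Gamma>" using that G1.cilia_sub by auto
    show ?thesis unfolding inv_rho_G(1)[OF c that(2)]
      by (rule support_other[OF G1.face_perm_permutes G1.finite_hedges inv_rho_mem(1)[OF c]
        G1.base_not_in_face[OF that]]) (simp add: face_perm_G)
  qed
  show "support (face_perm G) (inv (rho G) c) = support (face_perm \<Delta>) (inv (rho \<Delta>) c)"
    if "c \<in> cilia \<Delta>" "c \<noteq> base \<Delta>"
  proof -
    have c: "c \<in> hedges \<Delta>" using that G2.cilia_sub by auto
    show ?thesis unfolding inv_rho_G(2)[OF c that(2)]
      by (rule support_other[OF G2.face_perm_permutes G2.finite_hedges inv_rho_mem(2)[OF c]
        G2.base_not_in_face[OF that]]) (simp add: face_perm_G)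
  qed
qed

end

section \<open>The extended Hilbert space of the connected sum\<close>

text \<open>Common shape of \<open>edge_act\<close> and \<open>edge_dual_act\<close>:
  \<open>g\<close> is the operator on one copy of \<open>M\<close>, its first argument telling
  whether the half-edge is a source.\<close>

definition edge_op :: "('k::field, 'm::ab_group_add, 'z) kspace_scheme \<Rightarrow> (bool \<Rightarrow> 'v \<Rightarrow> 'm \<Rightarrow> 'm)
    \<Rightarrow> 'g kgraph \<Rightarrow> 'g \<Rightarrow> 'v \<Rightarrow> ((('g set \<Rightarrow> 'm) \<Rightarrow> 'k) \<Rightarrow> 'k) \<Rightarrow> (('g set \<Rightarrow> 'm) \<Rightarrow> 'k) \<Rightarrow> 'k" where
  "edge_op M g \<Gamma> h v = nslot (edges \<Gamma>) M (edge_of \<Gamma> h) (g (is_source \<Gamma> h) v)"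

lemma bilin_edge_op:
  assumes "edges \<Gamma> \<noteq> {}" "vspace M" "\<And>s. bilin V M M (g s)" "h \<in> hedges \<Gamma>"
  shows "bilin V (ntensor (edges \<Gamma>) M) (ntensor (edges \<Gamma>) M) (edge_op M g \<Gamma> h)"
  unfolding edge_op_def[abs_def] using assms by (intro bilin_nslot) (auto simp: edges_def)

text \<open>Treats vertex actions and dual face actions at once: \<open>V\<close> is
  \<open>H\<close> or its dual, and \<open>L K c\<close> is the vertex cycle or the reversed face
  cycle belonging to the cilium \<open>c\<close>.\<close>

locale graph_pair_ops = two_graphs \<Gamma> \<Delta> + coassoc V D
  for \<Gamma> \<Delta> :: "'g kgraph" and V :: "('k::field, 'v::ab_group_add, 'z) kspace_scheme"
    and D :: "'v \<Rightarrow> ('v \<Rightarrow> 'v \<Rightarrow> 'k) \<Rightarrow> 'k" +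
  fixes M :: "('k, 'm::ab_group_add, 'y) kspace_scheme" and g :: "bool \<Rightarrow> 'v \<Rightarrow> 'm \<Rightarrow> 'm" and b :: bool
    and L :: "'g kgraph \<Rightarrow> 'g \<Rightarrow> 'g list"
  assumes MV: "vspace M" and g: "\<And>s. bilin V M M (g s)"
    and L1: "\<And>c. c \<in> cilia \<Gamma> \<Longrightarrow> L \<Gamma> c \<noteq> [] \<and> set (L \<Gamma> c) \<subseteq> hedges \<Gamma>"
    and L2: "\<And>c. c \<in> cilia \<Delta> \<Longrightarrow> L \<Delta> c \<noteq> [] \<and> set (L \<Delta> c) \<subseteq> hedges \<Delta>"
    and LG: "L G (base \<Gamma>) = L \<Gamma> (base \<Gamma>) @ L \<Delta> (base \<Delta>)"
      "\<And>c. c \<in> cilia \<Gamma> \<Longrightarrow> c \<noteq> base \<Gamma> \<Longrightarrow> L G c = L \<Gamma> c"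
      "\<And>c. c \<in> cilia \<Delta> \<Longrightarrow> c \<noteq> base \<Delta> \<Longrightarrow> L G c = L \<Delta> c"
begin

abbreviation "N1 \<equiv> ntensor (edges \<Gamma>) M"
abbreviation "N2 \<equiv> ntensor (edges \<Delta>) M"
abbreviation "NG \<equiv> ntensor (edges G) M"
abbreviation "J \<equiv> njoin (edges \<Gamma>) (edges \<Delta>) M"

definition W :: "'g kgraph \<Rightarrow> 'g \<Rightarrow> 'v \<Rightarrow> ((('g set \<Rightarrow> 'm) \<Rightarrow> 'k) \<Rightarrow> 'k) \<Rightarrow> (('g set \<Rightarrow> 'm) \<Rightarrow> 'k) \<Rightarrow> 'k" where
  "W K c = op_list b V D (edge_op M g K) (L K c)"

lemma bilin_J: "bilin N1 N2 NG J"
  unfolding edges_G by (rule bilin_njoin[OF G1.edges_nonempty G2.edges_nonempty edges_disjoint MV])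

lemma edges_G_nonempty: "edges G \<noteq> {}"
  using G1.edges_nonempty by (simp add: edges_G)

lemma bilin_op: "h \<in> hedges \<Gamma> \<Longrightarrow> bilin V N1 N1 (edge_op M g \<Gamma> h)"
  "h \<in> hedges \<Delta> \<Longrightarrow> bilin V N2 N2 (edge_op M g \<Delta> h)" "h \<in> hedges G \<Longrightarrow> bilin V NG NG (edge_op M g G h)"
  by (intro bilin_edge_op G1.edges_nonempty G2.edges_nonempty edges_G_nonempty MV g; assumption)+

lemma edge_op_J:
  assumes "v \<in> carr V" "m \<in> carr N1" "n \<in> carr N2"
  shows "h \<in> hedges \<Gamma> \<Longrightarrow> edge_op M g G h v (J m n) = J (edge_op M g \<Gamma> h v m) n"
    and "h \<in> hedges \<Delta> \<Longrightarrow> edge_op M g G h v (J m n) = J m (edge_op M g \<Delta> h v n)"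
proof -
  note ns = nslot_njoin[OF G1.edges_nonempty G2.edges_nonempty edges_disjoint MV bilin_right[OF g
      assms(1)]
    assms(2,3), folded edges_G]
  show "edge_op M g G h v (J m n) = J (edge_op M g \<Gamma> h v m) n" if "h \<in> hedges \<Gamma>"
  proof -
    have "edge_of \<Gamma> h \<in> edges \<Gamma>" using that by (simp add: edges_def)
    then show ?thesis using that by (simp add: edge_op_def edge_of_G is_source_G ns(1))
  qed
  show "edge_op M g G h v (J m n) = J m (edge_op M g \<Delta> h v n)" if "h \<in> hedges \<Delta>"
  proof -
    have "edge_of \<Delta> h \<in> edges \<Delta>" using that by (simp add: edges_def)
    then show ?thesis using that by (simp add: edge_op_def edge_of_G is_source_G ns(2))
  qed
qed

lemma L_G:
  assumes "c \<in> cilia G"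
  shows "L G c \<noteq> [] \<and> set (L G c) \<subseteq> hedges G"
  proof (cases "c = base \<Gamma>")
    case True
    then show ?thesis using L1[OF G1.base_cilia] L2[OF G2.base_cilia] by (auto simp: LG G_simps)
  next
    case False
    then consider "c \<in> cilia \<Gamma>" | "c \<in> cilia \<Delta>" "c \<noteq> base \<Delta>" using assms by (auto simp: G_simps)
    then show ?thesis using False L1[of c] L2[of c] by cases (auto simp: LG G_simps)
  qed

lemma bilin_W:
  "c \<in> cilia \<Gamma> \<Longrightarrow> bilin V N1 N1 (W \<Gamma> c)" "c \<in> cilia \<Delta> \<Longrightarrow> bilin V N2 N2 (W \<Delta> c)"
  "c \<in> cilia G \<Longrightarrow> bilin V NG NG (W G c)"
proof -
  show "bilin V N1 N1 (W \<Gamma> c)" if "c \<in> cilia \<Gamma>"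
    unfolding W_def using L1[OF that] by (intro bilin_op_list bilin_op) auto
  show "bilin V N2 N2 (W \<Delta> c)" if "c \<in> cilia \<Delta>"
    unfolding W_def using L2[OF that] by (intro bilin_op_list bilin_op) auto
  show "bilin V NG NG (W G c)" if "c \<in> cilia G"
    unfolding W_def using L_G[OF that] by (intro bilin_op_list bilin_op) auto
qed

lemma W_J:
  assumes v: "v \<in> carr V" and m: "m \<in> carr N1" and n: "n \<in> carr N2"
  shows "W G (base \<Gamma>) v (J m n) = tlift V V (\<lambda>v1 v2. J (W \<Gamma> (base \<Gamma>) v1 m) (W \<Delta> (base \<Delta>) v2 n)) (D v)"
    and "c \<in> cilia \<Gamma> \<Longrightarrow> c \<noteq> base \<Gamma> \<Longrightarrow> W G c v (J m n) = J (W \<Gamma> c v m) n"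
    and "c \<in> cilia \<Delta> \<Longrightarrow> c \<noteq> base \<Delta> \<Longrightarrow> W G c v (J m n) = J m (W \<Delta> c v n)"
proof -
  show "W G (base \<Gamma>) v (J m n) = tlift V V (\<lambda>v1 v2. J (W \<Gamma> (base \<Gamma>) v1 m) (W \<Delta> (base \<Delta>) v2 n)) (D v)"
    unfolding W_def LG(1) using L1[OF G1.base_cilia] L2[OF G2.base_cilia]
    by (intro op_list_append[where N = NG and ?N1.0 = N1 and ?N2.0 = N2] bilin_op bilin_J edge_op_J v m
        n)
      (auto simp: G_simps)
  show "W G c v (J m n) = J (W \<Gamma> c v m) n" if "c \<in> cilia \<Gamma>" "c \<noteq> base \<Gamma>"
    unfolding W_def LG(2)[OF that] using L1[OF that(1)]
    by (intro op_list_map[OF _ _ bilin_left[OF bilin_J n]] bilin_op edge_op_J v m n) auto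
  show "W G c v (J m n) = J m (W \<Delta> c v n)" if "c \<in> cilia \<Delta>" "c \<noteq> base \<Delta>"
    unfolding W_def LG(3)[OF that] using L2[OF that(1)]
    by (intro op_list_map[OF _ _ bilin_right[OF bilin_J m]] bilin_op edge_op_J v m n) auto
qed

text \<open>The distinguished cilium heads \<open>cilia_list\<close>, so in \<open>foldr\<close> it
  acts last, after every other cilium has acted on a single factor. \<open>base \<Delta>\<close> is
  no cilium of the sum; the update gives it the second leg.\<close>

lemma foldr_W_J:
  assumes v: "\<And>c. c \<in> cilia G \<Longrightarrow> v c \<in> carr V" and m: "m \<in> carr N1" and n: "n \<in> carr N2"
  shows "foldr (\<lambda>c. W G c (v c)) (cilia_list G) (J m n) = tlift V V (\<lambda>v1 v2.
      J (foldr (\<lambda>c. W \<Gamma> c ((v(base \<Gamma> := v1)) c)) (cilia_list \<Gamma>) m)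
        (foldr (\<lambda>c. W \<Delta> c ((v(base \<Delta> := v2)) c)) (cilia_list \<Delta>) n)) (D (v (base \<Gamma>)))"
proof -
  obtain cs where cs: "cilia_list \<Gamma> = base \<Gamma> # cs" "distinct cs" "set cs = cilia \<Gamma> - {base \<Gamma>}"
    by (rule G1.cilia_list)
  obtain ds where ds: "cilia_list \<Delta> = base \<Delta> # ds" "distinct ds" "set ds = cilia \<Delta> - {base \<Delta>}"
    by (rule G2.cilia_list)
  let ?m = "foldr (\<lambda>c. W \<Gamma> c (v c)) cs m" and ?n = "foldr (\<lambda>c. W \<Delta> c (v c)) ds n"
  have vc: "v c \<in> carr V" if "c \<in> set cs" for c using v that cs by (auto simp: G_simps)
  have vd: "v c \<in> carr V" if "c \<in> set ds" for c using v that ds by (auto simp: G_simps)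
  have n': "foldr (\<lambda>c. W \<Delta> c (v c)) es n \<in> carr N2" if "set es \<subseteq> set ds" for es
    using that ds vd n by (intro foldr_mem[where V = V] bilin_W) auto
  have m': "foldr (\<lambda>c. W \<Gamma> c (v c)) es m \<in> carr N1" if "set es \<subseteq> set cs" for es
    using that cs vc m by (intro foldr_mem[where V = V] bilin_W) auto
  have Jn: "foldr (\<lambda>c. W G c (v c)) es (J m n) = J m (foldr (\<lambda>c. W \<Delta> c (v c)) es n)" if "set es \<subseteq> set
      ds" for es
    using that
  proof (induction es)
    case (Cons e es)
    then show ?case using ds vd by (auto simp: n' intro!: W_J(3) m)
  qed simp
  have Jm: "foldr (\<lambda>c. W G c (v c)) es (J m ?n) = J (foldr (\<lambda>c. W \<Gamma> c (v c)) es m) ?n" if "set es \<subseteq> set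
      cs" for es
    using that
  proof (induction es)
    case (Cons e es)
    then show ?case using cs vc by (auto simp: m' n' intro!: W_J(2))
  qed simp
  have "foldr (\<lambda>c. W G c (v c)) (cilia_list G) (J m n) = W G (base \<Gamma>) (v (base \<Gamma>)) (J ?m ?n)"
    using Jn[of ds] Jm[of cs] by (simp add: cilia_list_G cs(1) ds(1))
  also have "\<dots> = tlift V V (\<lambda>v1 v2. J (W \<Gamma> (base \<Gamma>) v1 ?m) (W \<Delta> (base \<Delta>) v2 ?n)) (D (v (base \<Gamma>)))"
    using G1.base_cilia by (intro W_J(1) m' n' v) (auto simp: G_simps)
  also have "\<dots> = tlift V V (\<lambda>v1 v2.
      J (foldr (\<lambda>c. W \<Gamma> c ((v(base \<Gamma> := v1)) c)) (cilia_list \<Gamma>) m)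
        (foldr (\<lambda>c. W \<Delta> c ((v(base \<Delta> := v2)) c)) (cilia_list \<Delta>) n)) (D (v (base \<Gamma>)))"
  proof -
    have "foldr (\<lambda>c. W \<Gamma> c ((v(base \<Gamma> := v1)) c)) cs m = ?m" for v1
      using cs by (intro foldr_cong) auto
    moreover have "foldr (\<lambda>c. W \<Delta> c ((v(base \<Delta> := v2)) c)) ds n = ?n" for v2
      using ds by (intro foldr_cong) auto
    ultimately show ?thesis unfolding cs(1) ds(1) by simp
  qed
  finally show ?thesis .
qed

end

section \<open>Coactions recovered from actions of the dual\<close>

context fd_algebra
begin

text \<open>In finite dimension a linear family \<open>F\<close> indexed by the dual is contraction
  of the tensor \<open>\<Sum>e\<in>E. tens H N e (F (\<epsilon> e))\<close>. Contractions with
  functionals separate tensors, so the description determines exactly this one.\<close>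

lemma coaction_of_dual_action:
  assumes N: "vspace N" "scl N = fscl" and F: "lin (dual H) N F"
  defines "d \<equiv> THE d. d \<in> carr (tensor H N)
     \<and> (\<forall>\<alpha>\<in>carr (dual H). tlift H N (\<lambda>a n. fscl (\<alpha> a) n) d = F \<alpha>)"
  shows "d \<in> carr (tensor H N)" and "\<And>\<alpha>. \<alpha> \<in> carr (dual H) \<Longrightarrow> lcontract H N \<alpha> d = F \<alpha>"
proof -
  obtain E \<epsilon> where b: "dual_basis H E \<epsilon>" using dual_basis_exists[OF vspace_H fd] .
  then interpret dual_basis H E \<epsilon> .
  let ?P = "\<lambda>d. d \<in> carr (tensor H N) \<and> (\<forall>\<alpha>\<in>carr (dual H). lcontract H N \<alpha> d = F \<alpha>)"
  define d' where "d' = (\<Sum>e\<in>E. tens H N e (F (\<epsilon> e)))"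
  have F\<epsilon>: "F (\<epsilon> e) \<in> carr N" if "e \<in> E" for e by (rule lin_mem[OF F \<epsilon>[OF that]])
  have mem: "d' \<in> carr (tensor H N)"
    unfolding d'_def by (intro vspace_sum vspace_tensor tens_mem E F\<epsilon>)
  have ev: "lcontract H N \<alpha> d' = F \<alpha>" if \<alpha>: "\<alpha> \<in> carr (dual H)" for \<alpha>
  proof (rule functional_eqI[OF N(1)])
    show "lcontract H N \<alpha> d' \<in> carr N" by (rule lcontract_mem[OF vspace_H N(1) mem])
    show "F \<alpha> \<in> carr N" by (rule lin_mem[OF F \<alpha>])
    fix \<nu> assume \<nu>: "lin N kfield \<nu>"
    have "\<nu> (lcontract H N \<alpha> d') = d' (\<lambda>a n. \<alpha> a * \<nu> n)"
      by (rule lcontract_functional[OF vspace_H N(1) mem dual_lin[OF \<alpha>] \<nu>])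
    also have "\<dots> = (\<Sum>e\<in>E. \<alpha> e * \<nu> (F (\<epsilon> e)))"
      by (simp add: d'_def sum_fun_apply tens_apply[OF bilin_mult[OF dual_lin[OF \<alpha>] \<nu>]])
    also have "\<dots> = (\<Sum>e\<in>E. \<nu> (F (fscl (\<alpha> e) (\<epsilon> e))))"
      using lin_kfield_scl[OF lin_comp[OF F \<nu>] \<epsilon>] by (intro sum.cong refl) simp
    also have "\<dots> = \<nu> (F (\<Sum>e\<in>E. fscl (\<alpha> e) (\<epsilon> e)))"
      using vspace_scl[of "dual H", OF vspace_dual \<epsilon>]
      by (intro lin_apply_sum[OF _ lin_comp[OF F \<nu>], symmetric]) auto
    \<comment> \<open>Expansion of \<open>\<alpha>\<close> in the coordinate functionals. Outside
      the carrier of \<open>H\<close> both sides vanish by the convention for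
      \<open>dual\<close>.\<close>
    also have "(\<Sum>e\<in>E. fscl (\<alpha> e) (\<epsilon> e)) = \<alpha>"
    proof
      fix x
      show "(\<Sum>e\<in>E. fscl (\<alpha> e) (\<epsilon> e)) x = \<alpha> x"
      proof (cases "x \<in> carr H")
        case True
        then show ?thesis
          by (simp add: sum_fun_apply expand_lin_kfield[OF dual_lin[OF \<alpha>] True] mult.commute)
      next
        case False
        then have "\<alpha> x = 0" "\<And>e. e \<in> E \<Longrightarrow> \<epsilon> e x = 0" using \<alpha> \<epsilon> by (auto simp: dual_def)
        then show ?thesis by (simp add: sum_fun_apply)
      qed
    qed
    finally show "\<nu> (lcontract H N \<alpha> d') = \<nu> (F \<alpha>)" .
  qed
  have "d = (THE d. ?P d)" unfolding d_def lcontract_def N(2) ..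
  also have "\<dots> = d'"
  proof (rule the_equality)
    show "?P d'" using mem ev by blast
    fix e assume e: "?P e"
    show "e = d'"
    proof (rule tensor_sep[OF vspace_H N(1) _ mem, where \<Phi> = "carr (dual H)" and \<Psi> = "{\<nu>. lin N kfield
        \<nu>}"])
      fix \<phi> \<psi> assume \<phi>: "\<phi> \<in> carr (dual H)" and "\<psi> \<in> {\<nu>. lin N kfield \<nu>}"
      then have \<psi>: "lin N kfield \<psi>" by simp
      have "e (\<lambda>a n. \<phi> a * \<psi> n) = \<psi> (lcontract H N \<phi> e)"
        using e by (intro lcontract_functional[OF vspace_H N(1) _ dual_lin[OF \<phi>] \<psi>, symmetric]) simp
      also have "\<dots> = \<psi> (lcontract H N \<phi> d')" using e \<phi> by (simp add: ev)
      also have "\<dots> = d' (\<lambda>a n. \<phi> a * \<psi> n)"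
        by (rule lcontract_functional[OF vspace_H N(1) mem dual_lin[OF \<phi>] \<psi>])
      finally show "e (\<lambda>a n. \<phi> a * \<psi> n) = d' (\<lambda>a n. \<phi> a * \<psi> n)" .
    qed (use e N in \<open>auto intro: dual_lin functional_sep dual_sep\<close>)
  qed
  finally have dd: "d = d'" .
  show "d \<in> carr (tensor H N)" "\<And>\<alpha>. \<alpha> \<in> carr (dual H) \<Longrightarrow> lcontract H N \<alpha> d = F \<alpha>"
    unfolding dd by (rule mem, rule ev)
qed

end

definition face_dual_act :: "('k::field, 'h::ab_group_add) khopf
    \<Rightarrow> ('k, 'm::ab_group_add, 'h) hopf_bimod \<Rightarrow> 'g kgraph \<Rightarrow> 'g \<Rightarrow> ('h \<Rightarrow> 'k)
    \<Rightarrow> ((('g set \<Rightarrow> 'm) \<Rightarrow> 'k) \<Rightarrow> 'k) \<Rightarrow> (('g set \<Rightarrow> 'm) \<Rightarrow> 'k) \<Rightarrow> 'k" where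
  "face_dual_act H M \<Gamma> c = face_dual_act_list H M \<Gamma> (rev (support (face_perm \<Gamma>) (inv (rho \<Gamma>) c)))"

text \<open>Isolates what the assembled actions and coactions ask of a graph. It is used for both
  summands and for the connected sum, so the sum does not have to be recognised as a Kitaev graph
  first.\<close>

locale graph_module_ops = hopf_powers H "cilia K"
  for H :: "('k::field, 'h::ab_group_add) khopf" and K :: "'g kgraph" +
  fixes M :: "('k, 'm::ab_group_add, 'h) hopf_bimod"
  assumes cilia: "distinct (cilia_list K)" "set (cilia_list K) = cilia K"
    and vertex: "\<And>c. c \<in> cilia K \<Longrightarrow> bilin H (hilbert_space M K) (hilbert_space M K) (vertex_act H M K c)"
    and face: "\<And>c. c \<in> cilia K \<Longrightarrow> bilin (dual H) (hilbert_space M K) (hilbert_space M K) (face_dual_act H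
        M K c)"
begin

abbreviation "N \<equiv> hilbert_space M K"

lemma vspace_N: "vspace N" and scl_N: "scl N = fscl"
  by (simp_all add: hilbert_space_def)

lemma carr_graph_module: "carr (graph_module H M K) = carr N" "scl (graph_module H M K) = scl N"
  by (simp_all add: graph_module_def)

lemma cilia_list_nonempty: "cilia_list K \<noteq> []"
  using cilia C(2) by auto

lemma
  assumes n: "n \<in> carr N"
  shows lin_lact_graph: "lin HC N (\<lambda>t. lact (graph_module H M K) t n)"
    and lact_graph_ntens: "(\<And>c. c \<in> cilia K \<Longrightarrow> a c \<in> carr H) \<Longrightarrow>
      lact (graph_module H M K) (ntens (cilia K) H a) n
        = foldr (\<lambda>c. vertex_act H M K c (a c)) (cilia_list K) n"
proof -
  have act: "bilin H N N (vertex_act H M K c)" if "c \<in> set (cilia_list K)" for c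
    using that by (intro vertex) (simp add: cilia)
  show "lin HC N (\<lambda>t. lact (graph_module H M K) t n)"
    using lin_left_assemble_act[OF HH vspace_N act cilia(1) cilia_list_nonempty n]
    by (simp add: graph_module_def cilia(2))
  show "lact (graph_module H M K) (ntens (cilia K) H a) n
        = foldr (\<lambda>c. vertex_act H M K c (a c)) (cilia_list K) n"
    if "\<And>c. c \<in> cilia K \<Longrightarrow> a c \<in> carr H"
    using left_assemble_act_ntens[OF HH vspace_N act cilia(1) cilia_list_nonempty n, where a = a] that
    by (simp add: graph_module_def cilia(2))
qed

lemma face_coact:
  assumes c: "c \<in> cilia K" and t: "t \<in> carr N"
  shows "face_coact H M K c t \<in> carr (tensor H N)"
    and "\<And>\<alpha>. \<alpha> \<in> carr (dual H) \<Longrightarrow> lcontract H N \<alpha> (face_coact H M K c t) = face_dual_act H M K c \<alpha> t"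
  using coaction_of_dual_action[OF vspace_N scl_N bilin_left[OF face[OF c] t]]
  unfolding face_coact_def face_dual_act_def by blast+

lemma lin_face_coact:
  assumes c: "c \<in> cilia K"
  shows "lin N (tensor H N) (face_coact H M K c)"
proof (rule lin_by_sep[OF HH vspace_N face_coact(1)[OF c] vspace_N, where \<Phi> = "carr (dual H)" and \<Psi> =
    "{\<nu>. lin N kfield \<nu>}"])
  fix \<phi> :: "'h \<Rightarrow> 'k" and \<psi> :: "((('g set \<Rightarrow> 'm) \<Rightarrow> 'k) \<Rightarrow> 'k) \<Rightarrow> 'k"
  assume \<phi>: "\<phi> \<in> carr (dual H)" and "\<psi> \<in> {\<nu>. lin N kfield \<nu>}"
  then have \<psi>: "lin N kfield \<psi>" by simp
  show "lin N kfield (\<lambda>x. face_coact H M K c x (\<lambda>v w. \<phi> v * \<psi> w))"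
  proof (rule lin_cong[OF vspace_N])
    show "face_coact H M K c x (\<lambda>v w. \<phi> v * \<psi> w) = \<psi> (face_dual_act H M K c \<phi> x)" if "x \<in> carr N" for x
      using lcontract_functional[OF HH vspace_N face_coact(1)[OF c that] dual_lin[OF \<phi>] \<psi>]
      by (simp add: face_coact(2)[OF c that \<phi>])
    show "lin N kfield (\<lambda>x. \<psi> (face_dual_act H M K c \<phi> x))"
      by (rule lin_comp[OF bilin_right[OF face[OF c] \<phi>] \<psi>])
  qed
qed (auto intro: dual_lin functional_sep[OF vspace_N] dual_sep_finite_dim[OF HH fdH])

lemma
  shows lin_lcoact_graph: "lin N (tensor HC N) (lcoact (graph_module H M K))"
    and lcoact_graph_eval: "(\<And>c. c \<in> cilia K \<Longrightarrow> \<alpha> c \<in> carr (dual H)) \<Longrightarrow> lin N kfield \<nu> \<Longrightarrow> n \<in> carr N \<Longrightarrow>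
      lcoact (graph_module H M K) n (\<lambda>u m. u (prod_form (cilia K) \<alpha>) * \<nu> m)
        = \<nu> (foldr (\<lambda>c. face_dual_act H M K c (\<alpha> c)) (cilia_list K) n)"
proof -
  show "lin N (tensor HC N) (lcoact (graph_module H M K))"
    using lin_left_assemble_coact[OF vspace_N lin_face_coact cilia] by (simp add: graph_module_def)
  assume \<alpha>: "\<And>c. c \<in> cilia K \<Longrightarrow> \<alpha> c \<in> carr (dual H)" and \<nu>: "lin N kfield \<nu>" and n: "n \<in> carr N"
  have "lcoact (graph_module H M K) n (\<lambda>u m. u (prod_form (cilia K) \<alpha>) * \<nu> m)
      = \<nu> (foldr (\<lambda>c n. lcontract H N (\<alpha> c) (face_coact H M K c n)) (cilia_list K) n)"
    using left_assemble_coact_eval[OF vspace_N lin_face_coact cilia \<alpha> \<nu> n] by (simp add: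
        graph_module_def)
  \<comment> \<open>Membership in the carrier is carried through the induction because the
    contraction of \<open>face_coact\<close> is known only there.\<close>
  also have "foldr (\<lambda>c n. lcontract H N (\<alpha> c) (face_coact H M K c n)) cs n
      = foldr (\<lambda>c. face_dual_act H M K c (\<alpha> c)) cs n \<and> foldr (\<lambda>c. face_dual_act H M K c (\<alpha> c)) cs n \<in>
          carr N"
    if "set cs \<subseteq> cilia K" for cs
    using that
  proof (induction cs)
    case (Cons c cs)
    then show ?case by (auto intro!: face_coact(2) \<alpha> bilin_mem[OF face])
  qed (simp add: n)
  then have "foldr (\<lambda>c n. lcontract H N (\<alpha> c) (face_coact H M K c n)) (cilia_list K) n
      = foldr (\<lambda>c. face_dual_act H M K c (\<alpha> c)) (cilia_list K) n" by (simp add: cilia)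
  finally show "lcoact (graph_module H M K) n (\<lambda>u m. u (prod_form (cilia K) \<alpha>) * \<nu> m)
        = \<nu> (foldr (\<lambda>c. face_dual_act H M K c (\<alpha> c)) (cilia_list K) n)" .
qed

end

section \<open>Cotensor products\<close>

lemma sum_list_swap:
  "(\<Sum>p\<leftarrow>ps. \<Sum>q\<leftarrow>qs. f p q) = (\<Sum>q\<leftarrow>qs. \<Sum>p\<leftarrow>ps. f p q :: 'a::comm_monoid_add)"
  by (induction ps) (simp_all add: sum_list_addf)

lemma bilin_sum_list:
  "vspace U \<Longrightarrow> (\<And>p. p \<in> set ps \<Longrightarrow> bilin V W U (f p)) \<Longrightarrow> bilin V W U (\<lambda>v w. \<Sum>p\<leftarrow>ps. f p v w)"
  by (intro bilinI lin_sum_list) (auto simp: bilin_def)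

lemma tensor_apply_sum_list:
  assumes "vspace V" "t \<in> carr (tensor V W)" "\<And>p. p \<in> set ps \<Longrightarrow> bilin V W kfield (f p)"
  shows "t (\<lambda>v w. \<Sum>p\<leftarrow>ps. f p v w) = (\<Sum>p\<leftarrow>ps. t (f p))"
proof -
  have "t (\<lambda>v w. \<Sum>p\<leftarrow>ps. f p v w) = (\<Sum>r\<leftarrow>trep V W t. \<Sum>p\<leftarrow>ps. f p (fst r) (snd r))"
    using tensor_apply[OF assms(1,2) bilin_sum_list[OF vspace_kfield assms(3)]] by (simp add: split_def)
  also have "\<dots> = (\<Sum>p\<leftarrow>ps. \<Sum>r\<leftarrow>trep V W t. f p (fst r) (snd r))" by (rule sum_list_swap)
  also have "\<dots> = (\<Sum>p\<leftarrow>ps. t (f p))"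
    using assms(3) by (intro arg_cong[where f = sum_list] map_cong) (auto simp: tensor_apply[OF
        assms(1,2)] split_def)
  finally show ?thesis .
qed

lemma tensor_apply_cmult:
  assumes "vspace V" "t \<in> carr (tensor V W)" "bilin V W kfield \<beta>"
  shows "t (\<lambda>v w. c * \<beta> v w) = c * t \<beta>"
  by (simp add: tensor_apply[OF assms] tensor_apply[OF assms(1,2) bilin_cmult[OF assms(3)]]
      split_def sum_list_const_mult)

text \<open>Pairing a product of coefficients with \<open>\<alpha>\<close> is pairing the
  coefficients with the two legs of the dual coproduct. Through this the coaction of
  \<open>X # Y\<close> at the distinguished cilium becomes a diagonal action of the dual.\<close>

lemma (in fd_algebra) dual_comult_contract:
  assumes X: "vspace X" "s \<in> carr (tensor X H)" and Y: "vspace Y" "t \<in> carr (tensor Y H)"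
    and \<alpha>: "\<alpha> \<in> carr (dual H)" and \<beta>: "bilin X Y kfield \<beta>"
  shows "dual_comult H \<alpha> (\<lambda>\<alpha>1 \<alpha>2. \<beta> (rcontract H X \<alpha>1 s) (rcontract H Y \<alpha>2 t))
    = (\<Sum>(x, a)\<leftarrow>trep X H s. \<Sum>(y, b)\<leftarrow>trep Y H t. \<beta> x y * \<alpha> (amult H a b))"
proof -
  let ?D = "dual H"
  note r = trep(1)[OF X] and r' = trep(1)[OF Y]
  \<comment> \<open>One summand for each pair of representing pure tensors. It is bilinear in the
    functionals, so evaluating \<open>dual_comult H \<alpha>\<close> can be exchanged with the
    finite sums.\<close>
  define G where "G p q \<alpha>1 \<alpha>2 = \<beta> (fst p) (fst q) * (\<alpha>1 (snd p) * \<alpha>2 (snd q))"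
    for p q and \<alpha>1 \<alpha>2 :: "'h \<Rightarrow> 'k"
  have m: "bilin ?D ?D kfield (\<lambda>\<alpha>1 \<alpha>2. \<alpha>1 a * \<alpha>2 b)" for a b by (intro bilin_mult lin_eval) simp_all
  have G: "bilin ?D ?D kfield (G p q)" for p q unfolding G_def by (intro bilin_cmult m)
  have "dual_comult H \<alpha> (\<lambda>\<alpha>1 \<alpha>2. \<beta> (rcontract H X \<alpha>1 s) (rcontract H Y \<alpha>2 t))
      = dual_comult H \<alpha> (\<lambda>\<alpha>1 \<alpha>2. \<Sum>p\<leftarrow>trep X H s. \<Sum>q\<leftarrow>trep Y H t. G p q \<alpha>1 \<alpha>2)"
  proof (rule tensor_cong[OF vspace_dual vspace_dual dual_comult_mem[OF \<alpha>]])
    fix \<alpha>1 \<alpha>2 assume a: "\<alpha>1 \<in> carr ?D" "\<alpha>2 \<in> carr ?D"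
    have t: "rcontract H Y \<alpha>2 t \<in> carr Y" by (rule rcontract_mem[OF vspace_H Y])
    note a1 = dual_lin[OF a(1)] and a2 = dual_lin[OF a(2)]
    have "\<beta> (rcontract H X \<alpha>1 s) (rcontract H Y \<alpha>2 t) = s (\<lambda>x a. \<beta> x (rcontract H Y \<alpha>2 t) * \<alpha>1 a)"
      by (rule rcontract_functional[OF vspace_H X a1 bilin_left[OF \<beta> t]])
    also have "\<dots> = (\<Sum>p\<leftarrow>trep X H s. \<beta> (fst p) (rcontract H Y \<alpha>2 t) * \<alpha>1 (snd p))"
      using tensor_apply[OF X bilin_mult[OF bilin_left[OF \<beta> t] a1]] by (simp add: split_def)
    also have "\<dots> = (\<Sum>p\<leftarrow>trep X H s. \<Sum>q\<leftarrow>trep Y H t. G p q \<alpha>1 \<alpha>2)"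
    proof (intro arg_cong[where f = sum_list] map_cong refl)
      fix p assume "p \<in> set (trep X H s)"
      then have p: "fst p \<in> carr X" using r by auto
      have "\<beta> (fst p) (rcontract H Y \<alpha>2 t) = (\<Sum>q\<leftarrow>trep Y H t. \<beta> (fst p) (fst q) * \<alpha>2 (snd q))"
        using rcontract_functional[OF vspace_H Y a2 bilin_right[OF \<beta> p]]
          tensor_apply[OF Y bilin_mult[OF bilin_right[OF \<beta> p] a2]] by (simp add: split_def)
      then show "\<beta> (fst p) (rcontract H Y \<alpha>2 t) * \<alpha>1 (snd p) = (\<Sum>q\<leftarrow>trep Y H t. G p q \<alpha>1 \<alpha>2)"
        by (simp add: G_def sum_list_const_mult mult_ac)
    qed
    finally show "\<beta> (rcontract H X \<alpha>1 s) (rcontract H Y \<alpha>2 t)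
        = (\<Sum>p\<leftarrow>trep X H s. \<Sum>q\<leftarrow>trep Y H t. G p q \<alpha>1 \<alpha>2)" .
  qed
  also have "\<dots> = (\<Sum>p\<leftarrow>trep X H s. \<Sum>q\<leftarrow>trep Y H t. dual_comult H \<alpha> (G p q))"
    by (subst tensor_apply_sum_list[OF vspace_dual dual_comult_mem[OF \<alpha>] bilin_sum_list[OF vspace_kfield
        G]])
      (simp add: tensor_apply_sum_list[OF vspace_dual dual_comult_mem[OF \<alpha>] G])
  also have "\<dots> = (\<Sum>p\<leftarrow>trep X H s. \<Sum>q\<leftarrow>trep Y H t. \<beta> (fst p) (fst q) * \<alpha> (amult H (snd p) (snd q)))"
    using r r' unfolding G_def
    by (intro arg_cong[where f = sum_list] map_cong refl)
      (subst tensor_apply_cmult[OF vspace_dual dual_comult_mem[OF \<alpha>] m], subst dual_comult_eval[OF \<alpha>],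
          auto)
  finally show ?thesis by (simp add: split_def)
qed

lemma rcontract_tens:
  "vspace H \<Longrightarrow> vspace N \<Longrightarrow> lin H kfield \<alpha> \<Longrightarrow> n \<in> carr N \<Longrightarrow> a \<in> carr H \<Longrightarrow>
    rcontract H N \<alpha> (tens N H n a) = scl N (\<alpha> a) n"
  unfolding rcontract_def by (rule tlift_tens[OF _ _ _ bilin_rcontract_form])

lemma lin_rcontract:
  "vspace H \<Longrightarrow> vspace N \<Longrightarrow> lin H kfield \<alpha> \<Longrightarrow> lin (tensor N H) N (rcontract H N \<alpha>)"
  unfolding rcontract_def by (rule tensor_universal(1)[OF _ _ _ bilin_rcontract_form])

section \<open>Diagonal actions on a tensor product of two spaces\<close>

context coassoc
begin

definition diag :: "('k, 'x::ab_group_add, 'c) kspace_scheme \<Rightarrow> ('k, 'y::ab_group_add, 'd) kspace_scheme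
    \<Rightarrow> ('v \<Rightarrow> 'x \<Rightarrow> 'x) \<Rightarrow> ('v \<Rightarrow> 'y \<Rightarrow> 'y) \<Rightarrow> 'v \<Rightarrow> 'x \<Rightarrow> 'y \<Rightarrow> ('x \<Rightarrow> 'y \<Rightarrow> 'k) \<Rightarrow> 'k" where
  "diag X Y p q v x y = tlift V V (\<lambda>v1 v2. tens X Y (p v1 x) (q v2 y)) (D v)"

lemma lin_diag:
  fixes X :: "('k, 'x::ab_group_add, 'c) kspace_scheme" and Y :: "('k, 'y::ab_group_add, 'd)
      kspace_scheme"
  assumes X: "vspace X" "bilin V X X p" and Y: "vspace Y" "bilin V Y Y q"
  shows "v \<in> carr V \<Longrightarrow> bilin X Y (tensor X Y) (diag X Y p q v)"
    and "x \<in> carr X \<Longrightarrow> y \<in> carr Y \<Longrightarrow> lin V (tensor X Y) (\<lambda>v. diag X Y p q v x y)"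
proof -
  show "lin V (tensor X Y) (\<lambda>v. diag X Y p q v x y)" if "x \<in> carr X" "y \<in> carr Y"
    unfolding diag_def using that
    by (intro lin_tlift_D vspace_tensor bilin_comp2[OF bilin_tens] bilin_left[OF X(2)] bilin_left[OF
        Y(2)])
  show "bilin X Y (tensor X Y) (diag X Y p q v)" if v: "v \<in> carr V"
    unfolding diag_def
  proof (intro bilinI lin_tlift_param V vspace_tensor D_mem v)
    fix v1 v2 w assume "v1 \<in> carr V" "v2 \<in> carr V"
    then show "w \<in> carr Y \<Longrightarrow> lin X (tensor X Y) (\<lambda>x. tens X Y (p v1 x) (q v2 w))"
      by (intro lin_comp[OF bilin_right[OF X(2)] bilin_left[OF bilin_tens]] bilin_mem[OF Y(2)])
  next
    fix v1 v2 w assume "v1 \<in> carr V" "v2 \<in> carr V"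
    then show "w \<in> carr X \<Longrightarrow> lin Y (tensor X Y) (\<lambda>y. tens X Y (p v1 w) (q v2 y))"
      by (intro lin_comp[OF bilin_right[OF Y(2)] bilin_right[OF bilin_tens]] bilin_mem[OF X(2)])
  qed
qed

end

text \<open>The counterpart of \<open>graph_pair_ops\<close> on the side of \<open>X # Y\<close>. It
  is used with \<open>V\<close> equal to \<open>H\<close> for the actions and equal to the dual of
  \<open>H\<close> for the contracted coactions.\<close>

locale sum_ops = two_graphs \<Gamma> \<Delta> + coassoc V D
  for \<Gamma> \<Delta> :: "'g kgraph" and V :: "('k::field, 'v::ab_group_add, 'z) kspace_scheme"
    and D :: "'v \<Rightarrow> ('v \<Rightarrow> 'v \<Rightarrow> 'k) \<Rightarrow> 'k" +
  fixes X :: "('k, 'x::ab_group_add, 'c) kspace_scheme" and Y :: "('k, 'y::ab_group_add, 'd)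
      kspace_scheme"
    and p :: "'g \<Rightarrow> 'v \<Rightarrow> 'x \<Rightarrow> 'x" and q :: "'g \<Rightarrow> 'v \<Rightarrow> 'y \<Rightarrow> 'y"
    and r :: "'g \<Rightarrow> 'v \<Rightarrow> (('x \<Rightarrow> 'y \<Rightarrow> 'k) \<Rightarrow> 'k) \<Rightarrow> ('x \<Rightarrow> 'y \<Rightarrow> 'k) \<Rightarrow> 'k"
  assumes XV: "vspace X" and YV: "vspace Y"
    and p: "\<And>c. c \<in> cilia \<Gamma> \<Longrightarrow> bilin V X X (p c)" and q: "\<And>c. c \<in> cilia \<Delta> \<Longrightarrow> bilin V Y Y (q c)"
    and r: "\<And>c. c \<in> cilia G \<Longrightarrow> bilin V (tensor X Y) (tensor X Y) (r c)"
    and r_base: "\<And>v x y. v \<in> carr V \<Longrightarrow> x \<in> carr X \<Longrightarrow> y \<in> carr Y \<Longrightarrow>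
      r (base \<Gamma>) v (tens X Y x y) = diag X Y (p (base \<Gamma>)) (q (base \<Delta>)) v x y"
    and r_left: "\<And>c v x y. c \<in> cilia \<Gamma> \<Longrightarrow> c \<noteq> base \<Gamma> \<Longrightarrow> v \<in> carr V \<Longrightarrow> x \<in> carr X \<Longrightarrow> y \<in> carr Y \<Longrightarrow>
      r c v (tens X Y x y) = tens X Y (p c v x) y"
    and r_right: "\<And>c v x y. c \<in> cilia \<Delta> \<Longrightarrow> c \<noteq> base \<Delta> \<Longrightarrow> v \<in> carr V \<Longrightarrow> x \<in> carr X \<Longrightarrow> y \<in> carr Y \<Longrightarrow>
      r c v (tens X Y x y) = tens X Y x (q c v y)"
begin

text \<open>In \<open>foldl\<close> the distinguished cilium acts first and produces a sum over the
  legs of the coproduct. On every summand each remaining cilium acts on one factor only.\<close>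

lemma foldl_r_tens:
  assumes v: "\<And>c. c \<in> cilia G \<Longrightarrow> v c \<in> carr V" and x: "x \<in> carr X" and y: "y \<in> carr Y"
  shows "foldl (\<lambda>z c. r c (v c) z) (tens X Y x y) (cilia_list G) = tlift V V (\<lambda>v1 v2.
      tens X Y (foldl (\<lambda>x c. p c ((v(base \<Gamma> := v1)) c) x) x (cilia_list \<Gamma>))
        (foldl (\<lambda>y c. q c ((v(base \<Delta> := v2)) c) y) y (cilia_list \<Delta>))) (D (v (base \<Gamma>)))"
proof -
  obtain cs where cs: "cilia_list \<Gamma> = base \<Gamma> # cs" "distinct cs" "set cs = cilia \<Gamma> - {base \<Gamma>}"
    by (rule G1.cilia_list)
  obtain ds where ds: "cilia_list \<Delta> = base \<Delta> # ds" "distinct ds" "set ds = cilia \<Delta> - {base \<Delta>}"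
    by (rule G2.cilia_list)
  have vc: "v c \<in> carr V" if "c \<in> set cs" for c using v that cs by (auto simp: G_simps)
  have vd: "v c \<in> carr V" if "c \<in> set ds" for c using v that ds by (auto simp: G_simps)
  have csd: "set (cs @ ds) \<subseteq> cilia G" using cs ds by (auto simp: G_simps)
  have vb: "v (base \<Gamma>) \<in> carr V" using v G1.base_cilia by (auto simp: G_simps)
  have c1: "foldl (\<lambda>z c. r c (v c) z) (tens X Y x y) es = tens X Y (foldl (\<lambda>x c. p c (v c) x) x es) y
      \<and> foldl (\<lambda>x c. p c (v c) x) x es \<in> carr X"
    if "set es \<subseteq> set cs" "x \<in> carr X" "y \<in> carr Y" for es x y
    using that
  proof (induction es rule: rev_induct)
    case (snoc e es)
    then show ?case using cs vc by (auto intro!: r_left bilin_mem[OF p])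
  qed simp
  have d1: "foldl (\<lambda>z c. r c (v c) z) (tens X Y x y) es = tens X Y x (foldl (\<lambda>y c. q c (v c) y) y es)
      \<and> foldl (\<lambda>y c. q c (v c) y) y es \<in> carr Y"
    if "set es \<subseteq> set ds" "x \<in> carr X" "y \<in> carr Y" for es x y
    using that
  proof (induction es rule: rev_induct)
    case (snoc e es)
    then show ?case using ds vd by (auto intro!: r_right bilin_mem[OF q])
  qed simp
  have pb: "bilin V X X (p (base \<Gamma>))" and qb: "bilin V Y Y (q (base \<Delta>))"
    using p q G1.base_cilia G2.base_cilia by auto
  have lin: "lin (tensor X Y) (tensor X Y) (\<lambda>z. foldl (\<lambda>z c. r c (v c) z) z (cs @ ds))"
    using csd v by (intro lin_foldl[where V = V] r) auto
  have "foldl (\<lambda>z c. r c (v c) z) (tens X Y x y) (cilia_list G)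
      = foldl (\<lambda>z c. r c (v c) z) (diag X Y (p (base \<Gamma>)) (q (base \<Delta>)) (v (base \<Gamma>)) x y) (cs @ ds)"
    by (simp add: cilia_list_G cs(1) ds(1) r_base[OF vb x y])
  also have "\<dots> = tlift V V (\<lambda>v1 v2. foldl (\<lambda>z c. r c (v c) z)
      (tens X Y (p (base \<Gamma>) v1 x) (q (base \<Delta>) v2 y)) (cs @ ds)) (D (v (base \<Gamma>)))"
    unfolding diag_def
    by (intro tlift_comm[OF V vspace_tensor vspace_tensor D_mem[OF vb] lin] tens_mem bilin_mem[OF pb]
        bilin_mem[OF qb] x y)
  also have "\<dots> = tlift V V (\<lambda>v1 v2.
      tens X Y (foldl (\<lambda>x c. p c ((v(base \<Gamma> := v1)) c) x) x (cilia_list \<Gamma>))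
        (foldl (\<lambda>y c. q c ((v(base \<Delta> := v2)) c) y) y (cilia_list \<Delta>))) (D (v (base \<Gamma>)))"
  proof (rule tlift_cong[OF V D_mem[OF vb]])
    fix v1 v2 assume w: "v1 \<in> carr V" "v2 \<in> carr V"
    have "foldl (\<lambda>x c. p c ((v(base \<Gamma> := v1)) c) x) x' cs = foldl (\<lambda>x c. p c (v c) x) x' cs" for x'
      using cs by (intro foldl_cong) auto
    moreover have "foldl (\<lambda>y c. q c ((v(base \<Delta> := v2)) c) y) y' ds = foldl (\<lambda>y c. q c (v c) y) y' ds"
        for y'
      using ds by (intro foldl_cong) auto
    moreover have "p (base \<Gamma>) v1 x \<in> carr X" "q (base \<Delta>) v2 y \<in> carr Y"
      using w x y bilin_mem[OF pb] bilin_mem[OF qb] by auto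
    ultimately show "foldl (\<lambda>z c. r c (v c) z) (tens X Y (p (base \<Gamma>) v1 x) (q (base \<Delta>) v2 y)) (cs @ ds)
      = tens X Y (foldl (\<lambda>x c. p c ((v(base \<Gamma> := v1)) c) x) x (cilia_list \<Gamma>))
        (foldl (\<lambda>y c. q c ((v(base \<Delta> := v2)) c) y) y (cilia_list \<Delta>))"
      unfolding cs(1) ds(1) by (simp add: c1 d1)
  qed
  finally show ?thesis .
qed

end

text \<open>\<open>RX \<alpha>\<close> and \<open>LN \<alpha>\<close> are the operators by which the
  product functional with components \<open>\<alpha> c\<close> acts through the coactions of
  \<open>X\<close> and of \<open>N\<close>.\<close>

locale cotensor_ops = powers H C
  for H :: "('k::field, 'h::ab_group_add) khopf" and C :: "'i set" +
  fixes X :: "('k, 'x::ab_group_add, (('i \<Rightarrow> 'h) \<Rightarrow> 'k) \<Rightarrow> 'k, (('i \<Rightarrow> 'h) \<Rightarrow> 'k) \<Rightarrow> 'k) right_modcomod"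
    and N :: "('k, 'n::ab_group_add, (('i \<Rightarrow> 'h) \<Rightarrow> 'k) \<Rightarrow> 'k, (('i \<Rightarrow> 'h) \<Rightarrow> 'k) \<Rightarrow> 'k) left_modcomod"
    and RX :: "('i \<Rightarrow> 'h \<Rightarrow> 'k) \<Rightarrow> 'x \<Rightarrow> 'x" and LN :: "('i \<Rightarrow> 'h \<Rightarrow> 'k) \<Rightarrow> 'n \<Rightarrow> 'n"
  assumes XV: "vspace X" and NV: "vspace N"
    and rc: "lin X (tensor X HC) (rcoact X)" and lc: "lin N (tensor HC N) (lcoact N)"
    and RX: "\<And>\<alpha>. (\<And>c. c \<in> C \<Longrightarrow> \<alpha> c \<in> carr (dual H)) \<Longrightarrow> lin X X (RX \<alpha>)"
    and LN: "\<And>\<alpha>. (\<And>c. c \<in> C \<Longrightarrow> \<alpha> c \<in> carr (dual H)) \<Longrightarrow> lin N N (LN \<alpha>)"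
    and rc_eval: "\<And>\<alpha> x \<phi>. (\<And>c. c \<in> C \<Longrightarrow> \<alpha> c \<in> carr (dual H)) \<Longrightarrow> x \<in> carr X \<Longrightarrow> lin X kfield \<phi> \<Longrightarrow>
      rcoact X x (\<lambda>x0 u. \<phi> x0 * u (prod_form C \<alpha>)) = \<phi> (RX \<alpha> x)"
    and lc_eval: "\<And>\<alpha> n \<nu>. (\<And>c. c \<in> C \<Longrightarrow> \<alpha> c \<in> carr (dual H)) \<Longrightarrow> n \<in> carr N \<Longrightarrow> lin N kfield \<nu> \<Longrightarrow>
      lcoact N n (\<lambda>u m. u (prod_form C \<alpha>) * \<nu> m) = \<nu> (LN \<alpha> n)"
begin

abbreviation "cot_left \<equiv> tlift X N (\<lambda>x n. tlift X HC (\<lambda>x0 c. tens3 X HC N x0 c n) (rcoact X x))"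
abbreviation "cot_right \<equiv> tlift X N (\<lambda>x n. tlift HC N (\<lambda>c n0. tens3 X HC N x c n0) (lcoact N n))"

lemma cot_mem:
  assumes t: "t \<in> carr (tensor X N)"
  shows "cot_left t \<in> carr (tensor X (tensor HC N))" "cot_right t \<in> carr (tensor X (tensor HC N))"
  using lin_mem[OF rc] lin_mem[OF lc]
  by (intro tlift_mem[OF XV _ t] tlift_mem[OF XV] tlift_mem[OF vspace_ntensor] vspace_tensor; simp add:
      tens3_def)+

lemma cot_eval:
  assumes t: "t \<in> carr (tensor X N)" and \<beta>: "bilin X N kfield \<beta>"
    and \<alpha>: "\<And>c. c \<in> C \<Longrightarrow> \<alpha> c \<in> carr (dual H)"
  defines "\<theta> \<equiv> \<lambda>x s. s (\<lambda>u n. u (prod_form C \<alpha>) * \<beta> x n)"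
  shows "cot_left t \<theta> = t (\<lambda>x n. \<beta> (RX \<alpha> x) n)" "cot_right t \<theta> = t (\<lambda>x n. \<beta> x (LN \<alpha> n))"
proof -
  let ?\<gamma> = "\<lambda>x u n. u (prod_form C \<alpha>) * \<beta> x n"
  have ev: "lin HC kfield (\<lambda>u. u \<mu>)" for \<mu> by (rule lin_eval) simp
  have \<gamma>: "trilin X HC N ?\<gamma>"
    using \<beta> by (intro trilinI lin_cmult lin_multc ev) (auto simp: bilin_def)
  note t3 = tens3_apply[OF \<gamma> XV vspace_ntensor]
  show "cot_left t \<theta> = t (\<lambda>x n. \<beta> (RX \<alpha> x) n)"
    unfolding \<theta>_def
  proof (rule tlift_apply_eq[OF XV NV t bilin_comp2[OF \<beta> RX[OF \<alpha>] lin_id]])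
    fix x n assume x: "x \<in> carr X" and n: "n \<in> carr N"
    note bn = bilin_left[OF \<beta> n]
    have "tlift X HC (\<lambda>x0 c. tens3 X HC N x0 c n) (rcoact X x) (\<lambda>x s. s (?\<gamma> x))
        = rcoact X x (\<lambda>x0 u. \<beta> x0 n * u (prod_form C \<alpha>))"
      by (rule tlift_apply_eq[OF XV vspace_ntensor lin_mem[OF rc x] bilin_mult[OF bn ev]])
        (subst t3, simp_all add: mult.commute)
    also have "\<dots> = \<beta> (RX \<alpha> x) n" by (rule rc_eval[OF \<alpha> x bn])
    finally show "tlift X HC (\<lambda>x0 c. tens3 X HC N x0 c n) (rcoact X x) (\<lambda>x s. s (?\<gamma> x)) = \<beta> (RX \<alpha> x) n"
        .
  qed assumption
  show "cot_right t \<theta> = t (\<lambda>x n. \<beta> x (LN \<alpha> n))"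
    unfolding \<theta>_def
  proof (rule tlift_apply_eq[OF XV NV t bilin_comp2[OF \<beta> lin_id LN[OF \<alpha>]]])
    fix x n assume x: "x \<in> carr X" and n: "n \<in> carr N"
    note bx = bilin_right[OF \<beta> x]
    have "tlift HC N (\<lambda>c n0. tens3 X HC N x c n0) (lcoact N n) (\<lambda>x s. s (?\<gamma> x))
        = lcoact N n (\<lambda>u n0. u (prod_form C \<alpha>) * \<beta> x n0)"
      by (rule tlift_apply_eq[OF vspace_ntensor NV lin_mem[OF lc n] bilin_mult[OF ev bx]])
        (simp add: t3 x)
    also have "\<dots> = \<beta> x (LN \<alpha> n)" by (rule lc_eval[OF \<alpha> n bx])
    finally show "tlift HC N (\<lambda>c n0. tens3 X HC N x c n0) (lcoact N n) (\<lambda>x s. s (?\<gamma> x)) = \<beta> x (LN \<alpha> n)"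
        .
  qed assumption
qed

text \<open>The two coactions are compared through product functionals on the middle factor, which
  separate its points. The form \<open>\<beta>\<close> is allowed to be any bilinear form and not
  just a product; this is what makes the criterion applicable to a form obtained by contracting with
  a second tensor.\<close>

lemma cotensor_iff:
  "t \<in> carr (cotensor (tensor_power H C) X N) \<longleftrightarrow> t \<in> carr (tensor X N) \<and>
     (\<forall>\<alpha> \<beta>. (\<forall>c\<in>C. \<alpha> c \<in> carr (dual H)) \<longrightarrow> bilin X N kfield \<beta> \<longrightarrow>
        t (\<lambda>x n. \<beta> (RX \<alpha> x) n) = t (\<lambda>x n. \<beta> x (LN \<alpha> n)))" (is "_ \<longleftrightarrow> ?T \<and> ?E")
proof -
  have "t \<in> carr (cotensor (tensor_power H C) X N) \<longleftrightarrow> ?T \<and> cot_left t = cot_right t"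
    unfolding cotensor_def by (simp add: tensor_power_same tens3_def[abs_def])
  also have "\<dots> \<longleftrightarrow> ?T \<and> ?E"
  proof (rule conj_cong[OF refl])
    assume t: ?T
    show "cot_left t = cot_right t \<longleftrightarrow> ?E"
    proof
      assume eq: "cot_left t = cot_right t"
      show ?E
      proof (intro allI impI)
        fix \<alpha> \<beta> assume \<alpha>: "\<forall>c\<in>C. \<alpha> c \<in> carr (dual H)" and \<beta>: "bilin X N kfield \<beta>"
        show "t (\<lambda>x n. \<beta> (RX \<alpha> x) n) = t (\<lambda>x n. \<beta> x (LN \<alpha> n))"
          using cot_eval(1)[OF t \<beta>, of \<alpha>] cot_eval(2)[OF t \<beta>, of \<alpha>] \<alpha> eq by simp
      qed
    next
      assume E: ?E
      \<comment> \<open>A product functional on the tensor power times a functional on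
        \<open>N\<close>; together these separate the points of the last two tensor factors.\<close>
      let ?\<Psi> = "{\<lambda>s. s (\<lambda>u n. \<pi> u * \<nu> n) |\<pi> \<nu>. \<pi> \<in> prod_evals \<and> lin N kfield \<nu>}"
      show "cot_left t = cot_right t"
      proof (rule tensor_sep[OF XV vspace_tensor cot_mem[OF t], where \<Phi> = "{\<phi>. lin X kfield \<phi>}" and \<Psi> =
          ?\<Psi>])
        fix \<phi> :: "'x \<Rightarrow> 'k" and \<psi> :: "_ \<Rightarrow> 'k"
        assume "\<phi> \<in> {\<phi>. lin X kfield \<phi>}" "\<psi> \<in> ?\<Psi>"
        then obtain \<alpha> \<nu> where \<phi>: "lin X kfield \<phi>" and \<nu>: "lin N kfield \<nu>"
          and \<alpha>: "\<And>c. c \<in> C \<Longrightarrow> \<alpha> c \<in> carr (dual H)" and \<psi>: "\<psi> = (\<lambda>s. s (\<lambda>u n. u (prod_form C \<alpha>) * \<nu> n))"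
          by (auto simp: prod_evals_def)
        have ev: "lin HC kfield (\<lambda>u. u \<mu>)" for \<mu> by (rule lin_eval) simp
        note \<beta> = bilin_mult[OF \<phi> \<nu>]
        \<comment> \<open>Regroups the factors so that \<open>\<phi> x * \<nu> n\<close> becomes the
          bilinear form to which \<open>cot_eval\<close> applies.\<close>
        have k: "w (\<lambda>x s. \<phi> x * \<psi> s) = w (\<lambda>x s. s (\<lambda>u n. u (prod_form C \<alpha>) * (\<phi> x * \<nu> n)))"
          if w: "w \<in> carr (tensor X (tensor HC N))" for w
        proof (rule tensor_cong[OF XV vspace_tensor w])
          fix x s assume s: "s \<in> carr (tensor HC N)"
          show "\<phi> x * \<psi> s = s (\<lambda>u n. u (prod_form C \<alpha>) * (\<phi> x * \<nu> n))"
            using tensor_apply_cmult[OF vspace_ntensor s bilin_mult[OF ev \<nu>], of "\<phi> x" "prod_form C \<alpha>"]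
            by (simp add: \<psi> mult.left_commute)
        qed
        show "cot_left t (\<lambda>x s. \<phi> x * \<psi> s) = cot_right t (\<lambda>x s. \<phi> x * \<psi> s)"
          unfolding k[OF cot_mem(1)[OF t]] k[OF cot_mem(2)[OF t]]
          using cot_eval(1)[OF t \<beta>, of \<alpha>] cot_eval(2)[OF t \<beta>, of \<alpha>] spec[OF spec[OF E, of \<alpha>], of "\<lambda>x n.
              \<phi> x * \<nu> n"] \<alpha> \<beta> by simp
      next
        fix w assume w: "w \<in> carr (tensor HC N)" and z: "\<And>\<psi>. \<psi> \<in> ?\<Psi> \<Longrightarrow> \<psi> w = 0"
        show "w = 0"
        proof (rule tensor_sep_zero[OF vspace_ntensor NV w prod_evals_lin _ prod_evals_sep
            all_lin_sep[OF NV]])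
          fix \<pi> \<nu> assume "\<pi> \<in> prod_evals" "\<nu> \<in> {\<nu>. lin N kfield \<nu>}"
          then have "(\<lambda>s. s (\<lambda>u n. \<pi> u * \<nu> n)) \<in> ?\<Psi>" by blast
          from z[OF this] show "w (\<lambda>u n. \<pi> u * \<nu> n) = 0" .
        qed simp_all
      qed (auto intro: functional_sep[OF XV] lin_eval)
    qed
  qed
  finally show ?thesis .
qed

lemma vspace_cotensor: "vspace (cotensor (tensor_power H C) X N)"
proof -
  let ?K = "cotensor (tensor_power H C) X N"
  have F: "vector_space (scl ?K)" by (simp add: cotensor_def vector_space_fscl)
  then interpret vector_space "scl ?K" .
  have sc: "scl ?K = fscl" by (simp add: cotensor_def)
  have T: "vspace (tensor X N)" by simp
  have "subspace (carr ?K)"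
  proof (rule subspaceI)
    show "0 \<in> carr ?K" unfolding cotensor_iff using vspace_zero[OF T] by simp
    show "x + y \<in> carr ?K" if "x \<in> carr ?K" "y \<in> carr ?K" for x y
      using that vspace_add[OF T] unfolding cotensor_iff by simp
    show "scl ?K c x \<in> carr ?K" if "x \<in> carr ?K" for c x
      using that vspace_scl[OF T] unfolding cotensor_iff sc by simp
  qed
  then show ?thesis using F by (simp add: vspace_def)
qed

end

section \<open>Bitensor products\<close>

text \<open>Tensors are evaluated at forms, so passing to the tensor product over \<open>A\<close>
  just forgets the values at forms that are not balanced.\<close>

lemma aproj_eval:
  fixes X :: "('k::field, 'x::ab_group_add, 'a::ab_group_add, 'c) right_modcomod"
    and N :: "('k, 'n::ab_group_add, 'a, 'c) left_modcomod"
  assumes "vspace X" "t \<in> carr (tensor X N)"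
  shows "aproj A X N t = (\<lambda>\<beta>. if balanced A X N \<beta> then t \<beta> else 0)"
proof
  fix \<beta>
  show "aproj A X N t \<beta> = (if balanced A X N \<beta> then t \<beta> else 0)"
  proof (cases "balanced A X N \<beta>")
    case True
    then show ?thesis using tlift_apply[OF assms, of "atens A X N" \<beta>]
      by (simp add: aproj_def atens_def balanced_def)
  next
    case False
    then show ?thesis
      by (simp add: aproj_def tlift_trep sum_list_apply atens_def split_def)
  qed
qed

text \<open>On the cotensor product the projection agrees with \<open>?P\<close>, which is linear on
  the whole function space. Hence its image is a subspace and it has a linear right inverse.\<close>

lemma Bit_section:
  fixes X :: "('k::field, 'x::ab_group_add, 'a::ab_group_add, 'c::ab_group_add) right_modcomod"
    and N :: "('k, 'n::ab_group_add, 'a, 'c) left_modcomod"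
  assumes X: "vspace X" and cot: "vspace (cotensor C X N)"
  shows "vspace (Bit A C X N)" "scl (Bit A C X N) = fscl"
    and "\<exists>s. lin (Bit A C X N) (cotensor C X N) s \<and> (\<forall>b\<in>carr (Bit A C X N). aproj A X N (s b) = b)"
    and "lin (cotensor C X N) (Bit A C X N) (aproj A X N)"
proof -
  let ?P = "\<lambda>t \<beta>. if balanced A X N \<beta> then t \<beta> else (0 :: 'k)"
  have Pt: "aproj A X N t = ?P t" if "t \<in> carr (cotensor C X N)" for t
    using that by (intro aproj_eval X) (simp add: cotensor_def)
  interpret vector_space_pair "fscl :: 'k \<Rightarrow> (('x \<Rightarrow> 'n \<Rightarrow> 'k) \<Rightarrow> 'k) \<Rightarrow> _" "fscl :: 'k \<Rightarrow> (('x \<Rightarrow> 'n \<Rightarrow> 'k) \<Rightarrow>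
      'k) \<Rightarrow> _"
    by (intro vector_space_pair.intro vector_space_fscl)
  have lP: "Vector_Spaces.linear fscl fscl ?P"
    by (unfold_locales) (auto simp: fun_eq_iff fscl_def)
  have carr: "carr (Bit A C X N) = ?P ` carr (cotensor C X N)"
    unfolding Bit_def using Pt by auto
  show s: "scl (Bit A C X N) = fscl" by (simp add: Bit_def atensor_def)
  have sc: "scl (cotensor C X N) = fscl" by (simp add: cotensor_def)
  have sub: "vs1.subspace (carr (cotensor C X N))" using cot by (simp add: vspace_def sc)
  show "vspace (Bit A C X N)"
    unfolding vspace_def s carr by (intro conjI vector_space_fscl linear_subspace_image[OF lP sub])
  show "\<exists>s. lin (Bit A C X N) (cotensor C X N) s \<and> (\<forall>b\<in>carr (Bit A C X N). aproj A X N (s b) = b)"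
  proof -
    obtain r where r: "range r \<subseteq> carr (cotensor C X N)" "Vector_Spaces.linear fscl fscl r"
        "\<forall>v\<in>?P ` carr (cotensor C X N). ?P (r v) = v"
      using linear_exists_right_inverse_on[OF lP sub] by blast
    interpret r: Vector_Spaces.linear fscl fscl r by (rule r(2))
    have "lin (Bit A C X N) (cotensor C X N) r"
      using r(1) by (auto simp: lin_def s sc r.add r.scale)
    moreover have "aproj A X N (r b) = b" if "b \<in> carr (Bit A C X N)" for b
    proof -
      have "r b \<in> carr (cotensor C X N)" using r(1) by auto
      moreover have "?P (r b) = b" using r(3) that unfolding carr by blast
      ultimately show ?thesis using Pt by simp
    qed
    ultimately show ?thesis by blast
  qed
  show "lin (cotensor C X N) (Bit A C X N) (aproj A X N)"
    unfolding lin_def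
  proof (intro conjI ballI allI)
    show "aproj A X N ` carr (cotensor C X N) \<subseteq> carr (Bit A C X N)" by (simp add: Bit_def)
    fix x y c assume x: "x \<in> carr (cotensor C X N)"
    show "aproj A X N (scl (cotensor C X N) c x) = scl (Bit A C X N) c (aproj A X N x)"
      using Pt[OF x] Pt[OF vspace_scl[OF cot x]] by (auto simp: s sc fun_eq_iff)
    assume y: "y \<in> carr (cotensor C X N)"
    show "aproj A X N (x + y) = aproj A X N x + aproj A X N y"
      using Pt[OF x] Pt[OF y] Pt[OF vspace_add[OF cot x y]] by (auto simp: fun_eq_iff)
  qed
qed

text \<open>\<open>f\<close> sends a pure tensor of \<open>v\<close> and \<open>w\<close> to the
  class of \<open>\<tau> (s v) (t w)\<close> for chosen sections \<open>s\<close> and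
  \<open>t\<close>. Its value at \<open>\<delta>\<close> is the value of \<open>v\<close> at
  \<open>\<beta>\<close> times that of \<open>w\<close> at \<open>\<gamma>\<close>. These products
  separate the tensor product of the two bitensor products, since a class that vanishes at all
  balanced forms is zero.\<close>

lemma Bit_tensor_embedding:
  fixes X :: "('k::field, 'x::ab_group_add, 'a::ab_group_add, 'c::ab_group_add) right_modcomod"
    and N :: "('k, 'n::ab_group_add, 'a, 'c) left_modcomod"
    and Y :: "('k, 'y::ab_group_add, 'b::ab_group_add, 'd::ab_group_add) right_modcomod"
    and L :: "('k, 'l::ab_group_add, 'b, 'd) left_modcomod"
    and Z :: "('k, 'z::ab_group_add, 'e::ab_group_add, 'f::ab_group_add) right_modcomod"
    and K :: "('k, 'm::ab_group_add, 'e, 'f) left_modcomod"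
  assumes X: "vspace X" and Y: "vspace Y" and Z: "vspace Z"
    and cots: "vspace (cotensor C X N)" "vspace (cotensor C' Y L)" "vspace (cotensor C'' Z K)"
    and \<tau>: "bilin (cotensor C X N) (cotensor C' Y L) (cotensor C'' Z K) \<tau>"
    and bal: "\<And>\<beta> \<gamma>. balanced A X N \<beta> \<Longrightarrow> balanced A' Y L \<gamma> \<Longrightarrow> \<exists>\<delta>. balanced A'' Z K \<delta> \<and>
      (\<forall>s\<in>carr (cotensor C X N). \<forall>t\<in>carr (cotensor C' Y L). \<tau> s t \<delta> = s \<beta> * t \<gamma>)"
  shows "\<exists>f. lin (tensor (Bit A C X N) (Bit A' C' Y L)) (Bit A'' C'' Z K) f
    \<and> inj_on f (carr (tensor (Bit A C X N) (Bit A' C' Y L)))"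
proof -
  let ?V = "Bit A C X N" and ?W = "Bit A' C' Y L" and ?U = "Bit A'' C'' Z K"
  note V = Bit_section[OF X cots(1), of A] and W = Bit_section[OF Y cots(2), of A']
    and U = Bit_section[OF Z cots(3), of A'']
  obtain s where s: "lin ?V (cotensor C X N) s" "\<forall>b\<in>carr ?V. aproj A X N (s b) = b" using V(3) by blast
  obtain t where t: "lin ?W (cotensor C' Y L) t" "\<forall>b\<in>carr ?W. aproj A' Y L (t b) = b" using W(3) by
      blast
  let ?g = "\<lambda>v w. aproj A'' Z K (\<tau> (s v) (t w))"
  have g: "bilin ?V ?W ?U ?g"
    by (rule bilin_comp[OF bilin_comp2[OF \<tau> s(1) t(1)] U(4)])
  define f where "f = tlift ?V ?W ?g"
  have f: "lin (tensor ?V ?W) ?U f" unfolding f_def by (rule tensor_universal(1)[OF V(1) W(1) U(1) g])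
  have tens: "u \<in> carr (tensor X N)" if "u \<in> carr (cotensor C X N)" for u using that by (simp add:
      cotensor_def)
  have tens': "u \<in> carr (tensor Y L)" if "u \<in> carr (cotensor C' Y L)" for u using that by (simp add:
      cotensor_def)
  have tens'': "u \<in> carr (tensor Z K)" if "u \<in> carr (cotensor C'' Z K)" for u using that by (simp add:
      cotensor_def)
  \<comment> \<open>A class and its section agree at balanced forms; at all others the class is
    zero.\<close>
  have sb: "v \<beta> = (if balanced A X N \<beta> then s v \<beta> else 0)" if "v \<in> carr ?V" for v \<beta>
    using aproj_eval[OF X tens[OF lin_mem[OF s(1) that]], of A] s(2) that by (metis (no_types))
  have tb: "w \<beta> = (if balanced A' Y L \<beta> then t w \<beta> else 0)" if "w \<in> carr ?W" for w \<beta>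
    using aproj_eval[OF Y tens'[OF lin_mem[OF t(1) that]], of A'] t(2) that by (metis (no_types))
  have "inj_on f (carr (tensor ?V ?W))"
  proof (rule inj_onI)
    fix u u' assume u: "u \<in> carr (tensor ?V ?W)" "u' \<in> carr (tensor ?V ?W)" and eq: "f u = f u'"
    let ?\<Phi> = "{\<lambda>v :: ('x \<Rightarrow> 'n \<Rightarrow> 'k) \<Rightarrow> 'k. v \<beta> |\<beta>. balanced A X N \<beta>}"
    let ?\<Psi> = "{\<lambda>v :: ('y \<Rightarrow> 'l \<Rightarrow> 'k) \<Rightarrow> 'k. v \<beta> |\<beta>. balanced A' Y L \<beta>}"
    show "u = u'"
    proof (rule tensor_sep[OF V(1) W(1) u, where \<Phi> = ?\<Phi> and \<Psi> = ?\<Psi>])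
      fix \<phi> \<psi> assume "\<phi> \<in> ?\<Phi>" "\<psi> \<in> ?\<Psi>"
      then obtain \<beta> \<gamma> where \<beta>: "balanced A X N \<beta>" "\<phi> = (\<lambda>v. v \<beta>)" and \<gamma>: "balanced A' Y L \<gamma>" "\<psi> = (\<lambda>v. v
          \<gamma>)"
        by blast
      obtain \<delta> where \<delta>: "balanced A'' Z K \<delta>"
          "\<forall>s\<in>carr (cotensor C X N). \<forall>t\<in>carr (cotensor C' Y L). \<tau> s t \<delta> = s \<beta> * t \<gamma>"
        using bal[OF \<beta>(1) \<gamma>(1)] by blast
      have ev: "f w \<delta> = w (\<lambda>v w. \<phi> v * \<psi> w)" if w: "w \<in> carr (tensor ?V ?W)" for w
        unfolding f_def
      proof (rule tlift_apply_eq[OF V(1) W(1) w])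
        show "bilin ?V ?W kfield (\<lambda>v w. \<phi> v * \<psi> w)"
          unfolding \<beta>(2) \<gamma>(2) by (intro bilin_mult lin_eval V W)
        fix a b assume a: "a \<in> carr ?V" and b: "b \<in> carr ?W"
        note sa = lin_mem[OF s(1) a] and tb' = lin_mem[OF t(1) b]
        have "?g a b \<delta> = \<tau> (s a) (t b) \<delta>"
          using aproj_eval[OF Z tens''[OF bilin_mem[OF \<tau> sa tb']], of A''] \<delta>(1) by simp
        also have "\<dots> = s a \<beta> * t b \<gamma>" using \<delta>(2) sa tb' by blast
        finally show "?g a b \<delta> = \<phi> a * \<psi> b" using sb[OF a, of \<beta>] tb[OF b, of \<gamma>] \<beta> \<gamma> by simp
      qed
      show "u (\<lambda>v w. \<phi> v * \<psi> w) = u' (\<lambda>v w. \<phi> v * \<psi> w)"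
        using ev[OF u(1)] ev[OF u(2)] eq by simp
    next
      fix v assume v: "v \<in> carr ?V" and z: "\<And>\<phi>. \<phi> \<in> ?\<Phi> \<Longrightarrow> \<phi> v = 0"
      show "v = 0"
      proof
        fix \<beta>
        show "v \<beta> = 0 \<beta>" using z[of "\<lambda>v. v \<beta>"] sb[OF v, of \<beta>] by (cases "balanced A X N \<beta>") auto
      qed
    next
      fix w assume w: "w \<in> carr ?W" and z: "\<And>\<phi>. \<phi> \<in> ?\<Psi> \<Longrightarrow> \<phi> w = 0"
      show "w = 0"
      proof
        fix \<beta>
        show "w \<beta> = 0 \<beta>" using z[of "\<lambda>v. v \<beta>"] tb[OF w, of \<beta>] by (cases "balanced A' Y L \<beta>") auto
      qed
    qed (use V W in \<open>auto intro: lin_eval\<close>)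
  qed
  then show ?thesis using f by blast
qed

section \<open>Products of functionals over joined index sets\<close>

lemma multilin_split_mult:
  assumes IJ: "I \<inter> J = {}" and \<phi>: "lin (ntensor I V) kfield \<phi>" and \<psi>: "lin (ntensor J V) kfield \<psi>"
  shows "multilin (I \<union> J) V kfield (\<lambda>v. \<phi> (ntens I V v) * \<psi> (ntens J V v))"
proof (rule multilinI)
  fix v i assume v: "v \<in> I \<union> J \<rightarrow>\<^sub>E carr V" and i: "i \<in> I \<union> J"
  have up: "lin V kfield (\<lambda>x. \<chi> (ntens K V (v(i := x))))"
    if "i \<in> K" "K \<subseteq> I \<union> J" "lin (ntensor K V) kfield \<chi>" for K \<chi>
  proof -
    have "ntens K V (v(i := x)) = ntens K V ((restrict v K)(i := x))" for x by (rule ntens_cong) auto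
    moreover have "restrict v K \<in> K \<rightarrow>\<^sub>E carr V" using v that(2) by auto
    ultimately show ?thesis using lin_comp[OF multilin_lin[OF multilin_ntens _ that(1)] that(3)] by simp
  qed
  have const: "ntens K V (v(i := x)) = ntens K V v" if "i \<notin> K" for K x
    using that by (intro ntens_cong) auto
  show "lin V kfield (\<lambda>x. \<phi> (ntens I V (v(i := x))) * \<psi> (ntens J V (v(i := x))))"
  proof (cases "i \<in> I")
    case True
    then have "i \<notin> J" using IJ by auto
    then show ?thesis using up[OF True _ \<phi>] by (simp add: const lin_multc)
  next
    case False
    then have "i \<in> J" using i by auto
    then show ?thesis using up[OF _ _ \<psi>] False by (simp add: const lin_cmult)
  qed
qed (simp add: kfield_def)

text \<open>The product of \<open>\<phi>\<close> and \<open>\<psi>\<close> as a functional on the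
  tensor power over \<open>I \<union> J\<close>, in effect composed with the inverse of
  \<open>njoin\<close>.\<close>

definition join_form :: "'i set \<Rightarrow> 'i set \<Rightarrow> ('k::field, 'v::ab_group_add, 'z) kspace_scheme
    \<Rightarrow> (((('i \<Rightarrow> 'v) \<Rightarrow> 'k) \<Rightarrow> 'k) \<Rightarrow> 'k) \<Rightarrow> (((('i \<Rightarrow> 'v) \<Rightarrow> 'k) \<Rightarrow> 'k) \<Rightarrow> 'k)
    \<Rightarrow> ((('i \<Rightarrow> 'v) \<Rightarrow> 'k) \<Rightarrow> 'k) \<Rightarrow> 'k" where
  "join_form I J V \<phi> \<psi> = nlift (I \<union> J) V (\<lambda>v. \<phi> (ntens I V v) * \<psi> (ntens J V v))"

lemma join_form:
  assumes I: "I \<noteq> {}" and J: "J \<noteq> {}" and IJ: "I \<inter> J = {}" and V: "vspace V"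
    and \<phi>: "lin (ntensor I V) kfield \<phi>" and \<psi>: "lin (ntensor J V) kfield \<psi>"
  shows lin_join_form: "lin (ntensor (I \<union> J) V) kfield (join_form I J V \<phi> \<psi>)"
    and join_form_njoin: "s \<in> carr (ntensor I V) \<Longrightarrow> t \<in> carr (ntensor J V) \<Longrightarrow>
      join_form I J V \<phi> \<psi> (njoin I J V s t) = \<phi> s * \<psi> t"
proof -
  have U: "I \<union> J \<noteq> {}" using I by auto
  note m = multilin_split_mult[OF IJ \<phi> \<psi>]
  show l: "lin (ntensor (I \<union> J) V) kfield (join_form I J V \<phi> \<psi>)"
    unfolding join_form_def by (rule lin_nlift[OF V vspace_kfield m U])
  note nj = bilin_njoin[OF I J IJ V]
  assume s: "s \<in> carr (ntensor I V)" and t: "t \<in> carr (ntensor J V)"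
  show "join_form I J V \<phi> \<psi> (njoin I J V s t) = \<phi> s * \<psi> t"
  proof (rule ntensor_lin_eq[OF I V lin_comp[OF bilin_left[OF nj t] l] lin_multc[OF \<phi>] vspace_kfield _
      s])
    fix p assume p: "p \<in> I \<rightarrow>\<^sub>E carr V"
    show "join_form I J V \<phi> \<psi> (njoin I J V (ntens I V p) t) = \<phi> (ntens I V p) * \<psi> t"
    proof (rule ntensor_lin_eq[OF J V lin_comp[OF bilin_right[OF nj ntens_mem_PiE[OF p]] l] lin_cmult[OF
        \<psi>] vspace_kfield _ t])
      fix q assume q: "q \<in> J \<rightarrow>\<^sub>E carr V"
      let ?v = "\<lambda>i. if i \<in> I then p i else q i"
      have v: "?v \<in> I \<union> J \<rightarrow>\<^sub>E carr V" by (rule PiE_join[OF p q])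
      have "join_form I J V \<phi> \<psi> (ntens (I \<union> J) V ?v) = \<phi> (ntens I V ?v) * \<psi> (ntens J V ?v)"
        unfolding join_form_def by (rule ntensor_universal(2)[OF V vspace_kfield m U v])
      moreover have "ntens I V ?v = ntens I V p" "ntens J V ?v = ntens J V q"
        using IJ by (auto intro!: ntens_cong)
      ultimately show "join_form I J V \<phi> \<psi> (njoin I J V (ntens I V p) (ntens J V q)) = \<phi> (ntens I V p) *
          \<psi> (ntens J V q)"
        by (simp add: njoin_ntens_PiE[OF I J IJ V p q])
    qed
  qed
qed

section \<open>The connected sum of module-comodules\<close>

text \<open>Linearity in each of four arguments, arranged in the two pairs in which such a form is
  contracted with tensors.\<close>

definition quadlin :: "('k::field, 'x::ab_group_add, 'a) kspace_scheme \<Rightarrow> ('k, 'm::ab_group_add, 'b)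
    kspace_scheme
    \<Rightarrow> ('k, 'y::ab_group_add, 'c) kspace_scheme \<Rightarrow> ('k, 'n::ab_group_add, 'd) kspace_scheme
    \<Rightarrow> ('x \<Rightarrow> 'm \<Rightarrow> 'y \<Rightarrow> 'n \<Rightarrow> 'k) \<Rightarrow> bool" where
  "quadlin X M Y N Q \<longleftrightarrow> (\<forall>x\<in>carr X. \<forall>m\<in>carr M. bilin Y N kfield (Q x m))
     \<and> (\<forall>y\<in>carr Y. \<forall>n\<in>carr N. bilin X M kfield (\<lambda>x m. Q x m y n))"

locale tensor_pair =
  fixes X :: "('k::field, 'x::ab_group_add, 'a) kspace_scheme" and M :: "('k, 'm::ab_group_add, 'b)
      kspace_scheme"
    and Y :: "('k, 'y::ab_group_add, 'c) kspace_scheme" and N :: "('k, 'n::ab_group_add, 'd)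
        kspace_scheme"
  assumes X: "vspace X" and M: "vspace M" and Y: "vspace Y" and N: "vspace N"
begin

lemma quadlin_contract:
  assumes Q: "quadlin X M Y N Q" and t: "t \<in> carr (tensor Y N)"
  shows "bilin X M kfield (\<lambda>x m. t (Q x m))"
  using Q unfolding quadlin_def
  by (intro bilinI lin_apply_param[OF Y t X] lin_apply_param[OF Y t M]) (auto simp: bilin_def)

lemma quadlin_comp:
  assumes Q: "quadlin X M Y N Q" and f: "lin X X f" "lin M M f'" "lin Y Y g" "lin N N g'"
  shows "quadlin X M Y N (\<lambda>x m y n. Q (f x) (f' m) (g y) (g' n))"
  unfolding quadlin_def
proof (intro conjI ballI)
  fix x m assume "x \<in> carr X" "m \<in> carr M"
  then show "bilin Y N kfield (\<lambda>y n. Q (f x) (f' m) (g y) (g' n))"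
    using Q by (intro bilin_comp2[OF _ f(3,4)]) (simp add: quadlin_def lin_mem[OF f(1)] lin_mem[OF
        f(2)])
next
  fix y n assume "y \<in> carr Y" "n \<in> carr N"
  then show "bilin X M kfield (\<lambda>x m. Q (f x) (f' m) (g y) (g' n))"
    using Q by (intro bilin_comp2[OF _ f(1,2), where f = "\<lambda>x m. Q x m (g y) (g' n)"])
      (simp add: quadlin_def lin_mem[OF f(3)] lin_mem[OF f(4)])
qed

lemma quadlin_sum:
  assumes Q: "\<And>r. r \<in> set rs \<Longrightarrow> quadlin X M Y N (Q r)"
    and s: "s \<in> carr (tensor X M)" and t: "t \<in> carr (tensor Y N)"
  shows "s (\<lambda>x m. t (\<lambda>y n. \<Sum>r\<leftarrow>rs. Q r x m y n)) = (\<Sum>r\<leftarrow>rs. s (\<lambda>x m. t (Q r x m)))"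
proof -
  have "s (\<lambda>x m. t (\<lambda>y n. \<Sum>r\<leftarrow>rs. Q r x m y n)) = s (\<lambda>x m. \<Sum>r\<leftarrow>rs. t (Q r x m))"
    using Q by (intro tensor_cong[OF X M s] tensor_apply_sum_list[OF Y t]) (auto simp: quadlin_def)
  also have "\<dots> = (\<Sum>r\<leftarrow>rs. s (\<lambda>x m. t (Q r x m)))"
    by (intro tensor_apply_sum_list[OF X s] quadlin_contract[OF Q t])
  finally show ?thesis .
qed

text \<open>Each condition is applied to a bilinear form made from \<open>Q\<close>: the one for
  \<open>t\<close> with \<open>x\<close> and \<open>m\<close> fixed, the one for \<open>s\<close>
  after contracting with \<open>t\<close>.\<close>

lemma quadlin_balanced:
  assumes Q: "quadlin X M Y N Q" and f: "lin X X f" "lin M M f'" "lin Y Y g" "lin N N g'"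
    and s: "s \<in> carr (tensor X M)" and t: "t \<in> carr (tensor Y N)"
    and bs: "\<And>\<beta>. bilin X M kfield \<beta> \<Longrightarrow> s (\<lambda>x m. \<beta> (f x) m) = s (\<lambda>x m. \<beta> x (f' m))"
    and bt: "\<And>\<beta>. bilin Y N kfield \<beta> \<Longrightarrow> t (\<lambda>y n. \<beta> (g y) n) = t (\<lambda>y n. \<beta> y (g' n))"
  shows "s (\<lambda>x m. t (\<lambda>y n. Q (f x) m (g y) n)) = s (\<lambda>x m. t (\<lambda>y n. Q x (f' m) y (g' n)))"
proof -
  have "s (\<lambda>x m. t (\<lambda>y n. Q (f x) m (g y) n)) = s (\<lambda>x m. t (\<lambda>y n. Q (f x) m y (g' n)))"
    using Q lin_mem[OF f(1)] by (intro tensor_cong[OF X M s] bt) (auto simp: quadlin_def)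
  also have "\<dots> = s (\<lambda>x m. t (\<lambda>y n. Q x (f' m) y (g' n)))"
    using bs[OF quadlin_contract[OF quadlin_comp[OF Q lin_id lin_id lin_id f(4)] t]] .
  finally show ?thesis .
qed

end

lemma bilin_tlift_body:
  assumes X: "vspace X" and Y: "vspace Y" and U: "vspace U"
    and B: "\<And>v. v \<in> carr V \<Longrightarrow> bilin X Y U (B v)"
      "\<And>x y. x \<in> carr X \<Longrightarrow> y \<in> carr Y \<Longrightarrow> lin V U (\<lambda>v. B v x y)"
  shows "bilin V (tensor X Y) U (\<lambda>v. tlift X Y (B v))"
  by (intro bilinI lin_tlift_param[OF X U] tensor_universal(1)[OF X Y U] B)

section \<open>Vertex and face operators for the given Hopf bimodule\<close>

locale connected_sum_modules = two_graphs \<Gamma> \<Delta> for \<Gamma> \<Delta> :: "'g kgraph" +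
  fixes H :: "('k::field, 'h::ab_group_add) khopf"
    and M :: "('k, 'm::ab_group_add, 'h) hopf_bimod"
    and X :: "('k, 'x::ab_group_add, (('g \<Rightarrow> 'h) \<Rightarrow> 'k) \<Rightarrow> 'k, (('g \<Rightarrow> 'h) \<Rightarrow> 'k) \<Rightarrow> 'k) right_modcomod"
    and Y :: "('k, 'y::ab_group_add, (('g \<Rightarrow> 'h) \<Rightarrow> 'k) \<Rightarrow> 'k, (('g \<Rightarrow> 'h) \<Rightarrow> 'k) \<Rightarrow> 'k) right_modcomod"
  assumes hopf: "hopf_algebra H" and fdim: "finite_dim H" and M: "involutive_hopf_bimodule H M"
    and modX: "right_module_comodule (graph_algebra H \<Gamma>) X"
    and modY: "right_module_comodule (graph_algebra H \<Delta>) Y"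
begin

lemma vspace_H: "vspace H"
  using hopf by (simp add: hopf_algebra_def is_algebra_def)

lemma finite_cilia_G: "finite (cilia G)" "cilia G \<noteq> {}"
  using G1.finite_cilia G2.finite_cilia G1.base_cilia by (auto simp: G_simps)

sublocale P1: tensor_power_modcomod H "cilia \<Gamma>" X
  using vspace_H fdim hopf modX G1.finite_cilia G1.base_cilia
  by unfold_locales (auto simp: graph_algebra_def)

sublocale P2: tensor_power_modcomod H "cilia \<Delta>" Y
  using vspace_H fdim hopf modY G2.finite_cilia G2.base_cilia
  by unfold_locales (auto simp: graph_algebra_def)

sublocale PG: hopf_powers H "cilia G"
  using vspace_H fdim hopf finite_cilia_G by unfold_locales auto

text \<open>Together with \<open>face_map\<close> below, the operators L and T of a half-edge on its
  own copy of \<open>M\<close>; \<open>s\<close> marks a source.\<close>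

definition vertex_map :: "bool \<Rightarrow> 'h \<Rightarrow> 'm \<Rightarrow> 'm" where
  "vertex_map s a m = (if s then bract M m (antipode H a) else lact M a m)"

definition face_map :: "bool \<Rightarrow> ('h \<Rightarrow> 'k) \<Rightarrow> 'm \<Rightarrow> 'm" where
  "face_map s \<alpha> m = (if s then lcontract H M \<alpha> (lcoact M m)
     else rcontract H M (\<lambda>a. \<alpha> (antipode H a)) (brcoact M m))"

lemma vspace_M: "vspace M" and bimodule:
  "bilin H M M (lact M)" "bilin M H M (bract M)" "lin M (tensor H M) (lcoact M)" "lin M (tensor M H)
      (brcoact M)"
  using M by (auto simp: involutive_hopf_bimodule_def left_module_def right_module_def
      left_comodule_def right_comodule_def)

lemma lin_antipode: "lin H H (antipode H)"
  using hopf by (simp add: hopf_algebra_def)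

lemma bilin_vertex_map: "bilin H M M (vertex_map s)"
proof (cases s)
  case True
  have "bilin H M M (\<lambda>a m. bract M m (antipode H a))"
    using bilin_comp2[OF bimodule(2) lin_id lin_antipode] by (simp add: bilin_def)
  then show ?thesis using True by (simp add: vertex_map_def[abs_def])
next
  case False
  then show ?thesis using bimodule(1) by (simp add: vertex_map_def[abs_def])
qed

lemma bilin_face_map: "bilin (dual H) M M (face_map s)"
proof (cases s)
  case True
  then show ?thesis using bilin_lcontract[OF vspace_H vspace_M bimodule(3)] by (simp add:
      face_map_def[abs_def])
next
  case False
  have "bilin (dual H) M M (\<lambda>\<alpha> m. rcontract H M (\<lambda>a. \<alpha> (antipode H a)) (brcoact M m))"
  proof (rule bilinI)
    show "lin (dual H) M (\<lambda>\<alpha>. rcontract H M (\<lambda>a. \<alpha> (antipode H a)) (brcoact M m))" if "m \<in> carr M" for m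
      unfolding rcontract_def
      by (intro lin_tlift_param vspace_M lin_mem[OF bimodule(4) that] lin_scl_left lin_eval) simp_all
    show "lin M M (\<lambda>m. rcontract H M (\<lambda>a. \<alpha> (antipode H a)) (brcoact M m))" if "\<alpha> \<in> carr (dual H)" for \<alpha>
      by (rule lin_comp[OF bimodule(4) lin_rcontract[OF vspace_H vspace_M lin_comp[OF lin_antipode
          dual_lin[OF that]]]])
  qed
  then show ?thesis using False by (simp add: face_map_def[abs_def])
qed

lemma edge_act_edge_op: "edge_act H M K = edge_op M vertex_map K"
  by (intro ext) (simp add: edge_act_def on_edge_nslot edge_op_def vertex_map_def[abs_def])

lemma edge_dual_act_edge_op: "edge_dual_act H M K = edge_op M face_map K"
  unfolding edge_dual_act_def[abs_def] on_edge_nslot edge_op_def[abs_def] face_map_def[abs_def]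
    lcontract_def rcontract_def ..

sublocale V: graph_pair_ops \<Gamma> \<Delta> H "comult H" M vertex_map True "\<lambda>K c. support (rho K) c"
proof unfold_locales
  show "coassociative H (comult H)" by (rule coassociative_comult[OF P1.coalgH])
  show "support (rho \<Gamma>) c \<noteq> [] \<and> set (support (rho \<Gamma>) c) \<subseteq> hedges \<Gamma>" if "c \<in> cilia \<Gamma>" for c
    using G1.set_support[OF G1.rho_permutes] that G1.cilia_sub by blast
  show "support (rho \<Delta>) c \<noteq> [] \<and> set (support (rho \<Delta>) c) \<subseteq> hedges \<Delta>" if "c \<in> cilia \<Delta>" for c
    using G2.set_support[OF G2.rho_permutes] that G2.cilia_sub by blast
qed (rule vspace_M bilin_vertex_map vertex_support_G; assumption?)+

text \<open>The flag is \<open>False\<close> because in the face coaction the operator applied last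
  takes the first leg of the dual coproduct.\<close>

sublocale F: graph_pair_ops \<Gamma> \<Delta> "dual H" "dual_comult H" M face_map False
  "\<lambda>K c. rev (support (face_perm K) (inv (rho K) c))"
proof unfold_locales
  show "coassociative (dual H) (dual_comult H)" by (rule P1.coassociative_dual)
  show "rev (support (face_perm \<Gamma>) (inv (rho \<Gamma>) c)) \<noteq> [] \<and>
      set (rev (support (face_perm \<Gamma>) (inv (rho \<Gamma>) c))) \<subseteq> hedges \<Gamma>" if "c \<in> cilia \<Gamma>" for c
  proof -
    have "inv (rho \<Gamma>) c \<in> hedges \<Gamma>" using that G1.cilia_sub inv_rho_mem by blast
    from G1.set_support[OF G1.face_perm_permutes this] show ?thesis by (simp only: rev_is_Nil_conv
        set_rev) blast
  qed
  show "rev (support (face_perm \<Delta>) (inv (rho \<Delta>) c)) \<noteq> [] \<and>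
      set (rev (support (face_perm \<Delta>) (inv (rho \<Delta>) c))) \<subseteq> hedges \<Delta>" if "c \<in> cilia \<Delta>" for c
  proof -
    have "inv (rho \<Delta>) c \<in> hedges \<Delta>" using that G2.cilia_sub inv_rho_mem by blast
    from G2.set_support[OF G2.face_perm_permutes this] show ?thesis by (simp only: rev_is_Nil_conv
        set_rev) blast
  qed
  \<comment> \<open>Reversal puts the part of \<open>\<Gamma>\<close> in front, so the first leg of
    the dual coproduct goes to \<open>\<Gamma>\<close>, as it does in \<open>X # Y\<close>.\<close>
  show "rev (support (face_perm G) (inv (rho G) (base \<Gamma>))) =
      rev (support (face_perm \<Gamma>) (inv (rho \<Gamma>) (base \<Gamma>))) @ rev (support (face_perm \<Delta>) (inv (rho \<Delta>) (base
          \<Delta>)))"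
    unfolding face_support_G(1) by (rule rev_append)
  show "rev (support (face_perm G) (inv (rho G) c)) = rev (support (face_perm \<Gamma>) (inv (rho \<Gamma>) c))"
    if "c \<in> cilia \<Gamma>" "c \<noteq> base \<Gamma>" for c unfolding face_support_G(2)[OF that] ..
  show "rev (support (face_perm G) (inv (rho G) c)) = rev (support (face_perm \<Delta>) (inv (rho \<Delta>) c))"
    if "c \<in> cilia \<Delta>" "c \<noteq> base \<Delta>" for c unfolding face_support_G(3)[OF that] ..
qed (rule vspace_M bilin_face_map)+

lemma vertex_act_W:
  assumes "support (rho K) c \<noteq> []"
  shows "vertex_act H M K c = V.W K c"
  by (intro ext) (simp only: vertex_act_def V.W_def vertex_act_list_op_list[OF assms] edge_act_edge_op)

lemma face_dual_act_W:
  assumes "rev (support (face_perm K) (inv (rho K) c)) \<noteq> []"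
  shows "face_dual_act H M K c = F.W K c"
  by (intro ext) (simp only: face_dual_act_def F.W_def face_dual_act_list_op_list[OF assms]
      edge_dual_act_edge_op)

lemma act_W:
  "c \<in> cilia \<Gamma> \<Longrightarrow> vertex_act H M \<Gamma> c = V.W \<Gamma> c" "c \<in> cilia \<Delta> \<Longrightarrow> vertex_act H M \<Delta> c = V.W \<Delta> c"
  "c \<in> cilia G \<Longrightarrow> vertex_act H M G c = V.W G c"
  "c \<in> cilia \<Gamma> \<Longrightarrow> face_dual_act H M \<Gamma> c = F.W \<Gamma> c" "c \<in> cilia \<Delta> \<Longrightarrow> face_dual_act H M \<Delta> c = F.W \<Delta> c"
  "c \<in> cilia G \<Longrightarrow> face_dual_act H M G c = F.W G c"
  by (intro vertex_act_W face_dual_act_W V.L1[THEN conjunct1] V.L2[THEN conjunct1] V.L_G[THEN conjunct1]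
    F.L1[THEN conjunct1] F.L2[THEN conjunct1] F.L_G[THEN conjunct1]; assumption)+

lemma cilia_list_props: "distinct (cilia_list \<Gamma>)" "set (cilia_list \<Gamma>) = cilia \<Gamma>"
  "distinct (cilia_list \<Delta>)" "set (cilia_list \<Delta>) = cilia \<Delta>"
  "distinct (cilia_list G)" "set (cilia_list G) = cilia G"
proof -
  obtain cs where cs: "cilia_list \<Gamma> = base \<Gamma> # cs" "distinct cs" "set cs = cilia \<Gamma> - {base \<Gamma>}"
    by (rule G1.cilia_list)
  obtain ds where ds: "cilia_list \<Delta> = base \<Delta> # ds" "distinct ds" "set ds = cilia \<Delta> - {base \<Delta>}"
    by (rule G2.cilia_list)
  show "distinct (cilia_list \<Gamma>)" "set (cilia_list \<Gamma>) = cilia \<Gamma>" using cs G1.base_cilia by auto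
  show "distinct (cilia_list \<Delta>)" "set (cilia_list \<Delta>) = cilia \<Delta>" using ds G2.base_cilia by auto
  show "distinct (cilia_list G)" "set (cilia_list G) = cilia G"
    using cs ds G1.base_cilia G1.cilia_sub G2.cilia_sub disj base_disjoint
    by (auto simp: cilia_list_G G_simps)
qed

sublocale M1: graph_module_ops H \<Gamma> M
  by unfold_locales (simp_all only: cilia_list_props act_W hilbert_space_def V.bilin_W F.bilin_W)

sublocale M2: graph_module_ops H \<Delta> M
  by unfold_locales (simp_all only: cilia_list_props act_W hilbert_space_def V.bilin_W F.bilin_W)

sublocale MG: graph_module_ops H G M
  by unfold_locales (simp_all only: cilia_list_props act_W hilbert_space_def V.bilin_W F.bilin_W)

section \<open>Actions and coactions of the single cilia on X # Y\<close>

abbreviation "XY \<equiv> tensor X Y"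

lemma sum_factor_ract_tlift:
  "sum_factor_ract H \<Gamma> \<Delta> X Y (base \<Gamma>) z h = tlift X Y (V.diag X Y
     (\<lambda>h x. factor_ract H (cilia \<Gamma>) X (base \<Gamma>) x h) (\<lambda>h y. factor_ract H (cilia \<Delta>) Y (base \<Delta>) y h) h) z"
  "c \<in> cilia \<Gamma> \<Longrightarrow> c \<noteq> base \<Gamma> \<Longrightarrow> sum_factor_ract H \<Gamma> \<Delta> X Y c z h
     = tlift X Y (\<lambda>x y. tens X Y (factor_ract H (cilia \<Gamma>) X c x h) y) z"
  "c \<in> cilia \<Delta> \<Longrightarrow> c \<noteq> base \<Delta> \<Longrightarrow> sum_factor_ract H \<Gamma> \<Delta> X Y c z h
     = tlift X Y (\<lambda>x y. tens X Y x (factor_ract H (cilia \<Delta>) Y c y h)) z"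
proof -
  show "sum_factor_ract H \<Gamma> \<Delta> X Y (base \<Gamma>) z h = tlift X Y (V.diag X Y
     (\<lambda>h x. factor_ract H (cilia \<Gamma>) X (base \<Gamma>) x h) (\<lambda>h y. factor_ract H (cilia \<Delta>) Y (base \<Delta>) y h) h) z"
    by (simp add: sum_factor_ract_def V.diag_def[abs_def] sw2_def)
  show "sum_factor_ract H \<Gamma> \<Delta> X Y c z h = tlift X Y (\<lambda>x y. tens X Y (factor_ract H (cilia \<Gamma>) X c x h) y)
      z"
    if "c \<in> cilia \<Gamma>" "c \<noteq> base \<Gamma>"
    using that by (simp add: sum_factor_ract_def)
  show "sum_factor_ract H \<Gamma> \<Delta> X Y c z h = tlift X Y (\<lambda>x y. tens X Y x (factor_ract H (cilia \<Delta>) Y c y h))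
      z"
    if c: "c \<in> cilia \<Delta>" "c \<noteq> base \<Delta>"
  proof -
    have "c \<notin> cilia \<Gamma>" "c \<noteq> base \<Gamma>" using c G1.cilia_sub G2.cilia_sub disj base_disjoint by auto
    then show ?thesis by (simp add: sum_factor_ract_def)
  qed
qed

lemma cilia_G_cases:
  assumes "c \<in> cilia G"
  obtains "c = base \<Gamma>" | "c \<in> cilia \<Gamma>" "c \<noteq> base \<Gamma>" | "c \<in> cilia \<Delta>" "c \<noteq> base \<Delta>"
  using assms by (auto simp: G_simps)

sublocale SV: sum_ops \<Gamma> \<Delta> H "comult H" X Y "\<lambda>c h x. factor_ract H (cilia \<Gamma>) X c x h"
  "\<lambda>c h y. factor_ract H (cilia \<Delta>) Y c y h" "\<lambda>c h z. sum_factor_ract H \<Gamma> \<Delta> X Y c z h"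
proof unfold_locales
  note p = P1.bilin_factor_ract and q = P2.bilin_factor_ract
  note XY = P1.XV P2.XV vspace_tensor
  note dg = V.lin_diag[OF P1.XV p[OF G1.base_cilia] P2.XV q[OF G2.base_cilia]]
  have left: "bilin X Y XY (\<lambda>x y. tens X Y (factor_ract H (cilia \<Gamma>) X c x h) y)" if "c \<in> cilia \<Gamma>" "h \<in>
      carr H" for c h
    by (rule bilin_comp2[OF bilin_tens bilin_right[OF p[OF that(1)] that(2)] lin_id])
  have right: "bilin X Y XY (\<lambda>x y. tens X Y x (factor_ract H (cilia \<Delta>) Y c y h))" if "c \<in> cilia \<Delta>" "h \<in>
      carr H" for c h
    by (rule bilin_comp2[OF bilin_tens lin_id bilin_right[OF q[OF that(1)] that(2)]])
  show "vspace X" "vspace Y" by (rule XY)+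
  show "bilin H X X (\<lambda>h x. factor_ract H (cilia \<Gamma>) X c x h)" if "c \<in> cilia \<Gamma>" for c by (rule p[OF that])
  show "bilin H Y Y (\<lambda>h y. factor_ract H (cilia \<Delta>) Y c y h)" if "c \<in> cilia \<Delta>" for c by (rule q[OF that])
  show "bilin H XY XY (\<lambda>h z. sum_factor_ract H \<Gamma> \<Delta> X Y c z h)" if "c \<in> cilia G" for c
    using that
  proof (cases rule: cilia_G_cases)
    case 1
    then show ?thesis unfolding sum_factor_ract_tlift 1 by (intro bilin_tlift_body XY dg)
  next
    case 2
    show ?thesis unfolding sum_factor_ract_tlift(2)[OF 2]
      by (intro bilin_tlift_body XY left 2 lin_comp[OF bilin_left[OF p] bilin_left[OF bilin_tens]])
  next
    case 3
    show ?thesis unfolding sum_factor_ract_tlift(3)[OF 3]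
      by (intro bilin_tlift_body XY right 3 lin_comp[OF bilin_left[OF q] bilin_right[OF bilin_tens]])
  qed
  fix h x y assume h: "h \<in> carr H" and x: "x \<in> carr X" and y: "y \<in> carr Y"
  show "sum_factor_ract H \<Gamma> \<Delta> X Y (base \<Gamma>) (tens X Y x y) h = V.diag X Y
     (\<lambda>h x. factor_ract H (cilia \<Gamma>) X (base \<Gamma>) x h) (\<lambda>h y. factor_ract H (cilia \<Delta>) Y (base \<Delta>) y h) h x
         y"
    unfolding sum_factor_ract_tlift by (rule tlift_tens[OF XY dg(1)[OF h] x y])
  show "sum_factor_ract H \<Gamma> \<Delta> X Y c (tens X Y x y) h = tens X Y (factor_ract H (cilia \<Gamma>) X c x h) y"
    if c: "c \<in> cilia \<Gamma>" "c \<noteq> base \<Gamma>" for c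
    unfolding sum_factor_ract_tlift(2)[OF c] by (rule tlift_tens[OF XY left[OF c(1) h] x y])
  show "sum_factor_ract H \<Gamma> \<Delta> X Y c (tens X Y x y) h = tens X Y x (factor_ract H (cilia \<Delta>) Y c y h)"
    if c: "c \<in> cilia \<Delta>" "c \<noteq> base \<Delta>" for c
    unfolding sum_factor_ract_tlift(3)[OF c] by (rule tlift_tens[OF XY right[OF c(1) h] x y])
qed

abbreviation "fx c x \<equiv> factor_rcoact H (cilia \<Gamma>) X c x"
abbreviation "fy c y \<equiv> factor_rcoact H (cilia \<Delta>) Y c y"

definition coact_base :: "'x \<Rightarrow> 'y \<Rightarrow> ((('x \<Rightarrow> 'y \<Rightarrow> 'k) \<Rightarrow> 'k) \<Rightarrow> 'h \<Rightarrow> 'k) \<Rightarrow> 'k" where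
  "coact_base x y = tlift X H (\<lambda>x0 a. tlift Y H (\<lambda>y0 b. tens XY H (tens X Y x0 y0) (amult H a b))
     (fy (base \<Delta>) y)) (fx (base \<Gamma>) x)"

definition coact_left :: "'g \<Rightarrow> 'x \<Rightarrow> 'y \<Rightarrow> ((('x \<Rightarrow> 'y \<Rightarrow> 'k) \<Rightarrow> 'k) \<Rightarrow> 'h \<Rightarrow> 'k) \<Rightarrow> 'k" where
  "coact_left c x y = tlift X H (\<lambda>x0 a. tens XY H (tens X Y x0 y) a) (fx c x)"

definition coact_right :: "'g \<Rightarrow> 'x \<Rightarrow> 'y \<Rightarrow> ((('x \<Rightarrow> 'y \<Rightarrow> 'k) \<Rightarrow> 'k) \<Rightarrow> 'h \<Rightarrow> 'k) \<Rightarrow> 'k" where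
  "coact_right c x y = tlift Y H (\<lambda>y0 b. tens XY H (tens X Y x y0) b) (fy c y)"

lemma sum_factor_rcoact_tlift:
  "sum_factor_rcoact H \<Gamma> \<Delta> X Y (base \<Gamma>) = tlift X Y coact_base"
  "c \<in> cilia \<Gamma> \<Longrightarrow> c \<noteq> base \<Gamma> \<Longrightarrow> sum_factor_rcoact H \<Gamma> \<Delta> X Y c = tlift X Y (coact_left c)"
  "c \<in> cilia \<Delta> \<Longrightarrow> c \<noteq> base \<Delta> \<Longrightarrow> sum_factor_rcoact H \<Gamma> \<Delta> X Y c = tlift X Y (coact_right c)"
proof -
  show "sum_factor_rcoact H \<Gamma> \<Delta> X Y (base \<Gamma>) = tlift X Y coact_base"
    by (rule ext) (simp add: sum_factor_rcoact_def coact_base_def[abs_def])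
  show "sum_factor_rcoact H \<Gamma> \<Delta> X Y c = tlift X Y (coact_left c)" if "c \<in> cilia \<Gamma>" "c \<noteq> base \<Gamma>"
    using that by (intro ext) (simp add: sum_factor_rcoact_def coact_left_def[abs_def])
  show "sum_factor_rcoact H \<Gamma> \<Delta> X Y c = tlift X Y (coact_right c)" if c: "c \<in> cilia \<Delta>" "c \<noteq> base \<Delta>"
  proof -
    have "c \<notin> cilia \<Gamma>" "c \<noteq> base \<Gamma>" using c G1.cilia_sub G2.cilia_sub disj base_disjoint by auto
    then show ?thesis by (intro ext) (simp add: sum_factor_rcoact_def coact_right_def[abs_def])
  qed
qed

lemma bilin_coact:
  "bilin X Y (tensor XY H) coact_base"
  "c \<in> cilia \<Gamma> \<Longrightarrow> bilin X Y (tensor XY H) (coact_left c)"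
  "c \<in> cilia \<Delta> \<Longrightarrow> bilin X Y (tensor XY H) (coact_right c)"
proof -
  note lx = P1.lin_factor_rcoact and ly = P2.lin_factor_rcoact
  note XV = P1.XV and YV = P2.XV and mem = lin_mem[OF lx] lin_mem[OF ly]
  let ?T = "tensor XY H"
  have b1: "bilin X H ?T (\<lambda>x0 a. tens XY H (tens X Y x0 y) (f a))" if "y \<in> carr Y" "lin H H f" for y f
    by (rule bilin_comp2[OF bilin_tens bilin_left[OF bilin_tens that(1)] that(2)])
  have b2: "bilin Y H ?T (\<lambda>y0 b. tens XY H (tens X Y x y0) (f b))" if "x \<in> carr X" "lin H H f" for x f
    by (rule bilin_comp2[OF bilin_tens bilin_right[OF bilin_tens that(1)] that(2)])
  note ml = bilin_left[OF P1.bilin_mult_H] and mr = bilin_right[OF P1.bilin_mult_H]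
  show "bilin X Y ?T (coact_left c)" if c: "c \<in> cilia \<Gamma>"
    unfolding coact_left_def
    by (intro bilinI lin_comp[OF lx[OF c] tensor_universal(1)] XV vspace_H vspace_tensor
        b1[OF _ lin_id] lin_tlift_param mem(1)[OF c]
        lin_comp[OF bilin_right[OF bilin_tens] bilin_left[OF bilin_tens]])
  show "bilin X Y ?T (coact_right c)" if c: "c \<in> cilia \<Delta>"
    unfolding coact_right_def
    by (intro bilinI lin_comp[OF ly[OF c] tensor_universal(1)] YV vspace_H vspace_tensor
        b2[OF _ lin_id] lin_tlift_param mem(2)[OF c]
        lin_comp[OF bilin_left[OF bilin_tens] bilin_left[OF bilin_tens]])
  show "bilin X Y ?T coact_base"
    unfolding coact_base_def
  proof (rule bilinI)
    note fyb = mem(2)[OF G2.base_cilia] and fxb = mem(1)[OF G1.base_cilia]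
    have inner: "bilin Y H ?T (\<lambda>y0 b. tens XY H (tens X Y x0 y0) (amult H a b))"
      if "x0 \<in> carr X" "a \<in> carr H" for x0 a
      by (rule b2[OF that(1) mr[OF that(2)]])
    show "lin Y ?T (\<lambda>y. tlift X H (\<lambda>x0 a. tlift Y H (\<lambda>y0 b. tens XY H (tens X Y x0 y0) (amult H a b))
        (fy (base \<Delta>) y)) (fx (base \<Gamma>) x))" if "x \<in> carr X" for x
      by (intro lin_tlift_param[OF XV vspace_tensor fxb[OF that]]
        lin_comp[OF ly[OF G2.base_cilia] tensor_universal(1)[OF YV vspace_H vspace_tensor inner]])
    show "lin X ?T (\<lambda>x. tlift X H (\<lambda>x0 a. tlift Y H (\<lambda>y0 b. tens XY H (tens X Y x0 y0) (amult H a b))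
        (fy (base \<Delta>) y)) (fx (base \<Gamma>) x))" if y: "y \<in> carr Y" for y
    proof (intro lin_comp[OF lx[OF G1.base_cilia] tensor_universal(1)[OF XV vspace_H vspace_tensor]]
        bilinI
        lin_tlift_param[OF YV vspace_tensor fyb[OF y]])
      fix y0 b a assume "y0 \<in> carr Y" "b \<in> carr H" "a \<in> carr H"
      then show "lin X ?T (\<lambda>x0. tens XY H (tens X Y x0 y0) (amult H a b))"
        by (intro lin_comp[OF bilin_left[OF bilin_tens] bilin_left[OF bilin_tens]] P1.mult_mem)
    next
      fix y0 b x0 assume "y0 \<in> carr Y" "b \<in> carr H" "x0 \<in> carr X"
      then show "lin H ?T (\<lambda>a. tens XY H (tens X Y x0 y0) (amult H a b))"
        by (intro lin_comp[OF ml bilin_right[OF bilin_tens]] tens_mem)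
    qed
  qed
qed

lemma lin_sum_factor_rcoact: "c \<in> cilia G \<Longrightarrow> lin XY (tensor XY H) (sum_factor_rcoact H \<Gamma> \<Delta> X Y c)"
proof (erule cilia_G_cases)
  note u = tensor_universal(1)[OF P1.XV P2.XV vspace_tensor]
  show "lin XY (tensor XY H) (sum_factor_rcoact H \<Gamma> \<Delta> X Y c)" if "c = base \<Gamma>"
    unfolding that sum_factor_rcoact_tlift by (rule u[OF bilin_coact(1)])
  show "lin XY (tensor XY H) (sum_factor_rcoact H \<Gamma> \<Delta> X Y c)" if "c \<in> cilia \<Gamma>" "c \<noteq> base \<Gamma>"
    unfolding sum_factor_rcoact_tlift(2)[OF that] by (rule u[OF bilin_coact(2)[OF that(1)]])
  show "lin XY (tensor XY H) (sum_factor_rcoact H \<Gamma> \<Delta> X Y c)" if "c \<in> cilia \<Delta>" "c \<noteq> base \<Delta>"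
    unfolding sum_factor_rcoact_tlift(3)[OF that] by (rule u[OF bilin_coact(3)[OF that(1)]])
qed

text \<open>Contracting with functionals turns the coactions of \<open>X # Y\<close> into actions of
  the dual. At the distinguished cilium the product of coefficients is turned into the dual
  coproduct by \<open>dual_comult_contract\<close>.\<close>

sublocale SF: sum_ops \<Gamma> \<Delta> "dual H" "dual_comult H" X Y "\<lambda>c \<alpha> x. rcontract H X \<alpha> (fx c x)"
  "\<lambda>c \<alpha> y. rcontract H Y \<alpha> (fy c y)" "\<lambda>c \<alpha> z. rcontract H XY \<alpha> (sum_factor_rcoact H \<Gamma> \<Delta> X Y c z)"
proof unfold_locales
  note XY = P1.XV P2.XV vspace_tensor and VH = vspace_H
  show "vspace X" "vspace Y" by (rule XY)+
  show p: "bilin (dual H) X X (\<lambda>\<alpha> x. rcontract H X \<alpha> (fx c x))" if "c \<in> cilia \<Gamma>" for c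
    by (rule bilin_rcontract[OF VH XY(1) P1.lin_factor_rcoact[OF that]])
  show q: "bilin (dual H) Y Y (\<lambda>\<alpha> y. rcontract H Y \<alpha> (fy c y))" if "c \<in> cilia \<Delta>" for c
    by (rule bilin_rcontract[OF VH XY(2) P2.lin_factor_rcoact[OF that]])
  show "bilin (dual H) XY XY (\<lambda>\<alpha> z. rcontract H XY \<alpha> (sum_factor_rcoact H \<Gamma> \<Delta> X Y c z))" if "c \<in> cilia
      G" for c
    by (rule bilin_rcontract[OF VH vspace_tensor lin_sum_factor_rcoact[OF that]])
  fix \<alpha> x y assume \<alpha>: "\<alpha> \<in> carr (dual H)" and x: "x \<in> carr X" and y: "y \<in> carr Y"
  note a = dual_lin[OF \<alpha>]
  have rt: "rcontract H XY \<alpha> (tens XY H (tens X Y x0 y0) b) = fscl (\<alpha> b) (tens X Y x0 y0)"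
    if "x0 \<in> carr X" "y0 \<in> carr Y" "b \<in> carr H" for x0 y0 b
    using that by (subst rcontract_tens[OF VH vspace_tensor a]) auto
  note lr = lin_rcontract[OF VH vspace_tensor a, of X Y]
  show "rcontract H XY \<alpha> (sum_factor_rcoact H \<Gamma> \<Delta> X Y c (tens X Y x y)) = tens X Y (rcontract H X \<alpha> (fx
      c x)) y"
    if c: "c \<in> cilia \<Gamma>" "c \<noteq> base \<Gamma>" for c
  proof -
    note m = P1.factor_rcoact_mem[OF c(1) x]
    have "rcontract H XY \<alpha> (sum_factor_rcoact H \<Gamma> \<Delta> X Y c (tens X Y x y)) = rcontract H XY \<alpha> (coact_left
        c x y)"
      unfolding sum_factor_rcoact_tlift(2)[OF c] tlift_tens[OF XY bilin_coact(2)[OF c(1)] x y] ..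
    also have "\<dots> = tlift X H (\<lambda>x0 a. fscl (\<alpha> a) (tens X Y x0 y)) (fx c x)"
      unfolding coact_left_def
      by (subst tlift_comm[OF XY(1) vspace_tensor vspace_tensor m lr])
        (auto intro!: tlift_cong[OF XY(1) m] rt y)
    also have "\<dots> = tlift X H (\<lambda>x0 a. tens X Y (scl X (\<alpha> a) x0) y) (fx c x)"
      using lin_scl[OF bilin_left[OF bilin_tens[of X Y] y]] by (intro tlift_cong[OF XY(1) m]) simp
    also have "\<dots> = tens X Y (rcontract H X \<alpha> (fx c x)) y"
      unfolding rcontract_def
      by (rule tlift_comm[OF XY(1,1) vspace_tensor m bilin_left[OF bilin_tens y], symmetric]) (rule
          vspace_scl[OF XY(1)])
    finally show ?thesis .
  qed
  show "rcontract H XY \<alpha> (sum_factor_rcoact H \<Gamma> \<Delta> X Y c (tens X Y x y)) = tens X Y x (rcontract H Y \<alpha>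
      (fy c y))"
    if c: "c \<in> cilia \<Delta>" "c \<noteq> base \<Delta>" for c
  proof -
    note m = P2.factor_rcoact_mem[OF c(1) y]
    have "rcontract H XY \<alpha> (sum_factor_rcoact H \<Gamma> \<Delta> X Y c (tens X Y x y)) = rcontract H XY \<alpha>
        (coact_right c x y)"
      unfolding sum_factor_rcoact_tlift(3)[OF c] tlift_tens[OF XY bilin_coact(3)[OF c(1)] x y] ..
    also have "\<dots> = tlift Y H (\<lambda>y0 a. fscl (\<alpha> a) (tens X Y x y0)) (fy c y)"
      unfolding coact_right_def
      by (subst tlift_comm[OF XY(2) vspace_tensor vspace_tensor m lr])
        (auto intro!: tlift_cong[OF XY(2) m] rt x)
    also have "\<dots> = tlift Y H (\<lambda>y0 a. tens X Y x (scl Y (\<alpha> a) y0)) (fy c y)"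
      using lin_scl[OF bilin_right[OF bilin_tens[of X Y] x]] by (intro tlift_cong[OF XY(2) m]) simp
    also have "\<dots> = tens X Y x (rcontract H Y \<alpha> (fy c y))"
      unfolding rcontract_def
      by (rule tlift_comm[OF XY(2,2) vspace_tensor m bilin_right[OF bilin_tens x], symmetric]) (rule
          vspace_scl[OF XY(2)])
    finally show ?thesis .
  qed
  let ?s = "fx (base \<Gamma>) x" and ?t = "fy (base \<Delta>) y"
  note s = P1.factor_rcoact_mem[OF G1.base_cilia x] and t = P2.factor_rcoact_mem[OF G2.base_cilia y]
  note pb = p[OF G1.base_cilia] and qb = q[OF G2.base_cilia]
  show "rcontract H XY \<alpha> (sum_factor_rcoact H \<Gamma> \<Delta> X Y (base \<Gamma>) (tens X Y x y)) = F.diag X Y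
      (\<lambda>\<alpha> x. rcontract H X \<alpha> (fx (base \<Gamma>) x)) (\<lambda>\<alpha> y. rcontract H Y \<alpha> (fy (base \<Delta>) y)) \<alpha> x y"
    unfolding sum_factor_rcoact_tlift(1) tlift_tens[OF XY bilin_coact(1) x y]
  proof (rule tensor_eqI[OF XY(1)])
    show "rcontract H XY \<alpha> (coact_base x y) \<in> carr XY"
      by (rule rcontract_mem[OF VH vspace_tensor bilin_mem[OF bilin_coact(1) x y]])
    show "F.diag X Y (\<lambda>\<alpha> x. rcontract H X \<alpha> (fx (base \<Gamma>) x)) (\<lambda>\<alpha> y. rcontract H Y \<alpha> (fy (base \<Delta>) y)) \<alpha> x
        y \<in> carr XY"
      by (rule bilin_mem[OF F.lin_diag(1)[OF XY(1) pb XY(2) qb \<alpha>] x y])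
    fix \<beta> assume \<beta>: "bilin X Y kfield \<beta>"
    have ev: "lin XY kfield (\<lambda>z. z \<beta>)" by (rule lin_eval) simp
    have "rcontract H XY \<alpha> (coact_base x y) \<beta> = coact_base x y (\<lambda>z a. z \<beta> * \<alpha> a)"
      by (rule rcontract_functional[OF VH vspace_tensor bilin_mem[OF bilin_coact(1) x y] a ev])
    \<comment> \<open>Both sides meet in the double sum over the representing lists of the two
      coactions.\<close>
    also have "\<dots> = (\<Sum>(x, a)\<leftarrow>trep X H ?s. \<Sum>(y, b)\<leftarrow>trep Y H ?t. \<beta> x y * \<alpha> (amult H a b))"
      by (simp add: coact_base_def tlift_trep sum_list_apply split_def tens_apply[OF bilin_mult[OF ev
          a]] tens_apply[OF \<beta>])
    also have "\<dots> = dual_comult H \<alpha> (\<lambda>\<alpha>1 \<alpha>2. \<beta> (rcontract H X \<alpha>1 ?s) (rcontract H Y \<alpha>2 ?t))"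
      by (rule P1.dual_comult_contract[OF XY(1) s XY(2) t \<alpha> \<beta>, symmetric])
    also have "\<dots> = F.diag X Y (\<lambda>\<alpha> x. rcontract H X \<alpha> (fx (base \<Gamma>) x)) (\<lambda>\<alpha> y. rcontract H Y \<alpha> (fy (base
        \<Delta>) y)) \<alpha> x y \<beta>"
      unfolding F.diag_def
      by (rule tlift_apply_eq[OF vspace_dual vspace_dual P1.dual_comult_mem[OF \<alpha>]
        bilin_comp2[OF \<beta> bilin_left[OF pb x] bilin_left[OF qb y]], symmetric]) (rule tens_apply[OF \<beta>])
    finally show "rcontract H XY \<alpha> (coact_base x y) \<beta>
      = F.diag X Y (\<lambda>\<alpha> x. rcontract H X \<alpha> (fx (base \<Gamma>) x)) (\<lambda>\<alpha> y. rcontract H Y \<alpha> (fy (base \<Delta>) y)) \<alpha> x y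
          \<beta>" .
  qed
qed


section \<open>Operators of families of functionals and of elements\<close>

abbreviation "J \<equiv> njoin (edges \<Gamma>) (edges \<Delta>) M"
abbreviation "Z \<equiv> sum_modcomod H \<Gamma> \<Delta> X Y"
abbreviation "D \<equiv> dual H"

lemma Z_space: "carr Z = carr XY" "scl Z = scl XY"
  by (simp_all add: sum_modcomod_def Let_def)

lemmas Z_same = same_space[where V = Z and V' = XY, OF Z_space]
lemmas M1_same = same_space[where V = "graph_module H M \<Gamma>" and V' = M1.N, OF M1.carr_graph_module]
lemmas M2_same = same_space[where V = "graph_module H M \<Delta>" and V' = M2.N, OF M2.carr_graph_module]
lemmas MG_same = same_space[where V = "graph_module H M G" and V' = MG.N, OF MG.carr_graph_module]

lemma bilin_J: "bilin M1.N M2.N MG.N J"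
  unfolding hilbert_space_def by (rule V.bilin_J)

text \<open>A family of functionals acting through the coactions, cilium by cilium;
  \<open>RY\<close> and \<open>RZ\<close> are the same for \<open>Y\<close> and
  \<open>X # Y\<close>, and \<open>LN\<close> for the Hilbert spaces. \<open>VN\<close> is the
  analogue for the vertex actions of a family of elements.\<close>

definition RX :: "('g \<Rightarrow> 'h \<Rightarrow> 'k) \<Rightarrow> 'x \<Rightarrow> 'x" where
  "RX \<alpha> x = foldl (\<lambda>x c. rcontract H X (\<alpha> c) (fx c x)) x (cilia_list \<Gamma>)"

definition RY :: "('g \<Rightarrow> 'h \<Rightarrow> 'k) \<Rightarrow> 'y \<Rightarrow> 'y" where
  "RY \<alpha> y = foldl (\<lambda>y c. rcontract H Y (\<alpha> c) (fy c y)) y (cilia_list \<Delta>)"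

definition RZ :: "('g \<Rightarrow> 'h \<Rightarrow> 'k) \<Rightarrow> (('x \<Rightarrow> 'y \<Rightarrow> 'k) \<Rightarrow> 'k) \<Rightarrow> ('x \<Rightarrow> 'y \<Rightarrow> 'k) \<Rightarrow> 'k" where
  "RZ \<alpha> z = foldl (\<lambda>z c. rcontract H XY (\<alpha> c) (sum_factor_rcoact H \<Gamma> \<Delta> X Y c z)) z (cilia_list G)"

definition LN :: "'g kgraph \<Rightarrow> ('g \<Rightarrow> 'h \<Rightarrow> 'k) \<Rightarrow> ((('g set \<Rightarrow> 'm) \<Rightarrow> 'k) \<Rightarrow> 'k) \<Rightarrow> (('g set \<Rightarrow> 'm) \<Rightarrow> 'k) \<Rightarrow> 'k"
    where
  "LN K \<alpha> = foldr (\<lambda>c. face_dual_act H M K c (\<alpha> c)) (cilia_list K)"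

definition VN :: "'g kgraph \<Rightarrow> ('g \<Rightarrow> 'h) \<Rightarrow> ((('g set \<Rightarrow> 'm) \<Rightarrow> 'k) \<Rightarrow> 'k) \<Rightarrow> (('g set \<Rightarrow> 'm) \<Rightarrow> 'k) \<Rightarrow> 'k" where
  "VN K a = foldr (\<lambda>c. vertex_act H M K c (a c)) (cilia_list K)"

lemma lin_RX: "(\<And>c. c \<in> cilia \<Gamma> \<Longrightarrow> \<alpha> c \<in> carr D) \<Longrightarrow> lin X X (RX \<alpha>)"
  unfolding RX_def by (rule lin_foldl[where V = D and act = "\<lambda>c \<alpha> x. rcontract H X \<alpha> (fx c x)"])
    (simp_all only: SF.p cilia_list_props)

lemma lin_RY: "(\<And>c. c \<in> cilia \<Delta> \<Longrightarrow> \<alpha> c \<in> carr D) \<Longrightarrow> lin Y Y (RY \<alpha>)"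
  unfolding RY_def by (rule lin_foldl[where V = D and act = "\<lambda>c \<alpha> y. rcontract H Y \<alpha> (fy c y)"])
    (simp_all only: SF.q cilia_list_props)

lemma lin_RZ: "(\<And>c. c \<in> cilia G \<Longrightarrow> \<alpha> c \<in> carr D) \<Longrightarrow> lin XY XY (RZ \<alpha>)"
  unfolding RZ_def
  by (rule lin_foldl[where V = D and act = "\<lambda>c \<alpha> z. rcontract H XY \<alpha> (sum_factor_rcoact H \<Gamma> \<Delta> X Y c
      z)"])
    (simp_all only: SF.r cilia_list_props)

lemma lin_LN:
  "(\<And>c. c \<in> cilia \<Gamma> \<Longrightarrow> \<alpha> c \<in> carr D) \<Longrightarrow> lin M1.N M1.N (LN \<Gamma> \<alpha>)"
  "(\<And>c. c \<in> cilia \<Delta> \<Longrightarrow> \<alpha> c \<in> carr D) \<Longrightarrow> lin M2.N M2.N (LN \<Delta> \<alpha>)"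
  "(\<And>c. c \<in> cilia G \<Longrightarrow> \<alpha> c \<in> carr D) \<Longrightarrow> lin MG.N MG.N (LN G \<alpha>)"
  unfolding LN_def by (rule lin_foldr[where V = D]; simp only: M1.face M2.face MG.face
      cilia_list_props)+

lemma lin_VN:
  "(\<And>c. c \<in> cilia G \<Longrightarrow> a c \<in> carr H) \<Longrightarrow> lin MG.N MG.N (VN G a)"
  unfolding VN_def by (rule lin_foldr[where V = H]; simp only: MG.vertex cilia_list_props)

text \<open>The coaction of \<open>X\<close> is given over the whole tensor power, while
  \<open>X # Y\<close> is built from its single factors. Contracting at once and contracting cilium
  by cilium therefore have to be matched.\<close>

lemma contr_RX:
  assumes \<alpha>: "\<And>c. c \<in> cilia \<Gamma> \<Longrightarrow> \<alpha> c \<in> carr D" and x: "x \<in> carr X"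
  shows "P1.contr \<alpha> x = RX \<alpha> x"
proof -
  have "RX \<alpha> x = P1.contr (\<lambda>c. if c \<in> set (cilia_list \<Gamma>) then \<alpha> c else counit H) x"
    unfolding RX_def using \<alpha> x by (intro P1.foldl_factor_rcoact) (simp_all add: cilia_list_props
        dual_lin)
  also have "\<dots> = P1.contr \<alpha> x"
    using \<alpha> x by (intro P1.contr_cong) (simp_all add: cilia_list_props dual_lin)
  finally show ?thesis ..
qed

lemma contr_RY:
  assumes \<alpha>: "\<And>c. c \<in> cilia \<Delta> \<Longrightarrow> \<alpha> c \<in> carr D" and y: "y \<in> carr Y"
  shows "P2.contr \<alpha> y = RY \<alpha> y"
proof -
  have "RY \<alpha> y = P2.contr (\<lambda>c. if c \<in> set (cilia_list \<Delta>) then \<alpha> c else counit H) y"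
    unfolding RY_def using \<alpha> y by (intro P2.foldl_factor_rcoact) (simp_all add: cilia_list_props
        dual_lin)
  also have "\<dots> = P2.contr \<alpha> y"
    using \<alpha> y by (intro P2.contr_cong) (simp_all add: cilia_list_props dual_lin)
  finally show ?thesis ..
qed

sublocale C1: cotensor_ops H "cilia \<Gamma>" X "graph_module H M \<Gamma>" RX "LN \<Gamma>"
proof unfold_locales
  show "vspace X" by (rule P1.XV)
  show "vspace (graph_module H M \<Gamma>)" unfolding M1_same by (rule M1.vspace_N)
  show "lin X (tensor X (ntensor (cilia \<Gamma>) H)) (rcoact X)" by (rule P1.lin_rcoact)
  show "lin (graph_module H M \<Gamma>) (tensor (ntensor (cilia \<Gamma>) H) (graph_module H M \<Gamma>)) (lcoact
      (graph_module H M \<Gamma>))"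
    unfolding M1_same by (rule M1.lin_lcoact_graph)
  fix \<alpha> assume \<alpha>: "\<And>c. c \<in> cilia \<Gamma> \<Longrightarrow> \<alpha> c \<in> carr D"
  show "lin X X (RX \<alpha>)" by (rule lin_RX[OF \<alpha>])
  show "lin (graph_module H M \<Gamma>) (graph_module H M \<Gamma>) (LN \<Gamma> \<alpha>)" unfolding M1_same by (rule lin_LN(1)[OF
      \<alpha>])
  show "rcoact X x (\<lambda>x0 u. \<phi> x0 * u (prod_form (cilia \<Gamma>) \<alpha>)) = \<phi> (RX \<alpha> x)"
    if "x \<in> carr X" "lin X kfield \<phi>" for x \<phi>
    using P1.contr_functional[OF that, of \<alpha>] contr_RX[of \<alpha> x] \<alpha> that by simp
  show "lcoact (graph_module H M \<Gamma>) n (\<lambda>u m. u (prod_form (cilia \<Gamma>) \<alpha>) * \<nu> m) = \<nu> (LN \<Gamma> \<alpha> n)"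
    if "n \<in> carr (graph_module H M \<Gamma>)" "lin (graph_module H M \<Gamma>) kfield \<nu>" for n \<nu>
    using that \<alpha> unfolding M1_same M1.carr_graph_module LN_def by (intro M1.lcoact_graph_eval)
qed

sublocale C2: cotensor_ops H "cilia \<Delta>" Y "graph_module H M \<Delta>" RY "LN \<Delta>"
proof unfold_locales
  show "vspace Y" by (rule P2.XV)
  show "vspace (graph_module H M \<Delta>)" unfolding M2_same by (rule M2.vspace_N)
  show "lin Y (tensor Y (ntensor (cilia \<Delta>) H)) (rcoact Y)" by (rule P2.lin_rcoact)
  show "lin (graph_module H M \<Delta>) (tensor (ntensor (cilia \<Delta>) H) (graph_module H M \<Delta>)) (lcoact
      (graph_module H M \<Delta>))"
    unfolding M2_same by (rule M2.lin_lcoact_graph)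
  fix \<alpha> assume \<alpha>: "\<And>c. c \<in> cilia \<Delta> \<Longrightarrow> \<alpha> c \<in> carr D"
  show "lin Y Y (RY \<alpha>)" by (rule lin_RY[OF \<alpha>])
  show "lin (graph_module H M \<Delta>) (graph_module H M \<Delta>) (LN \<Delta> \<alpha>)" unfolding M2_same by (rule lin_LN(2)[OF
      \<alpha>])
  show "rcoact Y y (\<lambda>x0 u. \<phi> x0 * u (prod_form (cilia \<Delta>) \<alpha>)) = \<phi> (RY \<alpha> y)"
    if "y \<in> carr Y" "lin Y kfield \<phi>" for y \<phi>
    using P2.contr_functional[OF that, of \<alpha>] contr_RY[of \<alpha> y] \<alpha> that by simp
  show "lcoact (graph_module H M \<Delta>) n (\<lambda>u m. u (prod_form (cilia \<Delta>) \<alpha>) * \<nu> m) = \<nu> (LN \<Delta> \<alpha> n)"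
    if "n \<in> carr (graph_module H M \<Delta>)" "lin (graph_module H M \<Delta>) kfield \<nu>" for n \<nu>
    using that \<alpha> unfolding M2_same M2.carr_graph_module LN_def by (intro M2.lcoact_graph_eval)
qed

lemma rcoact_Z: "rcoact Z = right_assemble_coact H XY (cilia_list G) (sum_factor_rcoact H \<Gamma> \<Delta> X Y)"
  by (simp add: sum_modcomod_def Let_def)

lemma ract_Z: "ract Z = right_assemble_act H (cilia_list G) (sum_factor_ract H \<Gamma> \<Delta> X Y)"
  by (simp add: sum_modcomod_def Let_def)

sublocale CG: cotensor_ops H "cilia G" Z "graph_module H M G" RZ "LN G"
proof unfold_locales
  show "vspace Z" unfolding Z_same by simp
  show "vspace (graph_module H M G)" unfolding MG_same by (rule MG.vspace_N)
  show "lin Z (tensor Z (ntensor (cilia G) H)) (rcoact Z)"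
    unfolding Z_same rcoact_Z
    by (rule PG.lin_right_assemble_coact[OF vspace_tensor lin_sum_factor_rcoact cilia_list_props(5,6)])
  show "lin (graph_module H M G) (tensor (ntensor (cilia G) H) (graph_module H M G)) (lcoact
      (graph_module H M G))"
    unfolding MG_same by (rule MG.lin_lcoact_graph)
  fix \<alpha> assume \<alpha>: "\<And>c. c \<in> cilia G \<Longrightarrow> \<alpha> c \<in> carr D"
  show "lin Z Z (RZ \<alpha>)" unfolding Z_same by (rule lin_RZ[OF \<alpha>])
  show "lin (graph_module H M G) (graph_module H M G) (LN G \<alpha>)" unfolding MG_same by (rule lin_LN(3)[OF
      \<alpha>])
  show "rcoact Z z (\<lambda>x0 u. \<phi> x0 * u (prod_form (cilia G) \<alpha>)) = \<phi> (RZ \<alpha> z)"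
    if "z \<in> carr Z" "lin Z kfield \<phi>" for z \<phi>
    using that \<alpha> unfolding Z_same Z_space rcoact_Z RZ_def
    by (intro PG.right_assemble_coact_eval[where coact = "sum_factor_rcoact H \<Gamma> \<Delta> X Y"] vspace_tensor
        lin_sum_factor_rcoact cilia_list_props)
  show "lcoact (graph_module H M G) n (\<lambda>u m. u (prod_form (cilia G) \<alpha>) * \<nu> m) = \<nu> (LN G \<alpha> n)"
    if "n \<in> carr (graph_module H M G)" "lin (graph_module H M G) kfield \<nu>" for n \<nu>
    using that \<alpha> unfolding MG_same MG.carr_graph_module LN_def by (intro MG.lcoact_graph_eval)
qed

lemma RZ_tens:
  assumes "\<forall>c\<in>cilia G. \<alpha> c \<in> carr D" "x \<in> carr X" "y \<in> carr Y"
  shows "RZ \<alpha> (tens X Y x y) = tlift D D (\<lambda>\<alpha>1 \<alpha>2. tens X Y (RX (\<alpha>(base \<Gamma> := \<alpha>1)) x) (RY (\<alpha>(base \<Delta> :=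
      \<alpha>2)) y))
    (dual_comult H (\<alpha> (base \<Gamma>)))"
  unfolding RZ_def RX_def RY_def by (rule SF.foldl_r_tens[OF bspec[OF assms(1)] assms(2,3)])

text \<open>The same tensor \<open>dual_comult H (\<alpha> (base \<Gamma>))\<close> governs this
  expansion and the one in \<open>RZ_tens\<close>, which allows them to be compared summand by
  summand.\<close>

lemma LN_J:
  assumes "\<forall>c\<in>cilia G. \<alpha> c \<in> carr D" "m \<in> carr M1.N" "n \<in> carr M2.N"
  shows "LN G \<alpha> (J m n) = tlift D D (\<lambda>\<alpha>1 \<alpha>2. J (LN \<Gamma> (\<alpha>(base \<Gamma> := \<alpha>1)) m) (LN \<Delta> (\<alpha>(base \<Delta> := \<alpha>2)) n))
    (dual_comult H (\<alpha> (base \<Gamma>)))"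
proof -
  have e: "LN K = (\<lambda>v. foldr (\<lambda>c. F.W K c (v c)) (cilia_list K))"
    if "\<And>c. c \<in> set (cilia_list K) \<Longrightarrow> face_dual_act H M K c = F.W K c" for K
    unfolding LN_def using that by (intro ext foldr_cong) auto
  have e1: "LN \<Gamma> = (\<lambda>v. foldr (\<lambda>c. F.W \<Gamma> c (v c)) (cilia_list \<Gamma>))"
    and e2: "LN \<Delta> = (\<lambda>v. foldr (\<lambda>c. F.W \<Delta> c (v c)) (cilia_list \<Delta>))"
    and e3: "LN G = (\<lambda>v. foldr (\<lambda>c. F.W G c (v c)) (cilia_list G))"
    by (rule e, simp only: cilia_list_props act_W)+
  show ?thesis unfolding e1 e2 e3
    by (rule F.foldr_W_J[OF bspec[OF assms(1)] assms(2,3)[unfolded hilbert_space_def]])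
qed

lemma VN_J:
  assumes "\<forall>c\<in>cilia G. a c \<in> carr H" "m \<in> carr M1.N" "n \<in> carr M2.N"
  shows "VN G a (J m n) = tlift H H (\<lambda>a1 a2. J (VN \<Gamma> (a(base \<Gamma> := a1)) m) (VN \<Delta> (a(base \<Delta> := a2)) n))
    (comult H (a (base \<Gamma>)))"
proof -
  have e: "VN K = (\<lambda>v. foldr (\<lambda>c. V.W K c (v c)) (cilia_list K))"
    if "\<And>c. c \<in> set (cilia_list K) \<Longrightarrow> vertex_act H M K c = V.W K c" for K
    unfolding VN_def using that by (intro ext foldr_cong) auto
  have e1: "VN \<Gamma> = (\<lambda>v. foldr (\<lambda>c. V.W \<Gamma> c (v c)) (cilia_list \<Gamma>))"
    and e2: "VN \<Delta> = (\<lambda>v. foldr (\<lambda>c. V.W \<Delta> c (v c)) (cilia_list \<Delta>))"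
    and e3: "VN G = (\<lambda>v. foldr (\<lambda>c. V.W G c (v c)) (cilia_list G))"
    by (rule e, simp only: cilia_list_props act_W)+
  show ?thesis unfolding e1 e2 e3
    by (rule V.foldr_W_J[OF bspec[OF assms(1)] assms(2,3)[unfolded hilbert_space_def]])
qed

section \<open>The rearrangement map and the forms on the connected sum\<close>

sublocale TP: tensor_pair X M1.N Y M2.N
  by unfold_locales (simp_all add: P1.XV P2.XV hilbert_space_def)

text \<open>The exchange of the two middle factors, followed by the identification of the Hilbert
  spaces through \<open>J\<close>.\<close>

definition tau :: "(('x \<Rightarrow> ((('g set \<Rightarrow> 'm) \<Rightarrow> 'k) \<Rightarrow> 'k) \<Rightarrow> 'k) \<Rightarrow> 'k)
    \<Rightarrow> (('y \<Rightarrow> ((('g set \<Rightarrow> 'm) \<Rightarrow> 'k) \<Rightarrow> 'k) \<Rightarrow> 'k) \<Rightarrow> 'k)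
    \<Rightarrow> ((('x \<Rightarrow> 'y \<Rightarrow> 'k) \<Rightarrow> 'k) \<Rightarrow> ((('g set \<Rightarrow> 'm) \<Rightarrow> 'k) \<Rightarrow> 'k) \<Rightarrow> 'k) \<Rightarrow> 'k" where
  "tau s t = tlift X M1.N (\<lambda>x m. tlift Y M2.N (\<lambda>y n. tens XY MG.N (tens X Y x y) (J m n)) t) s"

lemma quadlin_form:
  assumes \<beta>: "bilin XY MG.N U \<beta>"
  shows "m \<in> carr M1.N \<Longrightarrow> x \<in> carr X \<Longrightarrow> bilin Y M2.N U (\<lambda>y n. \<beta> (tens X Y x y) (J m n))"
    "n \<in> carr M2.N \<Longrightarrow> y \<in> carr Y \<Longrightarrow> bilin X M1.N U (\<lambda>x m. \<beta> (tens X Y x y) (J m n))"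
  by (intro bilin_comp2[OF \<beta>] bilin_right[OF bilin_tens] bilin_left[OF bilin_tens]
    bilin_right[OF bilin_J] bilin_left[OF bilin_J]; assumption)+

lemma quadlin_form_kfield: "bilin XY MG.N kfield \<beta> \<Longrightarrow> quadlin X M1.N Y M2.N (\<lambda>x m y n. \<beta> (tens X Y x y)
    (J m n))"
  unfolding quadlin_def by (blast intro: quadlin_form)

lemma bilin_tau_inner:
  assumes t: "t \<in> carr (tensor Y M2.N)"
  shows "bilin X M1.N (tensor XY MG.N) (\<lambda>x m. tlift Y M2.N (\<lambda>y n. tens XY MG.N (tens X Y x y) (J m n))
      t)"
  using quadlin_form(2)[OF bilin_tens]
  by (intro bilinI lin_tlift_param[OF TP.Y vspace_tensor t]) (auto simp: bilin_def)

lemma bilin_tau: "bilin (tensor X M1.N) (tensor Y M2.N) (tensor XY MG.N) tau"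
  unfolding tau_def
  by (intro bilinI tensor_universal(1)[OF TP.X TP.M vspace_tensor bilin_tau_inner]
    lin_tlift_param[OF TP.X vspace_tensor] tensor_universal(1)[OF TP.Y TP.N vspace_tensor
        quadlin_form(1)[OF bilin_tens]])

lemma tau_apply:
  assumes \<beta>: "bilin XY MG.N kfield \<beta>" and s: "s \<in> carr (tensor X M1.N)" and t: "t \<in> carr (tensor Y
      M2.N)"
  shows "tau s t \<beta> = s (\<lambda>x m. t (\<lambda>y n. \<beta> (tens X Y x y) (J m n)))"
  unfolding tau_def
proof (rule tlift_apply_eq[OF TP.X TP.M s TP.quadlin_contract[OF quadlin_form_kfield[OF \<beta>] t]])
  fix x m assume "x \<in> carr X" "m \<in> carr M1.N"
  then show "tlift Y M2.N (\<lambda>y n. tens XY MG.N (tens X Y x y) (J m n)) t \<beta> = t (\<lambda>y n. \<beta> (tens X Y x y) (J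
      m n))"
    by (intro tlift_apply_eq[OF TP.Y TP.N t quadlin_form(1)[OF \<beta>]] tens_apply[OF \<beta>])
qed

text \<open>\<open>base \<Delta>\<close> is not a cilium of the sum, so nothing is known about the
  family there before it is updated.\<close>

lemma cilia_upd:
  assumes "\<forall>c\<in>cilia G. \<alpha> c \<in> S" "v \<in> S"
  shows "c \<in> cilia \<Gamma> \<Longrightarrow> (\<alpha>(base \<Gamma> := v)) c \<in> S" "c \<in> cilia \<Delta> \<Longrightarrow> (\<alpha>(base \<Delta> := v)) c \<in> S"
  using assms by (auto simp: G_simps)

text \<open>The coaction operators on both sides are expanded along one representing list of the
  dual coproduct. Each summand carries operators for \<open>\<Gamma>\<close> and for
  \<open>\<Delta>\<close> with separate functionals, and to these the cotensor conditions of
  \<open>s\<close> and \<open>t\<close> apply.\<close>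

lemma tau_cotensor:
  assumes s: "s \<in> carr (cotensor (graph_algebra H \<Gamma>) X (graph_module H M \<Gamma>))"
    and t: "t \<in> carr (cotensor (graph_algebra H \<Delta>) Y (graph_module H M \<Delta>))"
  shows "tau s t \<in> carr (cotensor (graph_algebra H G) Z (graph_module H M G))"
proof -
  have s': "s \<in> carr (tensor X M1.N)" and t': "t \<in> carr (tensor Y M2.N)"
    using s t unfolding graph_algebra_def C1.cotensor_iff C2.cotensor_iff M1_same M2_same by auto
  have bs: "s (\<lambda>x n. \<beta> (RX \<alpha> x) n) = s (\<lambda>x n. \<beta> x (LN \<Gamma> \<alpha> n))"
    if "\<And>c. c \<in> cilia \<Gamma> \<Longrightarrow> \<alpha> c \<in> carr D" "bilin X M1.N kfield \<beta>" for \<alpha> \<beta>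
    using s that unfolding graph_algebra_def C1.cotensor_iff M1_same by blast
  have bt: "t (\<lambda>y n. \<beta> (RY \<alpha> y) n) = t (\<lambda>y n. \<beta> y (LN \<Delta> \<alpha> n))"
    if "\<And>c. c \<in> cilia \<Delta> \<Longrightarrow> \<alpha> c \<in> carr D" "bilin Y M2.N kfield \<beta>" for \<alpha> \<beta>
    using t that unfolding graph_algebra_def C2.cotensor_iff M2_same by blast
  have "tau s t (\<lambda>z n. \<beta> (RZ \<alpha> z) n) = tau s t (\<lambda>z n. \<beta> z (LN G \<alpha> n))"
    if \<alpha>: "\<And>c. c \<in> cilia G \<Longrightarrow> \<alpha> c \<in> carr D" and \<beta>: "bilin XY MG.N kfield \<beta>" for \<alpha> \<beta>
  proof -
    have \<alpha>': "\<forall>c\<in>cilia G. \<alpha> c \<in> carr D" using \<alpha> by blast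
    define Q where "Q x m y n = \<beta> (tens X Y x y) (J m n)" for x m y n
    have Q: "quadlin X M1.N Y M2.N Q" unfolding Q_def by (rule quadlin_form_kfield[OF \<beta>])
    \<comment> \<open>Fixing one representing list gives the expansions \<open>R\<close> and
      \<open>L\<close> the same index list, so their summands correspond.\<close>
    define rs where "rs = trep D D (dual_comult H (\<alpha> (base \<Gamma>)))"
    have b: "\<alpha> (base \<Gamma>) \<in> carr D" using G1.base_cilia by (intro \<alpha>) (auto simp: G_simps)
    note dm = P1.dual_comult_mem[OF b]
    have rs: "fst r \<in> carr D" "snd r \<in> carr D" if "r \<in> set rs" for r
      using trep(1)[OF vspace_dual dm] that by (auto simp: rs_def)
    let ?\<alpha>1 = "\<lambda>r. \<alpha>(base \<Gamma> := fst r)" and ?\<alpha>2 = "\<lambda>r. \<alpha>(base \<Delta> := snd r)"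
    note up = cilia_upd[OF \<alpha>']
    note lR = lin_RX[OF up(1)] lin_RY[OF up(2)] and lL = lin_LN(1)[OF up(1)] lin_LN(2)[OF up(2)]
    have R: "\<beta> (RZ \<alpha> (tens X Y x y)) (J m n) = (\<Sum>r\<leftarrow>rs. Q (RX (?\<alpha>1 r) x) m (RY (?\<alpha>2 r) y) n)"
      if "x \<in> carr X" "m \<in> carr M1.N" "y \<in> carr Y" "n \<in> carr M2.N" for x m y n
    proof -
      have "\<beta> (RZ \<alpha> (tens X Y x y)) (J m n) = tlift D D (\<lambda>\<alpha>1 \<alpha>2. Q (RX (\<alpha>(base \<Gamma> := \<alpha>1)) x) m (RY
          (\<alpha>(base \<Delta> := \<alpha>2)) y) n)
          (dual_comult H (\<alpha> (base \<Gamma>)))"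
        unfolding RZ_tens[OF \<alpha>' that(1,3)] Q_def
        by (rule tlift_comm[OF vspace_dual vspace_tensor vspace_kfield dm bilin_left[OF \<beta> bilin_mem[OF
            bilin_J that(2,4)]]])
          (intro tens_mem lin_mem[OF lR(1)] lin_mem[OF lR(2)] that)
      then show ?thesis by (simp add: tlift_trep rs_def split_def)
    qed
    have L: "\<beta> (tens X Y x y) (LN G \<alpha> (J m n)) = (\<Sum>r\<leftarrow>rs. Q x (LN \<Gamma> (?\<alpha>1 r) m) y (LN \<Delta> (?\<alpha>2 r) n))"
      if "x \<in> carr X" "m \<in> carr M1.N" "y \<in> carr Y" "n \<in> carr M2.N" for x m y n
    proof -
      have "\<beta> (tens X Y x y) (LN G \<alpha> (J m n)) = tlift D D (\<lambda>\<alpha>1 \<alpha>2. Q x (LN \<Gamma> (\<alpha>(base \<Gamma> := \<alpha>1)) m) y (LN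
          \<Delta> (\<alpha>(base \<Delta> := \<alpha>2)) n))
          (dual_comult H (\<alpha> (base \<Gamma>)))"
        unfolding LN_J[OF \<alpha>' that(2,4)] Q_def
        by (rule tlift_comm[OF vspace_dual MG.vspace_N vspace_kfield dm bilin_right[OF \<beta> tens_mem[OF
            that(1,3)]]])
          (intro bilin_mem[OF bilin_J] lin_mem[OF lL(1)] lin_mem[OF lL(2)] that)
      then show ?thesis by (simp add: tlift_trep rs_def split_def)
    qed
    have "tau s t (\<lambda>z n. \<beta> (RZ \<alpha> z) n) = s (\<lambda>x m. t (\<lambda>y n. \<beta> (RZ \<alpha> (tens X Y x y)) (J m n)))"
      by (rule tau_apply[OF bilin_comp2[OF \<beta> lin_RZ[OF \<alpha>] lin_id] s' t'])
    also have "\<dots> = s (\<lambda>x m. t (\<lambda>y n. \<Sum>r\<leftarrow>rs. Q (RX (?\<alpha>1 r) x) m (RY (?\<alpha>2 r) y) n))"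
      by (intro tensor_cong[OF TP.X TP.M s'] tensor_cong[OF TP.Y TP.N t'] R)
    also have "\<dots> = (\<Sum>r\<leftarrow>rs. s (\<lambda>x m. t (\<lambda>y n. Q (RX (?\<alpha>1 r) x) m (RY (?\<alpha>2 r) y) n)))"
      by (intro TP.quadlin_sum[OF _ s' t'] TP.quadlin_comp[OF Q _ lin_id _ lin_id] lR rs)
    \<comment> \<open>Here both cotensor conditions are used, in each summand with its own pair of
      functionals.\<close>
    also have "\<dots> = (\<Sum>r\<leftarrow>rs. s (\<lambda>x m. t (\<lambda>y n. Q x (LN \<Gamma> (?\<alpha>1 r) m) y (LN \<Delta> (?\<alpha>2 r) n))))"
      by (intro arg_cong[where f = sum_list] map_cong refl TP.quadlin_balanced[OF Q _ _ _ _ s' t'] lR lL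
          rs bs bt up)
    also have "\<dots> = s (\<lambda>x m. t (\<lambda>y n. \<Sum>r\<leftarrow>rs. Q x (LN \<Gamma> (?\<alpha>1 r) m) y (LN \<Delta> (?\<alpha>2 r) n)))"
      by (intro TP.quadlin_sum[OF _ s' t', symmetric] TP.quadlin_comp[OF Q lin_id _ lin_id] lL rs)
    also have "\<dots> = s (\<lambda>x m. t (\<lambda>y n. \<beta> (tens X Y x y) (LN G \<alpha> (J m n))))"
      by (intro tensor_cong[OF TP.X TP.M s'] tensor_cong[OF TP.Y TP.N t'] L[symmetric])
    also have "\<dots> = tau s t (\<lambda>z n. \<beta> z (LN G \<alpha> n))"
      by (rule tau_apply[OF bilin_comp2[OF \<beta> lin_id lin_LN(3)[OF \<alpha>]] s' t', symmetric])
    finally show ?thesis .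
  qed
  then show ?thesis
    unfolding graph_algebra_def CG.cotensor_iff Z_same MG_same using bilin_mem[OF bilin_tau s' t'] by
        blast
qed

text \<open>Returns from the single factors to actions of whole pure tensors, the form in which
  balancedness of forms on \<open>X\<close> and \<open>Y\<close> is available.\<close>

lemma foldl_sum_factor_ract:
  assumes "\<forall>c\<in>cilia G. a c \<in> carr H" "x \<in> carr X" "y \<in> carr Y"
  shows "foldl (\<lambda>z c. sum_factor_ract H \<Gamma> \<Delta> X Y c z (a c)) (tens X Y x y) (cilia_list G) = tlift H H
      (\<lambda>a1 a2.
      tens X Y (ract X x (ntens (cilia \<Gamma>) H (a(base \<Gamma> := a1)))) (ract Y y (ntens (cilia \<Delta>) H (a(base \<Delta>
          := a2)))))
      (comult H (a (base \<Gamma>)))"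
proof -
  have b: "a (base \<Gamma>) \<in> carr H" using G1.base_cilia assms(1) by (auto simp: G_simps)
  note up = cilia_upd[OF assms(1)]
  show ?thesis
  proof (rule trans[OF SV.foldl_r_tens[of a x y] tlift_cong[OF vspace_H V.D_mem[OF b]]])
    show "a c \<in> carr H" if "c \<in> cilia G" for c using assms(1) that by blast
    show "x \<in> carr X" "y \<in> carr Y" by (rule assms)+
    fix a1 a2 assume a12: "a1 \<in> carr H" "a2 \<in> carr H"
    have "foldl (\<lambda>x c. factor_ract H (cilia \<Gamma>) X c x ((a(base \<Gamma> := a1)) c)) x (cilia_list \<Gamma>)
        = ract X x (ntens (cilia \<Gamma>) H (a(base \<Gamma> := a1)))"
      using up(1)[OF a12(1)] assms(2)
      by (subst P1.foldl_factor_ract) (auto simp: cilia_list_props simp del: fun_upd_apply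
        intro!: arg_cong[where f = "ract X x"] ntens_cong)
    moreover have "foldl (\<lambda>y c. factor_ract H (cilia \<Delta>) Y c y ((a(base \<Delta> := a2)) c)) y (cilia_list \<Delta>)
        = ract Y y (ntens (cilia \<Delta>) H (a(base \<Delta> := a2)))"
      using up(2)[OF a12(2)] assms(3)
      by (subst P2.foldl_factor_ract) (auto simp: cilia_list_props simp del: fun_upd_apply
        intro!: arg_cong[where f = "ract Y y"] ntens_cong)
    ultimately show "tens X Y (foldl (\<lambda>x c. factor_ract H (cilia \<Gamma>) X c x ((a(base \<Gamma> := a1)) c)) x
        (cilia_list \<Gamma>))
        (foldl (\<lambda>y c. factor_ract H (cilia \<Delta>) Y c y ((a(base \<Delta> := a2)) c)) y (cilia_list \<Delta>))
      = tens X Y (ract X x (ntens (cilia \<Gamma>) H (a(base \<Gamma> := a1)))) (ract Y y (ntens (cilia \<Delta>) H (a(base \<Delta>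
          := a2))))"
      by simp
  qed
qed

text \<open>\<open>\<delta>\<close> is the product of \<open>\<beta>\<close> and
  \<open>\<gamma>\<close>. Acting with a family on either side splits its component at the
  distinguished cilium by the same coproduct, so on pure arguments balancedness of
  \<open>\<beta>\<close> and of \<open>\<gamma>\<close> can be used in each summand; linearity does
  the rest.\<close>

lemma balanced_sum:
  assumes \<beta>: "balanced (graph_algebra H \<Gamma>) X (graph_module H M \<Gamma>) \<beta>"
    and \<gamma>: "balanced (graph_algebra H \<Delta>) Y (graph_module H M \<Delta>) \<gamma>"
  defines "\<delta> \<equiv> \<lambda>z n. tlift X Y (\<lambda>x y. join_form (edges \<Gamma>) (edges \<Delta>) M (\<beta> x) (\<gamma> y) n) z"
  shows "balanced (graph_algebra H G) Z (graph_module H M G) \<delta>"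
    and "\<And>x m y n. x \<in> carr X \<Longrightarrow> m \<in> carr M1.N \<Longrightarrow> y \<in> carr Y \<Longrightarrow> n \<in> carr M2.N \<Longrightarrow>
      \<delta> (tens X Y x y) (J m n) = \<beta> x m * \<gamma> y n"
proof -
  have b\<beta>: "bilin X M1.N kfield \<beta>" and b\<gamma>: "bilin Y M2.N kfield \<gamma>"
    using \<beta> \<gamma> unfolding balanced_def M1_same M2_same by auto
  note gr = G1.edges_nonempty G2.edges_nonempty edges_disjoint vspace_M
  note b\<beta>' = b\<beta>[unfolded hilbert_space_def] and b\<gamma>' = b\<gamma>[unfolded hilbert_space_def]
  note jf = lin_join_form[OF gr bilin_right[OF b\<beta>'] bilin_right[OF b\<gamma>'], folded edges_G]
  let ?jf = "\<lambda>x y. join_form (edges \<Gamma>) (edges \<Delta>) M (\<beta> x) (\<gamma> y)"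
  \<comment> \<open>\<open>join_form\<close> is lifted over one representing list of
    \<open>n\<close>, so linearity of \<open>\<beta>\<close> in \<open>x\<close> and of
    \<open>\<gamma>\<close> in \<open>y\<close> is inherited termwise.\<close>
  have bj: "bilin X Y kfield (\<lambda>x y. ?jf x y n)" if n: "n \<in> carr MG.N" for n
  proof (rule bilinI)
    have pi: "ntens (edges \<Gamma>) M v \<in> carr M1.N" "ntens (edges \<Delta>) M v \<in> carr M2.N"
      if "v \<in> edges \<Gamma> \<union> edges \<Delta> \<rightarrow>\<^sub>E carr M" for v
      using that unfolding hilbert_space_def by (auto intro!: ntens_mem)
    have n': "n \<in> carr (ntensor (edges \<Gamma> \<union> edges \<Delta>) M)" using n by (simp add: hilbert_space_def edges_G)
    have ne: "edges \<Gamma> \<union> edges \<Delta> \<noteq> {}" using gr by auto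
    show "lin X kfield (\<lambda>x. ?jf x y n)" for y
      unfolding join_form_def
      by (intro lin_nlift_param[OF ne vspace_M vspace_kfield n'] lin_multc bilin_left[OF b\<beta>] pi)
    show "lin Y kfield (\<lambda>y. ?jf x y n)" for x
      unfolding join_form_def
      by (intro lin_nlift_param[OF ne vspace_M vspace_kfield n'] lin_cmult bilin_left[OF b\<gamma>] pi)
  qed
  have \<delta>: "bilin XY MG.N kfield \<delta>"
    unfolding \<delta>_def
  proof (rule bilinI)
    show "lin XY kfield (\<lambda>z. tlift X Y (\<lambda>x y. ?jf x y n) z)" if "n \<in> carr MG.N" for n
      by (rule tensor_universal(1)[OF TP.X TP.Y vspace_kfield bj[OF that]])
    show "lin MG.N kfield (\<lambda>n. tlift X Y (\<lambda>x y. ?jf x y n) z)" if "z \<in> carr XY" for z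
      using jf by (intro lin_tlift_param[OF TP.X vspace_kfield that]) (simp add: hilbert_space_def)
  qed
  show ev: "\<delta> (tens X Y x y) (J m n) = \<beta> x m * \<gamma> y n"
    if "x \<in> carr X" "m \<in> carr M1.N" "y \<in> carr Y" "n \<in> carr M2.N" for x m y n
    unfolding \<delta>_def tlift_tens[OF TP.X TP.Y vspace_kfield bj[OF bilin_mem[OF bilin_J that(2,4)]]
        that(1,3)]
    using that by (intro join_form_njoin[OF gr bilin_right[OF b\<beta>'] bilin_right[OF b\<gamma>']]) (simp_all add:
        hilbert_space_def)
  have bal\<beta>: "\<beta> (ract X x (ntens (cilia \<Gamma>) H a)) m = \<beta> x (VN \<Gamma> a m)"
    if "\<And>c. c \<in> cilia \<Gamma> \<Longrightarrow> a c \<in> carr H" "x \<in> carr X" "m \<in> carr M1.N" for a x m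
    using \<beta> that ntens_mem[of "cilia \<Gamma>" a H] M1.lact_graph_ntens[OF that(3,1)]
    by (simp add: balanced_def graph_algebra_def M1.carr_graph_module VN_def)
  have bal\<gamma>: "\<gamma> (ract Y y (ntens (cilia \<Delta>) H a)) n = \<gamma> y (VN \<Delta> a n)"
    if "\<And>c. c \<in> cilia \<Delta> \<Longrightarrow> a c \<in> carr H" "y \<in> carr Y" "n \<in> carr M2.N" for a y n
    using \<gamma> that ntens_mem[of "cilia \<Delta>" a H] M2.lact_graph_ntens[OF that(3,1)]
    by (simp add: balanced_def graph_algebra_def M2.carr_graph_module VN_def)
  have VNmem: "VN \<Gamma> a m \<in> carr M1.N" if "\<And>c. c \<in> cilia \<Gamma> \<Longrightarrow> a c \<in> carr H" "m \<in> carr M1.N" for a m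
    unfolding VN_def using that by (intro foldr_mem[where V = H] M1.vertex) (simp_all add:
        cilia_list_props)
  have VNmem': "VN \<Delta> a n \<in> carr M2.N" if "\<And>c. c \<in> cilia \<Delta> \<Longrightarrow> a c \<in> carr H" "n \<in> carr M2.N" for a n
    unfolding VN_def using that by (intro foldr_mem[where V = H] M2.vertex) (simp_all add:
        cilia_list_props)
  let ?RZ = "\<lambda>a z. foldl (\<lambda>z c. sum_factor_ract H \<Gamma> \<Delta> X Y c z (a c)) z (cilia_list G)"
  have pure: "\<delta> (?RZ a (tens X Y x y)) (J m n) = \<delta> (tens X Y x y) (VN G a (J m n))"
    if a: "\<And>c. c \<in> cilia G \<Longrightarrow> a c \<in> carr H" and x: "x \<in> carr X" and m: "m \<in> carr M1.N"
      and y: "y \<in> carr Y" and n: "n \<in> carr M2.N" for a x m y n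
  proof -
    have a': "\<forall>c\<in>cilia G. a c \<in> carr H" using a by blast
    have b: "a (base \<Gamma>) \<in> carr H" using G1.base_cilia by (intro a) (auto simp: G_simps)
    note up = cilia_upd[OF a'] and dm = V.D_mem[OF b]
    have rX: "ract X x (ntens (cilia \<Gamma>) H (a(base \<Gamma> := a1))) \<in> carr X" if "a1 \<in> carr H" for a1
      by (intro bilin_mem[OF P1.bilin_ract x] ntens_mem up that)
    have rY: "ract Y y (ntens (cilia \<Delta>) H (a(base \<Delta> := a2))) \<in> carr Y" if "a2 \<in> carr H" for a2
      by (intro bilin_mem[OF P2.bilin_ract y] ntens_mem up that)
    have "\<delta> (?RZ a (tens X Y x y)) (J m n) = tlift H H (\<lambda>a1 a2. \<delta> (tens X Y (ract X x (ntens (cilia \<Gamma>) H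
        (a(base \<Gamma> := a1))))
        (ract Y y (ntens (cilia \<Delta>) H (a(base \<Delta> := a2))))) (J m n)) (comult H (a (base \<Gamma>)))"
      unfolding foldl_sum_factor_ract[OF a' x y]
      by (rule tlift_comm[OF vspace_H vspace_tensor vspace_kfield dm bilin_left[OF \<delta> bilin_mem[OF
          bilin_J m n]]])
        (intro tens_mem rX rY)
    also have "\<dots> = tlift H H (\<lambda>a1 a2. \<delta> (tens X Y x y) (J (VN \<Gamma> (a(base \<Gamma> := a1)) m) (VN \<Delta> (a(base \<Delta> :=
        a2)) n)))
        (comult H (a (base \<Gamma>)))"
    proof (rule tlift_cong[OF vspace_H dm])
      fix a1 a2 assume a12: "a1 \<in> carr H" "a2 \<in> carr H"
      note u = up(1)[OF a12(1)] up(2)[OF a12(2)]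
      show "\<delta> (tens X Y (ract X x (ntens (cilia \<Gamma>) H (a(base \<Gamma> := a1)))) (ract Y y (ntens (cilia \<Delta>) H
          (a(base \<Delta> := a2))))) (J m n)
          = \<delta> (tens X Y x y) (J (VN \<Gamma> (a(base \<Gamma> := a1)) m) (VN \<Delta> (a(base \<Delta> := a2)) n))"
      proof -
        have "VN \<Gamma> (a(base \<Gamma> := a1)) m \<in> carr M1.N" by (rule VNmem[OF u(1) m])
        moreover have "VN \<Delta> (a(base \<Delta> := a2)) n \<in> carr M2.N" by (rule VNmem'[OF u(2) n])
        moreover have "\<beta> (ract X x (ntens (cilia \<Gamma>) H (a(base \<Gamma> := a1)))) m = \<beta> x (VN \<Gamma> (a(base \<Gamma> :=
            a1)) m)"
          by (rule bal\<beta>[OF u(1) x m])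
        moreover have "\<gamma> (ract Y y (ntens (cilia \<Delta>) H (a(base \<Delta> := a2)))) n = \<gamma> y (VN \<Delta> (a(base \<Delta> :=
            a2)) n)"
          by (rule bal\<gamma>[OF u(2) y n])
        ultimately show ?thesis
          using ev[OF rX[OF a12(1)] m rY[OF a12(2)] n] ev[OF x _ y] by simp
      qed
    qed
    also have "\<dots> = \<delta> (tens X Y x y) (VN G a (J m n))"
      unfolding VN_J[OF a' m n]
      by (rule tlift_comm[OF vspace_H MG.vspace_N vspace_kfield dm bilin_right[OF \<delta> tens_mem[OF x y]],
          symmetric])
        (intro bilin_mem[OF bilin_J] VNmem VNmem' up m n)
    finally show ?thesis .
  qed
  \<comment> \<open>Extends \<open>pure\<close> by linearity, in \<open>z\<close> from pure tensors
    and in \<open>n\<close> from joined tensors.\<close>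
  have fam: "\<delta> (?RZ a z) n = \<delta> z (VN G a n)"
    if a: "\<And>c. c \<in> cilia G \<Longrightarrow> a c \<in> carr H" and z: "z \<in> carr XY" and n: "n \<in> carr MG.N" for a z n
  proof -
    have lR: "lin XY XY (?RZ a)"
      by (rule lin_foldl[where V = H and act = "\<lambda>c h z. sum_factor_ract H \<Gamma> \<Delta> X Y c z h"])
        (simp_all only: SV.r cilia_list_props a)
    note lV = lin_VN[OF a]
    show ?thesis
    proof (rule tensor_lin_eq[OF TP.X TP.Y lin_comp[OF lR bilin_left[OF \<delta> n]] bilin_left[OF \<delta> lin_mem[OF
        lV n]] vspace_kfield _ z])
      fix x y assume x: "x \<in> carr X" and y: "y \<in> carr Y"
      note l1 = bilin_right[OF \<delta> lin_mem[OF lR tens_mem[OF x y]]]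
        and l2 = lin_comp[OF lV bilin_right[OF \<delta> tens_mem[OF x y]]]
      show "\<delta> (?RZ a (tens X Y x y)) n = \<delta> (tens X Y x y) (VN G a n)"
      proof (rule njoin_lin_eq[OF gr vspace_kfield l1[unfolded hilbert_space_def edges_G]
            l2[unfolded hilbert_space_def edges_G] _ n[unfolded hilbert_space_def edges_G]])
        fix m k assume "m \<in> carr (ntensor (edges \<Gamma>) M)" "k \<in> carr (ntensor (edges \<Delta>) M)"
        then show "\<delta> (?RZ a (tens X Y x y)) (J m k) = \<delta> (tens X Y x y) (VN G a (J m k))"
          by (intro pure a x y) (simp_all add: hilbert_space_def)
      qed
    qed
  qed
  show "balanced (graph_algebra H G) Z (graph_module H M G) \<delta>"
    unfolding balanced_def
  proof (intro conjI ballI)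
    show "bilin Z (graph_module H M G) kfield \<delta>" unfolding Z_same MG_same by (rule \<delta>)
    fix z u n assume "z \<in> carr Z" and "u \<in> carr (graph_algebra H G)" and "n \<in> carr (graph_module H M G)"
    then have z: "z \<in> carr XY" and u: "u \<in> carr PG.HC" and n: "n \<in> carr MG.N"
      by (simp_all add: Z_space graph_algebra_def MG.carr_graph_module)
    have r: "bilin H XY XY (\<lambda>h z. sum_factor_ract H \<Gamma> \<Delta> X Y c z h)" if "c \<in> set (cilia_list G)" for c
      using that by (simp only: cilia_list_props SV.r)
    have ra: "lin PG.HC XY (ract Z z)"
      using lin_right_assemble_act[where act = "sum_factor_ract H \<Gamma> \<Delta> X Y", OF vspace_H vspace_tensor _
          cilia_list_props(5) MG.cilia_list_nonempty z] r by (simp add: ract_Z cilia_list_props)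
    have rt: "ract Z z (ntens (cilia G) H a) = ?RZ a z" if "\<And>c. c \<in> cilia G \<Longrightarrow> a c \<in> carr H" for a
      using right_assemble_act_ntens[where act = "sum_factor_ract H \<Gamma> \<Delta> X Y" and a = a, OF vspace_H
          vspace_tensor _
          cilia_list_props(5) MG.cilia_list_nonempty z] r that by (simp add: ract_Z cilia_list_props)
    show "\<delta> (ract Z z u) n = \<delta> z (lact (graph_module H M G) u n)"
    \<comment> \<open>The last extension by linearity: from families, that is pure tensors of the
      algebra of the sum, to arbitrary elements \<open>u\<close>.\<close>
    proof (rule ntensor_lin_eq[OF PG.C(2) vspace_H _ _ vspace_kfield _ u])
      show "lin PG.HC kfield (\<lambda>u. \<delta> (ract Z z u) n)"
        by (rule lin_comp[OF ra bilin_left[OF \<delta> n]])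
      show "lin PG.HC kfield (\<lambda>u. \<delta> z (lact (graph_module H M G) u n))"
        by (rule lin_comp[OF MG.lin_lact_graph[OF n] bilin_right[OF \<delta> z]])
      fix a assume "a \<in> cilia G \<rightarrow>\<^sub>E carr H"
      then have a: "\<And>c. c \<in> cilia G \<Longrightarrow> a c \<in> carr H" by auto
      show "\<delta> (ract Z z (ntens (cilia G) H a)) n = \<delta> z (lact (graph_module H M G) (ntens (cilia G) H a)
          n)"
      proof -
        have "lact (graph_module H M G) (ntens (cilia G) H a) n = VN G a n"
          unfolding VN_def by (rule MG.lact_graph_ntens[OF n a])
        moreover have "ract Z z (ntens (cilia G) H a) = ?RZ a z" by (rule rt[OF a])
        moreover have "\<delta> (?RZ a z) n = \<delta> z (VN G a n)" by (rule fam[OF a z n])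
        ultimately show ?thesis by simp
      qed
    qed
  qed
qed

lemma embedding:
  "\<exists>f. lin (tensor (graph_bit H M \<Gamma> X) (graph_bit H M \<Delta> Y)) (graph_bit H M G Z) f
     \<and> inj_on f (carr (tensor (graph_bit H M \<Gamma> X) (graph_bit H M \<Delta> Y)))"
  unfolding graph_bit_def
proof (rule Bit_tensor_embedding[where \<tau> = tau])
  let ?C1 = "cotensor (graph_algebra H \<Gamma>) X (graph_module H M \<Gamma>)"
    and ?C2 = "cotensor (graph_algebra H \<Delta>) Y (graph_module H M \<Delta>)"
    and ?CG = "cotensor (graph_algebra H G) Z (graph_module H M G)"
  show "vspace X" "vspace Y" "vspace Z" by (rule C1.XV C2.XV CG.XV)+
  show "vspace ?C1" "vspace ?C2" "vspace ?CG"
    unfolding graph_algebra_def by (rule C1.vspace_cotensor C2.vspace_cotensor CG.vspace_cotensor)+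
  have c1: "s \<in> carr (tensor X M1.N)" if "s \<in> carr ?C1" for s
    using that unfolding graph_algebra_def C1.cotensor_iff M1_same by blast
  have c2: "t \<in> carr (tensor Y M2.N)" if "t \<in> carr ?C2" for t
    using that unfolding graph_algebra_def C2.cotensor_iff M2_same by blast
  have sc: "scl ?C1 = fscl" "scl ?C2 = fscl" "scl ?CG = fscl" by (simp_all add: cotensor_def)
  show "bilin ?C1 ?C2 ?CG tau"
    using bilin_tau tau_cotensor c1 c2 by (auto simp: bilin_def lin_def sc image_subset_iff)
  fix \<beta> \<gamma> assume b: "balanced (graph_algebra H \<Gamma>) X (graph_module H M \<Gamma>) \<beta>"
    "balanced (graph_algebra H \<Delta>) Y (graph_module H M \<Delta>) \<gamma>"
  obtain \<delta> where \<delta>: "balanced (graph_algebra H G) Z (graph_module H M G) \<delta>"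
    and ev: "\<And>x m y n. x \<in> carr X \<Longrightarrow> m \<in> carr M1.N \<Longrightarrow> y \<in> carr Y \<Longrightarrow> n \<in> carr M2.N \<Longrightarrow>
      \<delta> (tens X Y x y) (J m n) = \<beta> x m * \<gamma> y n"
    using balanced_sum[OF b] by blast
  have b\<beta>: "bilin X M1.N kfield \<beta>" and b\<gamma>: "bilin Y M2.N kfield \<gamma>" and b\<delta>: "bilin XY MG.N kfield \<delta>"
    using b \<delta> unfolding balanced_def M1_same M2_same MG_same Z_same by auto
  have "tau s t \<delta> = s \<beta> * t \<gamma>" if s: "s \<in> carr ?C1" and t: "t \<in> carr ?C2" for s t
  proof -
    have "tau s t \<delta> = s (\<lambda>x m. t (\<lambda>y n. \<delta> (tens X Y x y) (J m n)))"
      by (rule tau_apply[OF b\<delta> c1[OF s] c2[OF t]])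
    also have "\<dots> = s (\<lambda>x m. t (\<lambda>y n. \<beta> x m * \<gamma> y n))"
      by (intro tensor_cong[OF TP.X TP.M c1[OF s]] tensor_cong[OF TP.Y TP.N c2[OF t]] ev)
    also have "\<dots> = s (\<lambda>x m. t \<gamma> * \<beta> x m)"
      by (simp add: tensor_apply_cmult[OF TP.Y c2[OF t] b\<gamma>] mult.commute)
    also have "\<dots> = s \<beta> * t \<gamma>"
      by (simp add: tensor_apply_cmult[OF TP.X c1[OF s] b\<beta>])
    finally show ?thesis .
  qed
  then show "\<exists>\<delta>. balanced (graph_algebra H G) Z (graph_module H M G) \<delta> \<and>
      (\<forall>s\<in>carr ?C1. \<forall>t\<in>carr ?C2. tau s t \<delta> = s \<beta> * t \<gamma>)"
    using \<delta> by blast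
qed

end

theorem theorem8:
  fixes H :: "('k::field, 'h::ab_group_add) khopf"
    and M :: "('k, 'm::ab_group_add, 'h) hopf_bimod"
    and \<Gamma> \<Delta> :: "'g kgraph"
    and X :: "('k, 'x::ab_group_add, (('g \<Rightarrow> 'h) \<Rightarrow> 'k) \<Rightarrow> 'k, (('g \<Rightarrow> 'h) \<Rightarrow> 'k) \<Rightarrow> 'k) right_modcomod"
    and Y :: "('k, 'y::ab_group_add, (('g \<Rightarrow> 'h) \<Rightarrow> 'k) \<Rightarrow> 'k, (('g \<Rightarrow> 'h) \<Rightarrow> 'k) \<Rightarrow> 'k) right_modcomod"
  assumes "hopf_algebra H" and "finite_dim H"
    and "involutive_hopf_bimodule H M"
    and "kitaev_graph \<Gamma>" and "kitaev_graph \<Delta>" and "hedges \<Gamma> \<inter> hedges \<Delta> = {}"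
    and "right_module_comodule (graph_algebra H \<Gamma>) X"
    and "right_module_comodule (graph_algebra H \<Delta>) Y"
  shows "\<exists>f. lin (tensor (graph_bit H M \<Gamma> X) (graph_bit H M \<Delta> Y))
                 (graph_bit H M (connected_sum \<Gamma> \<Delta>) (sum_modcomod H \<Gamma> \<Delta> X Y)) f
           \<and> inj_on f (carr (tensor (graph_bit H M \<Gamma> X) (graph_bit H M \<Delta> Y)))"
proof -
  interpret connected_sum_modules \<Gamma> \<Delta> H M X Y
    by unfold_locales (use assms in auto)
  show ?thesis by (rule embedding)
qed

end
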